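(* Let $d\ge1$ and let $F_n\in(\mathbb D^{3,\infty})^d$, $n\in\mathbb N$, be such that $\sup_n\|F_n\|_{3,p}<\infty$ for every $p\in\mathbb N$. Let $F\in(\mathbb D^{2,2})^d$ be such that $\det\sigma_F>0$ almost surely. If $\lim_nF_n=F$ in $L^2$, then $\lim_nd_{TV}(F_n,F)=0$.
   Context: $d_{TV}(F,G)=\sup\{|\mathbb E(f(F))-\mathbb E(f(G))|:\|f\|_\infty\le1\}$. $W=(W^1,\dots,W^N)$ is a Brownian motion on $[0,1]$ on a probability space; $\mathbb D^{m,p}$ is the usual Malliavin–Sobolev space of functionals of $W$, $\mathbb D^{m,\infty}=\bigcap_{p\ge1}\mathbb D^{m,p}$, with norm $\|F\|_{m,p}^p=\mathbb E(|F|_m^p)$, $|F|_m^2=|F|^2+\sum_{k=1}^m|D^{(k)}F|^2$, $|D^{(k)}F|^2=\sum_{\alpha\in\{1,\dots,N\}^k}\int_{[0,1)^k}|D^\alpha_{s_1,\dots,s_k}F|^2ds_1\cdots ds_k$ (summed over components for vectors). The Malliavin covariance matrix is $\sigma_F^{i,j}=\sum_{k=1}^N\int_0^1D^k_sF^i\,D^k_sF^j\,ds$. *)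

theory Defs
  imports "HOL-Probability.Probability"
begin

section \<open>Brownian motion on the unit interval\<close>

text \<open>An N-dimensional Brownian motion indexed by \<open>[0,1]\<close>, with N the cardinality of the
  index type. The independence clause covers at once independence of the coordinates and of the
  increments over successive intervals.\<close>

definition brownian_motion :: "'a measure \<Rightarrow> (real \<Rightarrow> 'a \<Rightarrow> real ^ 'n) \<Rightarrow> bool" where
  "brownian_motion M W \<longleftrightarrow>
     prob_space M \<and>
     (\<forall>t\<in>{0..1}. W t \<in> borel_measurable M) \<and>
     (AE \<omega> in M. W 0 \<omega> = 0) \<and>
     (AE \<omega> in M. continuous_on {0..1} (\<lambda>t. W t \<omega>)) \<and>
     (\<forall>s t k. 0 \<le> s \<and> s < t \<and> t \<le> 1 \<longrightarrow>
        distributed M lborel (\<lambda>\<omega>. W t \<omega> $ k - W s \<omega> $ k) (normal_density 0 (sqrt (t - s)))) \<and>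
     (\<forall>(r::nat) \<tau>. 0 \<le> \<tau> 0 \<and> strict_mono_on {..r} \<tau> \<and> \<tau> r \<le> 1 \<longrightarrow>
        prob_space.indep_vars M (\<lambda>_. borel)
          (\<lambda>(j, k) \<omega>. W (\<tau> (Suc j)) \<omega> $ k - W (\<tau> j) \<omega> $ k) ({..<r} \<times> UNIV))"


section \<open>Smooth functions of finitely many real variables\<close>

definition partial_deriv :: "'i \<Rightarrow> (('i \<Rightarrow> real) \<Rightarrow> real) \<Rightarrow> ('i \<Rightarrow> real) \<Rightarrow> real" where
  "partial_deriv i f x = deriv (\<lambda>y. f (x(i := y))) (x i)"

fun partial_derivs :: "'i list \<Rightarrow> (('i \<Rightarrow> real) \<Rightarrow> real) \<Rightarrow> ('i \<Rightarrow> real) \<Rightarrow> real" where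
  "partial_derivs [] f = f"
| "partial_derivs (i # is) f = partial_deriv i (partial_derivs is f)"

text \<open>The class of infinitely differentiable functions on \<open>\<real>\<^sup>I\<close>, for a finite index set I, all of
  whose partial derivatives have polynomial growth. A function on \<open>\<real>\<^sup>I\<close> is represented by a
  function of all the coordinates that only depends on those in I; its continuity for the
  product topology is then ordinary continuity on \<open>\<real>\<^sup>I\<close>.\<close>

definition smooth_poly_growth :: "'i set \<Rightarrow> (('i \<Rightarrow> real) \<Rightarrow> real) \<Rightarrow> bool" where
  "smooth_poly_growth I f \<longleftrightarrow>
     (\<forall>x y. (\<forall>i\<in>I. x i = y i) \<longrightarrow> f x = f y) \<and>
     (\<forall>is. set is \<subseteq> I \<longrightarrow>
        continuous_on UNIV (partial_derivs is f) \<and>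
        (\<forall>i\<in>I. \<forall>x. (\<lambda>y. partial_derivs is f (x(i := y))) differentiable (at (x i))) \<and>
        (\<exists>C (q::nat). \<forall>x. \<bar>partial_derivs is f x\<bar> \<le> C * (1 + (\<Sum>i\<in>I. \<bar>x i\<bar>)) ^ q))"


section \<open>Simple functionals and their Malliavin derivatives\<close>

text \<open>A field of order k is a family \<open>D \<alpha> s \<omega>\<close> indexed by \<open>\<alpha> \<in> {1..N}\<^sup>k\<close> and \<open>s \<in> [0,1)\<^sup>k\<close>, where
  k-tuples are the extensional functions on \<open>{..<k}\<close> (values of \<open>\<alpha>\<close> and \<open>s\<close> outside \<open>{..<k}\<close> are
  \<^const>\<open>undefined\<close>, as in \<^const>\<open>PiE\<close> and \<^const>\<open>PiM\<close>). Other arguments are irrelevant.\<close>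

type_synonym ('a, 'n) field = "(nat \<Rightarrow> 'n) \<Rightarrow> (nat \<Rightarrow> real) \<Rightarrow> 'a \<Rightarrow> real"

abbreviation multi_indices :: "nat \<Rightarrow> (nat \<Rightarrow> 'n) set" where
  "multi_indices k \<equiv> {..<k} \<rightarrow>\<^sub>E UNIV"

definition lebesgue_cube :: "nat \<Rightarrow> (nat \<Rightarrow> real) measure" where
  "lebesgue_cube k = PiM {..<k} (\<lambda>_. restrict_space lborel {0..<1})"

text \<open>Simple functionals are \<open>f (W (t 0), \<dots>, W (t (r - 1)))\<close> with f smooth of polynomial growth; the
  coordinate \<open>(j, k)\<close> of the argument of f stands for the k-th component of W at time \<open>t j\<close>.\<close>

definition simple_data :: "nat \<Rightarrow> (nat \<Rightarrow> real) \<Rightarrow> ((nat \<times> 'n \<Rightarrow> real) \<Rightarrow> real) \<Rightarrow> bool" where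
  "simple_data r t f \<longleftrightarrow> (\<forall>j<r. t j \<in> {0..1}) \<and> smooth_poly_growth ({..<r} \<times> UNIV) f"

definition sample_path :: "(real \<Rightarrow> 'a \<Rightarrow> real ^ 'n) \<Rightarrow> (nat \<Rightarrow> real) \<Rightarrow> 'a \<Rightarrow> nat \<times> 'n \<Rightarrow> real" where
  "sample_path W t \<omega> = (\<lambda>(j, k). W (t j) \<omega> $ k)"

definition simple_functional ::
    "(real \<Rightarrow> 'a \<Rightarrow> real ^ 'n) \<Rightarrow> (nat \<Rightarrow> real) \<Rightarrow> ((nat \<times> 'n \<Rightarrow> real) \<Rightarrow> real) \<Rightarrow> 'a \<Rightarrow> real" where
  "simple_functional W t f \<omega> = f (sample_path W t \<omega>)"

text \<open>Since \<open>D\<^sup>k\<^sub>s W\<^sup>l\<^sub>t\<close> is 1 if \<open>k = l\<close> and \<open>s < t\<close>, and 0 otherwise, the k-th iterated derivative of a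
  simple functional is, by the chain rule, the sum over all \<open>j \<in> {..<r}\<^sup>k\<close> of the partial derivative
  of f in the coordinates \<open>(j l, \<alpha> l)\<close>, \<open>l < k\<close>, times the product of the indicators of
  \<open>s l < t (j l)\<close>.\<close>

definition simple_deriv ::
    "(real \<Rightarrow> 'a \<Rightarrow> real ^ 'n) \<Rightarrow> nat \<Rightarrow> (nat \<Rightarrow> real) \<Rightarrow> ((nat \<times> 'n \<Rightarrow> real) \<Rightarrow> real) \<Rightarrow>
      nat \<Rightarrow> ('a, 'n) field" where
  "simple_deriv W r t f k \<alpha> s \<omega> =
     (\<Sum>j\<in>{..<k} \<rightarrow>\<^sub>E {..<r}.
        partial_derivs (map (\<lambda>l. (j l, \<alpha> l)) [0..<k]) f (sample_path W t \<omega>) *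
        (\<Prod>l<k. indicat_real {0..<t (j l)} (s l)))"


section \<open>Sobolev norms, Sobolev spaces and Malliavin derivatives\<close>

definition ennreal_powr :: "ennreal \<Rightarrow> real \<Rightarrow> ennreal" where
  "ennreal_powr x p = (if x = \<top> then \<top> else ennreal (enn2real x powr p))"

text \<open>\<open>|D|\<^sup>2\<close> for a field of order k, and \<open>|F|\<^sup>2 + |D\<^sup>(\<^sup>1\<^sup>)|\<^sup>2 + \<dots> + |D\<^sup>(\<^sup>m\<^sup>)|\<^sup>2\<close>.\<close>

definition field_sq :: "nat \<Rightarrow> ('a, 'n::finite) field \<Rightarrow> 'a \<Rightarrow> ennreal" where
  "field_sq k D \<omega> = (\<Sum>\<alpha>\<in>multi_indices k. \<integral>\<^sup>+ s. ennreal ((D \<alpha> s \<omega>)\<^sup>2) \<partial>lebesgue_cube k)"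

definition sobolev_sq :: "nat \<Rightarrow> ('a \<Rightarrow> real) \<Rightarrow> (nat \<Rightarrow> ('a, 'n::finite) field) \<Rightarrow> 'a \<Rightarrow> ennreal" where
  "sobolev_sq m F D \<omega> = ennreal ((F \<omega>)\<^sup>2) + (\<Sum>k=1..m. field_sq k (D k) \<omega>)"

text \<open>\<open>has_malliavin_derivs M W m p F D\<close>: the fields \<open>D 1, \<dots>, D m\<close> are the derivatives of F
  obtained by closing the derivative operators from the simple functionals with respect to the
  norm of order \<open>(m, p)\<close>.\<close>

definition has_malliavin_derivs ::
    "'a measure \<Rightarrow> (real \<Rightarrow> 'a \<Rightarrow> real ^ 'n) \<Rightarrow> nat \<Rightarrow> real \<Rightarrow> ('a \<Rightarrow> real) \<Rightarrow>
      (nat \<Rightarrow> ('a, 'n) field) \<Rightarrow> bool" where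
  "has_malliavin_derivs M W m p F D \<longleftrightarrow>
     F \<in> borel_measurable M \<and>
     (\<forall>k\<in>{1..m}. \<forall>\<alpha>\<in>multi_indices k.
        (\<lambda>(\<omega>, s). D k \<alpha> s \<omega>) \<in> borel_measurable (M \<Otimes>\<^sub>M lebesgue_cube k)) \<and>
     (\<exists>r t f. (\<forall>n. simple_data (r n) (t n) (f n)) \<and>
        (\<lambda>n. \<integral>\<^sup>+ \<omega>. ennreal_powr
           (sobolev_sq m (\<lambda>\<omega>. simple_functional W (t n) (f n) \<omega> - F \<omega>)
              (\<lambda>k \<alpha> s \<omega>. simple_deriv W (r n) (t n) (f n) k \<alpha> s \<omega> - D k \<alpha> s \<omega>) \<omega>)
           (p / 2) \<partial>M) \<longlonglongrightarrow> 0)"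

definition malliavin_space ::
    "'a measure \<Rightarrow> (real \<Rightarrow> 'a \<Rightarrow> real ^ 'n) \<Rightarrow> nat \<Rightarrow> real \<Rightarrow> ('a \<Rightarrow> real) set" where
  "malliavin_space M W m p = {F. \<exists>D. has_malliavin_derivs M W m p F D}"

definition malliavin_space_inf ::
    "'a measure \<Rightarrow> (real \<Rightarrow> 'a \<Rightarrow> real ^ 'n) \<Rightarrow> nat \<Rightarrow> ('a \<Rightarrow> real) set" where
  "malliavin_space_inf M W m = (\<Inter>p\<in>{1..}. malliavin_space M W m p)"

text \<open>A version of \<open>D\<^sup>(\<^sup>k\<^sup>)F\<close>. It is taken in the largest space, of order \<open>(k, 1)\<close>, which contains
  those of order \<open>(m, p)\<close> for \<open>m \<ge> k\<close> and \<open>p \<ge> 1\<close>; the derivative operators being closable, the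
  version is unique up to null sets and agrees with the derivative in each of the smaller
  spaces.\<close>

definition malliavin_deriv ::
    "'a measure \<Rightarrow> (real \<Rightarrow> 'a \<Rightarrow> real ^ 'n) \<Rightarrow> nat \<Rightarrow> ('a \<Rightarrow> real) \<Rightarrow> ('a, 'n) field" where
  "malliavin_deriv M W k F = (SOME D. \<exists>E. has_malliavin_derivs M W k 1 F E \<and> D = E k)"

definition malliavin_norm ::
    "'a measure \<Rightarrow> (real \<Rightarrow> 'a \<Rightarrow> real ^ 'n) \<Rightarrow> nat \<Rightarrow> real \<Rightarrow> ('a \<Rightarrow> real ^ 'd) \<Rightarrow> ennreal" where
  "malliavin_norm M W m p F =
     ennreal_powr
       (\<integral>\<^sup>+ \<omega>. ennreal_powr
          (\<Sum>i\<in>UNIV. sobolev_sq m (\<lambda>\<omega>. F \<omega> $ i) (\<lambda>k. malliavin_deriv M W k (\<lambda>\<omega>. F \<omega> $ i)) \<omega>)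
          (p / 2) \<partial>M)
       (1 / p)"

text \<open>\<open>D\<^sup>k\<^sub>s F\<close>, with k and s turned into 1-tuples.\<close>

definition malliavin_deriv1 ::
    "'a measure \<Rightarrow> (real \<Rightarrow> 'a \<Rightarrow> real ^ 'n) \<Rightarrow> 'n \<Rightarrow> real \<Rightarrow> ('a \<Rightarrow> real) \<Rightarrow> 'a \<Rightarrow> real" where
  "malliavin_deriv1 M W k s F = malliavin_deriv M W 1 F (\<lambda>_\<in>{..<1}. k) (\<lambda>_\<in>{..<1}. s)"

definition malliavin_cov ::
    "'a measure \<Rightarrow> (real \<Rightarrow> 'a \<Rightarrow> real ^ 'n) \<Rightarrow> ('a \<Rightarrow> real ^ 'd) \<Rightarrow> 'a \<Rightarrow> real ^ 'd ^ 'd" where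
  "malliavin_cov M W F \<omega> =
     (\<chi> i j. \<Sum>k\<in>UNIV. LINT s:{0..<1}|lborel.
        malliavin_deriv1 M W k s (\<lambda>\<omega>. F \<omega> $ i) \<omega> * malliavin_deriv1 M W k s (\<lambda>\<omega>. F \<omega> $ j) \<omega>)"


section \<open>Total variation distance\<close>

definition tv_dist :: "'a measure \<Rightarrow> ('a \<Rightarrow> real ^ 'd) \<Rightarrow> ('a \<Rightarrow> real ^ 'd) \<Rightarrow> real" where
  "tv_dist M F G =
     (SUP f\<in>{f. f \<in> borel_measurable borel \<and> (\<forall>x. \<bar>f x\<bar> \<le> 1)}.
        \<bar>(\<integral>\<omega>. f (F \<omega>) \<partial>M) - (\<integral>\<omega>. f (G \<omega>) \<partial>M)\<bar>)"

end

theory Submission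
  imports Defs
begin

text \<open>Differentiate along the Cameron--Martin directions \<open>h = (b, k)\<close>, which move the k-th coordinate of
  the path by \<open>t \<mapsto> min t b\<close>; along \<open>h\<close> the derivative of a functional is the integral over
  \<open>[0, b)\<close> of its k-th Malliavin derivative. Interpolating between the convergence of \<open>Fn n\<close> to \<open>F\<close>
  and the bound on the second derivatives of \<open>Fn n\<close>, the directional derivatives of \<open>Fn n\<close> converge
  in probability to those of \<open>F\<close>.

  Given as many directions as \<open>F\<close> has components, weight the probability by a cutoff to the event
  that the matrix of the directional derivatives is invertible. Integration by parts bounds, uniformly
  in n, the effect of a small translation on the weighted law of \<open>Fn n\<close> in total variation. Hence
  this law is close to its convolution with a kernel, and there convergence in probability is enough.

  If the Malliavin matrix of \<open>F\<close> is invertible, then so is the matrix of the derivatives in suitable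
  directions with rational \<open>b\<close>: a vector orthogonal to all directional derivatives is in the kernel of
  the Malliavin matrix. So countably many weights exhaust the probability space.\<close>

section \<open>Differentiable functions with bounded derivatives\<close>

text \<open>The determinant of the Malliavin matrix of \<open>F\<close> is positive almost surely,
  without an integrable inverse, so one integration by parts for the whole law is impossible; this
  forces the localising weights. A weight must itself be differentiated. It is therefore built from
  the derivatives of \<open>Fn n\<close>, not from those of \<open>F\<close>, and it varies with n:
  its derivative contains second derivatives of \<open>Fn n\<close>, controlled in L^1 uniformly in
  n, and its limit is a function of the first derivatives of \<open>F\<close>. \<open>F\<close> is
  never integrated by parts; its smoothing estimate is inherited in the limit. The directions have
  indicators as densities because the divergence of such a direction is a Brownian coordinate at one
  time. No divergence operator has to be built: the formula comes from translating finitely many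
  independent Gaussian increments. Derivatives are treated as a relation between a functional and a
  candidate derivative, witnessed by functionals of finitely many path values, so that uniqueness of
  the derivative is never at stake.\<close>

definition C1 :: "('e::euclidean_space \<Rightarrow> 'f::euclidean_space) \<Rightarrow> ('e \<Rightarrow> 'e \<Rightarrow> 'f) \<Rightarrow> bool" where
  "C1 \<phi> \<phi>' \<longleftrightarrow> (\<forall>x. (\<phi> has_derivative \<phi>' x) (at x)) \<and> (\<forall>v. continuous_on UNIV (\<lambda>x. \<phi>' x v))"

text \<open>The bound on the derivative makes the function Lipschitz and lets the chain rule keep
  derivatives in L^1. The function itself may be unbounded, so that linear maps belong to the
  class.\<close>

definition C1_bounded :: "('e::euclidean_space \<Rightarrow> 'f::euclidean_space) \<Rightarrow> ('e \<Rightarrow> 'e \<Rightarrow> 'f) \<Rightarrow> bool" where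
  "C1_bounded \<phi> \<phi>' \<longleftrightarrow> C1 \<phi> \<phi>' \<and> (\<exists>K. \<forall>x v. norm (\<phi>' x v) \<le> K * norm v)"

lemma C1D: "C1 \<phi> \<phi>' \<Longrightarrow> (\<phi> has_derivative \<phi>' x) (at x)"
  and C1_deriv_continuous: "C1 \<phi> \<phi>' \<Longrightarrow> continuous_on UNIV (\<lambda>x. \<phi>' x v)"
  by (auto simp: C1_def)

lemma C1_bounded_imp_C1: "C1_bounded \<phi> \<phi>' \<Longrightarrow> C1 \<phi> \<phi>'"
  by (simp add: C1_bounded_def)

lemma C1_linear: "C1 \<phi> \<phi>' \<Longrightarrow> bounded_linear (\<phi>' x)"
  using C1D has_derivative_bounded_linear by blast

lemma C1_continuous: "C1 \<phi> \<phi>' \<Longrightarrow> continuous_on UNIV \<phi>"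
  by (meson C1D continuous_at_imp_continuous_on has_derivative_continuous)

lemma C1_deriv_expand:
  assumes "C1 \<phi> \<phi>'"
  shows "\<phi>' x v = (\<Sum>b\<in>Basis. (v \<bullet> b) *\<^sub>R \<phi>' x b)"
proof -
  interpret bounded_linear "\<phi>' x" by (rule C1_linear[OF assms])
  have "\<phi>' x v = \<phi>' x (\<Sum>b\<in>Basis. (v \<bullet> b) *\<^sub>R b)" by (simp add: euclidean_representation)
  also have "\<dots> = (\<Sum>b\<in>Basis. (v \<bullet> b) *\<^sub>R \<phi>' x b)" by (simp add: sum scaleR)
  finally show ?thesis .
qed

text \<open>\<open>C1\<close> demands continuity in each fixed direction; linearity in the direction
  and a finite basis upgrade it to joint continuity. This is the source of the measurability of
  \<open>\<phi>' (X \<omega>) (Y \<omega>)\<close>.\<close>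

lemma C1_deriv_continuous2:
  assumes "C1 \<phi> \<phi>'"
  shows "continuous_on UNIV (\<lambda>(x, v). \<phi>' x v)"
proof -
  have "continuous_on UNIV (\<lambda>p. \<Sum>b\<in>Basis. (snd p \<bullet> b) *\<^sub>R \<phi>' (fst p) b)"
    using continuous_on_compose2[OF C1_deriv_continuous[OF assms] continuous_on_fst[OF continuous_on_id]]
    by (intro continuous_intros) auto
  then show ?thesis
    by (subst C1_deriv_expand[OF assms]) (simp add: case_prod_unfold)
qed

lemma C1_bounded_linear: "bounded_linear f \<Longrightarrow> C1_bounded f (\<lambda>_. f)"
  unfolding C1_bounded_def C1_def
  using bounded_linear.nonneg_bounded[of f]
  by (auto simp: mult.commute intro: bounded_linear_imp_has_derivative)

lemma C1_bounded_lipschitz: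
  assumes "C1_bounded \<phi> \<phi>'"
  obtains K where "K > 0" "\<And>x v. norm (\<phi>' x v) \<le> K * norm v" "\<And>x y. norm (\<phi> x - \<phi> y) \<le> K * norm (x - y)"
proof -
  obtain K where K: "\<And>x v. norm (\<phi>' x v) \<le> K * norm v"
    using assms by (auto simp: C1_bounded_def)
  define L where "L = max K 1"
  have L: "norm (\<phi>' x v) \<le> L * norm v" for x v
    by (rule order_trans[OF K]) (auto simp: L_def intro: mult_right_mono)
  have "norm (\<phi> x - \<phi> y) \<le> L * norm (x - y)" for x y
  proof (rule differentiable_bound[where S=UNIV])
    show "(\<phi> has_derivative \<phi>' z) (at z)" for z
      using assms by (auto simp: C1_bounded_def C1_def)
    show "onorm (\<phi>' z) \<le> L" for z
      by (rule onorm_le) (rule L)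
  qed auto
  then show thesis using that[of L] L by (auto simp: L_def)
qed

lemma C1_const: "C1 (\<lambda>_. c) (\<lambda>_ _. 0)"
  by (auto simp: C1_def)

lemma C1_bounded_const: "C1_bounded (\<lambda>_. c) (\<lambda>_ _. 0)"
  by (auto simp: C1_bounded_def C1_const intro!: exI[of _ 0])

lemma C1_add: "C1 f f' \<Longrightarrow> C1 g g' \<Longrightarrow> C1 (\<lambda>x. f x + g x) (\<lambda>x v. f' x v + g' x v)"
  by (auto simp: C1_def intro!: derivative_intros continuous_intros)

lemma C1_mult:
  fixes f g :: "'e::euclidean_space \<Rightarrow> real"
  assumes "C1 f f'" "C1 g g'"
  shows "C1 (\<lambda>x. f x * g x) (\<lambda>x v. f x * g' x v + f' x v * g x)"
  using assms C1_continuous[OF assms(1)] C1_continuous[OF assms(2)]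
  by (auto simp: C1_def intro!: has_derivative_mult continuous_intros)

lemma C1_compose_real:
  fixes f :: "'e::euclidean_space \<Rightarrow> real"
  assumes "C1 f f'" "\<And>x. (q has_real_derivative q' x) (at x)" "continuous_on UNIV q'"
  shows "C1 (\<lambda>x. q (f x)) (\<lambda>x v. q' (f x) * f' x v)"
  unfolding C1_def
proof safe
  fix x
  show "((\<lambda>x. q (f x)) has_derivative (\<lambda>v. q' (f x) * f' x v)) (at x)"
    using has_derivative_compose[OF C1D[OF assms(1)] assms(2)[unfolded has_field_derivative_def]]
    by simp
next
  fix v
  show "continuous_on UNIV (\<lambda>x. q' (f x) * f' x v)"
    using assms(1) continuous_on_compose2[OF assms(3) C1_continuous[OF assms(1)]]
    by (auto simp: C1_def intro!: continuous_intros)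
qed

lemma C1_sum:
  assumes "finite I" "\<And>i. i \<in> I \<Longrightarrow> \<exists>f'. C1 (f i) f'"
  shows "\<exists>f'. C1 (\<lambda>x. \<Sum>i\<in>I. f i x) f'"
  using assms
proof (induction I rule: finite_induct)
  case empty
  then show ?case using C1_const by auto
next
  case (insert i I)
  then obtain f' g' where "C1 (f i) f'" "C1 (\<lambda>x. \<Sum>i\<in>I. f i x) g'" by blast
  from C1_add[OF this] show ?case using insert by auto
qed

lemma C1_prod:
  fixes f :: "'i \<Rightarrow> 'e::euclidean_space \<Rightarrow> real"
  assumes "finite I" "\<And>i. i \<in> I \<Longrightarrow> \<exists>f'. C1 (f i) f'"
  shows "\<exists>f'. C1 (\<lambda>x. \<Prod>i\<in>I. f i x) f'"
  using assms
proof (induction I rule: finite_induct)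
  case empty
  then show ?case using C1_const by auto
next
  case (insert i I)
  then obtain f' g' where "C1 (f i) f'" "C1 (\<lambda>x. \<Prod>i\<in>I. f i x) g'" by blast
  from C1_mult[OF this] show ?case using insert by auto
qed

text \<open>Outside the ball the function vanishes on an open set, so its derivative is zero there;
  on the ball each of the finitely many partial derivatives is bounded by compactness. Truncation by
  \<open>cutoff\<close> thereby turns C1 functions into members of
  \<open>C1_bounded\<close>.\<close>

lemma C1_compact_support:
  assumes f: "C1 f f'" and supp: "\<And>x. norm x > R \<Longrightarrow> f x = 0"
  shows "C1_bounded f f'"
proof -
  have zero: "f' x v = 0" if "norm x > R" for x v
  proof -
    have "(f has_derivative (\<lambda>_. 0)) (at x)"
    proof (rule has_derivative_transform_within_open[of "\<lambda>_. 0"])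
      show "open {y::'a. R < norm y}"
        by (intro open_Collect_less continuous_intros)
    qed (use that supp in auto)
    then have "f' x = (\<lambda>_. 0)"
      using C1D[OF f] has_derivative_unique by blast
    then show ?thesis by simp
  qed
  have "\<exists>B. \<forall>x. norm (f' x b) \<le> B" for b
  proof -
    have "compact ((\<lambda>x. f' x b) ` cball 0 R)"
      by (intro compact_continuous_image continuous_on_subset[OF C1_deriv_continuous[OF f]]) auto
    then obtain B where "\<forall>y\<in>(\<lambda>x. f' x b) ` cball 0 R. norm y \<le> B"
      using compact_imp_bounded bounded_iff by metis
    then have "norm (f' x b) \<le> max B 0" for x
      using zero[of x b] by (cases "norm x \<le> R") (auto simp: le_max_iff_disj)
    then show ?thesis by blast
  qed
  then obtain B where B: "\<And>b x. norm (f' x b) \<le> B b" by metis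
  have "norm (f' x v) \<le> (\<Sum>b\<in>Basis. B b) * norm v" for x v
  proof -
    have "norm (f' x v) \<le> (\<Sum>b\<in>Basis. norm ((v \<bullet> b) *\<^sub>R f' x b))"
      by (subst C1_deriv_expand[OF f]) (rule norm_sum)
    also have "\<dots> \<le> (\<Sum>b\<in>Basis. norm v * B b)"
      by (intro sum_mono) (auto intro!: mult_mono B simp: Basis_le_norm)
    finally show ?thesis by (simp add: sum_distrib_left mult.commute)
  qed
  then show ?thesis using f by (auto simp: C1_bounded_def)
qed

text \<open>The outer square makes the truncation continuously differentiable across the sphere of
  radius R, and the squared norm makes it so at the origin. One continuous derivative is all that
  \<open>C1\<close> asks for.\<close>

definition cutoff :: "real \<Rightarrow> 'e::euclidean_space \<Rightarrow> real" where
  "cutoff R x = (max 0 (1 - (norm x / R)\<^sup>2))\<^sup>2"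

lemma has_real_derivative_max_square:
  "((\<lambda>t::real. (max 0 t)\<^sup>2) has_real_derivative 2 * max 0 t) (at t)"
proof -
  consider "t > 0" | "t < 0" | "t = 0" by linarith
  then show ?thesis
  proof cases
    case 1
    have "((\<lambda>t::real. t\<^sup>2) has_real_derivative 2 * t) (at t)"
      by (auto intro!: derivative_eq_intros)
    then have "((\<lambda>t::real. (max 0 t)\<^sup>2) has_real_derivative 2 * t) (at t)"
      by (rule has_field_derivative_transform_within_open[of _ _ _ "{0<..}"]) (use 1 in auto)
    then show ?thesis using 1 by simp
  next
    case 2
    have "((\<lambda>t::real. 0) has_real_derivative 0) (at t)" by simp
    then have "((\<lambda>t::real. (max 0 t)\<^sup>2) has_real_derivative 0) (at t)"
      by (rule has_field_derivative_transform_within_open[of _ _ _ "{..<0}"]) (use 2 in auto)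
    then show ?thesis using 2 by simp
  next
    case 3
    have "((\<lambda>h::real. (max 0 h)\<^sup>2 / h) \<longlongrightarrow> 0) (at 0)"
    proof (rule Lim_null_comparison)
      show "\<forall>\<^sub>F h::real in at 0. norm ((max 0 h)\<^sup>2 / h) \<le> \<bar>h\<bar>"
        by (intro always_eventually) (auto simp: power2_eq_square max_def)
      show "((\<lambda>h::real. \<bar>h\<bar>) \<longlongrightarrow> 0) (at 0)"
        by (auto intro!: tendsto_eq_intros)
    qed
    then show ?thesis using 3 by (simp add: has_field_derivative_iff)
  qed
qed

lemma C1_cutoff: "\<exists>f'. C1 (cutoff R :: 'e::euclidean_space \<Rightarrow> real) f'"
proof -
  define c where "c = 1 / R\<^sup>2"
  have 1: "C1 (\<lambda>x::'e. x \<bullet> x) (\<lambda>x v. x \<bullet> v + v \<bullet> x)"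
    unfolding C1_def by (auto intro!: derivative_intros continuous_intros has_derivative_inner)
  have 2: "C1 (\<lambda>x::'e. 1 - (x \<bullet> x) * c) (\<lambda>x v. - c * (x \<bullet> v + v \<bullet> x))"
    by (rule C1_compose_real[OF 1, where q="\<lambda>t. 1 - t * c" and q'="\<lambda>_. - c"])
       (auto intro!: derivative_eq_intros)
  have 3: "continuous_on UNIV (\<lambda>t::real. 2 * max 0 t)"
    by (intro continuous_intros)
  have "cutoff R = (\<lambda>x::'e. (max 0 (1 - (x \<bullet> x) * c))\<^sup>2)"
    by (auto simp: cutoff_def fun_eq_iff power_divide power2_norm_eq_inner c_def)
  with C1_compose_real[OF 2 has_real_derivative_max_square 3] show ?thesis by auto
qed

lemma cutoff_nonneg [simp]: "0 \<le> cutoff R x"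
  by (simp add: cutoff_def)

lemma cutoff_le_1 [simp]: "cutoff R x \<le> 1"
  unfolding cutoff_def by (rule power_le_one) (auto intro: max.cobounded1)

lemma cutoff_eq_0:
  assumes "R > 0" "norm x \<ge> R"
  shows "cutoff R x = 0"
proof -
  have "1 \<le> (norm x / R)\<^sup>2" using assms by (intro one_le_power) simp
  then show ?thesis by (simp add: cutoff_def)
qed

lemma cutoff_tendsto_1: "(\<lambda>n. cutoff (real (Suc n)) x) \<longlonglongrightarrow> 1"
proof -
  have "(\<lambda>n. norm x / real (Suc n)) \<longlonglongrightarrow> 0"
    by (intro LIMSEQ_Suc lim_const_over_n)
  then have "(\<lambda>n. (max 0 (1 - (norm x / real (Suc n))\<^sup>2))\<^sup>2) \<longlonglongrightarrow> (max 0 (1 - 0\<^sup>2))\<^sup>2"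
    by (intro tendsto_intros)
  then show ?thesis by (simp add: cutoff_def)
qed

section \<open>Polynomials, determinants and cofactors as C1 functions\<close>

lemma C1_real_polynomial:
  fixes p :: "'e::euclidean_space \<Rightarrow> real"
  assumes "real_polynomial_function p"
  shows "\<exists>p'. C1 p p'"
  using assms
proof (induction rule: real_polynomial_function.induct)
  case (linear f)
  then show ?case using C1_bounded_linear C1_bounded_imp_C1 by blast
qed (auto intro: C1_const C1_add C1_mult)

lemma C1_mult_const: "\<exists>f'. C1 f f' \<Longrightarrow> \<exists>f'. C1 (\<lambda>x. c * f x :: real) f'"
  using C1_mult[OF C1_const] by blast

lemma C1_matrix_entry: "\<exists>f'. C1 (\<lambda>B::real^'d^'d. B $ i $ j) f'"
  using C1_bounded_imp_C1[OF C1_bounded_linear[OF bounded_linear_compose[OF bounded_linear_vec_nth bounded_linear_vec_nth]]]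
  by blast

lemma C1_det_gen:
  assumes "\<And>i j. \<exists>f'. C1 (\<lambda>x. A x $ i $ j) f'"
  shows "\<exists>f'. C1 (\<lambda>x. det (A x :: real^'d^'d)) f'"
  unfolding det_def
proof (intro C1_sum)
  show "finite {p. p permutes (UNIV :: 'd set)}" by simp
  fix p
  show "\<exists>f'. C1 (\<lambda>x. of_int (sign p) * (\<Prod>i\<in>UNIV. A x $ i $ p i)) f'"
    by (intro C1_mult_const C1_prod assms) simp
qed

lemma C1_det: "\<exists>f'. C1 (det :: real^'d^'d \<Rightarrow> real) f'"
  by (intro C1_det_gen C1_matrix_entry)

text \<open>The determinants that Cramer's rule produces: column k is replaced by a constant
  vector.\<close>

lemma C1_cofactor:
  "\<exists>f'. C1 (\<lambda>B::real^'d^'d. det (\<chi> i j. if j = k then c $ i else B $ i $ j)) f'"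
proof (intro C1_det_gen)
  fix i j
  show "\<exists>f'. C1 (\<lambda>B::real^'d^'d. (\<chi> i j. if j = k then c $ i else B $ i $ j) $ i $ j) f'"
    using C1_matrix_entry[of i j] C1_const[of "c $ i"] by (cases "j = k") auto
qed

section \<open>Cylindrical functions and the Cameron--Martin shift\<close>

text \<open>By Tonelli and induction on the index set, a coordinatewise translation changes a
  product measure by the product of the one-dimensional densities. Nonnegative integrands avoid
  every question of integrability.\<close>

lemma nn_integral_PiM_shift:
  fixes M :: "'i \<Rightarrow> real measure" and a :: "'i \<Rightarrow> real"
  assumes "product_sigma_finite M" "finite J" and sets[measurable_cong]: "\<And>i. sets (M i) = sets borel"
    and e[measurable]: "\<And>i. e i \<in> borel_measurable borel"
    and shift: "\<And>i f. f \<in> borel_measurable borel \<Longrightarrow>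
      (\<integral>\<^sup>+x. f (x + a i) \<partial>M i) = (\<integral>\<^sup>+x. f x * e i x \<partial>M i)"
    and f: "f \<in> borel_measurable (PiM J M)"
  shows "(\<integral>\<^sup>+x. f (\<lambda>i\<in>J. x i + a i) \<partial>PiM J M) = (\<integral>\<^sup>+x. f x * (\<Prod>i\<in>J. e i (x i)) \<partial>PiM J M)"
  using \<open>finite J\<close> f
proof (induction J arbitrary: f rule: finite_induct)
  case empty
  then show ?case by (simp add: PiM_empty nn_integral_count_space_finite)
next
  case (insert i J)
  interpret product_sigma_finite M by fact
  note [measurable] = insert.prems
  define g where "g x = (\<integral>\<^sup>+y. f (x(i := y)) * e i y \<partial>M i)" for x
  let ?P = "\<integral>\<^sup>+x. \<integral>\<^sup>+y. f (x(i := y)) * (\<Prod>j\<in>insert i J. e j ((x(i := y)) j)) \<partial>M i \<partial>PiM J M"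
  have eq: "(\<lambda>j\<in>insert i J. (x(i := y)) j + a j) = (\<lambda>j\<in>J. x j + a j)(i := y + a i)" for x y
    using insert.hyps by (auto simp: fun_eq_iff)
  have "(\<integral>\<^sup>+x. f (\<lambda>j\<in>insert i J. x j + a j) \<partial>PiM (insert i J) M) =
    (\<integral>\<^sup>+x. \<integral>\<^sup>+y. f ((\<lambda>j\<in>J. x j + a j)(i := y + a i)) \<partial>M i \<partial>PiM J M)"
    unfolding eq[symmetric] by (rule product_nn_integral_insert[OF insert.hyps(1,2)]) measurable
  also have "\<dots> = (\<integral>\<^sup>+x. g (\<lambda>j\<in>J. x j + a j) \<partial>PiM J M)"
  proof (intro nn_integral_cong)
    fix x assume x: "x \<in> space (PiM J M)"
    have z: "(\<lambda>j\<in>J. x j + a j) \<in> space (PiM J M)"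
      by (auto simp: space_PiM sets_eq_imp_space_eq[OF sets])
    have m: "(\<lambda>y. f ((\<lambda>j\<in>J. x j + a j)(i := y))) \<in> borel_measurable borel"
      using measurable_comp[OF measurable_component_update insert.prems, OF z insert.hyps(2)]
      unfolding comp_def measurable_cong_sets[OF sets refl] .
    show "(\<integral>\<^sup>+y. f ((\<lambda>j\<in>J. x j + a j)(i := y + a i)) \<partial>M i) = g (\<lambda>j\<in>J. x j + a j)"
      using shift[OF m, of i] by (simp add: g_def)
  qed
  also have "\<dots> = (\<integral>\<^sup>+x. g x * (\<Prod>j\<in>J. e j (x j)) \<partial>PiM J M)"
    unfolding g_def by (rule insert.IH) measurable
  also have "\<dots> = ?P"
  proof (intro nn_integral_cong)
    fix x assume x: "x \<in> space (PiM J M)"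
    have m: "(\<lambda>y. f (x(i := y))) \<in> borel_measurable (M i)"
      using measurable_comp[OF measurable_component_update insert.prems, OF x insert.hyps(2)]
      unfolding comp_def .
    have [measurable]: "e i \<in> borel_measurable (M i)"
      by (simp add: measurable_cong_sets[OF sets refl])
    have "(\<Prod>j\<in>insert i J. e j ((x(i := y)) j)) = e i y * (\<Prod>j\<in>J. e j (x j))" for y
    proof -
      have "(\<Prod>j\<in>J. e j ((x(i := y)) j)) = (\<Prod>j\<in>J. e j (x j))"
        using insert.hyps by (intro prod.cong) auto
      then show ?thesis using insert.hyps by simp
    qed
    then show "g x * (\<Prod>j\<in>J. e j (x j)) =
      (\<integral>\<^sup>+y. f (x(i := y)) * (\<Prod>j\<in>insert i J. e j ((x(i := y)) j)) \<partial>M i)"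
      using m by (simp add: g_def nn_integral_multc[symmetric] mult.assoc)
  qed
  also have "\<dots> = (\<integral>\<^sup>+x. f x * (\<Prod>j\<in>insert i J. e j (x j)) \<partial>PiM (insert i J) M)"
    by (rule product_nn_integral_insert[OF insert.hyps(1,2), symmetric]) measurable
  finally show ?case .
qed

text \<open>Completing the square: the Gaussian density of variance c at \<open>x - a\<close> is the
  one at x times \<open>exp (a * x / c - a\<^sup>2 / (2 * c))\<close>. This is the Cameron--Martin
  formula for a single increment.\<close>

lemma nn_integral_normal_shift:
  assumes f[measurable]: "f \<in> borel_measurable borel" and c: "c > 0"
  shows "(\<integral>\<^sup>+x. f (x + a) \<partial>density lborel (normal_density 0 (sqrt c))) =
    (\<integral>\<^sup>+x. f x * ennreal (exp (a * x / c - a\<^sup>2 / (2 * c))) \<partial>density lborel (normal_density 0 (sqrt c)))"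
proof -
  let ?n = "normal_density 0 (sqrt c)"
  have "?n (x - a) = ?n x * exp (a * x / c - a\<^sup>2 / (2 * c))" for x
    using c by (simp add: normal_density_def mult_exp_exp field_simps power2_eq_square)
  then have n: "ennreal (?n (x - a)) = ennreal (?n x) * ennreal (exp (a * x / c - a\<^sup>2 / (2 * c)))" for x
    by (simp add: ennreal_mult)
  have "(\<integral>\<^sup>+x. f (x + a) \<partial>density lborel ?n) = (\<integral>\<^sup>+x. ennreal (?n x) * f (x + a) \<partial>lborel)"
    by (subst nn_integral_density) auto
  also have "\<dots> = (\<integral>\<^sup>+x. ennreal (?n (x - a)) * f x \<partial>lborel)"
    by (subst nn_integral_real_affine[where c=1 and t="-a"]) auto
  also have "\<dots> = (\<integral>\<^sup>+x. f x * ennreal (exp (a * x / c - a\<^sup>2 / (2 * c))) \<partial>density lborel ?n)"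
    by (subst nn_integral_density) (auto simp: n mult_ac)
  finally show ?thesis .
qed

section \<open>Cylindrical functionals of a path and their closure properties\<close>

abbreviation path_space :: "(real \<Rightarrow> real^'n) measure" where
  "path_space \<equiv> PiM UNIV (\<lambda>_. borel)"

text \<open>Exponential growth in the sampled values keeps the class stable under multiplication by
  Cameron--Martin densities, while the exponential moments of Gaussian variables still make every
  member integrable. The times form a set that may be enlarged at will, so two functionals can be
  put over a common one.\<close>

definition cylindrical_on :: "real set \<Rightarrow> real \<Rightarrow> ((real \<Rightarrow> real^'n) \<Rightarrow> 'e::euclidean_space) \<Rightarrow> bool" where
  "cylindrical_on T c \<Psi> \<longleftrightarrow> \<Psi> \<in> borel_measurable path_space \<and>
     (\<forall>w w'. (\<forall>t\<in>T. w t = w' t) \<longrightarrow> \<Psi> w = \<Psi> w') \<and>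
     (\<forall>w. norm (\<Psi> w) \<le> exp (c * (1 + (\<Sum>t\<in>T. norm (w t)))))"

definition cylindrical :: "((real \<Rightarrow> real^'n) \<Rightarrow> 'e::euclidean_space) \<Rightarrow> bool" where
  "cylindrical \<Psi> \<longleftrightarrow> (\<exists>T c. finite T \<and> T \<subseteq> {0..1} \<and> 0 \<le> c \<and> cylindrical_on T c \<Psi>)"

lemma cylindrical_measurable: "cylindrical \<Psi> \<Longrightarrow> \<Psi> \<in> borel_measurable path_space"
  by (auto simp: cylindrical_def cylindrical_on_def)

lemma cylindrical_on_mono:
  assumes "cylindrical_on T c \<Psi>" "T \<subseteq> T'" "finite T'" "0 \<le> c" "c \<le> c'"
  shows "cylindrical_on T' c' \<Psi>"
proof -
  have "norm (\<Psi> w) \<le> exp (c' * (1 + (\<Sum>t\<in>T'. norm (w t))))" for w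
  proof -
    have "norm (\<Psi> w) \<le> exp (c * (1 + (\<Sum>t\<in>T. norm (w t))))"
      using assms(1) by (simp add: cylindrical_on_def)
    also have "\<dots> \<le> exp (c' * (1 + (\<Sum>t\<in>T'. norm (w t))))"
      using assms by (auto intro!: mult_mono add_mono sum_mono2 add_nonneg_nonneg sum_nonneg)
    finally show ?thesis .
  qed
  then show ?thesis using assms by (auto simp: cylindrical_on_def subset_iff)
qed

lemma cylindrical_common:
  assumes "cylindrical \<Psi>" "cylindrical \<Phi>"
  obtains T c where "finite T" "T \<subseteq> {0..1}" "0 \<le> c" "cylindrical_on T c \<Psi>" "cylindrical_on T c \<Phi>"
proof -
  obtain S c T d where "finite S" "S \<subseteq> {0..1}" "0 \<le> c" "cylindrical_on S c \<Psi>"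
    "finite T" "T \<subseteq> {0..1}" "0 \<le> d" "cylindrical_on T d \<Phi>"
    using assms by (auto simp: cylindrical_def)
  then show thesis
    using that[of "S \<union> T" "max c d"] cylindrical_on_mono[of S c \<Psi> "S \<union> T" "max c d"]
      cylindrical_on_mono[of T d \<Phi> "S \<union> T" "max c d"] by auto
qed

text \<open>Products, sums, pairs and the chain rule all go through this composition. The growth
  allowed for f is that of a product, which the sum of the exponents absorbs; sums and pairs fit
  because a + b is at most (1 + a)(1 + b).\<close>

lemma cylindrical_compose2:
  assumes "cylindrical \<Psi>" "cylindrical \<Phi>" and m: "(\<lambda>(x, y). f x y) \<in> borel_measurable borel"
    and K: "\<And>x y. norm (f x y) \<le> K * (1 + norm x) * (1 + norm y)"
  shows "cylindrical (\<lambda>w. f (\<Psi> w) (\<Phi> w))"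
proof -
  obtain T c where T: "finite T" "T \<subseteq> {0..1}" "0 \<le> c" and \<Psi>: "cylindrical_on T c \<Psi>" and \<Phi>: "cylindrical_on T c \<Phi>"
    using cylindrical_common assms(1,2) .
  have [measurable]: "\<Psi> \<in> borel_measurable path_space" "\<Phi> \<in> borel_measurable path_space"
    using \<Psi> \<Phi> by (auto simp: cylindrical_on_def)
  have "norm (f (\<Psi> w) (\<Phi> w)) \<le> exp ((\<bar>K\<bar> + 2 + 2 * c) * (1 + (\<Sum>t\<in>T. norm (w t))))" for w
  proof -
    let ?S = "1 + (\<Sum>t\<in>T. norm (w t))"
    have S: "?S \<ge> 1" by (simp add: sum_nonneg)
    \<comment> \<open>The added 1 costs a doubling, and 2 is at most \<open>exp 1\<close>, which
      raises the exponent by at most \<open>?S\<close>.\<close>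
    have e: "1 + norm x \<le> exp ((1 + c) * ?S)" if "norm x \<le> exp (c * ?S)" for x :: "'z::real_normed_vector"
    proof -
      have "1 \<le> exp (c * ?S)" using S T by auto
      then have "1 + norm x \<le> 2 * exp (c * ?S)" using that by linarith
      also have "\<dots> \<le> exp 1 * exp (c * ?S)" using exp_ge_add_one_self[of 1] by (intro mult_right_mono) auto
      also have "\<dots> \<le> exp ((1 + c) * ?S)" using S by (simp add: mult_exp_exp algebra_simps)
      finally show ?thesis .
    qed
    have "K \<le> exp \<bar>K\<bar>" using exp_ge_add_one_self[of "\<bar>K\<bar>"] by linarith
    also have "\<dots> \<le> exp (\<bar>K\<bar> * ?S)" using S by (simp add: mult_le_cancel_left1)
    finally have k: "K \<le> exp (\<bar>K\<bar> * ?S)" .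
    have "norm (f (\<Psi> w) (\<Phi> w)) \<le> K * (1 + norm (\<Psi> w)) * (1 + norm (\<Phi> w))" by (rule K)
    also have "\<dots> \<le> exp (\<bar>K\<bar> * ?S) * exp ((1 + c) * ?S) * exp ((1 + c) * ?S)"
      using \<Psi> \<Phi> by (intro mult_mono k e) (auto simp: cylindrical_on_def)
    also have "\<dots> = exp ((\<bar>K\<bar> + 2 + 2 * c) * ?S)"
      unfolding exp_add[symmetric] by (simp add: algebra_simps)
    finally show ?thesis .
  qed
  moreover have "(\<lambda>w. f (\<Psi> w) (\<Phi> w)) \<in> borel_measurable path_space"
  proof -
    have "(\<lambda>w. (\<Psi> w, \<Phi> w)) \<in> path_space \<rightarrow>\<^sub>M borel" by measurable
    from measurable_compose[OF this m] show ?thesis by simp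
  qed
  ultimately have "cylindrical_on T (\<bar>K\<bar> + 2 + 2 * c) (\<lambda>w. f (\<Psi> w) (\<Phi> w))"
    using \<Psi> \<Phi> unfolding cylindrical_on_def by metis
  moreover have "0 \<le> \<bar>K\<bar> + 2 + 2 * c" using T by simp
  ultimately show ?thesis using T unfolding cylindrical_def by blast
qed

lemma cylindrical_compose:
  assumes "cylindrical \<Psi>" "f \<in> borel_measurable borel" "\<And>x. norm (f x) \<le> K * (1 + norm x)"
  shows "cylindrical (\<lambda>w. f (\<Psi> w))"
proof (rule cylindrical_compose2[OF assms(1,1), where f="\<lambda>x y. f x" and K="\<bar>K\<bar>"])
  have "norm (f x) \<le> \<bar>K\<bar> * (1 + norm x) * (1 + norm y)" for x y
  proof -
    have "norm (f x) \<le> \<bar>K\<bar> * (1 + norm x)"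
      by (rule order_trans[OF assms(3)]) (auto intro!: mult_right_mono)
    also have "\<dots> \<le> \<bar>K\<bar> * (1 + norm x) * (1 + norm y)"
      using mult_left_mono[of 1 "1 + norm y" "\<bar>K\<bar> * (1 + norm x)"] by simp
    finally show ?thesis .
  qed
  then show "norm (f x) \<le> \<bar>K\<bar> * (1 + norm x) * (1 + norm y)" for x y .
  have "(\<lambda>p. f (fst p)) \<in> borel_measurable (borel :: ('b \<times> 'b) measure)"
    by (intro measurable_compose[OF _ assms(2)] borel_measurable_continuous_onI continuous_on_fst continuous_on_id)
  then show "(\<lambda>(x, y :: 'b). f x) \<in> borel_measurable borel"
    by (simp add: case_prod_unfold)
qed

lemma cylindrical_mult:
  assumes "cylindrical \<Psi>" "cylindrical \<Phi>"
  shows "cylindrical (\<lambda>w. \<Psi> w * \<Phi> w :: real)"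
proof (rule cylindrical_compose2[OF assms, where K=1])
  show "norm (x * y) \<le> 1 * (1 + norm x) * (1 + norm y)" for x y :: real
    by (simp add: abs_mult algebra_simps)
  show "(\<lambda>(x, y :: real). x * y) \<in> borel_measurable borel"
    by (intro borel_measurable_continuous_onI) (auto simp: case_prod_unfold intro!: continuous_intros)
qed

lemma add_le_mult_one_plus: "0 \<le> a \<Longrightarrow> 0 \<le> b \<Longrightarrow> a + b \<le> 1 * (1 + a) * (1 + b :: real)"
proof -
  assume "0 \<le> a" "0 \<le> b"
  then have "0 \<le> a * b" by simp
  moreover have "1 * (1 + a) * (1 + b) = 1 + a + b + a * b" by (simp add: algebra_simps)
  ultimately show ?thesis by linarith
qed

lemma cylindrical_add:
  assumes "cylindrical \<Psi>" "cylindrical \<Phi>"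
  shows "cylindrical (\<lambda>w. \<Psi> w + \<Phi> w)"
proof (rule cylindrical_compose2[OF assms, where K=1])
  show "norm (x + y) \<le> 1 * (1 + norm x) * (1 + norm y)" for x y :: 'b
    using norm_triangle_ineq[of x y] add_le_mult_one_plus[OF norm_ge_zero[of x] norm_ge_zero[of y]] by linarith
  show "(\<lambda>(x, y :: 'b). x + y) \<in> borel_measurable borel"
    by (intro borel_measurable_continuous_onI) (auto simp: case_prod_unfold intro!: continuous_intros)
qed

lemma cylindrical_Pair:
  assumes "cylindrical \<Psi>" "cylindrical \<Phi>"
  shows "cylindrical (\<lambda>w. (\<Psi> w, \<Phi> w))"
proof (rule cylindrical_compose2[OF assms, where K=1])
  show "norm (x, y) \<le> 1 * (1 + norm x) * (1 + norm y)" for x :: 'b and y :: 'c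
    using norm_Pair_le[of x y] add_le_mult_one_plus[OF norm_ge_zero[of x] norm_ge_zero[of y]] by linarith
qed simp

lemma cylindrical_const: "cylindrical (\<lambda>_. c)"
  unfolding cylindrical_def cylindrical_on_def
  by (intro exI[of _ "{}"] exI[of _ "norm c"])
     (auto intro!: order_trans[OF _ exp_ge_add_one_self])

lemma cylindrical_eval: "t \<in> {0..1} \<Longrightarrow> cylindrical (\<lambda>w. w t)"
  unfolding cylindrical_def cylindrical_on_def
proof (intro exI[of _ "{t}"] exI[of _ 1] conjI allI)
  show "norm (w t) \<le> exp (1 * (1 + (\<Sum>t\<in>{t}. norm (w t))))" for w :: "real \<Rightarrow> real^'n"
    using exp_ge_add_one_self[of "1 + norm (w t)"] by simp
qed auto

lemma cylindrical_sum:
  assumes "finite I" "\<And>i. i \<in> I \<Longrightarrow> cylindrical (\<Psi> i)"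
  shows "cylindrical (\<lambda>w. \<Sum>i\<in>I. \<Psi> i w)"
  using assms by (induction I rule: finite_induct) (auto intro: cylindrical_const cylindrical_add)

lemma cylindrical_linear:
  assumes "cylindrical \<Psi>" "bounded_linear f"
  shows "cylindrical (\<lambda>w. f (\<Psi> w))"
proof -
  obtain K where K: "\<And>x. norm (f x) \<le> norm x * K" "K \<ge> 0"
    using bounded_linear.nonneg_bounded[OF assms(2)] by auto
  have "norm (f x) \<le> K * (1 + norm x)" for x
    using K(1)[of x] K(2) by (simp add: algebra_simps)
  moreover have "f \<in> borel_measurable borel"
    by (intro borel_measurable_continuous_onI linear_continuous_on assms)
  ultimately show ?thesis by (intro cylindrical_compose[OF assms(1)])
qed

lemma cylindrical_C1_bounded:
  assumes "cylindrical \<Psi>" "C1_bounded \<phi> \<phi>'"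
  shows "cylindrical (\<lambda>w. \<phi> (\<Psi> w))"
proof -
  obtain K where K: "K > 0" "\<And>x y. norm (\<phi> x - \<phi> y) \<le> K * norm (x - y)"
    using C1_bounded_lipschitz[OF assms(2)] by metis
  have "norm (\<phi> x) \<le> (norm (\<phi> 0) + K) * (1 + norm x)" for x
  proof -
    have "norm (\<phi> x) \<le> norm (\<phi> 0) + norm (\<phi> x - \<phi> 0)"
      by (metis add.commute diff_add_cancel norm_triangle_ineq)
    also have "\<dots> \<le> norm (\<phi> 0) + K * norm x" using K(2)[of x 0] by simp
    also have "\<dots> \<le> (norm (\<phi> 0) + K) * (1 + norm x)" using K(1) by (simp add: algebra_simps)
    finally show ?thesis .
  qed
  moreover have "\<phi> \<in> borel_measurable borel"
    by (intro borel_measurable_continuous_onI C1_continuous[OF C1_bounded_imp_C1[OF assms(2)]])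
  ultimately show ?thesis by (intro cylindrical_compose[OF assms(1)])
qed

lemma cylindrical_C1_bounded_deriv:
  assumes "cylindrical \<Psi>" "cylindrical \<Phi>" "C1_bounded \<phi> \<phi>'"
  shows "cylindrical (\<lambda>w. \<phi>' (\<Psi> w) (\<Phi> w))"
proof -
  obtain K where K: "K > 0" "\<And>x v. norm (\<phi>' x v) \<le> K * norm v"
    using C1_bounded_lipschitz[OF assms(3)] by metis
  show ?thesis
  proof (rule cylindrical_compose2[OF assms(1,2), where K=K])
    show "norm (\<phi>' x v) \<le> K * (1 + norm x) * (1 + norm v)" for x v
    proof -
      have "K * norm v \<le> K * (1 + norm x) * (1 + norm v)"
        unfolding mult.assoc using K(1) by (intro mult_left_mono) (auto simp: algebra_simps)
      then show ?thesis using K(2)[of x v] by linarith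
    qed
    show "(\<lambda>(x, y). \<phi>' x y) \<in> borel_measurable borel"
      by (intro borel_measurable_continuous_onI C1_deriv_continuous2[OF C1_bounded_imp_C1[OF assms(3)]])
  qed
qed

text \<open>The primitive of the indicator of \<open>[0, b)\<close> in coordinate k. Its Wiener
  integral is the k-th coordinate of the path at time b; this value is the divergence in the
  integration by parts below.\<close>

definition shift :: "real \<times> 'n \<Rightarrow> real \<Rightarrow> real^'n" where
  "shift h t = axis (snd h) (min t (fst h))"

lemma borel_measurable_vec:
  fixes f :: "'a \<Rightarrow> 'b::euclidean_space^'d"
  assumes "\<And>i. (\<lambda>x. f x $ i) \<in> borel_measurable M"
  shows "f \<in> borel_measurable M"
  using assms by (subst borel_measurable_euclidean_space) (auto simp: Basis_vec_def inner_axis)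

section \<open>Brownian motion as a random element of path space\<close>

locale brownian =
  fixes M :: "'a measure" and W :: "real \<Rightarrow> 'a \<Rightarrow> real^'n"
  assumes bm: "brownian_motion M W"
begin

sublocale prob_space M
  using bm by (simp add: brownian_motion_def)

text \<open>Nothing is assumed about \<open>W t\<close> for t outside \<open>[0, 1]\<close>, not
  even measurability; the value 0 there makes the path a measurable map into
  \<open>path_space\<close>.\<close>

definition path :: "'a \<Rightarrow> real \<Rightarrow> real^'n" where
  "path \<omega> t = (if t \<in> {0..1} then W t \<omega> else 0)"

lemma W_measurable: "t \<in> {0..1} \<Longrightarrow> W t \<in> borel_measurable M"
  using bm by (auto simp: brownian_motion_def)

lemma path_measurable [measurable]: "path \<in> M \<rightarrow>\<^sub>M path_space"
proof (rule measurable_PiM_single')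
  show "(\<lambda>\<omega>. path \<omega> t) \<in> borel_measurable M" for t
    using W_measurable[of t] by (cases "t \<in> {0..1}") (auto simp: path_def)
qed auto

lemma path_component_measurable [measurable]: "(\<lambda>\<omega>. path \<omega> t $ k) \<in> borel_measurable M"
  using W_measurable[of t] by (cases "t \<in> {0..1}") (auto simp: path_def intro: measurable_compose[OF _ borel_measurable_nth])

end

section \<open>The Cameron--Martin formula on a finite grid, from independent Gaussian
  increments\<close>

locale brownian_grid = brownian M W for M :: "'a measure" and W :: "real \<Rightarrow> 'a \<Rightarrow> real^'n" +
  fixes r :: nat and \<tau> :: "nat \<Rightarrow> real"
  assumes \<tau>_mono: "strict_mono_on {..r} \<tau>" and \<tau>_0: "\<tau> 0 = 0" and \<tau>_1: "\<tau> r \<le> 1" and r_pos: "0 < r"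
begin

abbreviation cells :: "(nat \<times> 'n) set" where "cells \<equiv> {..<r} \<times> UNIV"

definition incr :: "'a \<Rightarrow> nat \<times> 'n \<Rightarrow> real" where
  "incr \<omega> = (\<lambda>i\<in>cells. path \<omega> (\<tau> (Suc (fst i))) $ snd i - path \<omega> (\<tau> (fst i)) $ snd i)"

text \<open>Indices past the grid receive the dummy length 1, so that every \<open>cell_law\<close>
  is a genuine normal law, as \<open>nn_integral_PiM_shift\<close> asks for.\<close>

definition len :: "nat \<Rightarrow> real" where
  "len j = (if j < r then \<tau> (Suc j) - \<tau> j else 1)"

text \<open>A step function recovered from the increments. It agrees with the path at the grid
  times, and the functionals treated on the grid look nowhere else.\<close>

definition rebuild :: "(nat \<times> 'n \<Rightarrow> real) \<Rightarrow> real \<Rightarrow> real^'n" where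
  "rebuild x t = (\<chi> l. \<Sum>j | j < r \<and> \<tau> (Suc j) \<le> t. x (j, l))"

lemma \<tau>_le: "i \<le> j \<Longrightarrow> j \<le> r \<Longrightarrow> \<tau> i \<le> \<tau> j"
  using \<tau>_mono by (cases "i = j") (auto simp: strict_mono_on_def intro!: less_imp_le)

lemma \<tau>_less_iff: "i \<le> r \<Longrightarrow> j \<le> r \<Longrightarrow> \<tau> i \<le> \<tau> j \<longleftrightarrow> i \<le> j"
  using \<tau>_mono \<tau>_le by (metis atMost_iff leD linorder_not_less strict_mono_onD)

lemma \<tau>_range: "i \<le> r \<Longrightarrow> \<tau> i \<in> {0..1}"
  using \<tau>_le[of 0 i] \<tau>_le[of i r] \<tau>_0 \<tau>_1 by auto

lemma len_pos: "len j > 0"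
  using \<tau>_mono by (auto simp: len_def strict_mono_on_def)

abbreviation cell_law :: "nat \<times> 'n \<Rightarrow> real measure" where
  "cell_law i \<equiv> density lborel (normal_density 0 (sqrt (len (fst i))))"

lemma incr_measurable [measurable]: "incr \<in> M \<rightarrow>\<^sub>M PiM cells (\<lambda>_. borel)"
  unfolding incr_def by (rule measurable_restrict) measurable

lemma rebuild_measurable [measurable]: "rebuild \<in> PiM cells (\<lambda>_. borel) \<rightarrow>\<^sub>M path_space"
proof (rule measurable_PiM_single')
  fix t :: real
  show "(\<lambda>x. rebuild x t) \<in> borel_measurable (PiM cells (\<lambda>_. borel))"
    by (rule borel_measurable_vec) (auto simp: rebuild_def)
qed auto

text \<open>The independence clause of \<open>brownian_motion\<close> treats time cells and
  coordinates jointly, so the law is a product over the pairs of both.\<close>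

lemma distr_incr: "distr M (PiM cells (\<lambda>_. borel)) incr = PiM cells cell_law"
proof -
  let ?X = "\<lambda>(j, k) \<omega>. W (\<tau> (Suc j)) \<omega> $ k - W (\<tau> j) \<omega> $ k"
  have ind: "indep_vars (\<lambda>_. borel) ?X cells"
  proof -
    have "0 \<le> \<tau> 0 \<and> strict_mono_on {..r} \<tau> \<and> \<tau> r \<le> 1" using \<tau>_mono \<tau>_0 \<tau>_1 by simp
    moreover have "\<forall>(r::nat) \<tau>. 0 \<le> \<tau> 0 \<and> strict_mono_on {..r} \<tau> \<and> \<tau> r \<le> 1 \<longrightarrow>
        indep_vars (\<lambda>_. borel)
          (\<lambda>(j, k) \<omega>. W (\<tau> (Suc j)) \<omega> $ k - W (\<tau> j) \<omega> $ k) ({..<r} \<times> UNIV)"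
      using bm unfolding brownian_motion_def by (elim conjE)
    ultimately show ?thesis by blast
  qed
  have rv: "?X i \<in> borel_measurable M" if "i \<in> cells" for i
    using ind that unfolding indep_vars_def by auto
  have law: "distr M borel (?X i) = cell_law i" if i: "i \<in> cells" for i
  proof -
    obtain j k where jk: "i = (j, k)" "j < r" using i by auto
    have "0 \<le> \<tau> j \<and> \<tau> j < \<tau> (Suc j) \<and> \<tau> (Suc j) \<le> 1"
      using jk \<tau>_range[of j] \<tau>_range[of "Suc j"] len_pos[of j] by (auto simp: len_def)
    then have "distributed M lborel (?X i) (normal_density 0 (sqrt (\<tau> (Suc j) - \<tau> j)))"
      using bm jk unfolding brownian_motion_def by auto
    from distributed_distr_eq_density[OF this] show ?thesis
      using jk by (simp add: len_def cong: distr_cong)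
  qed
  have "distr M (PiM cells (\<lambda>_. borel)) incr = distr M (PiM cells (\<lambda>_. borel)) (\<lambda>\<omega>. \<lambda>i\<in>cells. ?X i \<omega>)"
    using \<tau>_range by (intro distr_cong) (auto simp: incr_def path_def fun_eq_iff)
  also have "\<dots> = PiM cells (\<lambda>i. distr M borel (?X i))"
    by (rule indep_vars_iff_distr_eq_PiM'[where M'="\<lambda>_. borel", THEN iffD1, OF _ rv ind]) (use r_pos in auto)
  also have "\<dots> = PiM cells cell_law"
    by (intro PiM_cong law) auto
  finally show ?thesis .
qed

text \<open>The increments telescope down to \<open>W 0\<close>, which vanishes almost surely; hence
  the exceptional null set.\<close>

lemma AE_rebuild: "AE \<omega> in M. \<forall>i\<le>r. rebuild (incr \<omega>) (\<tau> i) = path \<omega> (\<tau> i)"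
proof -
  have "AE \<omega> in M. W 0 \<omega> = 0" using bm by (simp add: brownian_motion_def)
  then show ?thesis
  proof eventually_elim
    case (elim \<omega>)
    have "rebuild (incr \<omega>) (\<tau> i) = path \<omega> (\<tau> i)" if "i \<le> r" for i
    proof -
      have "{j. j < r \<and> \<tau> (Suc j) \<le> \<tau> i} = {..<i}"
        using that by (auto simp: \<tau>_less_iff Suc_le_eq)
      moreover have "(\<Sum>j<i. incr \<omega> (j, l)) = (\<Sum>j<i. path \<omega> (\<tau> (Suc j)) $ l - path \<omega> (\<tau> j) $ l)" for l
        using that by (intro sum.cong) (auto simp: incr_def)
      moreover have "path \<omega> (\<tau> 0) = 0" using elim by (simp add: \<tau>_0 path_def)
      ultimately show ?thesis
        by (simp add: rebuild_def vec_eq_iff sum_lessThan_telescope[where f="\<lambda>j. path \<omega> (\<tau> j) $ _"])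
    qed
    then show ?case by blast
  qed
qed

lemma sum_len: "p \<le> r \<Longrightarrow> (\<Sum>j<p. len j) = \<tau> p"
proof -
  assume "p \<le> r"
  then have "(\<Sum>j<p. len j) = (\<Sum>j<p. \<tau> (Suc j) - \<tau> j)" by (intro sum.cong) (auto simp: len_def)
  then show ?thesis by (simp add: sum_lessThan_telescope \<tau>_0)
qed

text \<open>Translating the path along the direction with corner \<open>\<tau> p\<close> adds
  \<open>\<epsilon> * len j\<close> to the increments of coordinate k over the cells before p and
  leaves all others alone. By independence this is a translation of a product of Gaussian laws. As
  each translation is proportional to the variance of its cell, the densities multiply to the
  exponential of a telescoping sum.\<close>

lemma cameron_martin_grid:
  assumes G[measurable]: "G \<in> borel_measurable path_space"
    and dep: "\<And>w w'. (\<And>i. i \<le> r \<Longrightarrow> w (\<tau> i) = w' (\<tau> i)) \<Longrightarrow> G w = (G w' :: ennreal)"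
    and p: "p \<le> r"
  shows "(\<integral>\<^sup>+\<omega>. G (\<lambda>t. path \<omega> t + \<epsilon> *\<^sub>R shift (\<tau> p, k) t) \<partial>M) =
    (\<integral>\<^sup>+\<omega>. G (path \<omega>) * ennreal (exp (\<epsilon> * path \<omega> (\<tau> p) $ k - \<epsilon>\<^sup>2 * \<tau> p / 2)) \<partial>M)"
proof -
  define a where "a i = (if snd i = k \<and> fst i < p then \<epsilon> * len (fst i) else 0)" for i :: "nat \<times> 'n"
  define e where "e i x = ennreal (exp (a i * x / len (fst i) - (a i)\<^sup>2 / (2 * len (fst i))))" for i x
  have [measurable]: "e i \<in> borel_measurable borel" for i
    unfolding e_def by measurable
  have psf: "product_sigma_finite cell_law"
    unfolding product_sigma_finite_def
    by (auto intro!: prob_space_imp_sigma_finite prob_space_normal_density simp: len_pos)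
  have "(\<integral>\<^sup>+\<omega>. G (\<lambda>t. path \<omega> t + \<epsilon> *\<^sub>R shift (\<tau> p, k) t) \<partial>M) =
      (\<integral>\<^sup>+\<omega>. G (rebuild (\<lambda>i\<in>cells. incr \<omega> i + a i)) \<partial>M)"
  proof (rule nn_integral_cong_AE, use AE_rebuild in eventually_elim)
    case (elim \<omega>)
    show ?case
    proof (rule dep)
      fix i assume i: "i \<le> r"
      have s: "{j. j < r \<and> \<tau> (Suc j) \<le> \<tau> i} = {..<i}"
        using i by (auto simp: \<tau>_less_iff Suc_le_eq)
      have "rebuild (\<lambda>i\<in>cells. incr \<omega> i + a i) (\<tau> i) $ l = rebuild (incr \<omega>) (\<tau> i) $ l + (\<Sum>j<i. a (j, l))" for l
        unfolding rebuild_def s using i by (simp add: sum.distrib[symmetric])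
      moreover have "(\<Sum>j<i. a (j, l)) = \<epsilon> * shift (\<tau> p, k) (\<tau> i) $ l" for l
      proof -
        \<comment> \<open>The cells before both i and p contribute, and their lengths add up to
          \<open>min (\<tau> i) (\<tau> p)\<close>, the value of the shift at
          \<open>\<tau> i\<close>.\<close>
        have "(\<Sum>j<i. a (j, k)) = (\<Sum>j<min i p. \<epsilon> * len j)"
          by (rule sum.mono_neutral_cong_right) (auto simp: a_def)
        also have "\<dots> = \<epsilon> * \<tau> (min i p)" using i p by (simp add: sum_distrib_left[symmetric] sum_len)
        also have "\<tau> (min i p) = min (\<tau> i) (\<tau> p)"
          using i p by (auto simp: min_def \<tau>_less_iff)
        finally show ?thesis by (cases "l = k") (auto simp: a_def shift_def axis_def)
      qed
      ultimately show "path \<omega> (\<tau> i) + \<epsilon> *\<^sub>R shift (\<tau> p, k) (\<tau> i) = rebuild (\<lambda>i\<in>cells. incr \<omega> i + a i) (\<tau> i)"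
        using elim i by (simp add: vec_eq_iff)
    qed
  qed
  also have "\<dots> = (\<integral>\<^sup>+x. G (rebuild (\<lambda>i\<in>cells. x i + a i)) \<partial>distr M (PiM cells (\<lambda>_. borel)) incr)"
    by (subst nn_integral_distr) auto
  also have "\<dots> = (\<integral>\<^sup>+x. G (rebuild x) * (\<Prod>i\<in>cells. e i (x i)) \<partial>distr M (PiM cells (\<lambda>_. borel)) incr)"
    unfolding distr_incr
  proof (rule nn_integral_PiM_shift[OF psf])
    show "(\<integral>\<^sup>+x. f (x + a i) \<partial>cell_law i) = (\<integral>\<^sup>+x. f x * e i x \<partial>cell_law i)"
      if "f \<in> borel_measurable borel" for i and f :: "real \<Rightarrow> ennreal"
      unfolding e_def by (rule nn_integral_normal_shift[OF that len_pos])
    have "sets (PiM cells cell_law) = sets (PiM cells (\<lambda>_. borel))"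
      by (intro sets_PiM_cong) auto
    then show "(\<lambda>x. G (rebuild x)) \<in> borel_measurable (PiM cells cell_law)"
      using measurable_compose[OF rebuild_measurable G] by (simp cong: measurable_cong_sets)
  qed auto
  also have "\<dots> = (\<integral>\<^sup>+\<omega>. G (rebuild (incr \<omega>)) * (\<Prod>i\<in>cells. e i (incr \<omega> i)) \<partial>M)"
    by (subst nn_integral_distr) auto
  also have "\<dots> = (\<integral>\<^sup>+\<omega>. G (path \<omega>) * ennreal (exp (\<epsilon> * path \<omega> (\<tau> p) $ k - \<epsilon>\<^sup>2 * \<tau> p / 2)) \<partial>M)"
  proof (rule nn_integral_cong_AE, use AE_rebuild in eventually_elim)
    case (elim \<omega>)
    have s: "{j. j < r \<and> \<tau> (Suc j) \<le> \<tau> p} = {..<p}"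
      using p by (auto simp: \<tau>_less_iff Suc_le_eq)
    have "(\<Prod>i\<in>cells. e i (incr \<omega> i)) =
        ennreal (exp (\<Sum>i\<in>cells. a i * incr \<omega> i / len (fst i) - (a i)\<^sup>2 / (2 * len (fst i))))"
      unfolding e_def by (subst prod_ennreal) (auto simp: exp_sum)
    \<comment> \<open>Where \<open>a i\<close> is not zero it is \<open>\<epsilon>\<close> times the
      variance of the cell, so the variance cancels in the linear term and one power of it survives
      in the quadratic term.\<close>
    also have "(\<Sum>i\<in>cells. a i * incr \<omega> i / len (fst i) - (a i)\<^sup>2 / (2 * len (fst i))) =
        (\<Sum>i\<in>{..<p} \<times> {k}. \<epsilon> * incr \<omega> i - \<epsilon>\<^sup>2 / 2 * len (fst i))"
    proof (rule sum.mono_neutral_cong_right)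
      show "a i * incr \<omega> i / len (fst i) - (a i)\<^sup>2 / (2 * len (fst i)) = \<epsilon> * incr \<omega> i - \<epsilon>\<^sup>2 / 2 * len (fst i)"
        if "i \<in> {..<p} \<times> {k}" for i
        using that len_pos[of "fst i"] by (auto simp: a_def field_simps power2_eq_square)
    qed (use p in \<open>auto simp: a_def\<close>)
    also have "\<dots> = \<epsilon> * rebuild (incr \<omega>) (\<tau> p) $ k - \<epsilon>\<^sup>2 * \<tau> p / 2"
      unfolding rebuild_def s
      using sum_len[OF p] sum_distrib_left[of "\<epsilon>\<^sup>2 / 2" len "{..<p}"]
      by (simp add: sum.cartesian_product' sum_subtractf sum_distrib_left)
    finally have "(\<Prod>i\<in>cells. e i (incr \<omega> i)) = ennreal (exp (\<epsilon> * path \<omega> (\<tau> p) $ k - \<epsilon>\<^sup>2 * \<tau> p / 2))"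
      using elim p by simp
    moreover have "G (rebuild (incr \<omega>)) = G (path \<omega>)"
      using elim by (intro dep) auto
    ultimately show ?case by simp
  qed
  finally show ?thesis .
qed

end

section \<open>The Cameron--Martin formula for functionals of finitely many times\<close>

context brownian
begin

lemma cameron_martin:
  assumes G: "G \<in> borel_measurable path_space"
    and T: "finite T" "T \<subseteq> {0..1}" and dep: "\<And>w w'. (\<And>t. t \<in> T \<Longrightarrow> w t = w' t) \<Longrightarrow> G w = (G w' :: ennreal)"
    and b: "b \<in> {0..1}"
  shows "(\<integral>\<^sup>+\<omega>. G (\<lambda>t. path \<omega> t + \<epsilon> *\<^sub>R shift (b, k) t) \<partial>M) =
    (\<integral>\<^sup>+\<omega>. G (path \<omega>) * ennreal (exp (\<epsilon> * path \<omega> b $ k - \<epsilon>\<^sup>2 * b / 2)) \<partial>M)"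
proof -
  \<comment> \<open>The grid has to start at 0 and to contain b; adding 1 gives it at least two
    points, hence a cell.\<close>
  define S where "S = T \<union> {0, 1, b}"
  define xs where "xs = sorted_list_of_set S"
  have S: "finite S" "S \<subseteq> {0..1}" "0 \<in> S" "1 \<in> S" "b \<in> S" using T b by (auto simp: S_def)
  have xs: "set xs = S" "sorted_wrt (<) xs" "length xs = card S"
    using S by (auto simp: xs_def)
  have "card S \<ge> 2"
    using card_mono[OF S(1), of "{0, 1}"] S by auto
  then obtain r where r: "card S = Suc r" "r > 0" by (cases "card S") auto
  have nth: "\<exists>i\<le>r. xs ! i = t" if "t \<in> S" for t
    using that xs r by (metis in_set_conv_nth less_Suc_eq_le)
  have in_S: "xs ! i \<in> S" if "i \<le> r" for i using that xs r by (metis le_imp_less_Suc nth_mem)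
  have mono: "strict_mono_on {..r} ((!) xs)"
    using xs r by (auto simp: strict_mono_on_def sorted_wrt_iff_nth_less)
  have "xs ! 0 = 0"
  proof -
    obtain i where "i \<le> r" "xs ! i = 0" using nth S by blast
    then have "xs ! 0 \<le> 0" using strict_mono_onD[OF mono, of 0 i] by (cases "i = 0") auto
    moreover have "xs ! 0 \<ge> 0" using in_S[of 0] S by auto
    ultimately show ?thesis by simp
  qed
  moreover have "xs ! r \<le> 1" using in_S[of r] S by auto
  ultimately interpret g: brownian_grid M W r "(!) xs"
    using mono r by unfold_locales auto
  obtain p where p: "p \<le> r" "xs ! p = b" using nth S by blast
  show ?thesis
    using g.cameron_martin_grid[OF G _ p(1), of \<epsilon> k] dep nth S_def unfolding p(2) by (metis UnI1)
qed

end

text \<open>The largest summand dominates: the sum is at most the number of terms times it.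
  Exponential moments of a sum are thus reduced to those of single coordinates, without independence
  and without Hoelder's inequality. The 1 covers the empty index set.\<close>

lemma exp_sum_le:
  fixes a :: "'i \<Rightarrow> real"
  assumes "finite I"
  shows "exp (\<Sum>i\<in>I. a i) \<le> 1 + (\<Sum>i\<in>I. exp (real (card I) * a i))"
proof (cases "I = {}")
  case False
  then have "Max (a ` I) \<in> a ` I" using assms by simp
  then obtain j where "j \<in> I" "Max (a ` I) = a j" by auto
  then have j: "j \<in> I" "\<And>i. i \<in> I \<Longrightarrow> a i \<le> a j"
    using Max_ge[of "a ` I"] assms by auto
  have "(\<Sum>i\<in>I. a i) \<le> real (card I) * a j"
    using sum_bounded_above[of I a "a j"] j by simp
  then have "exp (\<Sum>i\<in>I. a i) \<le> exp (real (card I) * a j)" by simp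
  also have "\<dots> \<le> (\<Sum>i\<in>I. exp (real (card I) * a i))"
    using member_le_sum[of j I "\<lambda>i. exp (real (card I) * a i)"] assms j by simp
  finally show ?thesis by simp
qed simp

text \<open>The derivative is required at every path rather than almost everywhere, so it is also
  available along the whole translated line (\<open>directional_deriv_at\<close>), where the mean
  value theorem is applied.\<close>

definition directional_deriv ::
    "real \<times> 'n \<Rightarrow> ((real \<Rightarrow> real^'n) \<Rightarrow> 'e::euclidean_space) \<Rightarrow> ((real \<Rightarrow> real^'n) \<Rightarrow> 'e) \<Rightarrow> bool" where
  "directional_deriv h \<Psi> \<Psi>' \<longleftrightarrow>
     (\<forall>w. ((\<lambda>\<epsilon>. \<Psi> (\<lambda>t. w t + \<epsilon> *\<^sub>R shift h t)) has_vector_derivative \<Psi>' w) (at 0))"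

lemma directional_deriv_at:
  assumes "directional_deriv h \<Psi> \<Psi>'"
  shows "((\<lambda>\<epsilon>. \<Psi> (\<lambda>t. w t + \<epsilon> *\<^sub>R shift h t)) has_vector_derivative \<Psi>' (\<lambda>t. w t + \<delta> *\<^sub>R shift h t)) (at \<delta>)"
proof -
  have "((\<lambda>\<epsilon>. \<Psi> (\<lambda>t. (w t + \<delta> *\<^sub>R shift h t) + \<epsilon> *\<^sub>R shift h t)) has_vector_derivative
      \<Psi>' (\<lambda>t. w t + \<delta> *\<^sub>R shift h t)) (at (\<delta> - \<delta>))"
    using assms by (simp add: directional_deriv_def)
  then have "((\<lambda>\<epsilon>. \<Psi> (\<lambda>t. w t + (\<delta> + \<epsilon>) *\<^sub>R shift h t)) has_vector_derivative
      \<Psi>' (\<lambda>t. w t + \<delta> *\<^sub>R shift h t)) (at (\<delta> - \<delta>))"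
    by (simp add: algebra_simps)
  moreover have "((\<lambda>\<epsilon>. \<epsilon> - \<delta>) has_vector_derivative 1) (at \<delta>)"
    by (auto intro!: derivative_eq_intros)
  ultimately show ?thesis
    using vector_diff_chain_at[of "\<lambda>\<epsilon>. \<epsilon> - \<delta>" 1 \<delta> "\<lambda>\<epsilon>. \<Psi> (\<lambda>t. w t + (\<delta> + \<epsilon>) *\<^sub>R shift h t)"]
    by (simp add: comp_def)
qed

lemma norm_shift_le:
  assumes "t \<in> {0..1}" "fst h \<in> {0..1}"
  shows "norm (shift h t) \<le> 1"
proof -
  have "shift h t = min t (fst h) *\<^sub>R axis (snd h) 1"
    by (simp add: shift_def vec_eq_iff axis_def)
  then show ?thesis using assms by (auto simp: norm_axis_1 intro: order_trans[OF min.cobounded1])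
qed

text \<open>The bound is the same for all translations g of size at most 1 on T, so a single
  integrable function dominates all the translated functionals at once.\<close>

lemma cylindrical_on_translate:
  assumes "cylindrical_on T c \<Psi>" "finite T" "0 \<le> c" "\<And>t. t \<in> T \<Longrightarrow> norm (g t) \<le> 1"
  shows "norm (\<Psi> (\<lambda>t. w t + g t)) \<le> exp ((c * (1 + real (card T))) * (1 + (\<Sum>t\<in>T. norm (w t))))"
    and "cylindrical_on T (c * (1 + real (card T))) (\<lambda>w. \<Psi> (\<lambda>t. w t + g t))"
proof -
  show *: "norm (\<Psi> (\<lambda>t. w t + g t)) \<le> exp ((c * (1 + real (card T))) * (1 + (\<Sum>t\<in>T. norm (w t))))" for w
  proof -
    have "norm (\<Psi> (\<lambda>t. w t + g t)) \<le> exp (c * (1 + (\<Sum>t\<in>T. norm (w t + g t))))"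
      using assms(1) by (simp add: cylindrical_on_def)
    also have "\<dots> \<le> exp ((c * (1 + real (card T))) * (1 + (\<Sum>t\<in>T. norm (w t))))"
    proof -
      have "(\<Sum>t\<in>T. norm (w t + g t)) \<le> (\<Sum>t\<in>T. norm (w t) + 1)"
        using assms(4) by (intro sum_mono) (auto intro: norm_triangle_le add_mono)
      also have "\<dots> = (\<Sum>t\<in>T. norm (w t)) + real (card T)" by (simp add: sum.distrib)
      finally have "1 + (\<Sum>t\<in>T. norm (w t + g t)) \<le> 1 + (\<Sum>t\<in>T. norm (w t)) + real (card T)" by simp
      also have "\<dots> \<le> (1 + real (card T)) * (1 + (\<Sum>t\<in>T. norm (w t)))"
        by (simp add: algebra_simps sum_nonneg)
      finally show ?thesis using assms(3) by (simp add: mult.assoc mult_left_mono)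
    qed
    finally show ?thesis .
  qed
  have "(\<lambda>w. (\<lambda>t. w t + g t)) \<in> path_space \<rightarrow>\<^sub>M path_space"
    by (rule measurable_PiM_single') auto
  from measurable_compose[OF this] have "(\<lambda>w. \<Psi> (\<lambda>t. w t + g t)) \<in> borel_measurable path_space"
    using assms(1) by (auto simp: cylindrical_on_def)
  then show "cylindrical_on T (c * (1 + real (card T))) (\<lambda>w. \<Psi> (\<lambda>t. w t + g t))"
    using assms(1) * unfolding cylindrical_on_def by simp
qed

lemma cylindrical_translate:
  assumes "cylindrical \<Psi>" "\<And>t. t \<in> {0..1} \<Longrightarrow> norm (g t) \<le> 1"
  shows "cylindrical (\<lambda>w. \<Psi> (\<lambda>t. w t + g t))"
proof -
  obtain T c where T: "finite T" "T \<subseteq> {0..1}" "0 \<le> c" "cylindrical_on T c \<Psi>"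
    using assms(1) by (auto simp: cylindrical_def)
  have "cylindrical_on T (c * (1 + real (card T))) (\<lambda>w. \<Psi> (\<lambda>t. w t + g t))"
    using T assms(2) by (intro cylindrical_on_translate(2)) auto
  then show ?thesis
    using T unfolding cylindrical_def by (intro exI[of _ T] exI[of _ "c * (1 + real (card T))"]) auto
qed

text \<open>Covers both the Cameron--Martin densities and the functions that dominate their
  difference quotients.\<close>

lemma cylindrical_exp:
  fixes k :: "'n::finite"
  assumes "t \<in> {0..1}"
  shows "cylindrical (\<lambda>w. exp (a * \<bar>w t $ k\<bar> + b * (w t $ k) + d))"
  unfolding cylindrical_def cylindrical_on_def
proof (intro exI[of _ "{t}"] exI[of _ "\<bar>a\<bar> + \<bar>b\<bar> + \<bar>d\<bar>"] conjI allI)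
  show "norm (exp (a * \<bar>w t $ k\<bar> + b * w t $ k + d)) \<le> exp ((\<bar>a\<bar> + \<bar>b\<bar> + \<bar>d\<bar>) * (1 + (\<Sum>t\<in>{t}. norm (w t))))" for w :: "real \<Rightarrow> real^'n"
  proof -
    have n: "\<bar>w t $ k\<bar> \<le> norm (w t)" by (rule component_le_norm_cart)
    have "a * \<bar>w t $ k\<bar> \<le> \<bar>a\<bar> * norm (w t)" using n by (intro mult_mono) auto
    moreover have "b * (w t $ k) \<le> \<bar>b\<bar> * norm (w t)"
      using n by (metis abs_ge_self abs_ge_zero abs_mult mult_left_mono order_trans)
    moreover have "\<bar>d\<bar> * 1 \<le> \<bar>d\<bar> * (1 + norm (w t))" by (intro mult_left_mono) auto
    moreover have "(\<bar>a\<bar> + \<bar>b\<bar> + \<bar>d\<bar>) * (1 + norm (w t)) =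
        \<bar>a\<bar> + \<bar>b\<bar> + \<bar>a\<bar> * norm (w t) + \<bar>b\<bar> * norm (w t) + \<bar>d\<bar> * (1 + norm (w t))"
      by (simp add: algebra_simps)
    ultimately have "a * \<bar>w t $ k\<bar> + b * w t $ k + d \<le> (\<bar>a\<bar> + \<bar>b\<bar> + \<bar>d\<bar>) * (1 + norm (w t))"
      by linarith
    then show ?thesis by simp
  qed
  have [measurable]: "(\<lambda>w. w t $ k) \<in> borel_measurable (path_space :: (real \<Rightarrow> real^'n) measure)"
    by (intro measurable_compose[OF _ borel_measurable_nth] measurable_component_singleton) simp
  show "(\<lambda>w. exp (a * \<bar>w t $ k\<bar> + b * w t $ k + d)) \<in> borel_measurable (path_space :: (real \<Rightarrow> real^'n) measure)"
    by measurable
qed (use assms in auto)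

lemma abs_exp_diff_one_le: "\<bar>exp x - 1\<bar> \<le> \<bar>x\<bar> * exp \<bar>x :: real\<bar>"
proof (cases "x \<ge> 0")
  case True
  have "exp x * (1 - x) \<le> exp x * exp (- x)"
    using exp_ge_add_one_self[of "- x"] by (intro mult_left_mono) auto
  then show ?thesis using True by (simp add: exp_minus algebra_simps)
next
  case False
  have "1 + x \<le> exp x" by (rule exp_ge_add_one_self)
  moreover have "exp x \<le> 1" using False by simp
  moreover have "\<bar>x\<bar> * 1 \<le> \<bar>x\<bar> * exp \<bar>x\<bar>" by (intro mult_left_mono) auto
  ultimately show ?thesis using False by linarith
qed

section \<open>Exponential moments and integration by parts for cylindrical functionals\<close>

context brownian
begin

text \<open>The Cameron--Martin formula for the constant 1 says that the density has integral one,
  and this is the exponential moment of a Brownian coordinate. The absolute value costs a sum of two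
  exponentials.\<close>

lemma integrable_exp_path:
  assumes t: "t \<in> {0..1}"
  shows "integrable M (\<lambda>\<omega>. exp (c * \<bar>path \<omega> t $ k\<bar>))"
proof -
  have 1: "integrable M (\<lambda>\<omega>. exp (c * path \<omega> t $ k))" for c
  proof (rule integrableI_nonneg)
    have "(\<integral>\<^sup>+\<omega>. ennreal (exp (c * path \<omega> t $ k - c\<^sup>2 * t / 2)) \<partial>M) = 1"
      using cameron_martin[of "\<lambda>_. 1" "{}" t c k] t by (simp add: emeasure_space_1)
    moreover have "ennreal (exp (c * path \<omega> t $ k)) = ennreal (exp (c\<^sup>2 * t / 2)) * ennreal (exp (c * path \<omega> t $ k - c\<^sup>2 * t / 2))" for \<omega>
      by (simp add: ennreal_mult[symmetric] mult_exp_exp)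
    ultimately show "(\<integral>\<^sup>+\<omega>. ennreal (exp (c * path \<omega> t $ k)) \<partial>M) < \<infinity>"
      by (simp add: nn_integral_cmult)
  qed auto
  show ?thesis
  proof (rule Bochner_Integration.integrable_bound[OF Bochner_Integration.integrable_add[OF 1[of c] 1[of "-c"]]])
    show "AE \<omega> in M. norm (exp (c * \<bar>path \<omega> t $ k\<bar>)) \<le> norm (exp (c * path \<omega> t $ k) + exp (- c * path \<omega> t $ k))"
    proof (intro AE_I2)
      fix \<omega>
      have "exp (c * \<bar>x\<bar>) \<le> exp (c * x) + exp (- c * x)" for x by (cases "x \<ge> 0") auto
      then show "norm (exp (c * \<bar>path \<omega> t $ k\<bar>)) \<le> norm (exp (c * path \<omega> t $ k) + exp (- c * path \<omega> t $ k))"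
        unfolding real_norm_def abs_exp_cancel by (rule order_trans[OF _ abs_ge_self])
    qed
  qed auto
qed

lemma cylindrical_integrable:
  assumes "cylindrical \<Psi>"
  shows "integrable M (\<lambda>\<omega>. \<Psi> (path \<omega>))"
proof -
  obtain T c where T: "finite T" "T \<subseteq> {0..1}" "0 \<le> c" "cylindrical_on T c \<Psi>"
    using assms by (auto simp: cylindrical_def)
  let ?I = "T \<times> (UNIV :: 'n set)"
  let ?B = "\<lambda>\<omega>. exp c * (1 + (\<Sum>i\<in>?I. exp (real (card ?I) * c * \<bar>path \<omega> (fst i) $ snd i\<bar>)))"
  have "integrable M ?B"
    using T by (intro integrable_mult_right Bochner_Integration.integrable_add Bochner_Integration.integrable_sum integrable_exp_path) auto
  then show ?thesis
  proof (rule Bochner_Integration.integrable_bound)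
    show "(\<lambda>\<omega>. \<Psi> (path \<omega>)) \<in> borel_measurable M"
      using measurable_compose[OF path_measurable cylindrical_measurable[OF assms]] .
    show "AE \<omega> in M. norm (\<Psi> (path \<omega>)) \<le> norm (?B \<omega>)"
    proof (intro AE_I2)
      fix \<omega>
      have "norm (\<Psi> (path \<omega>)) \<le> exp (c * (1 + (\<Sum>t\<in>T. norm (path \<omega> t))))"
        using T(4) by (simp add: cylindrical_on_def)
      also have "\<dots> \<le> exp (c * (1 + (\<Sum>t\<in>T. \<Sum>k\<in>UNIV. \<bar>path \<omega> t $ k\<bar>)))"
        using T(3) by (auto intro!: mult_left_mono sum_mono norm_le_l1_cart)
      also have "\<dots> = exp c * exp (\<Sum>i\<in>?I. c * \<bar>path \<omega> (fst i) $ snd i\<bar>)"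
        by (simp add: mult_exp_exp sum.cartesian_product case_prod_unfold sum_distrib_left algebra_simps)
      also have "\<dots> \<le> ?B \<omega>"
        using exp_sum_le[of ?I "\<lambda>i. c * \<bar>path \<omega> (fst i) $ snd i\<bar>"] T(1) by (simp add: mult.assoc)
      finally show "norm (\<Psi> (path \<omega>)) \<le> norm (?B \<omega>)"
        unfolding real_norm_def[of "?B \<omega>"] by (rule order_trans[OF _ abs_ge_self])
    qed
  qed
qed

lemma cameron_martin_integral:
  assumes \<Psi>: "cylindrical (\<Psi> :: (real \<Rightarrow> real^'n) \<Rightarrow> real)" and b: "b \<in> {0..1}" and \<epsilon>: "\<bar>\<epsilon>\<bar> \<le> 1"
  shows "(\<integral>\<omega>. \<Psi> (\<lambda>t. path \<omega> t + \<epsilon> *\<^sub>R shift (b, k) t) \<partial>M) =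
    (\<integral>\<omega>. \<Psi> (path \<omega>) * exp (\<epsilon> * path \<omega> b $ k - \<epsilon>\<^sup>2 * b / 2) \<partial>M)"
proof -
  obtain T c where T: "finite T" "T \<subseteq> {0..1}" "0 \<le> c" "cylindrical_on T c \<Psi>"
    using \<Psi> by (auto simp: cylindrical_def)
  have m: "\<Psi> \<in> borel_measurable path_space" using \<Psi> by (rule cylindrical_measurable)
  have g: "norm (\<epsilon> *\<^sub>R shift (b, k) t) \<le> 1" if "t \<in> {0..1}" for t
    using norm_shift_le[OF that, of "(b, k)"] b \<epsilon> by (simp add: mult_le_one)
  have i1: "integrable M (\<lambda>\<omega>. \<Psi> (\<lambda>t. path \<omega> t + \<epsilon> *\<^sub>R shift (b, k) t))"
    using cylindrical_integrable[OF cylindrical_translate[OF \<Psi> g]] by simp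
  have "cylindrical (\<lambda>w. \<Psi> w * exp (0 * \<bar>w b $ k\<bar> + \<epsilon> * (w b $ k) + (- \<epsilon>\<^sup>2 * b / 2)))"
    by (rule cylindrical_mult[OF \<Psi> cylindrical_exp[OF b]])
  from cylindrical_integrable[OF this]
  have i2: "integrable M (\<lambda>\<omega>. \<Psi> (path \<omega>) * exp (\<epsilon> * path \<omega> b $ k - \<epsilon>\<^sup>2 * b / 2))"
    by simp
  \<comment> \<open>\<open>ennreal\<close> sends negative values to 0, so taking f to be the
    identity and then negation gives the positive and the negative part.\<close>
  have cm: "(\<integral>\<^sup>+\<omega>. ennreal (f (\<Psi> (\<lambda>t. path \<omega> t + \<epsilon> *\<^sub>R shift (b, k) t))) \<partial>M) =
      (\<integral>\<^sup>+\<omega>. ennreal (f (\<Psi> (path \<omega>))) * ennreal (exp (\<epsilon> * path \<omega> b $ k - \<epsilon>\<^sup>2 * b / 2)) \<partial>M)"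
    if [measurable]: "f \<in> borel_measurable borel" for f :: "real \<Rightarrow> real"
  proof (rule cameron_martin[OF _ T(1,2) _ b])
    show "(\<lambda>w. ennreal (f (\<Psi> w))) \<in> borel_measurable path_space" using m by measurable
    show "ennreal (f (\<Psi> w)) = ennreal (f (\<Psi> w'))" if "\<And>t. t \<in> T \<Longrightarrow> w t = w' t" for w w'
      using T(4) that unfolding cylindrical_on_def by metis
  qed
  have "(\<integral>\<^sup>+\<omega>. ennreal (\<Psi> (\<lambda>t. path \<omega> t + \<epsilon> *\<^sub>R shift (b, k) t)) \<partial>M) =
      (\<integral>\<^sup>+\<omega>. ennreal (\<Psi> (path \<omega>) * exp (\<epsilon> * path \<omega> b $ k - \<epsilon>\<^sup>2 * b / 2)) \<partial>M)"
    using cm[of "\<lambda>x. x"] by (simp add: ennreal_mult''[symmetric])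
  moreover have "(\<integral>\<^sup>+\<omega>. ennreal (- \<Psi> (\<lambda>t. path \<omega> t + \<epsilon> *\<^sub>R shift (b, k) t)) \<partial>M) =
      (\<integral>\<^sup>+\<omega>. ennreal (- (\<Psi> (path \<omega>) * exp (\<epsilon> * path \<omega> b $ k - \<epsilon>\<^sup>2 * b / 2))) \<partial>M)"
    using cm[of uminus] by (simp add: ennreal_mult''[symmetric])
  ultimately show ?thesis
    unfolding real_lebesgue_integral_def[OF i1] real_lebesgue_integral_def[OF i2] by simp
qed

text \<open>Both sides of the Cameron--Martin identity are differentiated at
  \<open>\<epsilon> = 0\<close>. The left side gives the directional derivative, and on the right
  the density contributes its derivative, the path coordinate at time b. The limit runs along
  \<open>e m\<close>, with dominated convergence on either side.\<close>

lemma integration_by_parts_cylindrical: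
  assumes \<Psi>: "cylindrical (\<Psi> :: (real \<Rightarrow> real^'n) \<Rightarrow> real)" and \<Psi>': "cylindrical \<Psi>'"
    and deriv: "directional_deriv h \<Psi> \<Psi>'" and h: "fst h \<in> {0..1}"
  shows "(\<integral>\<omega>. \<Psi>' (path \<omega>) \<partial>M) = (\<integral>\<omega>. \<Psi> (path \<omega>) * path \<omega> (fst h) $ snd h \<partial>M)"
proof -
  obtain b k where hb: "h = (b, k)" and b: "b \<in> {0..1}" using h by (cases h) auto
  obtain T c where T: "finite T" "T \<subseteq> {0..1}" "0 \<le> c" "cylindrical_on T c \<Psi>" "cylindrical_on T c \<Psi>'"
    using cylindrical_common[OF \<Psi> \<Psi>'] by metis
  define e where "e m = 1 / real (Suc m)" for m
  have e: "0 < e m" "e m \<le> 1" for m by (auto simp: e_def)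
  have e0: "e \<longlonglongrightarrow> 0" unfolding e_def by (rule LIMSEQ_Suc[OF lim_1_over_n])
  have eat: "filterlim e (at 0) sequentially"
    using e e0 by (auto simp: filterlim_at less_imp_neq[symmetric])
  let ?N = "\<lambda>\<omega>. path \<omega> b $ k"
  let ?p = "\<lambda>\<epsilon> \<omega>. \<Psi> (\<lambda>t. path \<omega> t + \<epsilon> *\<^sub>R shift h t)"
  let ?D = "\<lambda>w. exp ((c * (1 + real (card T))) * (1 + (\<Sum>t\<in>T. norm (w t))))"
  have g: "norm (\<epsilon> *\<^sub>R shift h t) \<le> 1" if "t \<in> {0..1}" "\<bar>\<epsilon>\<bar> \<le> 1" for t \<epsilon>
    using norm_shift_le[OF that(1) h] that(2) by (simp add: mult_le_one)
  have m[measurable]: "\<Psi> \<in> borel_measurable path_space" "\<Psi>' \<in> borel_measurable path_space"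
    using \<Psi> \<Psi>' by (auto intro: cylindrical_measurable)
  have ip: "integrable M (?p \<epsilon>)" if "\<bar>\<epsilon>\<bar> \<le> 1" for \<epsilon>
    using cylindrical_integrable[OF cylindrical_translate[OF \<Psi> g]] that by simp
  have bound: "\<bar>(?p \<epsilon> \<omega> - ?p 0 \<omega>) / \<epsilon>\<bar> \<le> ?D (path \<omega>)" if \<epsilon>: "0 < \<epsilon>" "\<epsilon> \<le> 1" for \<epsilon> \<omega>
  proof -
    \<comment> \<open>The mean value theorem turns the difference quotient into the derivative at a
      translated path, where the bound uniform in the translation applies.\<close>
    have "\<exists>\<theta>>0. \<theta> < \<epsilon> \<and> ?p \<epsilon> \<omega> - ?p 0 \<omega> = (\<epsilon> - 0) * \<Psi>' (\<lambda>t. path \<omega> t + \<theta> *\<^sub>R shift h t)"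
      using \<epsilon> directional_deriv_at[OF deriv, of "path \<omega>"]
      by (intro MVT2) (auto simp: has_real_derivative_iff_has_vector_derivative)
    then obtain \<theta> where \<theta>: "0 < \<theta>" "\<theta> < \<epsilon>" "(?p \<epsilon> \<omega> - ?p 0 \<omega>) / \<epsilon> = \<Psi>' (\<lambda>t. path \<omega> t + \<theta> *\<^sub>R shift h t)"
      using \<epsilon> by (auto simp: field_simps)
    have "norm (\<Psi>' (\<lambda>t. path \<omega> t + \<theta> *\<^sub>R shift h t)) \<le> ?D (path \<omega>)"
      using g[of _ \<theta>] \<theta> \<epsilon> T by (intro cylindrical_on_translate(1)) auto
    then show ?thesis unfolding \<theta>(3) by simp
  qed
  have "cylindrical (?D :: (real \<Rightarrow> real^'n) \<Rightarrow> real)"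
    unfolding cylindrical_def cylindrical_on_def
    using T(1-3) by (intro exI[of _ T] exI[of _ "c * (1 + real (card T))"]) auto
  then have iD: "integrable M (\<lambda>\<omega>. ?D (path \<omega>))" by (rule cylindrical_integrable)
  have lim1: "(\<lambda>m. \<integral>\<omega>. (?p (e m) \<omega> - ?p 0 \<omega>) / e m \<partial>M) \<longlonglongrightarrow> (\<integral>\<omega>. \<Psi>' (path \<omega>) \<partial>M)"
  proof (rule integral_dominated_convergence[OF _ _ iD])
    show "(\<lambda>\<omega>. (?p (e m) \<omega> - ?p 0 \<omega>) / e m) \<in> borel_measurable M" for m
      using ip[of "e m"] ip[of 0] e[of m] by (intro borel_measurable_divide borel_measurable_diff borel_measurable_integrable) auto
    show "AE \<omega> in M. (\<lambda>m. (?p (e m) \<omega> - ?p 0 \<omega>) / e m) \<longlonglongrightarrow> \<Psi>' (path \<omega>)"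
    proof (intro AE_I2)
      fix \<omega>
      have "((\<lambda>\<epsilon>. ?p \<epsilon> \<omega>) has_real_derivative \<Psi>' (path \<omega>)) (at 0)"
        using deriv by (simp add: directional_deriv_def has_real_derivative_iff_has_vector_derivative)
      then have "((\<lambda>\<epsilon>. (?p \<epsilon> \<omega> - ?p 0 \<omega>) / \<epsilon>) \<longlongrightarrow> \<Psi>' (path \<omega>)) (at 0)"
        by (simp add: has_field_derivative_iff)
      from filterlim_compose[OF this eat]
      show "(\<lambda>m. (?p (e m) \<omega> - ?p 0 \<omega>) / e m) \<longlonglongrightarrow> \<Psi>' (path \<omega>)" .
    qed
    show "AE \<omega> in M. norm ((?p (e m) \<omega> - ?p 0 \<omega>) / e m) \<le> ?D (path \<omega>)" for m
      using bound[OF e] by simp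
  qed measurable
  let ?r = "\<lambda>\<epsilon> \<omega>. (exp (\<epsilon> * ?N \<omega> - \<epsilon>\<^sup>2 * b / 2) - 1) / \<epsilon>"
  have "cylindrical (\<lambda>w. \<Psi> w * exp (2 * \<bar>w b $ k\<bar> + 0 * (w b $ k) + 2))"
    by (rule cylindrical_mult[OF \<Psi> cylindrical_exp[OF b]])
  from integrable_norm[OF cylindrical_integrable[OF this]]
  have iE: "integrable M (\<lambda>\<omega>. \<bar>\<Psi> (path \<omega>)\<bar> * exp (2 * \<bar>?N \<omega>\<bar> + 2))"
    by (simp add: abs_mult)
  have lim2: "(\<lambda>m. \<integral>\<omega>. \<Psi> (path \<omega>) * ?r (e m) \<omega> \<partial>M) \<longlonglongrightarrow> (\<integral>\<omega>. \<Psi> (path \<omega>) * ?N \<omega> \<partial>M)"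
  proof (rule integral_dominated_convergence[OF _ _ iE])
    show "AE \<omega> in M. (\<lambda>m. \<Psi> (path \<omega>) * ?r (e m) \<omega>) \<longlonglongrightarrow> \<Psi> (path \<omega>) * ?N \<omega>"
    proof (intro AE_I2 tendsto_mult_left)
      fix \<omega>
      have "((\<lambda>\<epsilon>. exp (\<epsilon> * ?N \<omega> - \<epsilon>\<^sup>2 * b / 2)) has_real_derivative ?N \<omega>) (at 0)"
        by (auto intro!: derivative_eq_intros)
      then have "((\<lambda>\<epsilon>. ?r \<epsilon> \<omega>) \<longlongrightarrow> ?N \<omega>) (at 0)"
        by (simp add: has_field_derivative_iff)
      from filterlim_compose[OF this eat] show "(\<lambda>m. ?r (e m) \<omega>) \<longlonglongrightarrow> ?N \<omega>" .
    qed
    show "AE \<omega> in M. norm (\<Psi> (path \<omega>) * ?r (e m) \<omega>) \<le> \<bar>\<Psi> (path \<omega>)\<bar> * exp (2 * \<bar>?N \<omega>\<bar> + 2)" for m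
    proof (intro AE_I2)
      fix \<omega>
      let ?x = "e m * ?N \<omega> - (e m)\<^sup>2 * b / 2" and ?n = "\<bar>?N \<omega>\<bar> + 1"
      have "\<bar>e m * ?N \<omega>\<bar> = e m * \<bar>?N \<omega>\<bar>" using e[of m] by (simp add: abs_mult)
      moreover have "\<bar>(e m)\<^sup>2 * b / 2\<bar> \<le> e m * 1"
      proof -
        have "e m * b \<le> 1" using e[of m] b by (intro mult_le_one) auto
        then have "e m * (e m * b / 2) \<le> e m * 1" using e[of m] by (intro mult_left_mono) auto
        then show ?thesis using b by (simp add: power2_eq_square)
      qed
      \<comment> \<open>A factor \<open>e m\<close> is split off the exponent; it will cancel the
        denominator of \<open>?r\<close>.\<close>
      ultimately have x: "\<bar>?x\<bar> \<le> e m * ?n"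
        using abs_triangle_ineq4[of "e m * ?N \<omega>" "(e m)\<^sup>2 * b / 2"] by (simp add: algebra_simps)
      have "e m * ?n \<le> ?n" using mult_right_mono[of "e m" 1 ?n] e[of m] by simp
      have "\<bar>exp ?x - 1\<bar> \<le> \<bar>?x\<bar> * exp \<bar>?x\<bar>" by (rule abs_exp_diff_one_le)
      also have "\<dots> \<le> (e m * ?n) * exp ?n"
        using x \<open>e m * ?n \<le> ?n\<close> by (intro mult_mono) auto
      finally have "\<bar>?r (e m) \<omega>\<bar> \<le> ?n * exp ?n"
        using e[of m] by (simp add: field_simps)
      also have "\<dots> \<le> exp ?n * exp ?n"
        using exp_ge_add_one_self[of ?n] by (intro mult_right_mono) auto
      also have "\<dots> = exp (2 * \<bar>?N \<omega>\<bar> + 2)" by (simp add: mult_exp_exp)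
      finally show "norm (\<Psi> (path \<omega>) * ?r (e m) \<omega>) \<le> \<bar>\<Psi> (path \<omega>)\<bar> * exp (2 * \<bar>?N \<omega>\<bar> + 2)"
        unfolding real_norm_def abs_mult by (rule mult_left_mono) simp
    qed
  qed measurable
  have eq: "(\<integral>\<omega>. (?p (e m) \<omega> - ?p 0 \<omega>) / e m \<partial>M) = (\<integral>\<omega>. \<Psi> (path \<omega>) * ?r (e m) \<omega> \<partial>M)" for m
  proof -
    have i: "integrable M (\<lambda>\<omega>. \<Psi> (path \<omega>) * exp (e m * ?N \<omega> - (e m)\<^sup>2 * b / 2))"
    proof -
      have "cylindrical (\<lambda>w. \<Psi> w * exp (0 * \<bar>w b $ k\<bar> + e m * (w b $ k) + (- (e m)\<^sup>2 * b / 2)))"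
        by (rule cylindrical_mult[OF \<Psi> cylindrical_exp[OF b]])
      from cylindrical_integrable[OF this] show ?thesis by simp
    qed
    have "(\<integral>\<omega>. (?p (e m) \<omega> - ?p 0 \<omega>) / e m \<partial>M) = ((\<integral>\<omega>. ?p (e m) \<omega> \<partial>M) - (\<integral>\<omega>. \<Psi> (path \<omega>) \<partial>M)) / e m"
      using ip[of "e m"] ip[of 0] e[of m] by simp
    also have "(\<integral>\<omega>. ?p (e m) \<omega> \<partial>M) = (\<integral>\<omega>. \<Psi> (path \<omega>) * exp (e m * ?N \<omega> - (e m)\<^sup>2 * b / 2) \<partial>M)"
      using cameron_martin_integral[OF \<Psi> b, of "e m" k] e[of m] hb by simp
    also have "(\<dots> - (\<integral>\<omega>. \<Psi> (path \<omega>) \<partial>M)) / e m = (\<integral>\<omega>. (\<Psi> (path \<omega>) * exp (e m * ?N \<omega> - (e m)\<^sup>2 * b / 2) - \<Psi> (path \<omega>)) / e m \<partial>M)"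
      using i ip[of 0] by simp
    also have "\<dots> = (\<integral>\<omega>. \<Psi> (path \<omega>) * ?r (e m) \<omega> \<partial>M)"
      by (simp add: right_diff_distrib diff_divide_distrib)
    finally show ?thesis .
  qed
  show ?thesis
    using LIMSEQ_unique[OF lim1[unfolded eq] lim2] by (simp add: hb)
qed

end

section \<open>Weak directional derivatives\<close>

lemma tendsto_integral_L1:
  fixes f :: "nat \<Rightarrow> 'a \<Rightarrow> 'b::{banach, second_countable_topology}"
  assumes "\<And>n. integrable M (f n)" "integrable M g" "(\<lambda>n. \<integral>x. norm (f n x - g x) \<partial>M) \<longlonglongrightarrow> 0"
  shows "(\<lambda>n. \<integral>x. f n x \<partial>M) \<longlonglongrightarrow> (\<integral>x. g x \<partial>M)"
proof (rule LIM_zero_cancel, rule Lim_null_comparison[OF _ assms(3)])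
  show "\<forall>\<^sub>F n in sequentially. norm ((\<integral>x. f n x \<partial>M) - (\<integral>x. g x \<partial>M)) \<le> (\<integral>x. norm (f n x - g x) \<partial>M)"
    using assms(1,2) integral_norm_bound[of M "\<lambda>x. f _ x - g x"] by (intro always_eventually allI) simp
qed

context brownian
begin

text \<open>The two modes of convergence are chosen for stability: almost sure convergence of the
  functionals passes through every continuous function, and L^1 convergence of the derivatives
  survives multiplication by bounded factors. Accordingly \<open>X\<close> is measurable and
  \<open>X'\<close> integrable. This is a relation; that \<open>X\<close> determines
  \<open>X'\<close> is not claimed.\<close>

definition weak_deriv_approx ::
    "real \<times> 'n \<Rightarrow> (nat \<Rightarrow> (real \<Rightarrow> real^'n) \<Rightarrow> 'e::euclidean_space) \<Rightarrow> (nat \<Rightarrow> (real \<Rightarrow> real^'n) \<Rightarrow> 'e) \<Rightarrow>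
      ('a \<Rightarrow> 'e) \<Rightarrow> ('a \<Rightarrow> 'e) \<Rightarrow> bool" where
  "weak_deriv_approx h \<Psi> \<Psi>' X X' \<longleftrightarrow>
     (\<forall>n. cylindrical (\<Psi> n) \<and> cylindrical (\<Psi>' n) \<and> directional_deriv h (\<Psi> n) (\<Psi>' n)) \<and>
     X \<in> borel_measurable M \<and> integrable M X' \<and>
     (AE \<omega> in M. (\<lambda>n. \<Psi> n (path \<omega>)) \<longlonglongrightarrow> X \<omega>) \<and>
     (\<lambda>n. \<integral>\<omega>. norm (\<Psi>' n (path \<omega>) - X' \<omega>) \<partial>M) \<longlonglongrightarrow> 0"

definition weak_deriv :: "real \<times> 'n \<Rightarrow> ('a \<Rightarrow> 'e::euclidean_space) \<Rightarrow> ('a \<Rightarrow> 'e) \<Rightarrow> bool" where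
  "weak_deriv h X X' \<longleftrightarrow> (\<exists>\<Psi> \<Psi>'. weak_deriv_approx h \<Psi> \<Psi>' X X')"

text \<open>The common bound concerns the approximations, at every path. It provides the domination
  in the product rule and in integration by parts.\<close>

definition bounded_weak_deriv :: "real \<times> 'n \<Rightarrow> ('a \<Rightarrow> real) \<Rightarrow> ('a \<Rightarrow> real) \<Rightarrow> bool" where
  "bounded_weak_deriv h X X' \<longleftrightarrow>
     (\<exists>\<Psi> \<Psi>' c. weak_deriv_approx h \<Psi> \<Psi>' X X' \<and> (\<forall>n w. \<bar>\<Psi> n w\<bar> \<le> c))"

lemma weak_deriv_approxI:
  assumes "\<And>n. cylindrical (\<Psi> n)" "\<And>n. cylindrical (\<Psi>' n)" "\<And>n. directional_deriv h (\<Psi> n) (\<Psi>' n)"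
    and "X \<in> borel_measurable M" "integrable M X'" "AE \<omega> in M. (\<lambda>n. \<Psi> n (path \<omega>)) \<longlonglongrightarrow> X \<omega>"
    and "(\<lambda>n. \<integral>\<omega>. norm (\<Psi>' n (path \<omega>) - X' \<omega>) \<partial>M) \<longlonglongrightarrow> 0"
  shows "weak_deriv_approx h \<Psi> \<Psi>' X X'"
  using assms unfolding weak_deriv_approx_def by blast

lemma weak_deriv_approxD:
  assumes "weak_deriv_approx h \<Psi> \<Psi>' X X'"
  shows "cylindrical (\<Psi> n)" "cylindrical (\<Psi>' n)" "directional_deriv h (\<Psi> n) (\<Psi>' n)"
    and "X \<in> borel_measurable M" "integrable M X'" "AE \<omega> in M. (\<lambda>n. \<Psi> n (path \<omega>)) \<longlonglongrightarrow> X \<omega>"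
    and "(\<lambda>n. \<integral>\<omega>. norm (\<Psi>' n (path \<omega>) - X' \<omega>) \<partial>M) \<longlonglongrightarrow> 0"
  using assms unfolding weak_deriv_approx_def by blast+

section \<open>Calculus of weak directional derivatives\<close>

lemma weak_derivD:
  assumes "weak_deriv h X X'"
  shows weak_deriv_measurable: "X \<in> borel_measurable M" and weak_deriv_integrable: "integrable M X'"
  using assms by (auto simp: weak_deriv_def weak_deriv_approx_def)

lemma weak_deriv_cylindrical:
  assumes "cylindrical \<Psi>" "cylindrical \<Psi>'" "directional_deriv h \<Psi> \<Psi>'"
  shows "weak_deriv h (\<lambda>\<omega>. \<Psi> (path \<omega>)) (\<lambda>\<omega>. \<Psi>' (path \<omega>))"
  unfolding weak_deriv_def weak_deriv_approx_def
  using assms cylindrical_integrable[OF assms(2)] measurable_compose[OF path_measurable cylindrical_measurable[OF assms(1)]]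
  by (intro exI[of _ "\<lambda>_. \<Psi>"] exI[of _ "\<lambda>_. \<Psi>'"]) auto

text \<open>The approximations of the two components are combined index by index. Sums and
  differences are then linear images of a pair, and vectors are sums over their coordinates, so one
  chain rule yields all of them.\<close>

lemma weak_deriv_Pair:
  assumes "weak_deriv h X X'" "weak_deriv h Y Y'"
  shows "weak_deriv h (\<lambda>\<omega>. (X \<omega>, Y \<omega>)) (\<lambda>\<omega>. (X' \<omega>, Y' \<omega>))"
proof -
  obtain \<Psi> \<Psi>' \<Phi> \<Phi>' where XX: "weak_deriv_approx h \<Psi> \<Psi>' X X'" and YY: "weak_deriv_approx h \<Phi> \<Phi>' Y Y'"
    using assms by (auto simp: weak_deriv_def)
  note X = XX[unfolded weak_deriv_approx_def] and Y = YY[unfolded weak_deriv_approx_def]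
  have i: "integrable M (\<lambda>\<omega>. norm (\<Psi>' n (path \<omega>) - X' \<omega>))" "integrable M (\<lambda>\<omega>. norm (\<Phi>' n (path \<omega>) - Y' \<omega>))" for n
    using X Y by (auto intro!: integrable_norm Bochner_Integration.integrable_diff cylindrical_integrable)
  have iP: "integrable M (\<lambda>\<omega>. (X' \<omega>, Y' \<omega>))"
  proof (rule Bochner_Integration.integrable_bound)
    show "integrable M (\<lambda>\<omega>. norm (X' \<omega>) + norm (Y' \<omega>))"
      using X Y by auto
    show "(\<lambda>\<omega>. (X' \<omega>, Y' \<omega>)) \<in> borel_measurable M"
      using X Y by (auto intro!: borel_measurable_Pair)
  qed (auto simp: norm_Pair_le)
  have "(\<lambda>n. \<integral>\<omega>. norm ((\<Psi>' n (path \<omega>), \<Phi>' n (path \<omega>)) - (X' \<omega>, Y' \<omega>)) \<partial>M) \<longlonglongrightarrow> 0"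
  proof (rule tendsto_sandwich[OF _ _ tendsto_const])
    show "\<forall>\<^sub>F n in sequentially. (\<integral>\<omega>. norm ((\<Psi>' n (path \<omega>), \<Phi>' n (path \<omega>)) - (X' \<omega>, Y' \<omega>)) \<partial>M)
       \<le> (\<integral>\<omega>. norm (\<Psi>' n (path \<omega>) - X' \<omega>) \<partial>M) + (\<integral>\<omega>. norm (\<Phi>' n (path \<omega>) - Y' \<omega>) \<partial>M)"
    proof (intro always_eventually allI)
      fix n
      have "integrable M (\<lambda>\<omega>. norm ((\<Psi>' n (path \<omega>), \<Phi>' n (path \<omega>)) - (X' \<omega>, Y' \<omega>)))"
        using X Y iP by (intro integrable_norm Bochner_Integration.integrable_diff cylindrical_integrable[OF cylindrical_Pair]) auto
      then have "(\<integral>\<omega>. norm ((\<Psi>' n (path \<omega>), \<Phi>' n (path \<omega>)) - (X' \<omega>, Y' \<omega>)) \<partial>M) \<le>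
          (\<integral>\<omega>. norm (\<Psi>' n (path \<omega>) - X' \<omega>) + norm (\<Phi>' n (path \<omega>) - Y' \<omega>) \<partial>M)"
        using i by (intro integral_mono Bochner_Integration.integrable_add) (auto simp: norm_Pair_le)
      then show "(\<integral>\<omega>. norm ((\<Psi>' n (path \<omega>), \<Phi>' n (path \<omega>)) - (X' \<omega>, Y' \<omega>)) \<partial>M)
       \<le> (\<integral>\<omega>. norm (\<Psi>' n (path \<omega>) - X' \<omega>) \<partial>M) + (\<integral>\<omega>. norm (\<Phi>' n (path \<omega>) - Y' \<omega>) \<partial>M)"
        using i by simp
    qed
    show "(\<lambda>n. (\<integral>\<omega>. norm (\<Psi>' n (path \<omega>) - X' \<omega>) \<partial>M) + (\<integral>\<omega>. norm (\<Phi>' n (path \<omega>) - Y' \<omega>) \<partial>M)) \<longlonglongrightarrow> 0"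
      using X Y by (auto intro!: tendsto_add_zero)
  qed auto
  moreover have "directional_deriv h (\<lambda>w. (\<Psi> n w, \<Phi> n w)) (\<lambda>w. (\<Psi>' n w, \<Phi>' n w))" for n
    using weak_deriv_approxD(3)[OF XX] weak_deriv_approxD(3)[OF YY]
    unfolding directional_deriv_def by (intro allI has_vector_derivative_Pair) blast+
  moreover have "AE \<omega> in M. (\<lambda>n. (\<Psi> n (path \<omega>), \<Phi> n (path \<omega>))) \<longlonglongrightarrow> (X \<omega>, Y \<omega>)"
    using weak_deriv_approxD(6)[OF XX] weak_deriv_approxD(6)[OF YY]
    by eventually_elim (rule tendsto_Pair)
  ultimately have "weak_deriv_approx h (\<lambda>n w. (\<Psi> n w, \<Phi> n w)) (\<lambda>n w. (\<Psi>' n w, \<Phi>' n w))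
      (\<lambda>\<omega>. (X \<omega>, Y \<omega>)) (\<lambda>\<omega>. (X' \<omega>, Y' \<omega>))"
    using weak_deriv_approxD[OF XX] weak_deriv_approxD[OF YY] iP
    by (intro weak_deriv_approxI cylindrical_Pair borel_measurable_Pair)
  then show ?thesis unfolding weak_deriv_def by blast
qed

text \<open>The error of the derivative is \<open>\<phi>' (\<Psi> n) (\<Psi>' n - X')\<close>, at
  most K times the given L^1 error, plus the change of \<open>\<phi>'\<close> from X to
  \<open>\<Psi> n\<close> in the fixed direction \<open>X'\<close>. The latter tends to zero
  pointwise and is dominated by \<open>2 * K * norm X'\<close>.\<close>

lemma weak_deriv_approx_C1_bounded:
  assumes "weak_deriv_approx h \<Psi> \<Psi>' X X'" and \<phi>: "C1_bounded \<phi> \<phi>'"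
  shows "weak_deriv_approx h (\<lambda>n w. \<phi> (\<Psi> n w)) (\<lambda>n w. \<phi>' (\<Psi> n w) (\<Psi>' n w)) (\<lambda>\<omega>. \<phi> (X \<omega>)) (\<lambda>\<omega>. \<phi>' (X \<omega>) (X' \<omega>))"
proof -
  note X = assms(1)[unfolded weak_deriv_approx_def]
  note C1 = C1_bounded_imp_C1[OF \<phi>]
  obtain K where K: "K > 0" "\<And>x v. norm (\<phi>' x v) \<le> K * norm v"
    using C1_bounded_lipschitz[OF \<phi>] by metis
  have [measurable]: "\<phi> \<in> borel_measurable borel" "(\<lambda>(x, v). \<phi>' x v) \<in> borel_measurable borel"
    by (auto intro!: borel_measurable_continuous_onI C1_continuous[OF C1] C1_deriv_continuous2[OF C1])
  have m\<phi>': "(\<lambda>\<omega>. \<phi>' (Y \<omega>) (Z \<omega>)) \<in> borel_measurable M"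
    if "Y \<in> borel_measurable M" "Z \<in> borel_measurable M" for Y Z
    using measurable_compose[OF borel_measurable_Pair[OF that] \<open>(\<lambda>(x, v). \<phi>' x v) \<in> borel_measurable borel\<close>] by simp
  have m\<Psi>: "(\<lambda>\<omega>. \<Psi> n (path \<omega>)) \<in> borel_measurable M" "(\<lambda>\<omega>. \<Psi>' n (path \<omega>)) \<in> borel_measurable M" for n
    using X by (auto intro!: measurable_compose[OF path_measurable] cylindrical_measurable)
  have mX: "X \<in> borel_measurable M" "X' \<in> borel_measurable M" using X by auto
  have iP: "integrable M (\<lambda>\<omega>. \<phi>' (Y \<omega>) (X' \<omega>))" if "Y \<in> borel_measurable M" for Y
  proof (rule Bochner_Integration.integrable_bound[of M "\<lambda>\<omega>. K * norm (X' \<omega>)"])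
    show "AE \<omega> in M. norm (\<phi>' (Y \<omega>) (X' \<omega>)) \<le> norm (K * norm (X' \<omega>))"
      using K by (auto intro!: AE_I2 order_trans[OF K(2)] simp: abs_of_pos)
  qed (use X that in \<open>auto intro!: m\<phi>'\<close>)
  have i1: "integrable M (\<lambda>\<omega>. K * norm (\<Psi>' n (path \<omega>) - X' \<omega>))" for n
    using X by (auto intro!: integrable_mult_right integrable_norm Bochner_Integration.integrable_diff cylindrical_integrable)
  have i2: "integrable M (\<lambda>\<omega>. norm (\<phi>' (\<Psi> n (path \<omega>)) (X' \<omega>) - \<phi>' (X \<omega>) (X' \<omega>)))" for n
    using iP[OF m\<Psi>(1)] iP[OF mX(1)] by (intro integrable_norm Bochner_Integration.integrable_diff)
  have lim: "(\<lambda>n. \<integral>\<omega>. norm (\<phi>' (\<Psi> n (path \<omega>)) (X' \<omega>) - \<phi>' (X \<omega>) (X' \<omega>)) \<partial>M) \<longlonglongrightarrow> (\<integral>\<omega>. 0 \<partial>M)"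
  proof (rule integral_dominated_convergence[where w="\<lambda>\<omega>. 2 * K * norm (X' \<omega>)"])
    show "AE \<omega> in M. (\<lambda>n. norm (\<phi>' (\<Psi> n (path \<omega>)) (X' \<omega>) - \<phi>' (X \<omega>) (X' \<omega>))) \<longlonglongrightarrow> 0"
    proof -
      have "AE \<omega> in M. (\<lambda>n. \<Psi> n (path \<omega>)) \<longlonglongrightarrow> X \<omega>" using X by simp
      then show ?thesis
      proof eventually_elim
        case (elim \<omega>)
        have "(\<lambda>n. \<phi>' (\<Psi> n (path \<omega>)) (X' \<omega>)) \<longlonglongrightarrow> \<phi>' (X \<omega>) (X' \<omega>)"
          by (rule continuous_on_tendsto_compose[OF C1_deriv_continuous[OF C1] elim]) auto
        then show ?case using LIM_zero tendsto_norm_zero by blast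
      qed
    qed
    show "AE \<omega> in M. norm (norm (\<phi>' (\<Psi> n (path \<omega>)) (X' \<omega>) - \<phi>' (X \<omega>) (X' \<omega>))) \<le> 2 * K * norm (X' \<omega>)" for n
    proof (intro AE_I2)
      fix \<omega>
      show "norm (norm (\<phi>' (\<Psi> n (path \<omega>)) (X' \<omega>) - \<phi>' (X \<omega>) (X' \<omega>))) \<le> 2 * K * norm (X' \<omega>)"
        using norm_triangle_ineq4[of "\<phi>' (\<Psi> n (path \<omega>)) (X' \<omega>)" "\<phi>' (X \<omega>) (X' \<omega>)"]
          K(2)[of "\<Psi> n (path \<omega>)" "X' \<omega>"] K(2)[of "X \<omega>" "X' \<omega>"] by simp
    qed
    show "(\<lambda>\<omega>. norm (\<phi>' (\<Psi> n (path \<omega>)) (X' \<omega>) - \<phi>' (X \<omega>) (X' \<omega>))) \<in> borel_measurable M" for n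
      by (rule measurable_compose[OF borel_measurable_diff[OF m\<phi>'[OF m\<Psi>(1) mX(2)] m\<phi>'[OF mX]] borel_measurable_norm])
  qed (use X in auto)
  have "(\<lambda>n. \<integral>\<omega>. norm (\<phi>' (\<Psi> n (path \<omega>)) (\<Psi>' n (path \<omega>)) - \<phi>' (X \<omega>) (X' \<omega>)) \<partial>M) \<longlonglongrightarrow> 0"
  proof (rule tendsto_sandwich[OF _ _ tendsto_const])
    show "\<forall>\<^sub>F n in sequentially. (\<integral>\<omega>. norm (\<phi>' (\<Psi> n (path \<omega>)) (\<Psi>' n (path \<omega>)) - \<phi>' (X \<omega>) (X' \<omega>)) \<partial>M)
       \<le> K * (\<integral>\<omega>. norm (\<Psi>' n (path \<omega>) - X' \<omega>) \<partial>M) + (\<integral>\<omega>. norm (\<phi>' (\<Psi> n (path \<omega>)) (X' \<omega>) - \<phi>' (X \<omega>) (X' \<omega>)) \<partial>M)"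
    proof (intro always_eventually allI)
      fix n
      have "(\<integral>\<omega>. norm (\<phi>' (\<Psi> n (path \<omega>)) (\<Psi>' n (path \<omega>)) - \<phi>' (X \<omega>) (X' \<omega>)) \<partial>M) \<le>
          (\<integral>\<omega>. K * norm (\<Psi>' n (path \<omega>) - X' \<omega>) + norm (\<phi>' (\<Psi> n (path \<omega>)) (X' \<omega>) - \<phi>' (X \<omega>) (X' \<omega>)) \<partial>M)"
      proof (rule integral_mono)
        show "integrable M (\<lambda>\<omega>. norm (\<phi>' (\<Psi> n (path \<omega>)) (\<Psi>' n (path \<omega>)) - \<phi>' (X \<omega>) (X' \<omega>)))"
          using X iP[OF mX(1)] cylindrical_integrable[OF cylindrical_C1_bounded_deriv[OF _ _ \<phi>]]
          by (intro integrable_norm Bochner_Integration.integrable_diff) auto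
        show "integrable M (\<lambda>\<omega>. K * norm (\<Psi>' n (path \<omega>) - X' \<omega>) + norm (\<phi>' (\<Psi> n (path \<omega>)) (X' \<omega>) - \<phi>' (X \<omega>) (X' \<omega>)))"
          using i1 i2 by (intro Bochner_Integration.integrable_add)
        fix \<omega>
        interpret L: bounded_linear "\<phi>' (\<Psi> n (path \<omega>))" by (rule C1_linear[OF C1])
        have "norm (\<phi>' (\<Psi> n (path \<omega>)) (\<Psi>' n (path \<omega>)) - \<phi>' (X \<omega>) (X' \<omega>)) \<le>
          norm (\<phi>' (\<Psi> n (path \<omega>)) (\<Psi>' n (path \<omega>) - X' \<omega>)) + norm (\<phi>' (\<Psi> n (path \<omega>)) (X' \<omega>) - \<phi>' (X \<omega>) (X' \<omega>))"
          by (rule order_trans[OF _ norm_triangle_ineq]) (simp add: L.diff)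
        then show "norm (\<phi>' (\<Psi> n (path \<omega>)) (\<Psi>' n (path \<omega>)) - \<phi>' (X \<omega>) (X' \<omega>)) \<le>
           K * norm (\<Psi>' n (path \<omega>) - X' \<omega>) + norm (\<phi>' (\<Psi> n (path \<omega>)) (X' \<omega>) - \<phi>' (X \<omega>) (X' \<omega>))"
          using K(2)[of "\<Psi> n (path \<omega>)" "\<Psi>' n (path \<omega>) - X' \<omega>"] by linarith
      qed
      then show "(\<integral>\<omega>. norm (\<phi>' (\<Psi> n (path \<omega>)) (\<Psi>' n (path \<omega>)) - \<phi>' (X \<omega>) (X' \<omega>)) \<partial>M)
       \<le> K * (\<integral>\<omega>. norm (\<Psi>' n (path \<omega>) - X' \<omega>) \<partial>M) + (\<integral>\<omega>. norm (\<phi>' (\<Psi> n (path \<omega>)) (X' \<omega>) - \<phi>' (X \<omega>) (X' \<omega>)) \<partial>M)"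
        using i1 i2 by simp
    qed
    show "(\<lambda>n. K * (\<integral>\<omega>. norm (\<Psi>' n (path \<omega>) - X' \<omega>) \<partial>M) + (\<integral>\<omega>. norm (\<phi>' (\<Psi> n (path \<omega>)) (X' \<omega>) - \<phi>' (X \<omega>) (X' \<omega>)) \<partial>M)) \<longlonglongrightarrow> 0"
      using X lim by (intro tendsto_add_zero tendsto_mult_right_zero) auto
  qed auto
  moreover have "directional_deriv h (\<lambda>w. \<phi> (\<Psi> n w)) (\<lambda>w. \<phi>' (\<Psi> n w) (\<Psi>' n w))" for n
    unfolding directional_deriv_def
  proof
    fix w
    have "((\<lambda>\<epsilon>. \<Psi> n (\<lambda>t. w t + \<epsilon> *\<^sub>R shift h t)) has_vector_derivative \<Psi>' n w) (at 0)"
      using X by (simp add: directional_deriv_def)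
    moreover have "(\<phi> has_derivative \<phi>' (\<Psi> n w)) (at (\<Psi> n (\<lambda>t. w t + 0 *\<^sub>R shift h t)) within S)" for S
      using C1D[OF C1, of "\<Psi> n w"] by (simp add: has_derivative_at_withinI)
    ultimately show "((\<lambda>\<epsilon>. \<phi> (\<Psi> n (\<lambda>t. w t + \<epsilon> *\<^sub>R shift h t))) has_vector_derivative \<phi>' (\<Psi> n w) (\<Psi>' n w)) (at 0)"
      using vector_derivative_diff_chain_within[of "\<lambda>\<epsilon>. \<Psi> n (\<lambda>t. w t + \<epsilon> *\<^sub>R shift h t)" _ 0 UNIV \<phi>] by (simp add: comp_def)
  qed
  moreover have "AE \<omega> in M. (\<lambda>n. \<phi> (\<Psi> n (path \<omega>))) \<longlonglongrightarrow> \<phi> (X \<omega>)"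
  proof -
    have "AE \<omega> in M. (\<lambda>n. \<Psi> n (path \<omega>)) \<longlonglongrightarrow> X \<omega>" using X by simp
    then show ?thesis
      by eventually_elim (rule continuous_on_tendsto_compose[OF C1_continuous[OF C1]], auto)
  qed
  moreover have "\<phi> \<in> borel_measurable borel" by fact
  ultimately show ?thesis
    using weak_deriv_approxD(1,2)[OF assms(1)]
    by (intro weak_deriv_approxI cylindrical_C1_bounded[OF _ \<phi>] cylindrical_C1_bounded_deriv[OF _ _ \<phi>]
      iP[OF mX(1)] measurable_compose[OF mX(1)])
qed

lemma weak_deriv_C1_bounded:
  assumes "weak_deriv h X X'" "C1_bounded \<phi> \<phi>'"
  shows "weak_deriv h (\<lambda>\<omega>. \<phi> (X \<omega>)) (\<lambda>\<omega>. \<phi>' (X \<omega>) (X' \<omega>))"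
proof -
  obtain \<Psi> \<Psi>' where "weak_deriv_approx h \<Psi> \<Psi>' X X'" using assms by (auto simp: weak_deriv_def)
  from weak_deriv_approx_C1_bounded[OF this assms(2)] show ?thesis
    unfolding weak_deriv_def by (intro exI)
qed

text \<open>A bounded outer function bounds the approximations themselves, whatever X is. Bounded
  derivatives arise in this way or as products of such.\<close>

lemma bounded_weak_deriv_C1_bounded:
  assumes "weak_deriv h X X'" "C1_bounded \<phi> \<phi>'" "\<And>x. \<bar>\<phi> x\<bar> \<le> c"
  shows "bounded_weak_deriv h (\<lambda>\<omega>. \<phi> (X \<omega>)) (\<lambda>\<omega>. \<phi>' (X \<omega>) (X' \<omega>))"
proof -
  obtain \<Psi> \<Psi>' where "weak_deriv_approx h \<Psi> \<Psi>' X X'" using assms by (auto simp: weak_deriv_def)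
  from weak_deriv_approx_C1_bounded[OF this assms(2)] show ?thesis
    unfolding bounded_weak_deriv_def using assms(3) by (intro exI[of _ c] exI conjI allI)
qed

lemma weak_deriv_linear:
  assumes "weak_deriv h X X'" "bounded_linear f"
  shows "weak_deriv h (\<lambda>\<omega>. f (X \<omega>)) (\<lambda>\<omega>. f (X' \<omega>))"
  by (rule weak_deriv_C1_bounded[OF assms(1) C1_bounded_linear[OF assms(2)]])

lemma weak_deriv_add:
  assumes "weak_deriv h X X'" "weak_deriv h Y Y'"
  shows "weak_deriv h (\<lambda>\<omega>. X \<omega> + Y \<omega>) (\<lambda>\<omega>. X' \<omega> + Y' \<omega>)"
  using weak_deriv_linear[OF weak_deriv_Pair[OF assms], of "\<lambda>p. fst p + snd p"]
  by (simp add: bounded_linear_add bounded_linear_fst bounded_linear_snd)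

lemma weak_deriv_diff:
  assumes "weak_deriv h X X'" "weak_deriv h Y Y'"
  shows "weak_deriv h (\<lambda>\<omega>. X \<omega> - Y \<omega>) (\<lambda>\<omega>. X' \<omega> - Y' \<omega>)"
  using weak_deriv_linear[OF weak_deriv_Pair[OF assms], of "\<lambda>p. fst p - snd p"]
  by (simp add: bounded_linear_sub bounded_linear_fst bounded_linear_snd)

lemma weak_deriv_const: "weak_deriv h (\<lambda>_. c) (\<lambda>_. 0)"
  using weak_deriv_cylindrical[OF cylindrical_const[of c] cylindrical_const[of 0]]
  by (simp add: directional_deriv_def)

lemma weak_deriv_sum:
  assumes "finite I" "\<And>i. i \<in> I \<Longrightarrow> weak_deriv h (X i) (X' i)"
  shows "weak_deriv h (\<lambda>\<omega>. \<Sum>i\<in>I. X i \<omega>) (\<lambda>\<omega>. \<Sum>i\<in>I. X' i \<omega>)"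
  using assms by (induction I rule: finite_induct) (auto intro: weak_deriv_const weak_deriv_add)

lemma weak_deriv_vec:
  fixes X :: "'a \<Rightarrow> 'b::euclidean_space^'d"
  assumes "\<And>i. weak_deriv h (\<lambda>\<omega>. X \<omega> $ i) (\<lambda>\<omega>. X' \<omega> $ i)"
  shows "weak_deriv h X X'"
proof -
  have lin: "bounded_linear (axis i :: 'b \<Rightarrow> 'b^'d)" for i
    by (rule linear_conv_bounded_linear[THEN iffD1], rule linearI) (auto simp: vec_eq_iff axis_def)
  have rep: "x = (\<Sum>i\<in>UNIV. axis i (x $ i))" for x :: "'b^'d"
    by (simp add: vec_eq_iff axis_def if_distrib cong: if_cong)
  have "weak_deriv h (\<lambda>\<omega>. \<Sum>i\<in>UNIV. axis i (X \<omega> $ i)) (\<lambda>\<omega>. \<Sum>i\<in>UNIV. axis i (X' \<omega> $ i))"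
    by (intro weak_deriv_sum weak_deriv_linear[OF assms lin]) simp
  then show ?thesis unfolding rep[symmetric] by simp
qed

lemma bounded_weak_deriv_imp: "bounded_weak_deriv h X X' \<Longrightarrow> weak_deriv h X X'"
  by (auto simp: bounded_weak_deriv_def weak_deriv_def)

lemma bounded_weak_deriv_const: "bounded_weak_deriv h (\<lambda>_. c) (\<lambda>_. 0)"
  using bounded_weak_deriv_C1_bounded[OF weak_deriv_const[of h "0::real"] C1_bounded_const[of c]] by blast

text \<open>Each term of the product rule pairs a uniformly bounded factor that converges almost
  surely with a factor that converges in L^1, so each term converges in L^1.\<close>

lemma bounded_weak_deriv_mult:
  assumes "bounded_weak_deriv h X X'" "bounded_weak_deriv h Y Y'"
  shows "bounded_weak_deriv h (\<lambda>\<omega>. X \<omega> * Y \<omega>) (\<lambda>\<omega>. X \<omega> * Y' \<omega> + X' \<omega> * Y \<omega>)"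
proof -
  obtain \<Psi> \<Psi>' c where XX: "weak_deriv_approx h \<Psi> \<Psi>' X X'" and c: "\<And>n w. \<bar>\<Psi> n w\<bar> \<le> c"
    using assms(1) unfolding bounded_weak_deriv_def by blast
  obtain \<Phi> \<Phi>' d where YY: "weak_deriv_approx h \<Phi> \<Phi>' Y Y'" and d: "\<And>n w. \<bar>\<Phi> n w\<bar> \<le> d"
    using assms(2) unfolding bounded_weak_deriv_def by blast
  note X = XX[unfolded weak_deriv_approx_def] and Y = YY[unfolded weak_deriv_approx_def]
  have bX: "AE \<omega> in M. \<bar>X \<omega>\<bar> \<le> c"
  proof -
    have "AE \<omega> in M. (\<lambda>n. \<Psi> n (path \<omega>)) \<longlonglongrightarrow> X \<omega>" using X by simp
    then show ?thesis
      by eventually_elim (rule LIMSEQ_le_const2[OF tendsto_rabs], use c in auto)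
  qed
  have bY: "AE \<omega> in M. \<bar>Y \<omega>\<bar> \<le> d"
  proof -
    have "AE \<omega> in M. (\<lambda>n. \<Phi> n (path \<omega>)) \<longlonglongrightarrow> Y \<omega>" using Y by simp
    then show ?thesis
      by eventually_elim (rule LIMSEQ_le_const2[OF tendsto_rabs], use d in auto)
  qed
  \<comment> \<open>Stated for a generic pair of factors, since it serves both terms of the product
    rule.\<close>
  have half: "integrable M (\<lambda>\<omega>. A \<omega> * B' \<omega>)"
      "integrable M (\<lambda>\<omega>. \<bar>\<Theta> n (path \<omega>) * \<Xi>' n (path \<omega>) - A \<omega> * B' \<omega>\<bar>)"
      "(\<lambda>n. \<integral>\<omega>. \<bar>\<Theta> n (path \<omega>) * \<Xi>' n (path \<omega>) - A \<omega> * B' \<omega>\<bar> \<partial>M) \<longlonglongrightarrow> 0"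
    if \<Theta>: "\<And>n. cylindrical (\<Theta> n)" "\<And>n w. \<bar>\<Theta> n w\<bar> \<le> a" "AE \<omega> in M. (\<lambda>n. \<Theta> n (path \<omega>)) \<longlonglongrightarrow> A \<omega>"
      and A: "A \<in> borel_measurable M" "AE \<omega> in M. \<bar>A \<omega>\<bar> \<le> a"
      and \<Xi>: "\<And>n. cylindrical (\<Xi>' n)" "integrable M B'" "(\<lambda>n. \<integral>\<omega>. norm (\<Xi>' n (path \<omega>) - B' \<omega>) \<partial>M) \<longlonglongrightarrow> 0"
    for \<Theta> \<Xi>' :: "nat \<Rightarrow> (real \<Rightarrow> real^'n) \<Rightarrow> real" and A B' a n
  proof -
    have a: "a \<ge> 0" using \<Theta>(2)[of 0 undefined] by linarith
    have [measurable]: "(\<lambda>\<omega>. \<Theta> n (path \<omega>)) \<in> borel_measurable M" for n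
      using \<Theta>(1) by (auto intro!: measurable_compose[OF path_measurable] cylindrical_measurable)
    note A(1)[measurable]
    have [measurable]: "B' \<in> borel_measurable M" using \<Xi> by auto
    have i: "integrable M (\<lambda>\<omega>. C \<omega> * B' \<omega>)" if [measurable]: "C \<in> borel_measurable M" and "AE \<omega> in M. \<bar>C \<omega>\<bar> \<le> a" for C
    proof (rule Bochner_Integration.integrable_bound[of M "\<lambda>\<omega>. a * B' \<omega>"])
      show "AE \<omega> in M. norm (C \<omega> * B' \<omega>) \<le> norm (a * B' \<omega>)"
        using that(2) by eventually_elim (use a in \<open>auto simp: abs_mult intro!: mult_right_mono\<close>)
    qed (use \<Xi> in auto)
    show iA: "integrable M (\<lambda>\<omega>. A \<omega> * B' \<omega>)" by (rule i) (use A in auto)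
    have i\<Theta>: "integrable M (\<lambda>\<omega>. \<Theta> n (path \<omega>) * B' \<omega>)" for n by (rule i) (use \<Theta> in auto)
    show ii: "integrable M (\<lambda>\<omega>. \<bar>\<Theta> n (path \<omega>) * \<Xi>' n (path \<omega>) - A \<omega> * B' \<omega>\<bar>)" for n
      using cylindrical_integrable[OF cylindrical_mult[OF \<Theta>(1) \<Xi>(1)]] iA
      by (intro integrable_abs Bochner_Integration.integrable_diff)
    have i1: "integrable M (\<lambda>\<omega>. a * \<bar>\<Xi>' n (path \<omega>) - B' \<omega>\<bar>)" for n
      using \<Xi> by (intro integrable_mult_right integrable_abs Bochner_Integration.integrable_diff cylindrical_integrable) auto
    have i2: "integrable M (\<lambda>\<omega>. \<bar>\<Theta> n (path \<omega>) * B' \<omega> - A \<omega> * B' \<omega>\<bar>)" for n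
      using i\<Theta> iA by (intro integrable_abs Bochner_Integration.integrable_diff)
    have lim: "(\<lambda>n. \<integral>\<omega>. \<bar>\<Theta> n (path \<omega>) * B' \<omega> - A \<omega> * B' \<omega>\<bar> \<partial>M) \<longlonglongrightarrow> (\<integral>\<omega>. 0 \<partial>M)"
    proof (rule integral_dominated_convergence[where w="\<lambda>\<omega>. 2 * a * \<bar>B' \<omega>\<bar>"])
      show "AE \<omega> in M. (\<lambda>n. \<bar>\<Theta> n (path \<omega>) * B' \<omega> - A \<omega> * B' \<omega>\<bar>) \<longlonglongrightarrow> 0"
        using \<Theta>(3)
      proof eventually_elim
        case (elim \<omega>)
        have "(\<lambda>n. \<bar>\<Theta> n (path \<omega>) * B' \<omega> - A \<omega> * B' \<omega>\<bar>) \<longlonglongrightarrow> \<bar>A \<omega> * B' \<omega> - A \<omega> * B' \<omega>\<bar>"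
          by (intro tendsto_intros elim)
        then show ?case by simp
      qed
      show "AE \<omega> in M. norm \<bar>\<Theta> n (path \<omega>) * B' \<omega> - A \<omega> * B' \<omega>\<bar> \<le> 2 * a * \<bar>B' \<omega>\<bar>" for n
        using A(2)
      proof eventually_elim
        case (elim \<omega>)
        have "\<bar>\<Theta> n (path \<omega>) - A \<omega>\<bar> \<le> 2 * a" using \<Theta>(2)[of n "path \<omega>"] elim by linarith
        then have "\<bar>\<Theta> n (path \<omega>) - A \<omega>\<bar> * \<bar>B' \<omega>\<bar> \<le> 2 * a * \<bar>B' \<omega>\<bar>" by (rule mult_right_mono) simp
        then show ?case by (simp add: abs_mult[symmetric] left_diff_distrib)
      qed
    qed (use \<Xi> in auto)
    show "(\<lambda>n. \<integral>\<omega>. \<bar>\<Theta> n (path \<omega>) * \<Xi>' n (path \<omega>) - A \<omega> * B' \<omega>\<bar> \<partial>M) \<longlonglongrightarrow> 0"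
    proof (rule tendsto_sandwich[OF _ _ tendsto_const])
      show "\<forall>\<^sub>F n in sequentially. (\<integral>\<omega>. \<bar>\<Theta> n (path \<omega>) * \<Xi>' n (path \<omega>) - A \<omega> * B' \<omega>\<bar> \<partial>M) \<le>
        a * (\<integral>\<omega>. \<bar>\<Xi>' n (path \<omega>) - B' \<omega>\<bar> \<partial>M) + (\<integral>\<omega>. \<bar>\<Theta> n (path \<omega>) * B' \<omega> - A \<omega> * B' \<omega>\<bar> \<partial>M)"
      proof (intro always_eventually allI)
        fix n
        have "(\<integral>\<omega>. \<bar>\<Theta> n (path \<omega>) * \<Xi>' n (path \<omega>) - A \<omega> * B' \<omega>\<bar> \<partial>M) \<le>
           (\<integral>\<omega>. a * \<bar>\<Xi>' n (path \<omega>) - B' \<omega>\<bar> + \<bar>\<Theta> n (path \<omega>) * B' \<omega> - A \<omega> * B' \<omega>\<bar> \<partial>M)"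
        proof (rule integral_mono[OF ii Bochner_Integration.integrable_add[OF i1 i2]])
          fix \<omega>
          have "\<Theta> n (path \<omega>) * \<Xi>' n (path \<omega>) - A \<omega> * B' \<omega> =
            \<Theta> n (path \<omega>) * (\<Xi>' n (path \<omega>) - B' \<omega>) + (\<Theta> n (path \<omega>) * B' \<omega> - A \<omega> * B' \<omega>)"
            by (simp add: algebra_simps)
          moreover have "\<bar>\<Theta> n (path \<omega>) * (\<Xi>' n (path \<omega>) - B' \<omega>)\<bar> \<le> a * \<bar>\<Xi>' n (path \<omega>) - B' \<omega>\<bar>"
            unfolding abs_mult by (rule mult_right_mono[OF \<Theta>(2)]) simp
          ultimately show "\<bar>\<Theta> n (path \<omega>) * \<Xi>' n (path \<omega>) - A \<omega> * B' \<omega>\<bar> \<le>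
             a * \<bar>\<Xi>' n (path \<omega>) - B' \<omega>\<bar> + \<bar>\<Theta> n (path \<omega>) * B' \<omega> - A \<omega> * B' \<omega>\<bar>"
            by linarith
        qed
        then show "(\<integral>\<omega>. \<bar>\<Theta> n (path \<omega>) * \<Xi>' n (path \<omega>) - A \<omega> * B' \<omega>\<bar> \<partial>M) \<le>
          a * (\<integral>\<omega>. \<bar>\<Xi>' n (path \<omega>) - B' \<omega>\<bar> \<partial>M) + (\<integral>\<omega>. \<bar>\<Theta> n (path \<omega>) * B' \<omega> - A \<omega> * B' \<omega>\<bar> \<partial>M)"
          using i1 i2 by simp
      qed
      show "(\<lambda>n. a * (\<integral>\<omega>. \<bar>\<Xi>' n (path \<omega>) - B' \<omega>\<bar> \<partial>M) + (\<integral>\<omega>. \<bar>\<Theta> n (path \<omega>) * B' \<omega> - A \<omega> * B' \<omega>\<bar> \<partial>M)) \<longlonglongrightarrow> 0"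
        using \<Xi>(3) lim by (intro tendsto_add_zero tendsto_mult_right_zero) auto
    qed auto
  qed
  note XY' = half[OF weak_deriv_approxD(1)[OF XX] c weak_deriv_approxD(6)[OF XX] weak_deriv_approxD(4)[OF XX] bX
    weak_deriv_approxD(2)[OF YY] weak_deriv_approxD(5)[OF YY] weak_deriv_approxD(7)[OF YY]]
  note YX' = half[OF weak_deriv_approxD(1)[OF YY] d weak_deriv_approxD(6)[OF YY] weak_deriv_approxD(4)[OF YY] bY
    weak_deriv_approxD(2)[OF XX] weak_deriv_approxD(5)[OF XX] weak_deriv_approxD(7)[OF XX]]
  have L1: "(\<lambda>n. \<integral>\<omega>. norm ((\<Psi> n (path \<omega>) * \<Phi>' n (path \<omega>) + \<Psi>' n (path \<omega>) * \<Phi> n (path \<omega>)) -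
      (X \<omega> * Y' \<omega> + X' \<omega> * Y \<omega>)) \<partial>M) \<longlonglongrightarrow> 0"
  proof (rule tendsto_sandwich[OF _ _ tendsto_const tendsto_add_zero[OF XY'(3) YX'(3)]])
    show "\<forall>\<^sub>F n in sequentially. (\<integral>\<omega>. norm ((\<Psi> n (path \<omega>) * \<Phi>' n (path \<omega>) + \<Psi>' n (path \<omega>) * \<Phi> n (path \<omega>)) -
      (X \<omega> * Y' \<omega> + X' \<omega> * Y \<omega>)) \<partial>M) \<le>
      (\<integral>\<omega>. \<bar>\<Psi> n (path \<omega>) * \<Phi>' n (path \<omega>) - X \<omega> * Y' \<omega>\<bar> \<partial>M) + (\<integral>\<omega>. \<bar>\<Phi> n (path \<omega>) * \<Psi>' n (path \<omega>) - Y \<omega> * X' \<omega>\<bar> \<partial>M)"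
    proof (intro always_eventually allI)
      fix n
      have "(\<integral>\<omega>. norm ((\<Psi> n (path \<omega>) * \<Phi>' n (path \<omega>) + \<Psi>' n (path \<omega>) * \<Phi> n (path \<omega>)) -
        (X \<omega> * Y' \<omega> + X' \<omega> * Y \<omega>)) \<partial>M) \<le>
        (\<integral>\<omega>. \<bar>\<Psi> n (path \<omega>) * \<Phi>' n (path \<omega>) - X \<omega> * Y' \<omega>\<bar> + \<bar>\<Phi> n (path \<omega>) * \<Psi>' n (path \<omega>) - Y \<omega> * X' \<omega>\<bar> \<partial>M)"
      proof (rule integral_mono[OF _ Bochner_Integration.integrable_add[OF XY'(2) YX'(2)]])
        show "integrable M (\<lambda>\<omega>. norm ((\<Psi> n (path \<omega>) * \<Phi>' n (path \<omega>) + \<Psi>' n (path \<omega>) * \<Phi> n (path \<omega>)) -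
          (X \<omega> * Y' \<omega> + X' \<omega> * Y \<omega>)))"
        proof (intro integrable_norm Bochner_Integration.integrable_diff Bochner_Integration.integrable_add)
          show "integrable M (\<lambda>\<omega>. \<Psi> n (path \<omega>) * \<Phi>' n (path \<omega>))" "integrable M (\<lambda>\<omega>. \<Psi>' n (path \<omega>) * \<Phi> n (path \<omega>))"
            using X Y by (auto intro!: cylindrical_integrable[OF cylindrical_mult])
          show "integrable M (\<lambda>\<omega>. X' \<omega> * Y \<omega>)" using YX'(1) by (simp add: mult.commute)
        qed (rule XY'(1))
      qed (simp add: mult.commute)
      then show "(\<integral>\<omega>. norm ((\<Psi> n (path \<omega>) * \<Phi>' n (path \<omega>) + \<Psi>' n (path \<omega>) * \<Phi> n (path \<omega>)) -
        (X \<omega> * Y' \<omega> + X' \<omega> * Y \<omega>)) \<partial>M) \<le>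
        (\<integral>\<omega>. \<bar>\<Psi> n (path \<omega>) * \<Phi>' n (path \<omega>) - X \<omega> * Y' \<omega>\<bar> \<partial>M) + (\<integral>\<omega>. \<bar>\<Phi> n (path \<omega>) * \<Psi>' n (path \<omega>) - Y \<omega> * X' \<omega>\<bar> \<partial>M)"
        using XY'(2) YX'(2) by simp
    qed
  qed auto
  have "AE \<omega> in M. (\<lambda>n. \<Psi> n (path \<omega>) * \<Phi> n (path \<omega>)) \<longlonglongrightarrow> X \<omega> * Y \<omega>"
  proof -
    have "AE \<omega> in M. (\<lambda>n. \<Psi> n (path \<omega>)) \<longlonglongrightarrow> X \<omega>" "AE \<omega> in M. (\<lambda>n. \<Phi> n (path \<omega>)) \<longlonglongrightarrow> Y \<omega>"
      using X Y by simp_all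
    then show ?thesis by eventually_elim (rule tendsto_mult)
  qed
  moreover have "directional_deriv h (\<lambda>w. \<Psi> n w * \<Phi> n w) (\<lambda>w. \<Psi> n w * \<Phi>' n w + \<Psi>' n w * \<Phi> n w)" for n
    unfolding directional_deriv_def
  proof
    fix w
    have "directional_deriv h (\<Psi> n) (\<Psi>' n)" "directional_deriv h (\<Phi> n) (\<Phi>' n)" using X Y by simp_all
    then have "((\<lambda>\<epsilon>. \<Psi> n (\<lambda>t. w t + \<epsilon> *\<^sub>R shift h t)) has_vector_derivative \<Psi>' n w) (at 0)"
      "((\<lambda>\<epsilon>. \<Phi> n (\<lambda>t. w t + \<epsilon> *\<^sub>R shift h t)) has_vector_derivative \<Phi>' n w) (at 0)"
      by (auto simp: directional_deriv_def)
    from has_vector_derivative_mult[OF this]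
    show "((\<lambda>\<epsilon>. \<Psi> n (\<lambda>t. w t + \<epsilon> *\<^sub>R shift h t) * \<Phi> n (\<lambda>t. w t + \<epsilon> *\<^sub>R shift h t))
        has_vector_derivative \<Psi> n w * \<Phi>' n w + \<Psi>' n w * \<Phi> n w) (at 0)" by simp
  qed
  moreover have "integrable M (\<lambda>\<omega>. X \<omega> * Y' \<omega> + X' \<omega> * Y \<omega>)"
    using XY'(1) YX'(1) by (intro Bochner_Integration.integrable_add) (simp_all add: mult.commute)
  ultimately have "weak_deriv_approx h (\<lambda>n w. \<Psi> n w * \<Phi> n w) (\<lambda>n w. \<Psi> n w * \<Phi>' n w + \<Psi>' n w * \<Phi> n w)
      (\<lambda>\<omega>. X \<omega> * Y \<omega>) (\<lambda>\<omega>. X \<omega> * Y' \<omega> + X' \<omega> * Y \<omega>)"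
    using L1 weak_deriv_approxD[OF XX] weak_deriv_approxD[OF YY]
    by (intro weak_deriv_approxI cylindrical_mult cylindrical_add borel_measurable_times)
  moreover have "\<bar>\<Psi> n w * \<Phi> n w\<bar> \<le> c * d" for n w
    unfolding abs_mult using c[of n w] d[of n w] by (intro mult_mono) auto
  ultimately show ?thesis unfolding bounded_weak_deriv_def by blast
qed

text \<open>Passage to the limit in the cylindrical formula: the left side converges by the L^1
  convergence of the derivatives, and the right side is dominated by the uniform bound times the
  Brownian coordinate.\<close>

lemma integration_by_parts:
  assumes "bounded_weak_deriv h X X'" and h: "fst h \<in> {0..1}"
  shows "(\<integral>\<omega>. X' \<omega> \<partial>M) = (\<integral>\<omega>. X \<omega> * path \<omega> (fst h) $ snd h \<partial>M)"
proof -
  obtain \<Psi> \<Psi>' c where X: "weak_deriv_approx h \<Psi> \<Psi>' X X'" and c: "\<And>n w. \<bar>\<Psi> n w\<bar> \<le> c"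
    using assms by (auto simp: bounded_weak_deriv_def)
  note X = X[unfolded weak_deriv_approx_def]
  have c0: "0 \<le> c" using c[of 0 undefined] by linarith
  have iN: "integrable M (\<lambda>\<omega>. path \<omega> (fst h) $ snd h)"
    using cylindrical_integrable[OF cylindrical_linear[OF cylindrical_eval[OF h] bounded_linear_vec_nth]] .
  have [measurable]: "(\<lambda>\<omega>. \<Psi> n (path \<omega>)) \<in> borel_measurable M" for n
    using X by (auto intro!: measurable_compose[OF path_measurable] cylindrical_measurable)
  have "(\<lambda>n. \<integral>\<omega>. \<Psi>' n (path \<omega>) \<partial>M) \<longlonglongrightarrow> (\<integral>\<omega>. X' \<omega> \<partial>M)"
    using X by (intro tendsto_integral_L1 cylindrical_integrable) auto
  moreover have "(\<lambda>n. \<integral>\<omega>. \<Psi> n (path \<omega>) * path \<omega> (fst h) $ snd h \<partial>M) \<longlonglongrightarrow> (\<integral>\<omega>. X \<omega> * path \<omega> (fst h) $ snd h \<partial>M)"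
  proof (rule integral_dominated_convergence[where w="\<lambda>\<omega>. c * \<bar>path \<omega> (fst h) $ snd h\<bar>"])
    have "AE \<omega> in M. (\<lambda>n. \<Psi> n (path \<omega>)) \<longlonglongrightarrow> X \<omega>" using X by simp
    then show "AE \<omega> in M. (\<lambda>n. \<Psi> n (path \<omega>) * path \<omega> (fst h) $ snd h) \<longlonglongrightarrow> X \<omega> * path \<omega> (fst h) $ snd h"
      by eventually_elim (intro tendsto_intros)
    show "AE \<omega> in M. norm (\<Psi> n (path \<omega>) * path \<omega> (fst h) $ snd h) \<le> c * \<bar>path \<omega> (fst h) $ snd h\<bar>" for n
      using c by (auto simp: abs_mult intro!: mult_right_mono)
    show "integrable M (\<lambda>\<omega>. c * \<bar>path \<omega> (fst h) $ snd h\<bar>)" using iN by auto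
    show "(\<lambda>\<omega>. X \<omega> * path \<omega> (fst h) $ snd h) \<in> borel_measurable M"
      using X by (intro borel_measurable_times path_component_measurable) simp
  qed measurable
  moreover have "(\<integral>\<omega>. \<Psi>' n (path \<omega>) \<partial>M) = (\<integral>\<omega>. \<Psi> n (path \<omega>) * path \<omega> (fst h) $ snd h \<partial>M)" for n
    using X by (intro integration_by_parts_cylindrical h) auto
  ultimately show ?thesis by (simp add: LIMSEQ_unique)
qed

end

section \<open>Convergence in probability of the derivatives\<close>

text \<open>The distance that metrises convergence in probability. The truncation at 1 keeps the
  integrand bounded, so that no integrability of the variables is involved.\<close>

definition conv_in_prob :: "'a measure \<Rightarrow> (nat \<Rightarrow> 'a \<Rightarrow> 'e::euclidean_space) \<Rightarrow> ('a \<Rightarrow> 'e) \<Rightarrow> bool" where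
  "conv_in_prob M X Y \<longleftrightarrow> (\<forall>n. X n \<in> borel_measurable M) \<and> Y \<in> borel_measurable M \<and>
     (\<lambda>n. \<integral>\<omega>. min 1 (norm (X n \<omega> - Y \<omega>)) \<partial>M) \<longlonglongrightarrow> 0"

lemma (in prob_space) integrable_bounded_real:
  assumes "f \<in> borel_measurable M" "\<And>x. \<bar>f x\<bar> \<le> (c::real)"
  shows "integrable M f"
  using assms by (intro integrable_const_bound[of _ c]) auto

lemma (in prob_space) integrable_min_norm:
  assumes "X \<in> borel_measurable M" "Y \<in> borel_measurable M"
  shows "integrable M (\<lambda>\<omega>. min 1 (norm (X \<omega> - Y \<omega> :: 'e::euclidean_space)))"
  using assms by (intro integrable_bounded_real[of _ 1]) auto

lemma norm_vec_le_sum: "norm (x :: 'b::real_normed_vector^'d) \<le> (\<Sum>i\<in>UNIV. norm (x $ i))"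
  unfolding norm_vec_def by (rule L2_set_le_sum) simp

text \<open>The truncation does no harm: if some component distance reaches 1, its term alone is 1;
  otherwise no term is truncated and the norm is at most the sum of the components.\<close>

lemma (in prob_space) conv_in_prob_vec:
  fixes X :: "nat \<Rightarrow> 'a \<Rightarrow> 'b::euclidean_space^'d"
  assumes "\<And>i. conv_in_prob M (\<lambda>n \<omega>. X n \<omega> $ i) (\<lambda>\<omega>. Y \<omega> $ i)"
  shows "conv_in_prob M X Y"
proof -
  have [measurable]: "X n \<in> borel_measurable M" "Y \<in> borel_measurable M" for n
    using assms by (auto simp: conv_in_prob_def intro!: borel_measurable_vec)
  have m[measurable]: "(\<lambda>\<omega>. X n \<omega> $ i) \<in> borel_measurable M" "(\<lambda>\<omega>. Y \<omega> $ i) \<in> borel_measurable M" for n i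
    using assms by (auto simp: conv_in_prob_def)
  have "(\<lambda>n. \<integral>\<omega>. min 1 (norm (X n \<omega> - Y \<omega>)) \<partial>M) \<longlonglongrightarrow> 0"
  proof (rule tendsto_sandwich[OF _ _ tendsto_const])
    show "\<forall>\<^sub>F n in sequentially. (\<integral>\<omega>. min 1 (norm (X n \<omega> - Y \<omega>)) \<partial>M) \<le>
        (\<Sum>i\<in>UNIV. \<integral>\<omega>. min 1 (norm (X n \<omega> $ i - Y \<omega> $ i)) \<partial>M)"
    proof (intro always_eventually allI)
      fix n
      have i: "integrable M (\<lambda>\<omega>. min 1 (norm (X n \<omega> $ i - Y \<omega> $ i)))" for i
        by (intro integrable_min_norm m)
      have "(\<integral>\<omega>. min 1 (norm (X n \<omega> - Y \<omega>)) \<partial>M) \<le> (\<integral>\<omega>. (\<Sum>i\<in>UNIV. min 1 (norm (X n \<omega> $ i - Y \<omega> $ i))) \<partial>M)"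
      proof (rule integral_mono)
        fix \<omega>
        show "min 1 (norm (X n \<omega> - Y \<omega>)) \<le> (\<Sum>i\<in>UNIV. min 1 (norm (X n \<omega> $ i - Y \<omega> $ i)))"
        proof (cases "\<exists>i. norm (X n \<omega> $ i - Y \<omega> $ i) \<ge> 1")
          case True
          then obtain i where "norm (X n \<omega> $ i - Y \<omega> $ i) \<ge> 1" by blast
          then have "1 \<le> min 1 (norm (X n \<omega> $ i - Y \<omega> $ i))" by simp
          also have "\<dots> \<le> (\<Sum>i\<in>UNIV. min 1 (norm (X n \<omega> $ i - Y \<omega> $ i)))"
            by (rule member_le_sum) auto
          finally show ?thesis by simp
        next
          case False
          then have "norm (X n \<omega> $ i - Y \<omega> $ i) \<le> 1" for i by (auto simp: not_le intro: less_imp_le)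
          then have "min 1 (norm (X n \<omega> $ i - Y \<omega> $ i)) = norm ((X n \<omega> - Y \<omega>) $ i)" for i
            by (simp add: min_absorb2)
          then show ?thesis using norm_vec_le_sum[of "X n \<omega> - Y \<omega>"] by (simp add: min.coboundedI2)
        qed
      qed (use i in \<open>auto intro!: integrable_min_norm\<close>)
      then show "(\<integral>\<omega>. min 1 (norm (X n \<omega> - Y \<omega>)) \<partial>M) \<le>
        (\<Sum>i\<in>UNIV. \<integral>\<omega>. min 1 (norm (X n \<omega> $ i - Y \<omega> $ i)) \<partial>M)" using i by simp
    qed
    show "(\<lambda>n. \<Sum>i\<in>UNIV. \<integral>\<omega>. min 1 (norm (X n \<omega> $ i - Y \<omega> $ i)) \<partial>M) \<longlonglongrightarrow> 0"
      using assms by (intro tendsto_null_sum) (auto simp: conv_in_prob_def)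
  qed auto
  then show ?thesis by (simp add: conv_in_prob_def)
qed

lemma (in prob_space) conv_in_prob_component:
  fixes X :: "nat \<Rightarrow> 'a \<Rightarrow> 'b::euclidean_space^'d"
  assumes "conv_in_prob M X Y"
  shows "conv_in_prob M (\<lambda>n \<omega>. X n \<omega> $ i) (\<lambda>\<omega>. Y \<omega> $ i)"
proof -
  have m: "(\<lambda>\<omega>. Z \<omega> $ i) \<in> borel_measurable M" if "Z \<in> borel_measurable M" for Z :: "'a \<Rightarrow> 'b^'d"
    by (rule measurable_compose[OF that]) (intro borel_measurable_continuous_onI continuous_intros)
  have [measurable]: "X n \<in> borel_measurable M" "Y \<in> borel_measurable M" for n
    using assms by (auto simp: conv_in_prob_def)
  have "(\<lambda>n. \<integral>\<omega>. min 1 (norm (X n \<omega> $ i - Y \<omega> $ i)) \<partial>M) \<longlonglongrightarrow> 0"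
  proof (rule tendsto_sandwich[OF _ _ tendsto_const])
    show "(\<lambda>n. \<integral>\<omega>. min 1 (norm (X n \<omega> - Y \<omega>)) \<partial>M) \<longlonglongrightarrow> 0"
      using assms by (simp add: conv_in_prob_def)
    show "\<forall>\<^sub>F n in sequentially. (\<integral>\<omega>. min 1 (norm (X n \<omega> $ i - Y \<omega> $ i)) \<partial>M) \<le> (\<integral>\<omega>. min 1 (norm (X n \<omega> - Y \<omega>)) \<partial>M)"
    proof (intro always_eventually allI integral_mono integrable_min_norm m)
      show "min 1 (norm (X n \<omega> $ i - Y \<omega> $ i)) \<le> min 1 (norm (X n \<omega> - Y \<omega>))" for n \<omega>
        using Finite_Cartesian_Product.norm_nth_le[of "X n \<omega> - Y \<omega>" i] by (intro min.mono) auto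
    qed auto
  qed auto
  then show ?thesis using assms by (simp add: conv_in_prob_def m)
qed

text \<open>On \<open>[0, 1]\<close> the derivative of arctan is at least 1/2, hence arctan w is at
  least w / 2 there; this gives the constant 2. It allows \<open>u * arctan u\<close> to control the
  truncated square, with arctan bounded and of bounded derivative, so that the calculus of
  \<open>bounded_weak_deriv\<close> applies to it.\<close>

lemma arctan_mult_ge: "(min 1 \<bar>u\<bar>)\<^sup>2 \<le> 2 * (u * arctan u)"
proof -
  have pos: "(min 1 v)\<^sup>2 \<le> 2 * (v * arctan v)" if v: "v \<ge> 0" for v :: real
  proof -
    have half: "w / 2 \<le> arctan w" if w: "0 \<le> w" "w \<le> 1" for w
    proof (cases "w = 0")
      case False
      have "\<exists>z>0. z < w \<and> arctan w - arctan 0 = (w - 0) * inverse (1 + z\<^sup>2)"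
        using w False by (intro MVT2) (auto intro!: derivative_eq_intros)
      then obtain z where z: "0 < z" "z < w" "arctan w = w * inverse (1 + z\<^sup>2)" by auto
      have "z\<^sup>2 \<le> 1" using z w by (intro power_le_one) auto
      then have "1 / 2 \<le> inverse (1 + z\<^sup>2)"
        using z(1) by (simp add: field_simps add_pos_nonneg)
      then have "w * (1 / 2) \<le> w * inverse (1 + z\<^sup>2)" using w by (intro mult_left_mono) auto
      then show ?thesis using z by simp
    qed simp
    have "min 1 v / 2 \<le> arctan (min 1 v)" using v by (intro half) auto
    also have "\<dots> \<le> arctan v" by (simp add: arctan_monotone')
    finally have "min 1 v \<le> 2 * arctan v" by simp
    then have "min 1 v * min 1 v \<le> v * (2 * arctan v)"
      using v by (intro mult_mono) auto
    then show ?thesis by (simp add: power2_eq_square algebra_simps)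
  qed
  show ?thesis
    using pos[of u] pos[of "- u"] by (cases "u \<ge> 0") (auto simp: arctan_minus)
qed

section \<open>Interpolation between a functional and its second derivative\<close>

context brownian
begin

abbreviation noise :: "real \<times> 'n \<Rightarrow> 'a \<Rightarrow> real" where
  "noise h \<omega> \<equiv> path \<omega> (fst h) $ snd h"

lemma integrable_noise: "fst h \<in> {0..1} \<Longrightarrow> integrable M (noise h)"
  using cylindrical_integrable[OF cylindrical_linear[OF cylindrical_eval bounded_linear_vec_nth]] .

text \<open>The scaling leaves the slope at 0 equal to 1, while the values become as small as
  \<open>\<epsilon>\<close>: a function of small size whose derivative is close to 1 near the
  origin.\<close>

lemma C1_bounded_scaled_arctan:
  assumes "\<epsilon> > 0"
  shows "C1_bounded (\<lambda>t. \<epsilon> * arctan (t / \<epsilon>)) (\<lambda>t v. v / (1 + (t / \<epsilon>)\<^sup>2))"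
proof -
  have nz: "1 + (t / \<epsilon>)\<^sup>2 \<noteq> 0" for t :: real by (metis add_nonneg_eq_0_iff zero_le_one zero_le_power2 zero_neq_one)
  have "((\<lambda>t. \<epsilon> * arctan (t / \<epsilon>)) has_real_derivative \<epsilon> * (1 / \<epsilon> * inverse (1 + (t / \<epsilon>)\<^sup>2))) (at t)" for t
    using nz[of t] by (auto intro!: derivative_eq_intros)
  then have "((\<lambda>t. \<epsilon> * arctan (t / \<epsilon>)) has_real_derivative 1 / (1 + (t / \<epsilon>)\<^sup>2)) (at t)" for t
    using assms by (simp add: inverse_eq_divide)
  then have "((\<lambda>t. \<epsilon> * arctan (t / \<epsilon>)) has_derivative (\<lambda>v. v / (1 + (t / \<epsilon>)\<^sup>2))) (at t)" for t
    unfolding has_field_derivative_def by (rule has_derivative_eq_rhs) (auto simp: fun_eq_iff)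
  moreover have "continuous_on UNIV (\<lambda>t. v / (1 + (t / \<epsilon>)\<^sup>2))" for v
    using assms nz by (intro continuous_intros) auto
  moreover have "norm (v / (1 + (t / \<epsilon>)\<^sup>2)) \<le> 1 * norm v" for t v :: real
  proof -
    have "0 < 1 + (t / \<epsilon>)\<^sup>2" by (intro add_pos_nonneg) auto
    then have "\<bar>v\<bar> / (1 + (t / \<epsilon>)\<^sup>2) \<le> \<bar>v\<bar> / 1" by (intro divide_left_mono) auto
    then show ?thesis by (simp add: abs_divide)
  qed
  ultimately show ?thesis unfolding C1_bounded_def C1_def by blast
qed

text \<open>Interpolation: a bound on the second derivatives upgrades the convergence of the functionals
  to convergence of the first derivatives. It tests the derivative of
  \<open>\<epsilon> arctan ((x\<^sub>n - x) / \<epsilon>) arctan (y\<^sub>n - Z)\<close> with \<open>Z\<close> a smooth approximation of \<open>y\<close>; no closability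
  of the derivative is needed.\<close>

lemma conv_in_prob_weak_deriv:
  assumes h: "fst h \<in> {0..1}"
    and x: "\<And>n. weak_deriv h (xs n) (ys n)" and y: "\<And>n. weak_deriv h (ys n) (zs n)"
    and C: "\<And>n. (\<integral>\<omega>. \<bar>zs n \<omega>\<bar> \<partial>M) \<le> C"
    and x0: "weak_deriv h x y"
    and approx: "\<And>\<epsilon>. \<epsilon> > 0 \<Longrightarrow> \<exists>Z Z'. weak_deriv h Z Z' \<and> integrable M Z \<and> (\<integral>\<omega>. \<bar>Z \<omega> - y \<omega>\<bar> \<partial>M) \<le> \<epsilon>"
    and conv: "conv_in_prob M xs x"
  shows "conv_in_prob M ys (y :: 'a \<Rightarrow> real)"
proof -
  have [measurable]: "ys n \<in> borel_measurable M" "xs n \<in> borel_measurable M" for n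
    using x y weak_deriv_measurable by blast+
  have [measurable]: "x \<in> borel_measurable M" "y \<in> borel_measurable M"
    using weak_derivD[OF x0] by auto
  have int[simp]: "integrable M (zs n)" "integrable M (ys n)" "integrable M y" for n
    using weak_deriv_integrable x y x0 by blast+
  define m where "m n = (\<integral>\<omega>. min 1 \<bar>xs n \<omega> - x \<omega>\<bar> \<partial>M)" for n
  have m0: "m \<longlonglongrightarrow> 0" using conv by (simp add: conv_in_prob_def m_def[abs_def])
  define K where "K = (\<integral>\<omega>. \<bar>noise h \<omega>\<bar> \<partial>M)"
  \<comment> \<open>Here \<open>\<delta>\<close> is the accuracy with which Z approximates y,
    \<open>\<epsilon>\<close> the scale of the arctan, and \<open>\<eta>\<close> the level at which
    a truncated distance is compared with its square. The L^1 norm of \<open>Z'\<close> is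
    multiplied by \<open>\<epsilon>\<close>, so Z has to be fixed before
    \<open>\<epsilon>\<close>.\<close>
  have key: "(\<integral>\<omega>. min 1 \<bar>ys n \<omega> - y \<omega>\<bar> \<partial>M) \<le>
      \<delta> + (\<eta> + 1 / \<eta> * (2 * (4 * \<epsilon> * K + 2 * \<epsilon> * (C + (\<integral>\<omega>. \<bar>Z' \<omega>\<bar> \<partial>M)) + 2 * \<delta>) + 1 / \<epsilon> * m n))"
    if Z: "weak_deriv h Z Z'" "integrable M Z" "(\<integral>\<omega>. \<bar>Z \<omega> - y \<omega>\<bar> \<partial>M) \<le> \<delta>"
      and pos: "0 < \<eta>" "0 < \<epsilon>" "\<epsilon> \<le> 1" for \<delta> \<eta> \<epsilon> n Z Z'
  proof -
    have iZ[simp]: "integrable M Z'" using weak_deriv_integrable[OF Z(1)] .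
    have [measurable]: "Z \<in> borel_measurable M" "Z' \<in> borel_measurable M" "zs n \<in> borel_measurable M"
      using Z iZ int(1) borel_measurable_integrable by blast+
    define \<phi>1 where "\<phi>1 = (\<lambda>t::real. \<epsilon> * arctan (t / \<epsilon>))"
    \<comment> \<open>p and q are the derivatives of the two arctan factors; p is close to 1 where
      \<open>xs n\<close> is close to x on the scale \<open>\<epsilon>\<close>.\<close>
    define p where "p \<omega> = 1 / (1 + ((xs n \<omega> - x \<omega>) / \<epsilon>)\<^sup>2)" for \<omega>
    define q where "q \<omega> = 1 / (1 + (ys n \<omega> - Z \<omega>)\<^sup>2)" for \<omega>
    define u where "u \<omega> = ys n \<omega> - Z \<omega>" for \<omega>
    have at: "\<bar>arctan t\<bar> \<le> 2" for t using arctan_lbound[of t] arctan_ubound[of t] pi_less_4 by (auto simp: abs_le_iff)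
    have \<phi>1: "\<bar>\<phi>1 t\<bar> \<le> 2 * \<epsilon>" for t using at[of "t / \<epsilon>"] pos by (simp add: \<phi>1_def abs_mult)
    have c2: "C1_bounded arctan (\<lambda>t v. v / (1 + t\<^sup>2))"
      using C1_bounded_scaled_arctan[of 1] by simp
    have "bounded_weak_deriv h (\<lambda>\<omega>. \<phi>1 (xs n \<omega> - x \<omega>)) (\<lambda>\<omega>. (ys n \<omega> - y \<omega>) / (1 + ((xs n \<omega> - x \<omega>) / \<epsilon>)\<^sup>2))"
      using bounded_weak_deriv_C1_bounded[OF weak_deriv_diff[OF x x0] C1_bounded_scaled_arctan[OF pos(2)] \<phi>1[unfolded \<phi>1_def]]
      unfolding \<phi>1_def .
    moreover have "bounded_weak_deriv h (\<lambda>\<omega>. arctan (ys n \<omega> - Z \<omega>)) (\<lambda>\<omega>. (zs n \<omega> - Z' \<omega>) / (1 + (ys n \<omega> - Z \<omega>)\<^sup>2))"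
      using bounded_weak_deriv_C1_bounded[OF weak_deriv_diff[OF y Z(1)] c2 at] .
    ultimately have "bounded_weak_deriv h (\<lambda>\<omega>. \<phi>1 (xs n \<omega> - x \<omega>) * arctan (ys n \<omega> - Z \<omega>))
        (\<lambda>\<omega>. \<phi>1 (xs n \<omega> - x \<omega>) * ((zs n \<omega> - Z' \<omega>) / (1 + (ys n \<omega> - Z \<omega>)\<^sup>2)) +
             (ys n \<omega> - y \<omega>) / (1 + ((xs n \<omega> - x \<omega>) / \<epsilon>)\<^sup>2) * arctan (ys n \<omega> - Z \<omega>))"
      by (rule bounded_weak_deriv_mult)
    then have bd: "bounded_weak_deriv h (\<lambda>\<omega>. \<phi>1 (xs n \<omega> - x \<omega>) * arctan (u \<omega>))
        (\<lambda>\<omega>. \<phi>1 (xs n \<omega> - x \<omega>) * (q \<omega> * (zs n \<omega> - Z' \<omega>)) + p \<omega> * (ys n \<omega> - y \<omega>) * arctan (u \<omega>))"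
      by (simp add: p_def q_def u_def)
    have [measurable]: "\<phi>1 \<in> borel_measurable borel" unfolding \<phi>1_def by measurable
    have [measurable]: "p \<in> borel_measurable M" "q \<in> borel_measurable M" "u \<in> borel_measurable M"
      unfolding p_def q_def u_def by measurable
    have p01: "0 \<le> p \<omega>" "p \<omega> \<le> 1" and q01: "0 \<le> q \<omega>" "q \<omega> \<le> 1" for \<omega>
      by (auto simp: p_def q_def divide_le_eq add_pos_nonneg)
    have b1: "\<bar>\<phi>1 (xs n \<omega> - x \<omega>) * (q \<omega> * (zs n \<omega> - Z' \<omega>))\<bar> \<le> 2 * \<epsilon> * (\<bar>zs n \<omega>\<bar> + \<bar>Z' \<omega>\<bar>)" for \<omega>
    proof -
      have "\<bar>q \<omega> * (zs n \<omega> - Z' \<omega>)\<bar> \<le> 1 * (\<bar>zs n \<omega>\<bar> + \<bar>Z' \<omega>\<bar>)"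
        unfolding abs_mult using q01[of \<omega>] by (intro mult_mono) auto
      then show ?thesis unfolding abs_mult using \<phi>1[of "xs n \<omega> - x \<omega>"]
        by (intro mult_mono) (auto simp: abs_mult)
    qed
    have i1: "integrable M (\<lambda>\<omega>. \<phi>1 (xs n \<omega> - x \<omega>) * (q \<omega> * (zs n \<omega> - Z' \<omega>)))"
      by (rule Bochner_Integration.integrable_bound[of M "\<lambda>\<omega>. 2 * \<epsilon> * (\<bar>zs n \<omega>\<bar> + \<bar>Z' \<omega>\<bar>)"])
         (use b1 in \<open>auto intro!: AE_I2 order_trans[OF b1 abs_ge_self]\<close>)
    have b2: "\<bar>p \<omega> * v * arctan (u \<omega>)\<bar> \<le> 2 * \<bar>v\<bar>" for v \<omega>
    proof -
      have "\<bar>p \<omega> * v * arctan (u \<omega>)\<bar> \<le> 1 * \<bar>v\<bar> * 2"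
        unfolding abs_mult using p01[of \<omega>] at[of "u \<omega>"] by (intro mult_mono) auto
      then show ?thesis by simp
    qed
    have i2: "integrable M (\<lambda>\<omega>. p \<omega> * v \<omega> * arctan (u \<omega>))" if "integrable M v" for v
      by (rule Bochner_Integration.integrable_bound[of M "\<lambda>\<omega>. 2 * \<bar>v \<omega>\<bar>"])
         (use that in \<open>auto intro!: AE_I2 order_trans[OF b2]\<close>)
    have iN: "integrable M (\<lambda>\<omega>. \<bar>noise h \<omega>\<bar>)" using integrable_noise[OF h] by auto
    have iu: "integrable M u" unfolding u_def using Z by simp
    \<comment> \<open>Integration by parts removes the derivative from the first factor: both terms
      on the right carry \<open>\<phi>1\<close>, which is of size \<open>\<epsilon>\<close>.\<close>
    have "(\<integral>\<omega>. p \<omega> * (ys n \<omega> - y \<omega>) * arctan (u \<omega>) \<partial>M) =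
        (\<integral>\<omega>. \<phi>1 (xs n \<omega> - x \<omega>) * arctan (u \<omega>) * noise h \<omega> \<partial>M) -
        (\<integral>\<omega>. \<phi>1 (xs n \<omega> - x \<omega>) * (q \<omega> * (zs n \<omega> - Z' \<omega>)) \<partial>M)"
      using integration_by_parts[OF bd h] i1 i2[of "\<lambda>\<omega>. ys n \<omega> - y \<omega>"] by simp
    moreover have "(\<integral>\<omega>. \<phi>1 (xs n \<omega> - x \<omega>) * arctan (u \<omega>) * noise h \<omega> \<partial>M) \<le> 4 * \<epsilon> * K"
    proof -
      have "\<bar>\<phi>1 (xs n \<omega> - x \<omega>) * arctan (u \<omega>) * noise h \<omega>\<bar> \<le> 4 * \<epsilon> * \<bar>noise h \<omega>\<bar>" for \<omega>
      proof -
        have "\<bar>\<phi>1 (xs n \<omega> - x \<omega>)\<bar> * \<bar>arctan (u \<omega>)\<bar> * \<bar>noise h \<omega>\<bar> \<le> 2 * \<epsilon> * 2 * \<bar>noise h \<omega>\<bar>"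
          using \<phi>1 at pos by (intro mult_mono) auto
        then show ?thesis by (simp add: abs_mult)
      qed
      then have "(\<integral>\<omega>. \<phi>1 (xs n \<omega> - x \<omega>) * arctan (u \<omega>) * noise h \<omega> \<partial>M) \<le> (\<integral>\<omega>. 4 * \<epsilon> * \<bar>noise h \<omega>\<bar> \<partial>M)"
        using iN pos by (intro integral_mono') (auto simp: abs_le_iff intro!: mult_nonneg_nonneg)
      then show ?thesis by (simp add: K_def)
    qed
    moreover have "- (\<integral>\<omega>. \<phi>1 (xs n \<omega> - x \<omega>) * (q \<omega> * (zs n \<omega> - Z' \<omega>)) \<partial>M) \<le> 2 * \<epsilon> * (C + (\<integral>\<omega>. \<bar>Z' \<omega>\<bar> \<partial>M))"
    proof -
      have "- (\<integral>\<omega>. \<phi>1 (xs n \<omega> - x \<omega>) * (q \<omega> * (zs n \<omega> - Z' \<omega>)) \<partial>M) \<le> (\<integral>\<omega>. 2 * \<epsilon> * (\<bar>zs n \<omega>\<bar> + \<bar>Z' \<omega>\<bar>) \<partial>M)"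
        unfolding Bochner_Integration.integral_minus[symmetric] using i1 b1 by (intro integral_mono) (auto simp: abs_le_iff)
      also have "\<dots> = 2 * \<epsilon> * ((\<integral>\<omega>. \<bar>zs n \<omega>\<bar> \<partial>M) + (\<integral>\<omega>. \<bar>Z' \<omega>\<bar> \<partial>M))" by simp
      also have "\<dots> \<le> 2 * \<epsilon> * (C + (\<integral>\<omega>. \<bar>Z' \<omega>\<bar> \<partial>M))" using C[of n] pos by (intro mult_left_mono add_mono) auto
      finally show ?thesis .
    qed
    \<comment> \<open>Integration by parts speaks of \<open>ys n - y\<close>, but positivity needs
      the same u inside and outside the arctan; the exchange costs
      \<open>2 * \<delta>\<close>.\<close>
    moreover have "(\<integral>\<omega>. p \<omega> * u \<omega> * arctan (u \<omega>) \<partial>M) =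
        (\<integral>\<omega>. p \<omega> * (ys n \<omega> - y \<omega>) * arctan (u \<omega>) \<partial>M) - (\<integral>\<omega>. p \<omega> * (Z \<omega> - y \<omega>) * arctan (u \<omega>) \<partial>M)"
    proof -
      have "p \<omega> * u \<omega> * arctan (u \<omega>) = p \<omega> * (ys n \<omega> - y \<omega>) * arctan (u \<omega>) - p \<omega> * (Z \<omega> - y \<omega>) * arctan (u \<omega>)" for \<omega>
        by (simp add: u_def algebra_simps)
      then show ?thesis using i2[of "\<lambda>\<omega>. ys n \<omega> - y \<omega>"] i2[of "\<lambda>\<omega>. Z \<omega> - y \<omega>"] Z by simp
    qed
    moreover have "- (\<integral>\<omega>. p \<omega> * (Z \<omega> - y \<omega>) * arctan (u \<omega>) \<partial>M) \<le> 2 * \<delta>"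
    proof -
      have "- (\<integral>\<omega>. p \<omega> * (Z \<omega> - y \<omega>) * arctan (u \<omega>) \<partial>M) \<le> (\<integral>\<omega>. 2 * \<bar>Z \<omega> - y \<omega>\<bar> \<partial>M)"
        unfolding Bochner_Integration.integral_minus[symmetric] using i2[of "\<lambda>\<omega>. Z \<omega> - y \<omega>"] b2 Z
        by (intro integral_mono) (auto simp: abs_le_iff)
      then show ?thesis using Z by simp
    qed
    ultimately have e1: "(\<integral>\<omega>. p \<omega> * u \<omega> * arctan (u \<omega>) \<partial>M) \<le> 4 * \<epsilon> * K + 2 * \<epsilon> * (C + (\<integral>\<omega>. \<bar>Z' \<omega>\<bar> \<partial>M)) + 2 * \<delta>"
      by linarith
    \<comment> \<open>With \<open>t = \<bar>xs n - x\<bar> / \<epsilon>\<close>,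
      \<open>1 - p\<close> equals \<open>t\<^sup>2 / (1 + t\<^sup>2)\<close>, which is at most t. So
      p is far from 1 only where the functionals are far apart, which convergence in probability
      makes rare.\<close>
    have e2: "(\<integral>\<omega>. 1 - p \<omega> \<partial>M) \<le> 1 / \<epsilon> * m n"
    proof -
      have "1 - p \<omega> \<le> 1 / \<epsilon> * min 1 \<bar>xs n \<omega> - x \<omega>\<bar>" for \<omega>
      proof -
        define t where "t = \<bar>xs n \<omega> - x \<omega>\<bar> / \<epsilon>"
        have t: "t \<ge> 0" "p \<omega> = 1 / (1 + t\<^sup>2)" using pos by (auto simp: t_def p_def power_divide)
        have "1 + t\<^sup>2 > 0" by (simp add: add_pos_nonneg)
        then have "1 - p \<omega> = t\<^sup>2 / (1 + t\<^sup>2)" unfolding t(2) by (simp add: field_simps)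
        also have "\<dots> \<le> t"
        proof -
          have "t \<le> 1 + t\<^sup>2" using t(1) sum_power2_ge_zero[of "t - 1" 0] by (simp add: power2_eq_square algebra_simps)
          then have "t * t \<le> t * (1 + t\<^sup>2)" using t(1) by (rule mult_left_mono)
          then show ?thesis using \<open>1 + t\<^sup>2 > 0\<close> by (simp add: divide_le_eq power2_eq_square)
        qed
        finally have "1 - p \<omega> \<le> 1 / \<epsilon> * \<bar>xs n \<omega> - x \<omega>\<bar>" by (simp add: t_def)
        moreover have "1 - p \<omega> \<le> 1 / \<epsilon> * 1"
        proof -
          have "1 \<le> 1 / \<epsilon>" using pos by simp
          then show ?thesis using p01(1)[of \<omega>] by linarith
        qed
        ultimately show ?thesis by (auto simp: min_def)
      qed
      then have "(\<integral>\<omega>. 1 - p \<omega> \<partial>M) \<le> (\<integral>\<omega>. 1 / \<epsilon> * min 1 \<bar>xs n \<omega> - x \<omega>\<bar> \<partial>M)"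
        using p01 by (intro integral_mono Bochner_Integration.integrable_diff integrable_mult_right integrable_bounded_real[of _ 1]) auto
      then show ?thesis by (simp add: m_def)
    qed
    let ?m = "\<lambda>\<omega>. min 1 \<bar>u \<omega>\<bar>"
    have ip: "integrable M p" using p01 by (intro integrable_bounded_real[of _ 1]) auto
    have im: "integrable M (\<lambda>\<omega>. (?m \<omega>)\<^sup>2)"
      by (intro integrable_bounded_real[of _ 1]) (auto simp: power_le_one)
    have "(\<integral>\<omega>. (?m \<omega>)\<^sup>2 \<partial>M) \<le> (\<integral>\<omega>. 2 * (p \<omega> * u \<omega> * arctan (u \<omega>)) + (1 - p \<omega>) \<partial>M)"
    proof (rule integral_mono[OF im])
      show "integrable M (\<lambda>\<omega>. 2 * (p \<omega> * u \<omega> * arctan (u \<omega>)) + (1 - p \<omega>))"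
        using i2[OF iu] ip by (intro Bochner_Integration.integrable_add integrable_mult_right Bochner_Integration.integrable_diff) auto
      fix \<omega>
      have "(?m \<omega>)\<^sup>2 = p \<omega> * (?m \<omega>)\<^sup>2 + (1 - p \<omega>) * (?m \<omega>)\<^sup>2" by (simp add: algebra_simps)
      also have "\<dots> \<le> p \<omega> * (2 * (u \<omega> * arctan (u \<omega>))) + (1 - p \<omega>) * 1"
        using p01[of \<omega>] by (intro add_mono mult_left_mono arctan_mult_ge) (auto simp: power_le_one)
      finally show "(?m \<omega>)\<^sup>2 \<le> 2 * (p \<omega> * u \<omega> * arctan (u \<omega>)) + (1 - p \<omega>)" by (simp add: algebra_simps)
    qed
    also have "\<dots> = 2 * (\<integral>\<omega>. p \<omega> * u \<omega> * arctan (u \<omega>) \<partial>M) + (\<integral>\<omega>. 1 - p \<omega> \<partial>M)"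
      using i2[OF iu] ip by simp
    also have "\<dots> \<le> 2 * (4 * \<epsilon> * K + 2 * \<epsilon> * (C + (\<integral>\<omega>. \<bar>Z' \<omega>\<bar> \<partial>M)) + 2 * \<delta>) + 1 / \<epsilon> * m n"
      by (intro add_mono mult_left_mono e1 e2) auto
    finally have e3: "(\<integral>\<omega>. (?m \<omega>)\<^sup>2 \<partial>M) \<le> 2 * (4 * \<epsilon> * K + 2 * \<epsilon> * (C + (\<integral>\<omega>. \<bar>Z' \<omega>\<bar> \<partial>M)) + 2 * \<delta>) + 1 / \<epsilon> * m n" .
    \<comment> \<open>A nonnegative number is at most \<open>\<eta>\<close>, or else at most its
      square divided by \<open>\<eta>\<close>.\<close>
    have "(\<integral>\<omega>. min 1 \<bar>ys n \<omega> - y \<omega>\<bar> \<partial>M) \<le> (\<integral>\<omega>. \<bar>Z \<omega> - y \<omega>\<bar> + (\<eta> + 1 / \<eta> * (?m \<omega>)\<^sup>2) \<partial>M)"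
    proof (rule integral_mono)
      show "integrable M (\<lambda>\<omega>. min 1 \<bar>ys n \<omega> - y \<omega>\<bar>)" by (intro integrable_bounded_real[of _ 1]) auto
      show "integrable M (\<lambda>\<omega>. \<bar>Z \<omega> - y \<omega>\<bar> + (\<eta> + 1 / \<eta> * (?m \<omega>)\<^sup>2))"
        using im Z by (intro Bochner_Integration.integrable_add integrable_mult_right integrable_abs Bochner_Integration.integrable_diff) auto
      fix \<omega>
      have "min 1 \<bar>ys n \<omega> - y \<omega>\<bar> \<le> ?m \<omega> + \<bar>Z \<omega> - y \<omega>\<bar>" by (auto simp: u_def)
      moreover have "?m \<omega> \<le> \<eta> + 1 / \<eta> * (?m \<omega>)\<^sup>2"
      proof (cases "?m \<omega> \<le> \<eta>")
        case True
        have "0 \<le> 1 / \<eta> * (?m \<omega>)\<^sup>2" using pos by simp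
        with True show ?thesis by linarith
      next
        case False
        have "?m \<omega> * \<eta> \<le> ?m \<omega> * ?m \<omega>" using False by (intro mult_left_mono) auto
        then have "?m \<omega> \<le> 1 / \<eta> * (?m \<omega>)\<^sup>2" using pos by (simp add: field_simps power2_eq_square)
        then show ?thesis using pos by linarith
      qed
      ultimately show "min 1 \<bar>ys n \<omega> - y \<omega>\<bar> \<le> \<bar>Z \<omega> - y \<omega>\<bar> + (\<eta> + 1 / \<eta> * (?m \<omega>)\<^sup>2)" by linarith
    qed
    also have "\<dots> = (\<integral>\<omega>. \<bar>Z \<omega> - y \<omega>\<bar> \<partial>M) + (\<eta> + 1 / \<eta> * (\<integral>\<omega>. (?m \<omega>)\<^sup>2 \<partial>M))"
      using im Z by (simp add: prob_space)
    also have "\<dots> \<le> \<delta> + (\<eta> + 1 / \<eta> * (2 * (4 * \<epsilon> * K + 2 * \<epsilon> * (C + (\<integral>\<omega>. \<bar>Z' \<omega>\<bar> \<partial>M)) + 2 * \<delta>) + 1 / \<epsilon> * m n))"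
      using e3 pos Z by (intro add_mono mult_left_mono) auto
    finally show ?thesis .
  qed
  have "(\<lambda>n. \<integral>\<omega>. min 1 \<bar>ys n \<omega> - y \<omega>\<bar> \<partial>M) \<longlonglongrightarrow> 0"
  proof (rule LIMSEQ_I)
    fix e :: real assume e: "0 < e"
    \<comment> \<open>The bound in \<open>key\<close> consists of five terms, each brought to at
      most \<open>e / 6\<close>: by \<open>\<eta>\<close> and \<open>\<delta>\<close> first, then by
      \<open>\<epsilon>\<close>, which depends on the chosen \<open>Z'\<close> through A, and at
      last by n.\<close>
    define \<eta> where "\<eta> = e / 6"
    define \<delta> where "\<delta> = min (e / 6) (\<eta> * e / 24)"
    have \<eta>: "\<eta> > 0" and \<delta>: "\<delta> > 0" using e by (auto simp: \<eta>_def \<delta>_def)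
    obtain Z Z' where Z: "weak_deriv h Z Z'" "integrable M Z" "(\<integral>\<omega>. \<bar>Z \<omega> - y \<omega>\<bar> \<partial>M) \<le> \<delta>" using approx[OF \<delta>] by blast
    define A where "A = \<bar>4 * K + 2 * (C + (\<integral>\<omega>. \<bar>Z' \<omega>\<bar> \<partial>M))\<bar> + 1"
    define \<epsilon> where "\<epsilon> = min 1 (\<eta> * e / (12 * A))"
    have A: "A > 0" by (simp add: A_def add_nonneg_pos)
    have \<epsilon>: "0 < \<epsilon>" "\<epsilon> \<le> 1" using \<eta> e A by (auto simp: \<epsilon>_def)
    have "\<forall>\<^sub>F n in sequentially. m n < \<epsilon> * \<eta> * e / 6"
      using m0 \<epsilon> \<eta> e by (intro order_tendstoD) auto
    then obtain n0 where n0: "\<And>n. n \<ge> n0 \<Longrightarrow> m n < \<epsilon> * \<eta> * e / 6" by (auto simp: eventually_sequentially)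
    show "\<exists>no. \<forall>n\<ge>no. norm ((\<integral>\<omega>. min 1 \<bar>ys n \<omega> - y \<omega>\<bar> \<partial>M) - 0) < e"
    proof (intro exI[of _ n0] allI impI)
      fix n assume n: "n \<ge> n0"
      let ?a = "4 * K + 2 * (C + (\<integral>\<omega>. \<bar>Z' \<omega>\<bar> \<partial>M))"
      have t1: "1 / \<eta> * (2 * (\<epsilon> * ?a)) \<le> e / 6"
      proof -
        have "\<epsilon> * ?a \<le> \<epsilon> * A" using \<epsilon> by (intro mult_left_mono) (auto simp: A_def)
        also have "\<dots> \<le> \<eta> * e / (12 * A) * A" using A by (intro mult_right_mono) (auto simp: \<epsilon>_def)
        also have "\<dots> = \<eta> * e / 12" using A by simp
        finally show ?thesis using \<eta> by (simp add: field_simps)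
      qed
      have t2: "1 / \<eta> * (4 * \<delta>) \<le> e / 6"
      proof -
        have "\<delta> \<le> \<eta> * e / 24" by (simp add: \<delta>_def)
        then show ?thesis using \<eta> by (simp add: field_simps)
      qed
      have t3: "1 / \<eta> * (1 / \<epsilon> * m n) < e / 6"
        using n0[OF n] \<eta> \<epsilon> by (simp add: field_simps)
      have "(\<integral>\<omega>. min 1 \<bar>ys n \<omega> - y \<omega>\<bar> \<partial>M) \<le>
          \<delta> + (\<eta> + 1 / \<eta> * (2 * (4 * \<epsilon> * K + 2 * \<epsilon> * (C + (\<integral>\<omega>. \<bar>Z' \<omega>\<bar> \<partial>M)) + 2 * \<delta>) + 1 / \<epsilon> * m n))"
        by (rule key[OF Z \<eta> \<epsilon>])
      also have "\<dots> = \<delta> + \<eta> + 1 / \<eta> * (2 * (\<epsilon> * ?a)) + 1 / \<eta> * (4 * \<delta>) + 1 / \<eta> * (1 / \<epsilon> * m n)"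
        by (simp add: algebra_simps)
      also have "\<dots> < e" using t1 t2 t3 e by (simp add: \<eta>_def \<delta>_def)
      finally show "norm ((\<integral>\<omega>. min 1 \<bar>ys n \<omega> - y \<omega>\<bar> \<partial>M) - 0) < e"
        by (simp add: integral_nonneg_AE)
    qed
  qed
  then show ?thesis by (simp add: conv_in_prob_def)
qed

end

section \<open>Smoothing\<close>

text \<open>A tent: Lipschitz with constant 1 and supported in the ball of radius
  \<open>\<delta>\<close>, the two properties on which the estimates rest. Its mass is divided out
  in \<open>smoothing\<close>.\<close>

definition kernel :: "real \<Rightarrow> 'e::euclidean_space \<Rightarrow> real" where
  "kernel \<delta> u = max 0 (\<delta> - norm u)"

definition smoothing :: "real \<Rightarrow> ('e::euclidean_space \<Rightarrow> real) \<Rightarrow> 'e \<Rightarrow> real" where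
  "smoothing \<delta> g x = (\<integral>u. g (x - u) * kernel \<delta> u \<partial>lborel) / (\<integral>u. kernel \<delta> (u :: 'e) \<partial>lborel)"

lemma kernel_measurable [measurable]: "kernel \<delta> \<in> borel_measurable borel"
  unfolding kernel_def by measurable

lemma kernel_nonneg: "0 \<le> kernel \<delta> u"
  by (simp add: kernel_def)

lemma integrable_indicator_cball: "integrable lborel (\<lambda>u. indicator (cball x r) u :: real)"
  using emeasure_bounded_finite[of "cball x r"] by (simp add: integrable_indicator_iff)

lemma kernel_le: "kernel \<delta> u \<le> \<bar>\<delta>\<bar> * indicator (cball 0 \<delta>) u"
  using norm_ge_zero[of u] abs_ge_self[of \<delta>] by (auto simp: kernel_def indicator_def max_def simp del: norm_ge_zero)

lemma integrable_kernel: "integrable lborel (kernel \<delta> :: 'e::euclidean_space \<Rightarrow> real)"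
  by (rule Bochner_Integration.integrable_bound[of _ "\<lambda>u. \<bar>\<delta>\<bar> * indicator (cball 0 \<delta>) u"])
     (use kernel_le[of \<delta>] in \<open>auto intro!: integrable_mult_right integrable_indicator_cball simp: kernel_nonneg abs_mult\<close>)

lemma integral_kernel_pos:
  assumes "\<delta> > 0"
  shows "0 < (\<integral>u. kernel \<delta> (u :: 'e::euclidean_space) \<partial>lborel)"
proof -
  have "0 < \<delta> / 2 * measure lborel (cball (0::'e) (\<delta> / 2))"
    using assms by (intro mult_pos_pos) (auto simp: content_cball_pos)
  also have "\<dots> = (\<integral>u. \<delta> / 2 * indicator (cball (0::'e) (\<delta> / 2)) u \<partial>lborel)" by simp
  also have "\<dots> \<le> (\<integral>u. kernel \<delta> (u :: 'e) \<partial>lborel)"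
    by (intro integral_mono integrable_kernel integrable_mult_right integrable_indicator_cball)
       (auto simp: kernel_def indicator_def max_def)
  finally show ?thesis .
qed

lemma lborel_integral_reflect:
  fixes f :: "'e::euclidean_space \<Rightarrow> real"
  assumes [measurable]: "f \<in> borel_measurable borel"
  shows "(\<integral>u. f (x - u) \<partial>lborel) = (\<integral>u. f u \<partial>lborel)"
proof -
  have "distr lborel borel (\<lambda>u::'e. x - u) = lborel"
    using lborel_affine[of "-1" x] by (simp add: density_1)
  then have "(\<integral>u. f u \<partial>lborel) = (\<integral>u. f u \<partial>distr lborel borel (\<lambda>u::'e. x - u))" by simp
  also have "\<dots> = (\<integral>u. f (x - u) \<partial>lborel)" by (rule integral_distr) auto
  finally show ?thesis by simp
qed

lemma integrable_mult_kernel: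
  fixes g :: "'e::euclidean_space \<Rightarrow> real"
  assumes [measurable]: "g \<in> borel_measurable borel" and "\<And>x. \<bar>g x\<bar> \<le> c"
  shows "integrable lborel (\<lambda>u. g u * kernel \<delta> u)"
proof (rule Bochner_Integration.integrable_bound[of _ "\<lambda>u. c * kernel \<delta> u"])
  show "AE u in lborel. norm (g u * kernel \<delta> u) \<le> norm (c * kernel \<delta> u)"
    using assms(2) by (intro AE_I2) (auto simp: abs_mult intro!: mult_right_mono order_trans[OF assms(2) abs_ge_self])
qed (auto intro!: integrable_mult_right integrable_kernel)

lemma abs_smoothing_le:
  fixes g :: "'e::euclidean_space \<Rightarrow> real"
  assumes [measurable]: "g \<in> borel_measurable borel" and g: "\<And>x. \<bar>g x\<bar> \<le> 1" and \<delta>: "\<delta> > 0"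
  shows "\<bar>smoothing \<delta> g x\<bar> \<le> 1"
proof -
  let ?c = "\<integral>u. kernel \<delta> (u :: 'e) \<partial>lborel"
  have "\<bar>\<integral>u. g (x - u) * kernel \<delta> u \<partial>lborel\<bar> \<le> (\<integral>u. \<bar>g (x - u) * kernel \<delta> u\<bar> \<partial>lborel)"
    by (rule integral_abs_bound)
  also have "\<dots> \<le> ?c"
  proof (rule integral_mono)
    show "integrable lborel (\<lambda>u. \<bar>g (x - u) * kernel \<delta> u\<bar>)"
      by (intro integrable_abs integrable_mult_kernel[of _ 1]) (auto simp: g)
    show "\<bar>g (x - u) * kernel \<delta> u\<bar> \<le> kernel \<delta> u" for u
      using mult_right_mono[OF g[of "x - u"] kernel_nonneg[of \<delta> u]] by (simp add: abs_mult kernel_nonneg)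
  qed (rule integrable_kernel)
  finally show ?thesis
    using integral_kernel_pos[OF \<delta>, where 'e='e] by (simp add: smoothing_def abs_divide)
qed

text \<open>Reflecting the variable of integration moves the point from the argument of g into the
  kernel. The difference is then controlled by the Lipschitz kernel on two balls, and g enters
  through its bound. The constant depends on \<open>\<delta>\<close> alone, so it is obtained before
  g is given.\<close>

lemma smoothing_lipschitz:
  assumes \<delta>: "\<delta> > 0"
  obtains L where "L \<ge> 0"
    "\<forall>(g :: 'e::euclidean_space \<Rightarrow> real) x y. g \<in> borel_measurable borel \<longrightarrow> (\<forall>x. \<bar>g x\<bar> \<le> 1) \<longrightarrow>
      \<bar>smoothing \<delta> g x - smoothing \<delta> g y\<bar> \<le> L * norm (x - y)"
proof -
  let ?c = "\<integral>u. kernel \<delta> (u :: 'e) \<partial>lborel" and ?V = "measure lborel (cball (0::'e) \<delta>)"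
  have c: "?c > 0" by (rule integral_kernel_pos[OF \<delta>])
  show thesis
  proof (rule that[of "2 * ?V / ?c"], goal_cases)
    case 1
    show ?case using c by simp
  next
    case 2
    show ?case
    proof (intro allI impI)
  fix g :: "'e \<Rightarrow> real" and x y :: 'e
  assume gm[measurable]: "g \<in> borel_measurable borel" and g0: "\<forall>x. \<bar>g x\<bar> \<le> 1"
  note g = g0[rule_format]
  have refl: "(\<integral>u. g (z - u) * kernel \<delta> u \<partial>lborel) = (\<integral>u. g u * kernel \<delta> (z - u) \<partial>lborel)" for z
    using lborel_integral_reflect[of "\<lambda>u. g u * kernel \<delta> (z - u)" z] by simp
  have V: "measure lborel (cball z \<delta>) = ?V" for z :: 'e
    using \<delta> by (simp add: content_cball)
  have dist: "\<bar>kernel \<delta> (x - u) - kernel \<delta> (y - u)\<bar> \<le> norm (x - y) * (indicator (cball x \<delta>) u + indicator (cball y \<delta>) u)" for u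
  proof -
    have "norm (x - u) \<le> norm (x - y) + norm (y - u)" using norm_triangle_ineq[of "x - y" "y - u"] by simp
    moreover have "norm (y - u) \<le> norm (x - y) + norm (x - u)"
      using norm_triangle_ineq[of "y - x" "x - u"] by (simp add: norm_minus_commute)
    ultimately have "\<bar>kernel \<delta> (x - u) - kernel \<delta> (y - u)\<bar> \<le> norm (x - y)"
      by (auto simp: kernel_def max_def)
    then show ?thesis by (auto simp: indicator_def dist_norm kernel_def)
  qed
  have int: "integrable lborel (\<lambda>u. g u * kernel \<delta> (z - u))" for z
  proof -
    have "integrable lborel (\<lambda>u. \<bar>\<delta>\<bar> * indicator (cball z \<delta>) u)"
      by (intro integrable_mult_right integrable_indicator_cball)
    then show ?thesis
    proof (rule Bochner_Integration.integrable_bound)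
      show "AE u in lborel. norm (g u * kernel \<delta> (z - u)) \<le> norm (\<bar>\<delta>\<bar> * indicator (cball z \<delta>) u)"
      proof (intro AE_I2)
        fix u
        have "\<bar>g u * kernel \<delta> (z - u)\<bar> \<le> 1 * kernel \<delta> (z - u)"
          unfolding abs_mult using g[of u] by (intro mult_mono) (auto simp: kernel_nonneg)
        also have "\<dots> \<le> \<bar>\<delta>\<bar> * indicator (cball z \<delta>) u"
          using kernel_le[of \<delta> "z - u"] by (simp add: indicator_def dist_norm norm_minus_commute[of u z])
        finally show "norm (g u * kernel \<delta> (z - u)) \<le> norm (\<bar>\<delta>\<bar> * indicator (cball z \<delta>) u)" by (simp add: abs_mult)
      qed
    qed measurable
  qed
  have "\<bar>(\<integral>u. g u * kernel \<delta> (x - u) \<partial>lborel) - (\<integral>u. g u * kernel \<delta> (y - u) \<partial>lborel)\<bar> =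
      \<bar>\<integral>u. g u * kernel \<delta> (x - u) - g u * kernel \<delta> (y - u) \<partial>lborel\<bar>"
    using int by simp
  also have "\<dots> \<le> (\<integral>u. \<bar>g u * kernel \<delta> (x - u) - g u * kernel \<delta> (y - u)\<bar> \<partial>lborel)"
    by (rule integral_abs_bound)
  also have "\<dots> \<le> (\<integral>u. norm (x - y) * (indicator (cball x \<delta>) u + indicator (cball y \<delta>) u) \<partial>lborel)"
  proof (rule integral_mono)
    show "integrable lborel (\<lambda>u. \<bar>g u * kernel \<delta> (x - u) - g u * kernel \<delta> (y - u)\<bar>)"
      using int by (intro integrable_abs Bochner_Integration.integrable_diff)
    show "integrable lborel (\<lambda>u. norm (x - y) * (indicator (cball x \<delta>) u + indicator (cball y \<delta>) u))"
      by (intro integrable_mult_right Bochner_Integration.integrable_add integrable_indicator_cball)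
    fix u
    have "\<bar>g u * kernel \<delta> (x - u) - g u * kernel \<delta> (y - u)\<bar> \<le> 1 * \<bar>kernel \<delta> (x - u) - kernel \<delta> (y - u)\<bar>"
      unfolding right_diff_distrib[symmetric] abs_mult using g[of u] by (intro mult_right_mono) auto
    also have "\<dots> \<le> norm (x - y) * (indicator (cball x \<delta>) u + indicator (cball y \<delta>) u)"
      using dist[of u] by simp
    finally show "\<bar>g u * kernel \<delta> (x - u) - g u * kernel \<delta> (y - u)\<bar> \<le> norm (x - y) * (indicator (cball x \<delta>) u + indicator (cball y \<delta>) u)" .
  qed
  also have "\<dots> = norm (x - y) * (2 * ?V)"
    using integrable_indicator_cball[of x \<delta>] integrable_indicator_cball[of y \<delta>] by (simp add: V[of x] V[of y])
  finally have "\<bar>(\<integral>u. g u * kernel \<delta> (x - u) \<partial>lborel) - (\<integral>u. g u * kernel \<delta> (y - u) \<partial>lborel)\<bar> / ?c \<le> norm (x - y) * (2 * ?V) / ?c"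
    using c by (intro divide_right_mono) auto
  moreover have "smoothing \<delta> g x - smoothing \<delta> g y =
      ((\<integral>u. g u * kernel \<delta> (x - u) \<partial>lborel) - (\<integral>u. g u * kernel \<delta> (y - u) \<partial>lborel)) / ?c"
    by (simp only: smoothing_def refl diff_divide_distrib)
  ultimately have "\<bar>smoothing \<delta> g x - smoothing \<delta> g y\<bar> \<le> norm (x - y) * (2 * ?V) / ?c"
    by (simp only: abs_divide abs_of_pos[OF c])
  also have "norm (x - y) * (2 * ?V) / ?c = 2 * ?V / ?c * norm (x - y)"
    unfolding times_divide_eq_left by (simp only: mult.commute)
  finally show "\<bar>smoothing \<delta> g x - smoothing \<delta> g y\<bar> \<le> 2 * ?V / ?c * norm (x - y)" .
    qed
  qed
qed

text \<open>By Fubini the smoothing error is the average over u, with the kernel as weight, of the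
  errors caused by translating by u. The kernel vanishes beyond \<open>\<delta>\<close>, and a
  shorter translation costs at most \<open>C * \<delta>\<close>.\<close>

lemma (in prob_space) smoothing_error:
  fixes X :: "'a \<Rightarrow> 'e::euclidean_space" and g :: "'e \<Rightarrow> real"
  assumes [measurable]: "X \<in> borel_measurable M" "R \<in> borel_measurable M" "g \<in> borel_measurable borel"
    and g: "\<And>x. \<bar>g x\<bar> \<le> 1" and R: "\<And>\<omega>. \<bar>R \<omega>\<bar> \<le> 1" and \<delta>: "\<delta> > 0"
    and shift: "\<And>u. \<bar>\<integral>\<omega>. (g (X \<omega>) - g (X \<omega> - u)) * R \<omega> \<partial>M\<bar> \<le> C * norm u"
  shows "\<bar>\<integral>\<omega>. (g (X \<omega>) - smoothing \<delta> g (X \<omega>)) * R \<omega> \<partial>M\<bar> \<le> C * \<delta>"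
proof -
  interpret lb: pair_sigma_finite M "lborel :: 'e measure" ..
  let ?c = "\<integral>u. kernel \<delta> (u :: 'e) \<partial>lborel"
  have c: "?c > 0" by (rule integral_kernel_pos[OF \<delta>])
  \<comment> \<open>Read off the shift estimate at a basis vector, whose norm is 1.\<close>
  have C: "C \<ge> 0"
  proof -
    obtain b :: 'e where "b \<in> Basis" using nonempty_Basis by blast
    then show ?thesis using shift[of b] by simp
  qed
  let ?f = "\<lambda>\<omega> u. (g (X \<omega>) - g (X \<omega> - u)) * R \<omega> * kernel \<delta> u"
  have bf: "\<bar>(g (X \<omega>) - g (X \<omega> - u)) * R \<omega>\<bar> \<le> 2" for \<omega> u
  proof -
    have "\<bar>g (X \<omega>) - g (X \<omega> - u)\<bar> \<le> 2" using g[of "X \<omega>"] g[of "X \<omega> - u"] by linarith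
    then have "\<bar>g (X \<omega>) - g (X \<omega> - u)\<bar> * \<bar>R \<omega>\<bar> \<le> 2 * 1" using R by (intro mult_mono) auto
    then show ?thesis by (simp add: abs_mult)
  qed
  have int: "integrable (M \<Otimes>\<^sub>M lborel) (\<lambda>(\<omega>, u). ?f \<omega> u)"
  proof (rule Bochner_Integration.integrable_bound)
    show "integrable (M \<Otimes>\<^sub>M lborel) (\<lambda>(\<omega>, u :: 'e). 2 * kernel \<delta> u)"
    proof (rule lb.Fubini_integrable)
      show "integrable M (\<lambda>\<omega>. \<integral>u. norm (case (\<omega>, u) of (\<omega>, u) \<Rightarrow> 2 * kernel \<delta> u) \<partial>lborel)" by simp
    qed (auto intro!: integrable_mult_right integrable_kernel)
    show "AE p in M \<Otimes>\<^sub>M lborel. norm (case p of (\<omega>, u) \<Rightarrow> ?f \<omega> u) \<le> norm (case p of (\<omega>, u) \<Rightarrow> 2 * kernel \<delta> u)"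
      by (intro AE_I2) (auto simp: abs_mult[of _ "kernel _ _"] kernel_nonneg intro!: mult_right_mono bf)
  qed measurable
  have "(g x - smoothing \<delta> g x) * r = (\<integral>u. (g x - g (x - u)) * r * kernel \<delta> u \<partial>lborel) / ?c" for x r
  proof -
    have "(\<integral>u. (g x - g (x - u)) * r * kernel \<delta> u \<partial>lborel) = (\<integral>u. r * g x * kernel \<delta> u - r * (g (x - u) * kernel \<delta> u) \<partial>lborel)"
      by (simp add: algebra_simps)
    also have "\<dots> = r * g x * ?c - r * (\<integral>u. g (x - u) * kernel \<delta> u \<partial>lborel)"
      using integrable_kernel[of \<delta>, where 'e='e] integrable_mult_kernel[of "\<lambda>u. g (x - u)" 1 \<delta>] g
      by (subst Bochner_Integration.integral_diff) (auto intro!: integrable_mult_right)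
    finally show ?thesis using c by (simp add: smoothing_def field_simps)
  qed
  then have "(\<integral>\<omega>. (g (X \<omega>) - smoothing \<delta> g (X \<omega>)) * R \<omega> \<partial>M) = (\<integral>\<omega>. \<integral>u. ?f \<omega> u \<partial>lborel \<partial>M) / ?c"
    by simp
  also have "(\<integral>\<omega>. \<integral>u. ?f \<omega> u \<partial>lborel \<partial>M) = (\<integral>u. \<integral>\<omega>. ?f \<omega> u \<partial>M \<partial>lborel)"
    using lb.Fubini_integral[OF int] by simp
  finally have eq: "(\<integral>\<omega>. (g (X \<omega>) - smoothing \<delta> g (X \<omega>)) * R \<omega> \<partial>M) = (\<integral>u. \<integral>\<omega>. ?f \<omega> u \<partial>M \<partial>lborel) / ?c" .
  have "\<bar>\<integral>u. \<integral>\<omega>. ?f \<omega> u \<partial>M \<partial>lborel\<bar> \<le> (\<integral>u. \<bar>\<integral>\<omega>. ?f \<omega> u \<partial>M\<bar> \<partial>lborel)"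
    by (rule integral_abs_bound)
  also have "\<dots> \<le> (\<integral>u. C * \<delta> * kernel \<delta> (u :: 'e) \<partial>lborel)"
  proof (rule integral_mono)
    show "integrable lborel (\<lambda>u. \<bar>\<integral>\<omega>. ?f \<omega> u \<partial>M\<bar>)"
      using lb.integrable_snd[OF int] by (rule integrable_abs)
    show "integrable lborel (\<lambda>u::'e. C * \<delta> * kernel \<delta> u)"
      by (intro integrable_mult_right integrable_kernel)
    fix u :: 'e
    have "\<bar>\<integral>\<omega>. ?f \<omega> u \<partial>M\<bar> = \<bar>\<integral>\<omega>. (g (X \<omega>) - g (X \<omega> - u)) * R \<omega> \<partial>M\<bar> * kernel \<delta> u"
      by (simp add: abs_mult kernel_nonneg)
    also have "\<dots> \<le> C * norm u * kernel \<delta> u"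
      by (intro mult_right_mono shift kernel_nonneg)
    also have "\<dots> \<le> C * \<delta> * kernel \<delta> u"
    proof (cases "norm u \<le> \<delta>")
      case True
      then show ?thesis using C by (intro mult_right_mono mult_left_mono kernel_nonneg) auto
    qed (simp add: kernel_def)
    finally show "\<bar>\<integral>\<omega>. ?f \<omega> u \<partial>M\<bar> \<le> C * \<delta> * kernel \<delta> u" .
  qed
  finally have "\<bar>\<integral>u. \<integral>\<omega>. ?f \<omega> u \<partial>M \<partial>lborel\<bar> \<le> C * \<delta> * ?c" by simp
  then show ?thesis unfolding eq using c by (simp add: abs_divide divide_le_eq)
qed

text \<open>An indicator is approximated by a Urysohn function between a compact subset and an open
  superset, which the regularity of finite Borel measures provides; additivity and dominated
  convergence extend this to all integrable functions.\<close>

lemma integrable_approx_continuous: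
  fixes f :: "'e::euclidean_space \<Rightarrow> real"
  assumes fin: "finite_measure \<mu>" and sets: "sets \<mu> = sets borel" and f: "integrable \<mu> f" and e: "e > 0"
  shows "\<exists>g. continuous_on UNIV g \<and> bounded (range g) \<and> (\<integral>x. \<bar>f x - g x\<bar> \<partial>\<mu>) < e"
proof -
  interpret finite_measure \<mu> by fact
  note [measurable_cong] = sets
  have int: "integrable \<mu> g" if g: "continuous_on UNIV g" "bounded (range g)" for g :: "'e \<Rightarrow> real"
  proof -
    obtain B where B: "\<forall>x. \<bar>g x\<bar> \<le> B" using g(2) by (auto simp: bounded_iff)
    have "g \<in> borel_measurable \<mu>" using borel_measurable_continuous_onI[OF g(1)] by measurable
    then show ?thesis using B by (intro integrable_const_bound[of _ B]) auto
  qed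
  have "\<forall>e>0. \<exists>g. continuous_on UNIV g \<and> bounded (range g) \<and> (\<integral>x. \<bar>f x - g x\<bar> \<partial>\<mu>) < e"
    using f
  proof (induction rule: integrable_induct)
    case (base A c)
    have A: "A \<in> sets borel" using base sets by simp
    show ?case
    proof (intro allI impI)
      fix e :: real assume e: "e > 0"
      \<comment> \<open>Chosen so that \<open>\<bar>c\<bar> * (2 * d)\<close> is strictly below e,
        also when c is 0.\<close>
      define d where "d = e / (2 * (\<bar>c\<bar> + 1))"
      have d: "d > 0" using e by (auto simp: d_def)
      have finA: "emeasure \<mu> A \<noteq> \<infinity>" using base by auto
      have s: "emeasure \<mu> (space \<mu>) \<noteq> \<infinity>" by simp
      obtain K where K: "K \<subseteq> A" "compact K" "measure \<mu> A - d < measure \<mu> K"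
      proof -
        have "\<exists>K\<in>{K. K \<subseteq> A \<and> compact K}. ennreal (measure \<mu> A - d) < emeasure \<mu> K" if "measure \<mu> A - d \<ge> 0"
        proof (rule less_SUP_iff[THEN iffD1])
          have "ennreal (measure \<mu> A - d) < emeasure \<mu> A"
            using d that by (simp add: emeasure_eq_measure ennreal_lessI)
          then show "ennreal (measure \<mu> A - d) < (SUP K\<in>{K. K \<subseteq> A \<and> compact K}. emeasure \<mu> K)"
            using inner_regular[OF sets s A] by simp
        qed
        then show thesis
          using that[of "{}"] that by (cases "measure \<mu> A - d \<ge> 0") (auto simp: emeasure_eq_measure ennreal_less_iff)
      qed
      obtain U where U: "A \<subseteq> U" "open U" "measure \<mu> U < measure \<mu> A + d"
      proof -
        have "emeasure \<mu> A < ennreal (measure \<mu> A + d)"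
          using d by (simp add: emeasure_eq_measure ennreal_lessI add_nonneg_pos)
        then have "(INF U\<in>{U. A \<subseteq> U \<and> open U}. emeasure \<mu> U) < ennreal (measure \<mu> A + d)"
          using outer_regular[OF sets s A] by simp
        then obtain U where "A \<subseteq> U" "open U" "emeasure \<mu> U < ennreal (measure \<mu> A + d)"
          by (auto simp: INF_less_iff)
        then show thesis using that[of U] by (auto simp: emeasure_eq_measure ennreal_less_iff)
      qed
      have disj: "K \<inter> (- U) = {}" using K U by auto
      obtain g :: "'e \<Rightarrow> real" where g: "continuous_on UNIV g" "\<And>x. g x \<in> closed_segment 1 0"
          "\<And>x. x \<in> K \<Longrightarrow> g x = 1" "\<And>x. x \<in> - U \<Longrightarrow> g x = 0"
        using Urysohn[of K "- U" 1 0] disj K U compact_imp_closed by blast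
      have g01: "0 \<le> g x \<and> g x \<le> 1" for x using g(2)[of x] by (auto simp: closed_segment_eq_real_ivl)
      have cont: "continuous_on UNIV (\<lambda>x. c * g x)" using g by (intro continuous_intros)
      have bdd: "bounded (range (\<lambda>x. c * g x))"
      proof -
        have "norm (c * g x) \<le> \<bar>c\<bar>" for x
          using g01[of x] mult_left_mono[of "g x" 1 "\<bar>c\<bar>"] by (simp add: abs_mult)
        then show ?thesis unfolding bounded_iff by blast
      qed
      have m[measurable]: "K \<in> sets \<mu>" "U \<in> sets \<mu>" "A \<in> sets \<mu>"
        using K U A sets by (auto simp: compact_imp_closed)
      have "(\<integral>x. \<bar>indicator A x *\<^sub>R c - c * g x\<bar> \<partial>\<mu>) \<le> (\<integral>x. \<bar>c\<bar> * indicator (U - K) x \<partial>\<mu>)"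
      proof (rule integral_mono)
        show "integrable \<mu> (\<lambda>x. \<bar>indicator A x *\<^sub>R c - c * g x\<bar>)"
          using base int[OF cont bdd] by (intro integrable_abs Bochner_Integration.integrable_diff integrable_scaleR_left) (auto simp: integrable_indicator_iff)
        show "integrable \<mu> (\<lambda>x. \<bar>c\<bar> * indicator (U - K) x)"
          by (intro integrable_mult_right) (auto simp: integrable_indicator_iff emeasure_eq_measure)
        fix x
        consider "x \<in> K" | "x \<notin> U" | "x \<in> U - K" by blast
        then show "\<bar>indicator A x *\<^sub>R c - c * g x\<bar> \<le> \<bar>c\<bar> * indicator (U - K) x"
        proof cases
          case 3
          have "\<bar>indicator A x - g x\<bar> \<le> 1" using g01[of x] by (auto simp: indicator_def)
          then have "\<bar>c\<bar> * \<bar>indicator A x - g x\<bar> \<le> \<bar>c\<bar> * 1" by (intro mult_left_mono) auto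
          then show ?thesis using 3 by (simp add: abs_mult[symmetric] algebra_simps)
        qed (use g K U in \<open>auto simp: indicator_def\<close>)
      qed
      also have "\<dots> = \<bar>c\<bar> * (measure \<mu> U - measure \<mu> K)"
      proof -
        have "measure \<mu> (U - K) = measure \<mu> U - measure \<mu> K" using K U by (intro finite_measure_Diff) auto
        then show ?thesis by simp
      qed
      also have "\<dots> \<le> \<bar>c\<bar> * (2 * d)" using K U by (intro mult_left_mono) auto
      also have "\<dots> < (\<bar>c\<bar> + 1) * (2 * d)" using d by (intro mult_strict_right_mono) auto
      also have "\<dots> = e"
      proof -
        have "k * (2 * (e / (2 * k))) = e" if "k \<noteq> 0" for k :: real using that by simp
        from this[of "\<bar>c\<bar> + 1"] show ?thesis unfolding d_def by linarith
      qed
      finally show "\<exists>g. continuous_on UNIV g \<and> bounded (range g) \<and> (\<integral>x. \<bar>indicator A x *\<^sub>R c - g x\<bar> \<partial>\<mu>) < e"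
        using cont bdd by (intro exI[of _ "\<lambda>x. c * g x"]) auto
    qed
  next
    case (add f1 f2)
    show ?case
    proof (intro allI impI)
      fix e :: real assume "e > 0"
      then obtain g1 g2 where g1: "continuous_on UNIV g1" "bounded (range g1)" "(\<integral>x. \<bar>f1 x - g1 x\<bar> \<partial>\<mu>) < e / 2"
        and g2: "continuous_on UNIV g2" "bounded (range g2)" "(\<integral>x. \<bar>f2 x - g2 x\<bar> \<partial>\<mu>) < e / 2"
        using add.IH by (meson half_gt_zero)
      have i: "integrable \<mu> (\<lambda>x. \<bar>f1 x - g1 x\<bar>)" "integrable \<mu> (\<lambda>x. \<bar>f2 x - g2 x\<bar>)"
        using add.hyps int g1 g2 by auto
      have "(\<integral>x. \<bar>f1 x + f2 x - (g1 x + g2 x)\<bar> \<partial>\<mu>) \<le> (\<integral>x. \<bar>f1 x - g1 x\<bar> + \<bar>f2 x - g2 x\<bar> \<partial>\<mu>)"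
        using add.hyps int g1 g2 i by (intro integral_mono) auto
      also have "\<dots> < e" using g1 g2 i by simp
      finally show "\<exists>g. continuous_on UNIV g \<and> bounded (range g) \<and> (\<integral>x. \<bar>f1 x + f2 x - g x\<bar> \<partial>\<mu>) < e"
        using g1 g2 by (intro exI[of _ "\<lambda>x. g1 x + g2 x"]) (auto intro!: continuous_intros bounded_plus_comp)
    qed
  next
    case (lim f s)
    show ?case
    proof (intro allI impI)
      fix e :: real assume e: "e > 0"
      have "(\<lambda>i. \<integral>x. \<bar>f x - s i x\<bar> \<partial>\<mu>) \<longlonglongrightarrow> (\<integral>x. 0 \<partial>\<mu>)"
      proof (rule integral_dominated_convergence[where w="\<lambda>x. 3 * \<bar>f x\<bar>"])
        show "AE x in \<mu>. (\<lambda>i. \<bar>f x - s i x\<bar>) \<longlonglongrightarrow> 0"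
        proof (intro AE_I2)
          fix x assume "x \<in> space \<mu>"
          then have "(\<lambda>i. \<bar>f x - s i x\<bar>) \<longlonglongrightarrow> \<bar>f x - f x\<bar>" by (intro tendsto_intros lim)
          then show "(\<lambda>i. \<bar>f x - s i x\<bar>) \<longlonglongrightarrow> 0" by simp
        qed
        show "AE x in \<mu>. norm \<bar>f x - s i x\<bar> \<le> 3 * \<bar>f x\<bar>" for i
        proof (intro AE_I2)
          fix x assume "x \<in> space \<mu>"
          then have "norm (s i x) \<le> 2 * norm (f x)" using lim by blast
          then have "\<bar>s i x\<bar> \<le> 2 * \<bar>f x\<bar>" by simp
          then show "norm \<bar>f x - s i x\<bar> \<le> 3 * \<bar>f x\<bar>" by simp
        qed
      qed (use lim in auto)
      then have "\<forall>\<^sub>F i in sequentially. (\<integral>x. \<bar>f x - s i x\<bar> \<partial>\<mu>) < e / 2"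
        using e by (intro order_tendstoD) auto
      then obtain i where i: "(\<integral>x. \<bar>f x - s i x\<bar> \<partial>\<mu>) < e / 2" by (auto simp: eventually_sequentially)
      obtain g where g: "continuous_on UNIV g" "bounded (range g)" "(\<integral>x. \<bar>s i x - g x\<bar> \<partial>\<mu>) < e / 2"
        using lim.IH[of i] e by (meson half_gt_zero)
      have ii: "integrable \<mu> (\<lambda>x. \<bar>f x - s i x\<bar>)" "integrable \<mu> (\<lambda>x. \<bar>s i x - g x\<bar>)"
        using lim int g by auto
      have "(\<integral>x. \<bar>f x - g x\<bar> \<partial>\<mu>) \<le> (\<integral>x. \<bar>f x - s i x\<bar> + \<bar>s i x - g x\<bar> \<partial>\<mu>)"
        using lim int g ii by (intro integral_mono) auto
      also have "\<dots> < e" using i g ii by simp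
      finally show "\<exists>g. continuous_on UNIV g \<and> bounded (range g) \<and> (\<integral>x. \<bar>f x - g x\<bar> \<partial>\<mu>) < e"
        using g by blast
    qed
  qed
  then show ?thesis using e by blast
qed

text \<open>Polynomials approximate g uniformly on balls of growing radius; multiplication by
  \<open>cutoff\<close> makes them bounded with bounded derivatives, at the price of convergence
  that is merely pointwise.\<close>

lemma continuous_approx_C1_bounded:
  fixes g :: "'e::euclidean_space \<Rightarrow> real"
  assumes g: "continuous_on UNIV g" "\<And>x. \<bar>g x\<bar> \<le> 1"
  shows "\<exists>t t'. (\<forall>m::nat. C1_bounded (t m) (t' m) \<and> (\<forall>x. \<bar>t m x\<bar> \<le> 1)) \<and> (\<forall>x. (\<lambda>m. t m x) \<longlonglongrightarrow> g x)"
proof -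
  have "\<exists>q. real_polynomial_function q \<and> (\<forall>x\<in>cball 0 (real (Suc m)). \<bar>g x - q x\<bar> < 1 / real (Suc m))" for m :: nat
    using Stone_Weierstrass_real_polynomial_function[of "cball 0 (real (Suc m))" g "1 / real (Suc m)"]
      continuous_on_subset[OF g(1)] by (metis compact_cball of_nat_0_less_iff subset_UNIV zero_less_Suc zero_less_divide_1_iff)
  then obtain q where q: "\<And>m::nat. real_polynomial_function (q m)"
    "\<And>m x. norm x \<le> real (Suc m) \<Longrightarrow> \<bar>g x - q m x\<bar> < 1 / real (Suc m)"
    by (metis mem_cball_0)
  \<comment> \<open>On the ball the polynomial may exceed 1 by the approximation error; this factor
    scales it back and tends to 1.\<close>
  define a where "a m = 1 / (1 + 1 / real (Suc m))" for m
  define t where "t m x = cutoff (real (Suc m)) x * (a m * q m x)" for m x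
  have a: "0 < a m" for m unfolding a_def by (intro divide_pos_pos add_pos_nonneg) auto
  have zero: "t m x = 0" if "norm x > real (Suc m)" for m x
    using that by (simp add: t_def cutoff_eq_0)
  have "\<exists>t'. C1_bounded (t m) t'" for m
  proof -
    obtain q' where "C1 (q m) q'" using C1_real_polynomial[OF q(1)] by blast
    then have "\<exists>f'. C1 (\<lambda>x. a m * q m x) f'" by (intro C1_mult_const exI)
    then obtain f' c' where "C1 (\<lambda>x. a m * q m x) f'" "C1 (cutoff (real (Suc m)) :: 'e \<Rightarrow> real) c'"
      using C1_cutoff by blast
    from C1_compact_support[OF C1_mult[OF this(2,1)], of "real (Suc m)"] zero[of m]
    show ?thesis unfolding t_def by blast
  qed
  then obtain t' where t': "\<And>m. C1_bounded (t m) (t' m)" by metis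
  have bound: "\<bar>t m x\<bar> \<le> 1" for m x
  proof (cases "norm x > real (Suc m)")
    case False
    have "\<bar>q m x\<bar> \<le> 1 + 1 / real (Suc m)" using q(2)[of x m] g(2)[of x] False by linarith
    then have "a m * \<bar>q m x\<bar> \<le> a m * (1 + 1 / real (Suc m))" using a[of m] by (intro mult_left_mono) auto
    also have "\<dots> = 1" using a[of m] by (simp add: a_def)
    finally have "\<bar>a m * q m x\<bar> \<le> 1" using a[of m] by (simp add: abs_mult)
    then have "\<bar>cutoff (real (Suc m)) x\<bar> * \<bar>a m * q m x\<bar> \<le> 1 * 1" by (intro mult_mono) auto
    then show ?thesis by (simp add: t_def abs_mult)
  qed (simp add: zero)
  have "(\<lambda>m. t m x) \<longlonglongrightarrow> g x" for x
  proof -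
    have inv: "(\<lambda>m. 1 / real (Suc m)) \<longlonglongrightarrow> 0" by (rule LIMSEQ_Suc[OF lim_1_over_n])
    have "(\<lambda>m. a m) \<longlonglongrightarrow> 1 / (1 + 0)" unfolding a_def by (intro tendsto_intros inv) auto
    moreover have "(\<lambda>m. q m x) \<longlonglongrightarrow> g x"
    proof (rule LIM_zero_cancel, rule Lim_null_comparison[OF _ inv])
      obtain N :: nat where N: "norm x \<le> real N" using real_arch_simple by blast
      show "\<forall>\<^sub>F m in sequentially. norm (q m x - g x) \<le> 1 / real (Suc m)"
      proof (rule eventually_sequentiallyI[of N])
        fix m assume "N \<le> m"
        then have "norm x \<le> real (Suc m)" using N by linarith
        from q(2)[OF this] show "norm (q m x - g x) \<le> 1 / real (Suc m)"
          by (simp add: abs_minus_commute)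
      qed
    qed
    ultimately have "(\<lambda>m. t m x) \<longlonglongrightarrow> 1 * (1 / (1 + 0) * g x)"
      unfolding t_def by (intro tendsto_intros cutoff_tendsto_1)
    then show ?thesis by simp
  qed
  then show ?thesis using t' bound by blast
qed

text \<open>Leads from bounded Borel test functions to those that can be differentiated, first
  through continuous functions and then through C1 functions, with the bound 1 preserved.\<close>

lemma measurable_approx_C1_bounded:
  fixes f :: "'e::euclidean_space \<Rightarrow> real"
  assumes fin: "finite_measure \<mu>" and sets: "sets \<mu> = sets borel" and f: "f \<in> borel_measurable borel" "\<And>x. \<bar>f x\<bar> \<le> 1"
    and e: "e > 0"
  shows "\<exists>g g'. C1_bounded g g' \<and> (\<forall>x. \<bar>g x\<bar> \<le> 1) \<and> (\<integral>x. \<bar>f x - g x\<bar> \<partial>\<mu>) < e"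
proof -
  interpret finite_measure \<mu> by fact
  note [measurable_cong] = sets
  have int: "integrable \<mu> h" if "h \<in> borel_measurable borel" "\<And>x. \<bar>h x\<bar> \<le> 1" for h :: "'e \<Rightarrow> real"
    using that by (intro integrable_const_bound[of _ 1]) auto
  have fi: "integrable \<mu> f" by (rule int[OF f])
  obtain g0 where g0: "continuous_on UNIV g0" "(\<integral>x. \<bar>f x - g0 x\<bar> \<partial>\<mu>) < e / 2" "bounded (range g0)"
    using integrable_approx_continuous[OF fin sets fi, of "e / 2"] e by auto
  \<comment> \<open>Clamping to \<open>[-1, 1]\<close> can only bring the approximation closer to f,
    whose values lie there.\<close>
  define g where "g x = max (- 1) (min 1 (g0 x))" for x
  have g: "continuous_on UNIV g" "\<And>x. \<bar>g x\<bar> \<le> 1"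
    using g0 unfolding g_def by (auto intro!: continuous_intros)
  have [measurable]: "g0 \<in> borel_measurable borel" "g \<in> borel_measurable borel" "f \<in> borel_measurable borel"
    using g0 g f by (auto intro: borel_measurable_continuous_onI)
  obtain B where B: "\<And>x. \<bar>g0 x\<bar> \<le> B" using g0(3) by (auto simp: bounded_iff)
  have ig0: "integrable \<mu> g0" using B by (intro integrable_const_bound[of _ B]) auto
  have ig: "integrable \<mu> g" by (rule int) (use g in auto)
  have "(\<integral>x. \<bar>f x - g x\<bar> \<partial>\<mu>) \<le> (\<integral>x. \<bar>f x - g0 x\<bar> \<partial>\<mu>)"
  proof (rule integral_mono)
    show "\<bar>f x - g x\<bar> \<le> \<bar>f x - g0 x\<bar>" for x using f(2)[of x] by (auto simp: g_def)
  qed (use fi ig0 ig in auto)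
  then have fg: "(\<integral>x. \<bar>f x - g x\<bar> \<partial>\<mu>) < e / 2" using g0 by simp
  obtain t t' where t: "\<And>m::nat. C1_bounded (t m) (t' m)" "\<And>m x. \<bar>t m x\<bar> \<le> 1" "\<And>x. (\<lambda>m. t m x) \<longlonglongrightarrow> g x"
    using continuous_approx_C1_bounded[OF g] by blast
  have [measurable]: "t m \<in> borel_measurable borel" for m
    using C1_continuous[OF C1_bounded_imp_C1[OF t(1)]] by (rule borel_measurable_continuous_onI)
  have it: "integrable \<mu> (t m)" for m by (rule int) (use t in auto)
  have "(\<lambda>m. \<integral>x. \<bar>g x - t m x\<bar> \<partial>\<mu>) \<longlonglongrightarrow> (\<integral>x. 0 \<partial>\<mu>)"
  proof (rule integral_dominated_convergence[where w="\<lambda>_. 2"])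
    show "AE x in \<mu>. (\<lambda>m. \<bar>g x - t m x\<bar>) \<longlonglongrightarrow> 0"
    proof (intro AE_I2)
      fix x
      have "(\<lambda>m. \<bar>g x - t m x\<bar>) \<longlonglongrightarrow> \<bar>g x - g x\<bar>" by (intro tendsto_intros t)
      then show "(\<lambda>m. \<bar>g x - t m x\<bar>) \<longlonglongrightarrow> 0" by simp
    qed
    show "AE x in \<mu>. norm \<bar>g x - t m x\<bar> \<le> 2" for m
    proof (intro AE_I2)
      fix x show "norm \<bar>g x - t m x\<bar> \<le> 2" using g(2)[of x] t(2)[of m x] by simp
    qed
  qed auto
  then have "\<forall>\<^sub>F m in sequentially. (\<integral>x. \<bar>g x - t m x\<bar> \<partial>\<mu>) < e / 2" using e by (intro order_tendstoD) auto
  then obtain m where m: "(\<integral>x. \<bar>g x - t m x\<bar> \<partial>\<mu>) < e / 2" by (auto simp: eventually_sequentially)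
  have "(\<integral>x. \<bar>f x - t m x\<bar> \<partial>\<mu>) \<le> (\<integral>x. \<bar>f x - g x\<bar> + \<bar>g x - t m x\<bar> \<partial>\<mu>)"
    using fi ig it by (intro integral_mono) auto
  also have "\<dots> < e" using fg m fi ig it by simp
  finally show ?thesis using t by blast
qed

section \<open>Weights that localise to invertible matrices\<close>

lemma C1_compact_support_bounded:
  fixes f :: "'e::euclidean_space \<Rightarrow> real"
  assumes f: "C1 f f'" and supp: "\<And>x. norm x > R \<Longrightarrow> f x = 0"
  obtains c where "c \<ge> 0" "\<And>x. \<bar>f x\<bar> \<le> c"
proof -
  have "compact (f ` cball 0 R)"
    by (intro compact_continuous_image continuous_on_subset[OF C1_continuous[OF f]]) auto
  then obtain B where B: "\<forall>y\<in>f ` cball 0 R. norm y \<le> B"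
    using compact_imp_bounded bounded_iff by metis
  have "\<bar>f x\<bar> \<le> max B 0" for x
    using supp[of x] B by (cases "norm x \<le> R") (auto simp: le_max_iff_disj)
  then show thesis using that[of "max B 0"] by auto
qed

text \<open>By Cramer's rule this is entry \<open>(l, i)\<close> of the adjugate matrix: divided by
  \<open>det B\<close> it is the corresponding entry of the inverse.\<close>

definition cofactor_entry :: "'d \<Rightarrow> 'd \<Rightarrow> real^'d^'d \<Rightarrow> real" where
  "cofactor_entry l i B = det (\<chi> p q. if q = l then axis i 1 $ p else B $ p $ q)"

lemma cofactor_expansion:
  fixes B :: "real^'d^'d"
  assumes "det B \<noteq> 0"
  shows "(\<Sum>l\<in>UNIV. B $ j $ l * cofactor_entry l i B) = (if i = j then det B else 0)"
proof -
  have "B *v (\<chi> l. cofactor_entry l i B / det B) = axis i 1"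
    using cramer[OF assms, of "\<chi> l. cofactor_entry l i B / det B" "axis i 1"]
    by (simp add: cofactor_entry_def)
  then have "(\<Sum>l\<in>UNIV. B $ j $ l * (cofactor_entry l i B / det B)) = (axis i 1 :: real^'d) $ j"
    by (metis (no_types, lifting) matrix_vector_mult_def sum.cong vec_lambda_beta)
  then have "(\<Sum>l\<in>UNIV. B $ j $ l * cofactor_entry l i B) / det B = (axis i 1 :: real^'d) $ j"
    by (simp add: sum_divide_distrib)
  then show ?thesis using assms by (auto simp: axis_def field_simps split: if_splits)
qed

text \<open>A smooth regularisation of the reciprocal that vanishes at 0 and tends to
  \<open>1 / t\<close> for every nonzero t as r grows.\<close>

definition damped_inverse :: "nat \<Rightarrow> real \<Rightarrow> real" where
  "damped_inverse r t = t / (t\<^sup>2 + 1 / real (Suc r))"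

lemma has_real_derivative_damped_inverse:
  "(damped_inverse r has_real_derivative
     (1 * (t\<^sup>2 + 1 / real (Suc r)) - t * (2 * t)) / ((t\<^sup>2 + 1 / real (Suc r)) * (t\<^sup>2 + 1 / real (Suc r)))) (at t)"
  unfolding damped_inverse_def
proof (rule DERIV_divide)
  have "0 < t\<^sup>2 + 1 / real (Suc r)" by (intro add_nonneg_pos) auto
  then show "t\<^sup>2 + 1 / real (Suc r) \<noteq> 0" by simp
qed (auto intro!: derivative_eq_intros)

text \<open>A cutoff that approximates the indicator of the invertible matrices, and the entries of the
  corresponding truncation of the inverse matrix.\<close>

definition det_cutoff :: "nat \<Rightarrow> real^'d^'d \<Rightarrow> real" where
  "det_cutoff r B = cutoff (real (Suc r)) B * (det B * damped_inverse r (det B))"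

definition inverse_cutoff :: "nat \<Rightarrow> 'd \<Rightarrow> 'd \<Rightarrow> real^'d^'d \<Rightarrow> real" where
  "inverse_cutoff r l i B = cutoff (real (Suc r)) B * (cofactor_entry l i B * damped_inverse r (det B))"

lemma C1_damped_inverse_det: "\<exists>f'. C1 (\<lambda>B::real^'d^'d. damped_inverse r (det B)) f'"
proof -
  obtain f' where "C1 (det :: real^'d^'d \<Rightarrow> real) f'" using C1_det by blast
  moreover have "continuous_on UNIV (\<lambda>t. (1 * (t\<^sup>2 + 1 / real (Suc r)) - t * (2 * t)) / ((t\<^sup>2 + 1 / real (Suc r)) * (t\<^sup>2 + 1 / real (Suc r))))"
  proof (intro continuous_intros ballI)
    fix t :: real
    have "0 < t\<^sup>2 + 1 / real (Suc r)" by (intro add_nonneg_pos) auto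
    then show "(t\<^sup>2 + 1 / real (Suc r)) * (t\<^sup>2 + 1 / real (Suc r)) \<noteq> 0" by simp
  qed
  ultimately show ?thesis
    using C1_compose_real[OF _ has_real_derivative_damped_inverse] by blast
qed

lemma C1_bounded_cutoff_mult:
  fixes f :: "'e::euclidean_space \<Rightarrow> real"
  assumes "\<exists>f'. C1 f f'"
  shows "\<exists>f' c. C1_bounded (\<lambda>x. cutoff (real (Suc r)) x * f x) f' \<and> 0 \<le> c \<and> (\<forall>x. \<bar>cutoff (real (Suc r)) x * f x\<bar> \<le> c)"
proof -
  obtain f' c' where "C1 f f'" "C1 (cutoff (real (Suc r)) :: 'e \<Rightarrow> real) c'"
    using assms C1_cutoff by blast
  note C = C1_mult[OF this(2,1)]
  have z: "cutoff (real (Suc r)) x * f x = 0" if "norm x > real (Suc r)" for x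
    using that by (simp add: cutoff_eq_0)
  obtain c where "c \<ge> 0" "\<And>x. \<bar>cutoff (real (Suc r)) x * f x\<bar> \<le> c"
    using C1_compact_support_bounded[OF C z] by blast
  then show ?thesis using C1_compact_support[OF C z] by blast
qed

lemma C1_bounded_det_cutoff: "\<exists>f'. C1_bounded (det_cutoff r :: real^'d^'d \<Rightarrow> real) f'"
proof -
  obtain f' g' where "C1 (det :: real^'d^'d \<Rightarrow> real) f'" "C1 (\<lambda>B::real^'d^'d. damped_inverse r (det B)) g'"
    using C1_det C1_damped_inverse_det by blast
  from C1_bounded_cutoff_mult[OF exI, OF C1_mult[OF this], of r] show ?thesis
    unfolding det_cutoff_def[abs_def] by blast
qed

lemma C1_bounded_inverse_cutoff:
  "\<exists>f' c. C1_bounded (inverse_cutoff r l i :: real^'d^'d \<Rightarrow> real) f' \<and> 0 \<le> c \<and> (\<forall>B. \<bar>inverse_cutoff r l i B\<bar> \<le> c)"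
proof -
  obtain f' g' where "C1 (\<lambda>B::real^'d^'d. cofactor_entry l i B) f'" "C1 (\<lambda>B::real^'d^'d. damped_inverse r (det B)) g'"
    using C1_cofactor C1_damped_inverse_det unfolding cofactor_entry_def by blast
  from C1_bounded_cutoff_mult[OF exI, OF C1_mult[OF this], of r] show ?thesis
    unfolding inverse_cutoff_def[abs_def] .
qed

text \<open>The identity is exact: the truncated inverse is the adjugate times the same scalar
  factor whose product with the determinant defines \<open>det_cutoff\<close>. Singular matrices are
  covered because \<open>damped_inverse\<close> is 0 at 0.\<close>

lemma inverse_cutoff_expansion:
  "(\<Sum>l\<in>UNIV. B $ j $ l * inverse_cutoff r l i B) = (if i = j then det_cutoff r B else 0)"
proof (cases "det B = 0")
  case False
  have "(\<Sum>l\<in>UNIV. B $ j $ l * inverse_cutoff r l i B) =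
      (\<Sum>l\<in>UNIV. B $ j $ l * cofactor_entry l i B) * (cutoff (real (Suc r)) B * damped_inverse r (det B))"
    unfolding inverse_cutoff_def sum_distrib_right by (intro sum.cong) auto
  then show ?thesis
    unfolding cofactor_expansion[OF False] by (simp add: det_cutoff_def)
qed (simp add: inverse_cutoff_def det_cutoff_def damped_inverse_def)

lemma det_cutoff_range: "0 \<le> det_cutoff r B" "det_cutoff r B \<le> 1"
proof -
  have p: "0 < (det B)\<^sup>2 + 1 / real (Suc r)" by (intro add_nonneg_pos) auto
  have e: "det B * damped_inverse r (det B) = (det B)\<^sup>2 / ((det B)\<^sup>2 + 1 / real (Suc r))"
    by (simp add: damped_inverse_def power2_eq_square)
  have "0 \<le> det B * damped_inverse r (det B)" "det B * damped_inverse r (det B) \<le> 1"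
    unfolding e using p by (auto simp: divide_le_eq)
  then show "0 \<le> det_cutoff r B" "det_cutoff r B \<le> 1"
    unfolding det_cutoff_def by (auto intro!: mult_nonneg_nonneg mult_le_one)
qed

lemma abs_det_cutoff: "\<bar>det_cutoff r B\<bar> \<le> 1" "\<bar>1 - det_cutoff r B\<bar> \<le> 1"
  using det_cutoff_range[of r B] by auto

lemma det_cutoff_tendsto_1:
  assumes "det B \<noteq> 0"
  shows "(\<lambda>r. det_cutoff r B) \<longlonglongrightarrow> 1"
proof -
  have "(\<lambda>r. 1 / real (Suc r)) \<longlonglongrightarrow> 0" by (rule LIMSEQ_Suc[OF lim_1_over_n])
  then have "(\<lambda>r. cutoff (real (Suc r)) B * (det B * (det B / ((det B)\<^sup>2 + 1 / real (Suc r))))) \<longlonglongrightarrow>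
      1 * (det B * (det B / ((det B)\<^sup>2 + 0)))"
    using assms by (intro tendsto_intros cutoff_tendsto_1) auto
  then show ?thesis using assms by (simp add: det_cutoff_def damped_inverse_def power2_eq_square)
qed

text \<open>Brings a bounded Lipschitz function into the shape of \<open>conv_in_prob\<close>: the
  Lipschitz estimate serves for t up to 1, and the bound \<open>2 * c\<close> beyond.\<close>

lemma lipschitz_bounded_le_min:
  assumes "\<bar>a - b\<bar> \<le> L * t" "\<bar>a\<bar> \<le> c" "\<bar>b\<bar> \<le> (c::real)" "0 \<le> L" "0 \<le> t"
  shows "\<bar>a - b\<bar> \<le> (L + 2 * c) * min 1 t"
proof (cases "t \<le> 1")
  case True
  have "0 \<le> c * t" using assms by (intro mult_nonneg_nonneg) linarith+
  moreover have "(L + 2 * c) * min 1 t = L * t + 2 * (c * t)" using True by (simp add: min_def algebra_simps)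
  ultimately show ?thesis using assms by linarith
qed (use assms in \<open>simp add: min_def\<close>)

text \<open>Up to the limit in total variation, Malliavin calculus is condensed into what the
  directions in H reveal. Index \<open>h h'\<close> in \<open>D2Fn\<close> means differentiation
  along h first and then along \<open>h'\<close>. \<open>DF\<close> enters as the limit in
  \<open>convD\<close>, and H is countable so that countably many weights arise.\<close>

locale weak_convergence = brownian M W for M :: "'a measure" and W :: "real \<Rightarrow> 'a \<Rightarrow> real^'n" +
  fixes Fn :: "nat \<Rightarrow> 'a \<Rightarrow> real^'d" and F :: "'a \<Rightarrow> real^'d"
    and DFn :: "nat \<Rightarrow> real \<times> 'n \<Rightarrow> 'a \<Rightarrow> real^'d" and DF :: "real \<times> 'n \<Rightarrow> 'a \<Rightarrow> real^'d"
    and D2Fn :: "nat \<Rightarrow> real \<times> 'n \<Rightarrow> real \<times> 'n \<Rightarrow> 'a \<Rightarrow> real^'d" and H :: "(real \<times> 'n) set"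
  assumes H: "\<And>h. h \<in> H \<Longrightarrow> fst h \<in> {0..1}" and H_countable: "countable H"
    and deriv1: "\<And>n h. h \<in> H \<Longrightarrow> weak_deriv h (Fn n) (DFn n h)"
    and deriv2: "\<And>n h h'. h \<in> H \<Longrightarrow> h' \<in> H \<Longrightarrow> weak_deriv h' (DFn n h) (D2Fn n h h')"
    and D2_bound: "\<And>h h'. h \<in> H \<Longrightarrow> h' \<in> H \<Longrightarrow> \<exists>C. \<forall>n. (\<integral>\<omega>. norm (D2Fn n h h' \<omega>) \<partial>M) \<le> C"
    and conv: "conv_in_prob M Fn F"
    and convD: "\<And>h. h \<in> H \<Longrightarrow> conv_in_prob M (\<lambda>n. DFn n h) (DF h)"
begin

definition jac :: "('d \<Rightarrow> real \<times> 'n) \<Rightarrow> 'a \<Rightarrow> real^'d^'d" where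
  "jac s \<omega> = (\<chi> i l. DF (s l) \<omega> $ i)"

definition jacn :: "('d \<Rightarrow> real \<times> 'n) \<Rightarrow> nat \<Rightarrow> 'a \<Rightarrow> real^'d^'d" where
  "jacn s n \<omega> = (\<chi> i l. DFn n (s l) \<omega> $ i)"

definition jacn_deriv :: "('d \<Rightarrow> real \<times> 'n) \<Rightarrow> nat \<Rightarrow> real \<times> 'n \<Rightarrow> 'a \<Rightarrow> real^'d^'d" where
  "jacn_deriv s n h \<omega> = (\<chi> i l. D2Fn n (s l) h \<omega> $ i)"

lemma weak_deriv_jacn:
  assumes "range s \<subseteq> H" "h \<in> H"
  shows "weak_deriv h (jacn s n) (jacn_deriv s n h)"
proof (intro weak_deriv_vec)
  fix i l
  have "weak_deriv h (\<lambda>\<omega>. DFn n (s l) \<omega> $ i) (\<lambda>\<omega>. D2Fn n (s l) h \<omega> $ i)"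
    using assms by (intro weak_deriv_linear[OF deriv2] bounded_linear_vec_nth) auto
  then show "weak_deriv h (\<lambda>\<omega>. jacn s n \<omega> $ i $ l) (\<lambda>\<omega>. jacn_deriv s n h \<omega> $ i $ l)"
    by (simp add: jacn_def jacn_deriv_def)
qed

lemma jacn_deriv_bound:
  assumes "range s \<subseteq> H" "h \<in> H"
  obtains C where "\<And>n. (\<integral>\<omega>. norm (jacn_deriv s n h \<omega>) \<partial>M) \<le> C"
proof -
  have "\<exists>C. \<forall>n. (\<integral>\<omega>. norm (D2Fn n (s l) h \<omega>) \<partial>M) \<le> C" for l
    using assms by (intro D2_bound) auto
  then obtain C where C: "\<And>l n. (\<integral>\<omega>. norm (D2Fn n (s l) h \<omega>) \<partial>M) \<le> C l" by metis
  have int: "integrable M (\<lambda>\<omega>. norm (D2Fn n (s l) h \<omega>))" for n l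
    using weak_deriv_integrable[OF deriv2[of "s l" h n]] assms by auto
  have "(\<integral>\<omega>. norm (jacn_deriv s n h \<omega>) \<partial>M) \<le> (\<Sum>i\<in>(UNIV::'d set). \<Sum>l\<in>UNIV. C l)" for n
  proof -
    have "(\<integral>\<omega>. norm (jacn_deriv s n h \<omega>) \<partial>M) \<le> (\<integral>\<omega>. (\<Sum>i\<in>(UNIV::'d set). \<Sum>l\<in>UNIV. norm (D2Fn n (s l) h \<omega>)) \<partial>M)"
    proof (rule integral_mono)
      show "integrable M (\<lambda>\<omega>. norm (jacn_deriv s n h \<omega>))"
        using weak_deriv_integrable[OF weak_deriv_jacn[OF assms]] by auto
      show "integrable M (\<lambda>\<omega>. \<Sum>i\<in>(UNIV::'d set). \<Sum>l\<in>UNIV. norm (D2Fn n (s l) h \<omega>))"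
        by (intro Bochner_Integration.integrable_sum int)
      fix \<omega>
      have "norm (jacn_deriv s n h \<omega>) \<le> (\<Sum>i\<in>UNIV. norm (jacn_deriv s n h \<omega> $ i))" by (rule norm_vec_le_sum)
      also have "\<dots> \<le> (\<Sum>i\<in>UNIV. \<Sum>l\<in>UNIV. norm (jacn_deriv s n h \<omega> $ i $ l))" by (intro sum_mono norm_vec_le_sum)
      also have "\<dots> \<le> (\<Sum>i\<in>(UNIV::'d set). \<Sum>l\<in>UNIV. norm (D2Fn n (s l) h \<omega>))"
        by (intro sum_mono) (simp add: jacn_deriv_def component_le_norm_cart)
      finally show "norm (jacn_deriv s n h \<omega>) \<le> (\<Sum>i\<in>(UNIV::'d set). \<Sum>l\<in>UNIV. norm (D2Fn n (s l) h \<omega>))" .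
    qed
    also have "\<dots> = (\<Sum>i\<in>(UNIV::'d set). \<Sum>l\<in>UNIV. \<integral>\<omega>. norm (D2Fn n (s l) h \<omega>) \<partial>M)"
      using int by (simp add: Bochner_Integration.integral_sum)
    also have "\<dots> \<le> (\<Sum>i\<in>(UNIV::'d set). \<Sum>l\<in>UNIV. C l)" by (intro sum_mono C)
    finally show ?thesis .
  qed
  then show thesis by (rule that)
qed

lemma conv_in_prob_jacn:
  assumes "range s \<subseteq> H"
  shows "conv_in_prob M (jacn s) (jac s)"
proof (intro conv_in_prob_vec)
  fix i l
  have "conv_in_prob M (\<lambda>n \<omega>. DFn n (s l) \<omega> $ i) (\<lambda>\<omega>. DF (s l) \<omega> $ i)"
    using assms by (intro conv_in_prob_component convD) auto
  then show "conv_in_prob M (\<lambda>n \<omega>. jacn s n \<omega> $ i $ l) (\<lambda>\<omega>. jac s \<omega> $ i $ l)"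
    by (simp add: jacn_def jac_def)
qed

text \<open>A weight is a sequence together with its limit. The members of the sequence, which go
  with \<open>Fn n\<close>, are differentiable in all directions of H with L^1 bounds uniform in n,
  for the integration by parts; the limit, which goes with F, is reached in L^1.\<close>

definition smooth_weight :: "(nat \<Rightarrow> 'a \<Rightarrow> real) \<Rightarrow> ('a \<Rightarrow> real) \<Rightarrow> bool" where
  "smooth_weight \<kappa> \<kappa>\<^sub>0 \<longleftrightarrow>
     (\<forall>n. \<kappa> n \<in> borel_measurable M \<and> (\<forall>\<omega>. 0 \<le> \<kappa> n \<omega> \<and> \<kappa> n \<omega> \<le> 1)) \<and>
     \<kappa>\<^sub>0 \<in> borel_measurable M \<and> (\<forall>\<omega>. 0 \<le> \<kappa>\<^sub>0 \<omega> \<and> \<kappa>\<^sub>0 \<omega> \<le> 1) \<and>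
     (\<forall>h\<in>H. \<exists>\<kappa>' C. \<forall>n. bounded_weak_deriv h (\<kappa> n) (\<kappa>' n) \<and> (\<integral>\<omega>. \<bar>\<kappa>' n \<omega>\<bar> \<partial>M) \<le> C) \<and>
     (\<lambda>n. \<integral>\<omega>. \<bar>\<kappa> n \<omega> - \<kappa>\<^sub>0 \<omega>\<bar> \<partial>M) \<longlonglongrightarrow> 0"

lemma smooth_weight_1: "smooth_weight (\<lambda>_ _. 1) (\<lambda>_. 1)"
proof -
  have "\<exists>\<kappa>' C. \<forall>n::nat. bounded_weak_deriv h (\<lambda>_. 1) (\<kappa>' n) \<and> (\<integral>\<omega>. \<bar>\<kappa>' n \<omega>\<bar> \<partial>M) \<le> C" for h
    by (intro exI[of _ "\<lambda>_ _. 0"] exI[of _ 0] allI conjI bounded_weak_deriv_const) simp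
  then show ?thesis by (auto simp: smooth_weight_def)
qed

lemma integral_abs_C1_bounded_deriv_mult_le:
  fixes X' :: "'a \<Rightarrow> 'e::euclidean_space"
  assumes \<phi>: "\<And>x v. norm (\<phi>' x v) \<le> K * norm v" "K \<ge> 0" and \<psi>: "\<And>\<omega>. \<bar>\<psi> \<omega>\<bar> \<le> c" "0 \<le> c"
    and \<kappa>: "\<And>\<omega>. \<bar>\<kappa> \<omega>\<bar> \<le> 1" and int: "integrable M \<kappa>'" "integrable M X'"
    and i: "integrable M (\<lambda>\<omega>. \<kappa> \<omega> * \<phi>' (X \<omega>) (X' \<omega>) + \<kappa>' \<omega> * \<psi> \<omega>)"
  shows "(\<integral>\<omega>. \<bar>\<kappa> \<omega> * \<phi>' (X \<omega>) (X' \<omega>) + \<kappa>' \<omega> * \<psi> \<omega> :: real\<bar> \<partial>M) \<le> K * (\<integral>\<omega>. norm (X' \<omega>) \<partial>M) + c * (\<integral>\<omega>. \<bar>\<kappa>' \<omega>\<bar> \<partial>M)"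
proof -
  have "(\<integral>\<omega>. \<bar>\<kappa> \<omega> * \<phi>' (X \<omega>) (X' \<omega>) + \<kappa>' \<omega> * \<psi> \<omega>\<bar> \<partial>M) \<le> (\<integral>\<omega>. K * norm (X' \<omega>) + c * \<bar>\<kappa>' \<omega>\<bar> \<partial>M)"
  proof (rule integral_mono[OF integrable_abs[OF i]])
    show "integrable M (\<lambda>\<omega>. K * norm (X' \<omega>) + c * \<bar>\<kappa>' \<omega>\<bar>)"
      by (intro Bochner_Integration.integrable_add integrable_mult_right integrable_norm integrable_abs int)
    fix \<omega>
    have "\<bar>\<kappa> \<omega> * \<phi>' (X \<omega>) (X' \<omega>)\<bar> \<le> 1 * (K * norm (X' \<omega>))"
      unfolding abs_mult using \<phi>(1)[of "X \<omega>" "X' \<omega>"] \<kappa> by (intro mult_mono) auto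
    moreover have "\<bar>\<kappa>' \<omega> * \<psi> \<omega>\<bar> \<le> \<bar>\<kappa>' \<omega>\<bar> * c"
      unfolding abs_mult using \<psi> by (intro mult_left_mono) auto
    ultimately show "\<bar>\<kappa> \<omega> * \<phi>' (X \<omega>) (X' \<omega>) + \<kappa>' \<omega> * \<psi> \<omega>\<bar> \<le> K * norm (X' \<omega>) + c * \<bar>\<kappa>' \<omega>\<bar>"
      by (simp add: mult.commute)
  qed
  then show ?thesis using int by simp
qed

text \<open>Product rule and chain rule. The derivative of the matrix of first derivatives consists
  of second derivatives, so their uniform L^1 bound and that of the derivative of the weight combine
  to a constant C that is the same for all n.\<close>

lemma bounded_weak_deriv_jacn_mult:
  assumes \<kappa>: "smooth_weight \<kappa> \<kappa>\<^sub>0" and s: "range s \<subseteq> H" and h: "h \<in> H"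
    and \<psi>: "C1_bounded \<psi> \<psi>'" "\<And>B. \<bar>\<psi> B\<bar> \<le> c" "0 \<le> c"
  obtains Y C where "\<And>n. bounded_weak_deriv h (\<lambda>\<omega>. \<kappa> n \<omega> * \<psi> (jacn s n \<omega>)) (Y n)" "\<And>n. (\<integral>\<omega>. \<bar>Y n \<omega>\<bar> \<partial>M) \<le> C"
proof -
  obtain \<kappa>' C where \<kappa>': "\<And>n. bounded_weak_deriv h (\<kappa> n) (\<kappa>' n)" "\<And>n. (\<integral>\<omega>. \<bar>\<kappa>' n \<omega>\<bar> \<partial>M) \<le> C"
    using \<kappa> h unfolding smooth_weight_def by metis
  obtain C2 where C2: "\<And>n. (\<integral>\<omega>. norm (jacn_deriv s n h \<omega>) \<partial>M) \<le> C2" using jacn_deriv_bound[OF s h] by blast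
  obtain K where K: "K > 0" "\<And>x v. norm (\<psi>' x v) \<le> K * norm v" using C1_bounded_lipschitz[OF \<psi>(1)] by metis
  define Y where "Y n \<omega> = \<kappa> n \<omega> * \<psi>' (jacn s n \<omega>) (jacn_deriv s n h \<omega>) + \<kappa>' n \<omega> * \<psi> (jacn s n \<omega>)" for n \<omega>
  have b: "bounded_weak_deriv h (\<lambda>\<omega>. \<kappa> n \<omega> * \<psi> (jacn s n \<omega>)) (Y n)" for n
    unfolding Y_def
    by (rule bounded_weak_deriv_mult[OF \<kappa>'(1) bounded_weak_deriv_C1_bounded[OF weak_deriv_jacn[OF s h] \<psi>(1,2)]])
  have "(\<integral>\<omega>. \<bar>Y n \<omega>\<bar> \<partial>M) \<le> K * C2 + c * C" for n
  proof -
    have "(\<integral>\<omega>. \<bar>Y n \<omega>\<bar> \<partial>M) \<le> K * (\<integral>\<omega>. norm (jacn_deriv s n h \<omega>) \<partial>M) + c * (\<integral>\<omega>. \<bar>\<kappa>' n \<omega>\<bar> \<partial>M)"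
      unfolding Y_def
    proof (rule integral_abs_C1_bounded_deriv_mult_le[where \<phi>'=\<psi>' and X="jacn s n" and X'="jacn_deriv s n h"
        and \<psi>="\<lambda>\<omega>. \<psi> (jacn s n \<omega>)" and \<kappa>="\<kappa> n" and \<kappa>'="\<kappa>' n"])
      show "integrable M (\<kappa>' n)" using weak_deriv_integrable[OF bounded_weak_deriv_imp[OF \<kappa>'(1)]] .
      show "integrable M (jacn_deriv s n h)" using weak_deriv_integrable[OF weak_deriv_jacn[OF s h]] .
      show "integrable M (\<lambda>\<omega>. \<kappa> n \<omega> * \<psi>' (jacn s n \<omega>) (jacn_deriv s n h \<omega>) + \<kappa>' n \<omega> * \<psi> (jacn s n \<omega>))"
        using weak_deriv_integrable[OF bounded_weak_deriv_imp[OF b]] unfolding Y_def .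
      show "\<bar>\<kappa> n \<omega>\<bar> \<le> 1" for \<omega> using \<kappa> by (simp add: smooth_weight_def)
    qed (use K \<psi> in auto)
    also have "\<dots> \<le> K * C2 + c * C" using K \<psi> C2[of n] \<kappa>'(2)[of n] by (intro add_mono mult_left_mono) auto
    finally show ?thesis .
  qed
  with b show thesis by (rule that)
qed

text \<open>\<open>det_cutoff r\<close> is bounded and Lipschitz, which upgrades the convergence in
  probability of the matrices to L^1 convergence.\<close>

lemma conv_det_cutoff:
  assumes s: "range s \<subseteq> H"
  shows "(\<lambda>n. \<integral>\<omega>. \<bar>det_cutoff r (jacn s n \<omega>) - det_cutoff r (jac s \<omega>)\<bar> \<partial>M) \<longlonglongrightarrow> 0"
    and "(\<lambda>\<omega>. det_cutoff r (jacn s n \<omega>)) \<in> borel_measurable M" "(\<lambda>\<omega>. det_cutoff r (jac s \<omega>)) \<in> borel_measurable M"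
proof -
  note c = conv_in_prob_jacn[OF s]
  obtain \<theta>' where \<theta>: "C1_bounded (det_cutoff r :: real^'d^'d \<Rightarrow> real) \<theta>'" using C1_bounded_det_cutoff by blast
  obtain K where K: "K > 0" "\<And>x y. norm (det_cutoff r x - det_cutoff r (y::real^'d^'d)) \<le> K * norm (x - y)"
    using C1_bounded_lipschitz[OF \<theta>] by metis
  have tm: "det_cutoff r \<in> borel_measurable (borel :: (real^'d^'d) measure)"
    using C1_continuous[OF C1_bounded_imp_C1[OF \<theta>]] by (rule borel_measurable_continuous_onI)
  have jm: "jacn s n \<in> borel_measurable M" "jac s \<in> borel_measurable M" for n
    using c by (auto simp: conv_in_prob_def)
  show m: "(\<lambda>\<omega>. det_cutoff r (jacn s n \<omega>)) \<in> borel_measurable M" "(\<lambda>\<omega>. det_cutoff r (jac s \<omega>)) \<in> borel_measurable M" for n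
    using measurable_compose[OF jm(1) tm] measurable_compose[OF jm(2) tm] .
  show "(\<lambda>n. \<integral>\<omega>. \<bar>det_cutoff r (jacn s n \<omega>) - det_cutoff r (jac s \<omega>)\<bar> \<partial>M) \<longlonglongrightarrow> 0"
  proof (rule tendsto_sandwich[OF _ _ tendsto_const])
    show "(\<lambda>n. (K + 2 * 1) * (\<integral>\<omega>. min 1 (norm (jacn s n \<omega> - jac s \<omega>)) \<partial>M)) \<longlonglongrightarrow> 0"
      using c by (intro tendsto_mult_right_zero) (simp add: conv_in_prob_def)
    show "\<forall>\<^sub>F n in sequentially. (\<integral>\<omega>. \<bar>det_cutoff r (jacn s n \<omega>) - det_cutoff r (jac s \<omega>)\<bar> \<partial>M) \<le>
        (K + 2 * 1) * (\<integral>\<omega>. min 1 (norm (jacn s n \<omega> - jac s \<omega>)) \<partial>M)"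
    proof (intro always_eventually allI)
      fix n
      have "(\<integral>\<omega>. \<bar>det_cutoff r (jacn s n \<omega>) - det_cutoff r (jac s \<omega>)\<bar> \<partial>M) \<le>
          (\<integral>\<omega>. (K + 2 * 1) * min 1 (norm (jacn s n \<omega> - jac s \<omega>)) \<partial>M)"
      proof (rule integral_mono)
        fix \<omega>
        have "\<bar>det_cutoff r (jacn s n \<omega>)\<bar> \<le> 1" "\<bar>det_cutoff r (jac s \<omega>)\<bar> \<le> 1"
          using det_cutoff_range[of r "jacn s n \<omega>"] det_cutoff_range[of r "jac s \<omega>"] by simp_all
        then show "\<bar>det_cutoff r (jacn s n \<omega>) - det_cutoff r (jac s \<omega>)\<bar> \<le> (K + 2 * 1) * min 1 (norm (jacn s n \<omega> - jac s \<omega>))"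
          using K by (intro lipschitz_bounded_le_min) auto
        show "integrable M (\<lambda>\<omega>. (K + 2 * 1) * min 1 (norm (jacn s n \<omega> - jac s \<omega>)))"
          by (intro integrable_mult_right integrable_min_norm jm)
        show "integrable M (\<lambda>\<omega>. \<bar>det_cutoff r (jacn s n \<omega>) - det_cutoff r (jac s \<omega>)\<bar>)"
          by (intro integrable_abs Bochner_Integration.integrable_diff; rule integrable_bounded_real[of _ 1])
             (use m abs_det_cutoff in auto)
      qed
      then show "(\<integral>\<omega>. \<bar>det_cutoff r (jacn s n \<omega>) - det_cutoff r (jac s \<omega>)\<bar> \<partial>M) \<le>
        (K + 2 * 1) * (\<integral>\<omega>. min 1 (norm (jacn s n \<omega> - jac s \<omega>)) \<partial>M)" by simp
    qed
  qed auto
qed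

lemma weights_L1_mult:
  assumes m: "\<And>n. a n \<in> borel_measurable M" "\<And>n. b n \<in> borel_measurable M" "a\<^sub>0 \<in> borel_measurable M" "b\<^sub>0 \<in> borel_measurable M"
    and r: "\<And>n \<omega>. \<bar>a n \<omega>\<bar> \<le> 1" "\<And>n \<omega>. \<bar>b n \<omega>\<bar> \<le> 1" "\<And>\<omega>. \<bar>a\<^sub>0 \<omega>\<bar> \<le> 1" "\<And>\<omega>. \<bar>b\<^sub>0 \<omega>\<bar> \<le> (1::real)"
    and a: "(\<lambda>n. \<integral>\<omega>. \<bar>a n \<omega> - a\<^sub>0 \<omega>\<bar> \<partial>M) \<longlonglongrightarrow> 0" and b: "(\<lambda>n. \<integral>\<omega>. \<bar>b n \<omega> - b\<^sub>0 \<omega>\<bar> \<partial>M) \<longlonglongrightarrow> 0"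
  shows "(\<lambda>n. \<integral>\<omega>. \<bar>a n \<omega> * b n \<omega> - a\<^sub>0 \<omega> * b\<^sub>0 \<omega>\<bar> \<partial>M) \<longlonglongrightarrow> 0"
proof (rule tendsto_sandwich[OF _ _ tendsto_const tendsto_add_zero[OF a b]])
  note m[measurable]
  have i: "integrable M (\<lambda>\<omega>. \<bar>a n \<omega> - a\<^sub>0 \<omega>\<bar>)" "integrable M (\<lambda>\<omega>. \<bar>b n \<omega> - b\<^sub>0 \<omega>\<bar>)" for n
  proof -
    have "integrable M (a n)" "integrable M (b n)" "integrable M a\<^sub>0" "integrable M b\<^sub>0"
      by (rule integrable_bounded_real[of _ 1]; use m r in auto)+
    then show "integrable M (\<lambda>\<omega>. \<bar>a n \<omega> - a\<^sub>0 \<omega>\<bar>)" "integrable M (\<lambda>\<omega>. \<bar>b n \<omega> - b\<^sub>0 \<omega>\<bar>)" by auto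
  qed
  show "\<forall>\<^sub>F n in sequentially. (\<integral>\<omega>. \<bar>a n \<omega> * b n \<omega> - a\<^sub>0 \<omega> * b\<^sub>0 \<omega>\<bar> \<partial>M) \<le>
    (\<integral>\<omega>. \<bar>a n \<omega> - a\<^sub>0 \<omega>\<bar> \<partial>M) + (\<integral>\<omega>. \<bar>b n \<omega> - b\<^sub>0 \<omega>\<bar> \<partial>M)"
  proof (intro always_eventually allI)
    fix n
    have "(\<integral>\<omega>. \<bar>a n \<omega> * b n \<omega> - a\<^sub>0 \<omega> * b\<^sub>0 \<omega>\<bar> \<partial>M) \<le> (\<integral>\<omega>. \<bar>a n \<omega> - a\<^sub>0 \<omega>\<bar> + \<bar>b n \<omega> - b\<^sub>0 \<omega>\<bar> \<partial>M)"
    proof (rule integral_mono)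
      fix \<omega>
      have "\<bar>a n \<omega> - a\<^sub>0 \<omega>\<bar> * \<bar>b n \<omega>\<bar> \<le> \<bar>a n \<omega> - a\<^sub>0 \<omega>\<bar> * 1" using r by (intro mult_left_mono) auto
      moreover have "\<bar>a\<^sub>0 \<omega>\<bar> * \<bar>b n \<omega> - b\<^sub>0 \<omega>\<bar> \<le> 1 * \<bar>b n \<omega> - b\<^sub>0 \<omega>\<bar>" using r by (intro mult_right_mono) auto
      moreover have "a n \<omega> * b n \<omega> - a\<^sub>0 \<omega> * b\<^sub>0 \<omega> = (a n \<omega> - a\<^sub>0 \<omega>) * b n \<omega> + a\<^sub>0 \<omega> * (b n \<omega> - b\<^sub>0 \<omega>)"
        by (simp add: algebra_simps)
      ultimately show "\<bar>a n \<omega> * b n \<omega> - a\<^sub>0 \<omega> * b\<^sub>0 \<omega>\<bar> \<le> \<bar>a n \<omega> - a\<^sub>0 \<omega>\<bar> + \<bar>b n \<omega> - b\<^sub>0 \<omega>\<bar>"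
        using abs_triangle_ineq[of "(a n \<omega> - a\<^sub>0 \<omega>) * b n \<omega>" "a\<^sub>0 \<omega> * (b n \<omega> - b\<^sub>0 \<omega>)"] by (simp add: abs_mult)
    next
      show "integrable M (\<lambda>\<omega>. \<bar>a n \<omega> * b n \<omega> - a\<^sub>0 \<omega> * b\<^sub>0 \<omega>\<bar>)"
        using r by (intro integrable_abs Bochner_Integration.integrable_diff integrable_bounded_real[of _ 1])
          (auto simp: abs_mult intro!: mult_le_one)
    qed (use i in auto)
    then show "(\<integral>\<omega>. \<bar>a n \<omega> * b n \<omega> - a\<^sub>0 \<omega> * b\<^sub>0 \<omega>\<bar> \<partial>M) \<le> (\<integral>\<omega>. \<bar>a n \<omega> - a\<^sub>0 \<omega>\<bar> \<partial>M) + (\<integral>\<omega>. \<bar>b n \<omega> - b\<^sub>0 \<omega>\<bar> \<partial>M)"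
      using i by simp
  qed
qed auto

text \<open>The complement of a localising factor is again admissible as a factor. This permits
  successive localisation, each factor acting on what the earlier ones have left over.\<close>

lemma smooth_weight_mult:
  assumes \<kappa>: "smooth_weight \<kappa> \<kappa>\<^sub>0" and s: "range s \<subseteq> H"
  shows "smooth_weight (\<lambda>n \<omega>. \<kappa> n \<omega> * (1 - det_cutoff r (jacn s n \<omega>))) (\<lambda>\<omega>. \<kappa>\<^sub>0 \<omega> * (1 - det_cutoff r (jac s \<omega>)))"
proof -
  note c = conv_det_cutoff[OF s, of r]
  note [measurable] = c(2,3)
  have k: "\<kappa> n \<in> borel_measurable M" "\<kappa>\<^sub>0 \<in> borel_measurable M" "0 \<le> \<kappa> n \<omega>" "\<kappa> n \<omega> \<le> 1" "0 \<le> \<kappa>\<^sub>0 \<omega>" "\<kappa>\<^sub>0 \<omega> \<le> 1" for n \<omega>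
    using \<kappa> by (auto simp: smooth_weight_def)
  note [measurable] = k(1,2)
  obtain \<theta>' where \<theta>: "C1_bounded (det_cutoff r :: real^'d^'d \<Rightarrow> real) \<theta>'" using C1_bounded_det_cutoff by blast
  have "\<exists>\<theta>'. C1_bounded (\<lambda>B::real^'d^'d. 1 - det_cutoff r B) \<theta>'"
  proof -
    obtain K where "\<And>x v. norm (\<theta>' x v) \<le> K * norm v" using C1_bounded_lipschitz[OF \<theta>] by metis
    moreover have "C1 (\<lambda>B::real^'d^'d. 1 - det_cutoff r B) (\<lambda>x v. - \<theta>' x v)"
      using C1_bounded_imp_C1[OF \<theta>] unfolding C1_def by (auto intro!: derivative_eq_intros continuous_intros)
    ultimately show ?thesis unfolding C1_bounded_def by (intro exI[of _ "\<lambda>x v. - \<theta>' x v"]) auto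
  qed
  then obtain \<psi>' where \<psi>: "C1_bounded (\<lambda>B::real^'d^'d. 1 - det_cutoff r B) \<psi>'" by blast
  have "\<exists>\<kappa>' C. \<forall>n. bounded_weak_deriv h (\<lambda>\<omega>. \<kappa> n \<omega> * (1 - det_cutoff r (jacn s n \<omega>))) (\<kappa>' n) \<and> (\<integral>\<omega>. \<bar>\<kappa>' n \<omega>\<bar> \<partial>M) \<le> C"
    if "h \<in> H" for h
  proof -
    have "\<bar>1 - det_cutoff r B\<bar> \<le> 1" for B :: "real^'d^'d"
      using det_cutoff_range[of r B] by simp
    from bounded_weak_deriv_jacn_mult[OF \<kappa> s that \<psi> this] obtain Y C where
      "\<And>n. bounded_weak_deriv h (\<lambda>\<omega>. \<kappa> n \<omega> * (1 - det_cutoff r (jacn s n \<omega>))) (Y n)" "\<And>n. (\<integral>\<omega>. \<bar>Y n \<omega>\<bar> \<partial>M) \<le> C"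
      by auto
    then show ?thesis by blast
  qed
  moreover have "(\<lambda>n. \<integral>\<omega>. \<bar>\<kappa> n \<omega> * (1 - det_cutoff r (jacn s n \<omega>)) - \<kappa>\<^sub>0 \<omega> * (1 - det_cutoff r (jac s \<omega>))\<bar> \<partial>M) \<longlonglongrightarrow> 0"
  proof (rule weights_L1_mult)
    show "(\<lambda>n. \<integral>\<omega>. \<bar>1 - det_cutoff r (jacn s n \<omega>) - (1 - det_cutoff r (jac s \<omega>))\<bar> \<partial>M) \<longlonglongrightarrow> 0"
      using c(1) by (simp add: abs_minus_commute)
    show "(\<lambda>n. \<integral>\<omega>. \<bar>\<kappa> n \<omega> - \<kappa>\<^sub>0 \<omega>\<bar> \<partial>M) \<longlonglongrightarrow> 0" using \<kappa> by (simp add: smooth_weight_def)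
  qed (use k in \<open>auto simp: abs_det_cutoff\<close>)
  moreover have "0 \<le> \<kappa> n \<omega> * (1 - det_cutoff r (jacn s n \<omega>)) \<and> \<kappa> n \<omega> * (1 - det_cutoff r (jacn s n \<omega>)) \<le> 1"
    "0 \<le> \<kappa>\<^sub>0 \<omega> * (1 - det_cutoff r (jac s \<omega>)) \<and> \<kappa>\<^sub>0 \<omega> * (1 - det_cutoff r (jac s \<omega>)) \<le> 1" for n \<omega>
    using k det_cutoff_range[of r] by (auto intro!: mult_le_one mult_nonneg_nonneg)
  ultimately show ?thesis
    unfolding smooth_weight_def by (intro conjI allI ballI) auto
qed

end

section \<open>Convergence in total variation under a nondegeneracy condition\<close>

text \<open>Differentiation under the expectation: the difference quotients are dominated by the
  constant \<open>K * norm y\<close>, with K a Lipschitz constant of g.\<close>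

lemma (in prob_space) has_real_derivative_integral_shift:
  fixes X :: "'a \<Rightarrow> 'e::euclidean_space" and g :: "'e \<Rightarrow> real"
  assumes [measurable]: "X \<in> borel_measurable M" "R \<in> borel_measurable M" and R: "\<And>\<omega>. \<bar>R \<omega>\<bar> \<le> 1"
    and g: "C1_bounded g g'" "\<And>x. \<bar>g x\<bar> \<le> 1"
  shows "((\<lambda>t. \<integral>\<omega>. g (X \<omega> - t *\<^sub>R y) * R \<omega> \<partial>M) has_real_derivative
    (\<integral>\<omega>. - g' (X \<omega> - t *\<^sub>R y) y * R \<omega> \<partial>M)) (at t)"
proof -
  note C1 = C1_bounded_imp_C1[OF g(1)]
  have [measurable]: "g \<in> borel_measurable borel" "(\<lambda>x. g' x y) \<in> borel_measurable borel"
    using C1_continuous[OF C1] C1_deriv_continuous[OF C1] by (auto intro: borel_measurable_continuous_onI)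
  obtain K where K: "K > 0" "\<And>x y. norm (g x - g y) \<le> K * norm (x - y)"
    using C1_bounded_lipschitz[OF g(1)] by metis
  have int: "integrable M (\<lambda>\<omega>. g (X \<omega> - t *\<^sub>R y) * R \<omega>)" for t
    using g(2) R by (intro integrable_bounded_real[of _ 1]) (auto simp: abs_mult intro!: mult_le_one)
  let ?q = "\<lambda>s \<omega>. (g (X \<omega> - s *\<^sub>R y) * R \<omega> - g (X \<omega> - t *\<^sub>R y) * R \<omega>) / (s - t)"
  have lim: "((\<lambda>s. \<integral>\<omega>. ?q s \<omega> \<partial>M) \<longlongrightarrow> (\<integral>\<omega>. - g' (X \<omega> - t *\<^sub>R y) y * R \<omega> \<partial>M)) (at t)"
    unfolding tendsto_at_iff_sequentially comp_def
  proof (intro allI impI)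
    fix S :: "nat \<Rightarrow> real" assume S: "\<forall>i. S i \<in> UNIV - {t}" "S \<longlonglongrightarrow> t"
    show "(\<lambda>i. \<integral>\<omega>. ?q (S i) \<omega> \<partial>M) \<longlonglongrightarrow> (\<integral>\<omega>. - g' (X \<omega> - t *\<^sub>R y) y * R \<omega> \<partial>M)"
    proof (rule integral_dominated_convergence[where w="\<lambda>_. K * norm y"])
      show "AE \<omega> in M. (\<lambda>i. ?q (S i) \<omega>) \<longlonglongrightarrow> - g' (X \<omega> - t *\<^sub>R y) y * R \<omega>"
      proof (intro AE_I2)
        fix \<omega>
        have 1: "((\<lambda>s. X \<omega> - s *\<^sub>R y) has_vector_derivative - y) (at t)"
          by (auto intro!: derivative_eq_intros)
        have 2: "(g has_derivative g' (X \<omega> - t *\<^sub>R y)) (at (X \<omega> - t *\<^sub>R y) within range (\<lambda>s. X \<omega> - s *\<^sub>R y))"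
          using C1D[OF C1] by (rule has_derivative_at_withinI)
        have "((\<lambda>s. g (X \<omega> - s *\<^sub>R y)) has_vector_derivative g' (X \<omega> - t *\<^sub>R y) (- y)) (at t)"
          using vector_derivative_diff_chain_within[OF 1 2] by (simp add: comp_def)
        then have "((\<lambda>s. g (X \<omega> - s *\<^sub>R y)) has_real_derivative - g' (X \<omega> - t *\<^sub>R y) y) (at t)"
          using linear_neg[OF bounded_linear.linear[OF C1_linear[OF C1]]]
          by (simp add: has_real_derivative_iff_has_vector_derivative)
        then have "((\<lambda>s. g (X \<omega> - s *\<^sub>R y) * R \<omega>) has_real_derivative - g' (X \<omega> - t *\<^sub>R y) y * R \<omega>) (at t)"
          by (rule DERIV_cmult_right)
        then have "((\<lambda>s. ?q s \<omega>) \<longlongrightarrow> - g' (X \<omega> - t *\<^sub>R y) y * R \<omega>) (at t)"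
          by (simp add: has_field_derivative_iff)
        then show "(\<lambda>i. ?q (S i) \<omega>) \<longlonglongrightarrow> - g' (X \<omega> - t *\<^sub>R y) y * R \<omega>"
          using S unfolding tendsto_at_iff_sequentially comp_def by blast
      qed
      show "AE \<omega> in M. norm (?q (S i) \<omega>) \<le> K * norm y" for i
      proof (intro AE_I2)
        fix \<omega>
        have "\<bar>g (X \<omega> - S i *\<^sub>R y) - g (X \<omega> - t *\<^sub>R y)\<bar> \<le> K * norm ((t - S i) *\<^sub>R y)"
          using K(2)[of "X \<omega> - S i *\<^sub>R y" "X \<omega> - t *\<^sub>R y"] by (simp add: algebra_simps)
        then have "\<bar>g (X \<omega> - S i *\<^sub>R y) - g (X \<omega> - t *\<^sub>R y)\<bar> * \<bar>R \<omega>\<bar> \<le> K * norm ((t - S i) *\<^sub>R y) * 1"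
          using R K(1) by (intro mult_mono) auto
        moreover have "\<bar>g (X \<omega> - S i *\<^sub>R y) * R \<omega> - g (X \<omega> - t *\<^sub>R y) * R \<omega>\<bar> =
            \<bar>g (X \<omega> - S i *\<^sub>R y) - g (X \<omega> - t *\<^sub>R y)\<bar> * \<bar>R \<omega>\<bar>"
          by (simp only: left_diff_distrib[symmetric] abs_mult)
        moreover have "K * norm ((t - S i) *\<^sub>R y) * 1 = K * norm y * \<bar>S i - t\<bar>" by (simp add: abs_minus_commute)
        ultimately have "\<bar>g (X \<omega> - S i *\<^sub>R y) * R \<omega> - g (X \<omega> - t *\<^sub>R y) * R \<omega>\<bar> \<le> K * norm y * \<bar>S i - t\<bar>"
          by (simp only:)
        then show "norm (?q (S i) \<omega>) \<le> K * norm y"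
          using S(1) by (simp add: abs_divide divide_le_eq)
      qed
    qed measurable
  qed
  have eq: "(\<integral>\<omega>. ?q s \<omega> \<partial>M) = ((\<integral>\<omega>. g (X \<omega> - s *\<^sub>R y) * R \<omega> \<partial>M) - (\<integral>\<omega>. g (X \<omega> - t *\<^sub>R y) * R \<omega> \<partial>M)) / (s - t)" for s
    using int by simp
  show ?thesis using lim unfolding eq has_field_derivative_iff .
qed

section \<open>Weighted integration by parts and the effect of translations on weighted laws\<close>

context weak_convergence
begin

abbreviation weighted :: "(nat \<Rightarrow> 'a \<Rightarrow> real) \<Rightarrow> nat \<Rightarrow> ('d \<Rightarrow> real \<times> 'n) \<Rightarrow> nat \<Rightarrow> 'a \<Rightarrow> real" where
  "weighted \<kappa> r s n \<omega> \<equiv> \<kappa> n \<omega> * det_cutoff r (jacn s n \<omega>)"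

text \<open>Integration by parts in direction \<open>s l\<close>, for the product of
  \<open>g (Fn n)\<close> with a weighted entry of the truncated inverse. It transfers the
  derivative from g to the other factors, so that g remains in the bound through its supremum: c
  times the mean of the noise, plus the L^1 bound for the derivative of the weighted entry. Being
  uniform in g and n, the constant D is obtained before them.\<close>

lemma weighted_entry_bound:
  assumes \<kappa>: "smooth_weight \<kappa> \<kappa>\<^sub>0" and s: "range s \<subseteq> H"
  obtains D where "\<forall>(g :: real^'d \<Rightarrow> real) g' n. C1_bounded g g' \<longrightarrow> (\<forall>x. \<bar>g x\<bar> \<le> 1) \<longrightarrow>
      integrable M (\<lambda>\<omega>. g' (Fn n \<omega>) (DFn n (s l) \<omega>) * (\<kappa> n \<omega> * inverse_cutoff r l i (jacn s n \<omega>))) \<and>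
      \<bar>\<integral>\<omega>. g' (Fn n \<omega>) (DFn n (s l) \<omega>) * (\<kappa> n \<omega> * inverse_cutoff r l i (jacn s n \<omega>)) \<partial>M\<bar> \<le> D"
proof -
  have h: "s l \<in> H" using s by auto
  obtain \<psi>' c where \<psi>: "C1_bounded (inverse_cutoff r l i :: real^'d^'d \<Rightarrow> real) \<psi>'" "0 \<le> c" "\<And>B. \<bar>inverse_cutoff r l i (B::real^'d^'d)\<bar> \<le> c"
    using C1_bounded_inverse_cutoff by blast
  obtain Y C where Y: "\<And>n. bounded_weak_deriv (s l) (\<lambda>\<omega>. \<kappa> n \<omega> * inverse_cutoff r l i (jacn s n \<omega>)) (Y n)" "\<And>n. (\<integral>\<omega>. \<bar>Y n \<omega>\<bar> \<partial>M) \<le> C"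
    using bounded_weak_deriv_jacn_mult[OF \<kappa> s h \<psi>(1,3,2)] by blast
  let ?P = "\<lambda>n \<omega>. \<kappa> n \<omega> * inverse_cutoff r l i (jacn s n \<omega>)"
  have P: "\<bar>?P n \<omega>\<bar> \<le> c" for n \<omega>
  proof -
    have "\<bar>\<kappa> n \<omega>\<bar> \<le> 1" using \<kappa> by (simp add: smooth_weight_def)
    then have "\<bar>\<kappa> n \<omega>\<bar> * \<bar>inverse_cutoff r l i (jacn s n \<omega>)\<bar> \<le> 1 * c" using \<psi> by (intro mult_mono) auto
    then show ?thesis by (simp add: abs_mult)
  qed
  have iY: "integrable M (Y n)" for n
    using weak_derivD[OF bounded_weak_deriv_imp[OF Y(1)]] by auto
  have iN: "integrable M (noise (s l))" by (rule integrable_noise[OF H[OF h]])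
  show thesis
  proof (rule that[of "c * (\<integral>\<omega>. \<bar>noise (s l) \<omega>\<bar> \<partial>M) + C"], intro allI impI conjI)
    fix g :: "real^'d \<Rightarrow> real" and g' n assume g0: "C1_bounded g g'" "\<forall>x. \<bar>g x\<bar> \<le> 1"
    note g = g0(1) g0(2)[rule_format]
    have mg: "(\<lambda>\<omega>. g (Fn n \<omega>)) \<in> borel_measurable M"
      by (rule measurable_compose[OF weak_deriv_measurable[OF deriv1[OF h]]
            borel_measurable_continuous_onI[OF C1_continuous[OF C1_bounded_imp_C1[OF g(1)]]]])
    note b = bounded_weak_deriv_mult[OF bounded_weak_deriv_C1_bounded[OF deriv1[OF h] g] Y(1), of n n]
    have gY: "integrable M (\<lambda>\<omega>. g (Fn n \<omega>) * Y n \<omega>)"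
    proof (rule Bochner_Integration.integrable_bound[OF iY[of n]])
      show "AE \<omega> in M. norm (g (Fn n \<omega>) * Y n \<omega>) \<le> norm (Y n \<omega>)"
        using g(2) by (intro AE_I2) (simp add: abs_mult mult_left_le_one_le)
    qed (use mg iY in auto)
    have i: "integrable M (\<lambda>\<omega>. g (Fn n \<omega>) * Y n \<omega> + g' (Fn n \<omega>) (DFn n (s l) \<omega>) * ?P n \<omega>)"
      using weak_deriv_integrable[OF bounded_weak_deriv_imp[OF b]] .
    \<comment> \<open>The product rule makes the sum of both terms integrable; subtracting the one
      without \<open>g'\<close> leaves the other integrable.\<close>
    from Bochner_Integration.integrable_diff[OF i gY]
    show int: "integrable M (\<lambda>\<omega>. g' (Fn n \<omega>) (DFn n (s l) \<omega>) * ?P n \<omega>)" by simp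
    have "(\<integral>\<omega>. g' (Fn n \<omega>) (DFn n (s l) \<omega>) * ?P n \<omega> \<partial>M) =
        (\<integral>\<omega>. g (Fn n \<omega>) * ?P n \<omega> * noise (s l) \<omega> \<partial>M) - (\<integral>\<omega>. g (Fn n \<omega>) * Y n \<omega> \<partial>M)"
      using integration_by_parts[OF b H[OF h]] gY int by simp
    moreover have "\<bar>\<integral>\<omega>. g (Fn n \<omega>) * ?P n \<omega> * noise (s l) \<omega> \<partial>M\<bar> \<le> c * (\<integral>\<omega>. \<bar>noise (s l) \<omega>\<bar> \<partial>M)"
    proof -
      have le: "\<bar>g (Fn n \<omega>) * ?P n \<omega> * noise (s l) \<omega>\<bar> \<le> c * \<bar>noise (s l) \<omega>\<bar>" for \<omega>
      proof -
        have "\<bar>g (Fn n \<omega>)\<bar> * \<bar>?P n \<omega>\<bar> \<le> 1 * c" by (rule mult_mono) (use g(2) P in auto)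
        then have "\<bar>g (Fn n \<omega>)\<bar> * \<bar>?P n \<omega>\<bar> * \<bar>noise (s l) \<omega>\<bar> \<le> 1 * c * \<bar>noise (s l) \<omega>\<bar>" by (rule mult_right_mono) simp
        then show ?thesis by (simp only: abs_mult mult_1 mult.assoc)
      qed
      have "\<bar>\<integral>\<omega>. g (Fn n \<omega>) * ?P n \<omega> * noise (s l) \<omega> \<partial>M\<bar> \<le> (\<integral>\<omega>. c * \<bar>noise (s l) \<omega>\<bar> \<partial>M)"
        by (rule order_trans[OF integral_abs_bound integral_mono'])
           (use le iN \<psi>(2) in \<open>auto intro!: integrable_mult_right integrable_abs mult_nonneg_nonneg\<close>)
      then show ?thesis by simp
    qed
    moreover have "\<bar>\<integral>\<omega>. g (Fn n \<omega>) * Y n \<omega> \<partial>M\<bar> \<le> C"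
    proof -
      have "\<bar>\<integral>\<omega>. g (Fn n \<omega>) * Y n \<omega> \<partial>M\<bar> \<le> (\<integral>\<omega>. \<bar>Y n \<omega>\<bar> \<partial>M)"
        by (rule order_trans[OF integral_abs_bound integral_mono'])
           (use g(2) iY in \<open>auto simp: abs_mult mult_left_le_one_le\<close>)
      then show ?thesis using Y(2)[of n] by linarith
    qed
    ultimately show "\<bar>\<integral>\<omega>. g' (Fn n \<omega>) (DFn n (s l) \<omega>) * ?P n \<omega> \<partial>M\<bar> \<le> c * (\<integral>\<omega>. \<bar>noise (s l) \<omega>\<bar> \<partial>M) + C"
      by linarith
  qed
qed

text \<open>The derivatives of \<open>g (Fn n)\<close> along the chosen directions are the gradient
  of g times \<open>jacn s n\<close>. Multiplying by the truncated inverse solves for the gradient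
  up to the factor \<open>det_cutoff\<close>, so every weighted partial derivative of g is a sum of
  expressions bounded by \<open>weighted_entry_bound\<close>.\<close>

lemma weighted_derivative_bound:
  assumes \<kappa>: "smooth_weight \<kappa> \<kappa>\<^sub>0" and s: "range s \<subseteq> H"
  obtains C where "C \<ge> 0" "\<forall>(g :: real^'d \<Rightarrow> real) g' n v. C1_bounded g g' \<longrightarrow> (\<forall>x. \<bar>g x\<bar> \<le> 1) \<longrightarrow>
      \<bar>\<integral>\<omega>. g' (Fn n \<omega>) v * weighted \<kappa> r s n \<omega> \<partial>M\<bar> \<le> C * norm v"
proof -
  let ?P = "\<lambda>l i n \<omega>. \<kappa> n \<omega> * inverse_cutoff r l i (jacn s n \<omega>)"
  \<comment> \<open>Naming the bound as a predicate allows D to be chosen as a function of both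
    indices.\<close>
  define Q where "Q l i D \<longleftrightarrow> (\<forall>(g :: real^'d \<Rightarrow> real) g' n. C1_bounded g g' \<longrightarrow> (\<forall>x. \<bar>g x\<bar> \<le> 1) \<longrightarrow>
      integrable M (\<lambda>\<omega>. g' (Fn n \<omega>) (DFn n (s l) \<omega>) * ?P l i n \<omega>) \<and>
      \<bar>\<integral>\<omega>. g' (Fn n \<omega>) (DFn n (s l) \<omega>) * ?P l i n \<omega> \<partial>M\<bar> \<le> D)" for l i D
  have "\<exists>D. Q l i D" for l i
    unfolding Q_def by (rule weighted_entry_bound[OF \<kappa> s, where r=r and l=l and i=i]) (rule exI)
  then obtain D where "\<And>l i. Q l i (D l i)" by metis
  then have D: "integrable M (\<lambda>\<omega>. g' (Fn n \<omega>) (DFn n (s l) \<omega>) * ?P l i n \<omega>) \<and>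
      \<bar>\<integral>\<omega>. g' (Fn n \<omega>) (DFn n (s l) \<omega>) * ?P l i n \<omega> \<partial>M\<bar> \<le> D l i"
    if "C1_bounded g g'" "\<And>x. \<bar>g x\<bar> \<le> 1" for g g' n l i
    using that unfolding Q_def by blast
  show thesis
  proof (rule that[of "\<Sum>i\<in>UNIV. \<Sum>l\<in>UNIV. \<bar>D l i\<bar>"], goal_cases)
    case 1
    show ?case by (auto intro!: sum_nonneg)
  next
    case 2
    show ?case
    proof (intro allI impI)
    fix g :: "real^'d \<Rightarrow> real" and g' n and v :: "real^'d" assume g0: "C1_bounded g g'" "\<forall>x. \<bar>g x\<bar> \<le> 1"
    note g = g0(1) g0(2)[rule_format]
    note lin = C1_linear[OF C1_bounded_imp_C1[OF g(1)]]
    have expand: "g' x w = (\<Sum>j\<in>UNIV. w $ j * g' x (axis j 1))" for x w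
    proof -
      interpret bounded_linear "g' x" by (rule lin)
      have "w = (\<Sum>j\<in>UNIV. w $ j *\<^sub>R axis j 1)"
        by (simp add: vec_eq_iff axis_def if_distrib cong: if_cong)
      then have "g' x w = g' x (\<Sum>j\<in>UNIV. w $ j *\<^sub>R axis j 1)" by simp
      then show ?thesis by (simp add: sum scaleR)
    qed
    \<comment> \<open>Once the sums are exchanged, \<open>inverse_cutoff_expansion\<close> leaves
      the term with \<open>j = i\<close>.\<close>
    have entry: "g' (Fn n \<omega>) (axis i 1) * weighted \<kappa> r s n \<omega> = (\<Sum>l\<in>UNIV. g' (Fn n \<omega>) (DFn n (s l) \<omega>) * ?P l i n \<omega>)" for i \<omega>
    proof -
      have "(\<Sum>l\<in>UNIV. g' (Fn n \<omega>) (DFn n (s l) \<omega>) * ?P l i n \<omega>) =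
          (\<Sum>l\<in>UNIV. \<Sum>j\<in>UNIV. g' (Fn n \<omega>) (axis j 1) * \<kappa> n \<omega> * (jacn s n \<omega> $ j $ l * inverse_cutoff r l i (jacn s n \<omega>)))"
      proof (intro sum.cong refl)
        fix l
        have "g' (Fn n \<omega>) (DFn n (s l) \<omega>) = (\<Sum>j\<in>UNIV. jacn s n \<omega> $ j $ l * g' (Fn n \<omega>) (axis j 1))"
          by (subst expand) (simp add: jacn_def)
        then show "g' (Fn n \<omega>) (DFn n (s l) \<omega>) * ?P l i n \<omega> =
            (\<Sum>j\<in>UNIV. g' (Fn n \<omega>) (axis j 1) * \<kappa> n \<omega> * (jacn s n \<omega> $ j $ l * inverse_cutoff r l i (jacn s n \<omega>)))"
          by (simp only: sum_distrib_right) (simp add: mult_ac)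
      qed
      also have "\<dots> = (\<Sum>j\<in>UNIV. g' (Fn n \<omega>) (axis j 1) * \<kappa> n \<omega> * (\<Sum>l\<in>UNIV. jacn s n \<omega> $ j $ l * inverse_cutoff r l i (jacn s n \<omega>)))"
        by (subst sum.swap) (simp add: sum_distrib_left)
      also have "\<dots> = g' (Fn n \<omega>) (axis i 1) * weighted \<kappa> r s n \<omega>"
        by (simp add: inverse_cutoff_expansion if_distrib mult_ac cong: if_cong)
      finally show ?thesis by simp
    qed
    have "(\<integral>\<omega>. g' (Fn n \<omega>) v * weighted \<kappa> r s n \<omega> \<partial>M) =
        (\<integral>\<omega>. (\<Sum>i\<in>UNIV. v $ i * (\<Sum>l\<in>UNIV. g' (Fn n \<omega>) (DFn n (s l) \<omega>) * ?P l i n \<omega>)) \<partial>M)"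
      unfolding entry[symmetric] by (subst expand) (simp add: sum_distrib_left sum_distrib_right mult_ac)
    also have "\<dots> = (\<Sum>i\<in>UNIV. v $ i * (\<Sum>l\<in>UNIV. \<integral>\<omega>. g' (Fn n \<omega>) (DFn n (s l) \<omega>) * ?P l i n \<omega> \<partial>M))"
      using D[OF g, of n] by (simp add: Bochner_Integration.integral_sum)
    finally have "\<bar>\<integral>\<omega>. g' (Fn n \<omega>) v * weighted \<kappa> r s n \<omega> \<partial>M\<bar> \<le>
        (\<Sum>i\<in>UNIV. \<bar>v $ i * (\<Sum>l\<in>UNIV. \<integral>\<omega>. g' (Fn n \<omega>) (DFn n (s l) \<omega>) * ?P l i n \<omega> \<partial>M)\<bar>)"
      by (simp only: sum_abs)
    also have "\<dots> \<le> (\<Sum>i\<in>UNIV. norm v * (\<Sum>l\<in>UNIV. \<bar>D l i\<bar>))"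
    proof (intro sum_mono)
      fix i
      have "\<bar>\<Sum>l\<in>UNIV. \<integral>\<omega>. g' (Fn n \<omega>) (DFn n (s l) \<omega>) * ?P l i n \<omega> \<partial>M\<bar> \<le>
          (\<Sum>l\<in>UNIV. \<bar>\<integral>\<omega>. g' (Fn n \<omega>) (DFn n (s l) \<omega>) * ?P l i n \<omega> \<partial>M\<bar>)"
        by (rule sum_abs)
      also have "\<dots> \<le> (\<Sum>l\<in>UNIV. \<bar>D l i\<bar>)"
        using D[OF g, of n] by (intro sum_mono) (meson abs_ge_self order_trans)
      finally show "\<bar>v $ i * (\<Sum>l\<in>UNIV. \<integral>\<omega>. g' (Fn n \<omega>) (DFn n (s l) \<omega>) * ?P l i n \<omega> \<partial>M)\<bar> \<le> norm v * (\<Sum>l\<in>UNIV. \<bar>D l i\<bar>)"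
        unfolding abs_mult by (intro mult_mono component_le_norm_cart) auto
    qed
    finally show "\<bar>\<integral>\<omega>. g' (Fn n \<omega>) v * weighted \<kappa> r s n \<omega> \<partial>M\<bar> \<le> (\<Sum>i\<in>UNIV. \<Sum>l\<in>UNIV. \<bar>D l i\<bar>) * norm v"
      by (simp add: sum_distrib_left mult.commute)
    qed
  qed
qed

lemma Fn_measurable: "Fn n \<in> borel_measurable M" and F_measurable: "F \<in> borel_measurable M"
  using conv by (auto simp: conv_in_prob_def)

lemma weighted_props:
  assumes \<kappa>: "smooth_weight \<kappa> \<kappa>\<^sub>0" and s: "range s \<subseteq> H"
  shows "weighted \<kappa> r s n \<in> borel_measurable M" "(\<lambda>\<omega>. \<kappa>\<^sub>0 \<omega> * det_cutoff r (jac s \<omega>)) \<in> borel_measurable M"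
    "\<bar>weighted \<kappa> r s n \<omega>\<bar> \<le> 1" "\<bar>\<kappa>\<^sub>0 \<omega> * det_cutoff r (jac s \<omega>)\<bar> \<le> 1"
    "(\<lambda>n. \<integral>\<omega>. \<bar>weighted \<kappa> r s n \<omega> - \<kappa>\<^sub>0 \<omega> * det_cutoff r (jac s \<omega>)\<bar> \<partial>M) \<longlonglongrightarrow> 0"
proof -
  note c = conv_det_cutoff[OF s, of r]
  have k: "\<kappa> n \<in> borel_measurable M" "\<kappa>\<^sub>0 \<in> borel_measurable M" "\<bar>\<kappa> n \<omega>\<bar> \<le> 1" "\<bar>\<kappa>\<^sub>0 \<omega>\<bar> \<le> 1"
    "(\<lambda>n. \<integral>\<omega>. \<bar>\<kappa> n \<omega> - \<kappa>\<^sub>0 \<omega>\<bar> \<partial>M) \<longlonglongrightarrow> 0" for n \<omega>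
    using \<kappa> by (auto simp: smooth_weight_def)
  show "weighted \<kappa> r s n \<in> borel_measurable M" "(\<lambda>\<omega>. \<kappa>\<^sub>0 \<omega> * det_cutoff r (jac s \<omega>)) \<in> borel_measurable M"
    using k c by (auto intro!: borel_measurable_times)
  show "\<bar>weighted \<kappa> r s n \<omega>\<bar> \<le> 1" "\<bar>\<kappa>\<^sub>0 \<omega> * det_cutoff r (jac s \<omega>)\<bar> \<le> 1"
    unfolding abs_mult using k abs_det_cutoff(1) by (auto intro!: mult_le_one)
  show "(\<lambda>n. \<integral>\<omega>. \<bar>weighted \<kappa> r s n \<omega> - \<kappa>\<^sub>0 \<omega> * det_cutoff r (jac s \<omega>)\<bar> \<partial>M) \<longlonglongrightarrow> 0"
    by (rule weights_L1_mult) (use k c abs_det_cutoff in auto)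
qed

text \<open>By the mean value theorem the difference is a derivative of g at a point translated by
  \<open>z *\<^sub>R y\<close>. Equivalently it is the derivative of a translate of g, which is a
  test function with the same bound, so \<open>weighted_derivative_bound\<close> applies. The
  weighted law of \<open>Fn n\<close> thus moves in total variation by a multiple of the length of
  the translation.\<close>

lemma weighted_shift_bound:
  assumes \<kappa>: "smooth_weight \<kappa> \<kappa>\<^sub>0" and s: "range s \<subseteq> H"
  obtains C where "C \<ge> 0" "\<forall>(g :: real^'d \<Rightarrow> real) g' n y. C1_bounded g g' \<longrightarrow> (\<forall>x. \<bar>g x\<bar> \<le> 1) \<longrightarrow>
      \<bar>\<integral>\<omega>. (g (Fn n \<omega>) - g (Fn n \<omega> - y)) * weighted \<kappa> r s n \<omega> \<partial>M\<bar> \<le> C * norm y"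
proof -
  obtain C where C0: "C \<ge> 0" "\<forall>(g :: real^'d \<Rightarrow> real) g' n v. C1_bounded g g' \<longrightarrow> (\<forall>x. \<bar>g x\<bar> \<le> 1) \<longrightarrow>
      \<bar>\<integral>\<omega>. g' (Fn n \<omega>) v * weighted \<kappa> r s n \<omega> \<partial>M\<bar> \<le> C * norm v"
    using weighted_derivative_bound[OF \<kappa> s, where r=r] by blast
  note C = C0(1) C0(2)[rule_format]
  note R = weighted_props[OF \<kappa> s, where r=r]
  show thesis
  proof (rule that[OF C(1)], intro allI impI)
    fix g :: "real^'d \<Rightarrow> real" and g' n and y :: "real^'d" assume g0: "C1_bounded g g'" "\<forall>x. \<bar>g x\<bar> \<le> 1"
    note g = g0(1) g0(2)[rule_format]
    note [measurable] = R(1) Fn_measurable[of n]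
    have [measurable]: "g \<in> borel_measurable borel"
      using C1_continuous[OF C1_bounded_imp_C1[OF g(1)]] by (rule borel_measurable_continuous_onI)
    let ?\<phi> = "\<lambda>t. \<integral>\<omega>. g (Fn n \<omega> - t *\<^sub>R y) * weighted \<kappa> r s n \<omega> \<partial>M"
    have shifted: "C1_bounded (\<lambda>x. g (x - z)) (\<lambda>x. g' (x - z))" for z
      unfolding C1_bounded_def C1_def
    proof (intro conjI allI)
      fix x
      show "((\<lambda>x. g (x - z)) has_derivative g' (x - z)) (at x)"
      proof -
        have "((\<lambda>x. x - z) has_derivative (\<lambda>v. v)) (at x)" by (auto intro!: derivative_eq_intros)
        from has_derivative_compose[OF this C1D[OF C1_bounded_imp_C1[OF g(1)]]] show ?thesis by simp
      qed
    next
      fix v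
      show "continuous_on UNIV (\<lambda>x. g' (x - z) v)"
        by (rule continuous_on_compose2[OF C1_deriv_continuous[OF C1_bounded_imp_C1[OF g(1)]]]) (auto intro!: continuous_intros)
    next
      show "\<exists>K. \<forall>x v. norm (g' (x - z) v) \<le> K * norm v" using g(1) unfolding C1_bounded_def by blast
    qed
    have "\<exists>z. 0 < z \<and> z < 1 \<and> ?\<phi> 1 - ?\<phi> 0 = (1 - 0) * (\<integral>\<omega>. - g' (Fn n \<omega> - z *\<^sub>R y) y * weighted \<kappa> r s n \<omega> \<partial>M)"
      by (rule MVT2) (use has_real_derivative_integral_shift[OF Fn_measurable R(1) R(3) g] in auto)
    then obtain z where "?\<phi> 1 - ?\<phi> 0 = - (\<integral>\<omega>. g' (Fn n \<omega> - z *\<^sub>R y) y * weighted \<kappa> r s n \<omega> \<partial>M)" by auto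
    then have "\<bar>?\<phi> 0 - ?\<phi> 1\<bar> \<le> C * norm y"
      using C(2)[OF shifted[of "z *\<^sub>R y"] g(2), where n=n and v=y] by simp
    moreover have "(\<integral>\<omega>. (g (Fn n \<omega>) - g (Fn n \<omega> - y)) * weighted \<kappa> r s n \<omega> \<partial>M) = ?\<phi> 0 - ?\<phi> 1"
    proof -
      have "integrable M (\<lambda>\<omega>. g (Fn n \<omega> - t *\<^sub>R y) * weighted \<kappa> r s n \<omega>)" for t
      proof (rule integrable_bounded_real[of _ 1])
        show "\<bar>g (Fn n \<omega> - t *\<^sub>R y) * weighted \<kappa> r s n \<omega>\<bar> \<le> 1" for \<omega>
          unfolding abs_mult[of "g _"] by (rule mult_le_one) (use g R(3) in auto)
      qed measurable
      from Bochner_Integration.integral_diff[OF this[of 0] this[of 1]]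
      show ?thesis by (simp add: left_diff_distrib)
    qed
    ultimately show "\<bar>\<integral>\<omega>. (g (Fn n \<omega>) - g (Fn n \<omega> - y)) * weighted \<kappa> r s n \<omega> \<partial>M\<bar> \<le> C * norm y" by simp
  qed
qed

text \<open>Separates the error of the weight, multiplied by a bounded q, from the error of the
  functional, which a bounded Lipschitz q translates into the distance of convergence in
  probability.\<close>

lemma lipschitz_weighted_diff:
  assumes \<kappa>: "smooth_weight \<kappa> \<kappa>\<^sub>0" and s: "range s \<subseteq> H"
    and q: "q \<in> borel_measurable borel" "\<And>x. \<bar>q x\<bar> \<le> 1" "\<And>x y. \<bar>q x - q y\<bar> \<le> L * norm (x - y)" "0 \<le> L"
  shows "\<bar>(\<integral>\<omega>. q (Fn n \<omega>) * weighted \<kappa> r s n \<omega> \<partial>M) - (\<integral>\<omega>. q (F \<omega>) * (\<kappa>\<^sub>0 \<omega> * det_cutoff r (jac s \<omega>)) \<partial>M)\<bar> \<le>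
    (\<integral>\<omega>. \<bar>weighted \<kappa> r s n \<omega> - \<kappa>\<^sub>0 \<omega> * det_cutoff r (jac s \<omega>)\<bar> \<partial>M) + (L + 2) * (\<integral>\<omega>. min 1 (norm (Fn n \<omega> - F \<omega>)) \<partial>M)"
proof -
  note R = weighted_props[OF \<kappa> s, where r=r]
  let ?R = "weighted \<kappa> r s n" and ?S = "\<lambda>\<omega>. \<kappa>\<^sub>0 \<omega> * det_cutoff r (jac s \<omega>)"
  note [measurable] = R(1,2) Fn_measurable F_measurable q(1)
  have b: "\<bar>q x * t\<bar> \<le> 1" if "\<bar>t\<bar> \<le> 1" for x t
    unfolding abs_mult using q(2) that by (intro mult_le_one) auto
  have i1: "integrable M (\<lambda>\<omega>. q (Fn n \<omega>) * ?R \<omega>)" and i2: "integrable M (\<lambda>\<omega>. q (F \<omega>) * ?S \<omega>)"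
    by (rule integrable_bounded_real[of _ 1]; use b R in auto)+
  have iR: "integrable M (\<lambda>\<omega>. \<bar>?R \<omega> - ?S \<omega>\<bar>)"
    by (intro integrable_abs Bochner_Integration.integrable_diff; rule integrable_bounded_real[of _ 1]; use R in auto)
  have im: "integrable M (\<lambda>\<omega>. (L + 2) * min 1 (norm (Fn n \<omega> - F \<omega>)))"
    by (intro integrable_mult_right integrable_min_norm Fn_measurable F_measurable)
  have "\<bar>(\<integral>\<omega>. q (Fn n \<omega>) * ?R \<omega> \<partial>M) - (\<integral>\<omega>. q (F \<omega>) * ?S \<omega> \<partial>M)\<bar> = \<bar>\<integral>\<omega>. q (Fn n \<omega>) * ?R \<omega> - q (F \<omega>) * ?S \<omega> \<partial>M\<bar>"
    using i1 i2 by simp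
  also have "\<dots> \<le> (\<integral>\<omega>. \<bar>q (Fn n \<omega>) * ?R \<omega> - q (F \<omega>) * ?S \<omega>\<bar> \<partial>M)" by (rule integral_abs_bound)
  also have "\<dots> \<le> (\<integral>\<omega>. \<bar>?R \<omega> - ?S \<omega>\<bar> + (L + 2) * min 1 (norm (Fn n \<omega> - F \<omega>)) \<partial>M)"
  proof (rule integral_mono[OF integrable_abs[OF Bochner_Integration.integrable_diff[OF i1 i2]] Bochner_Integration.integrable_add[OF iR im]])
    fix \<omega>
    have eq: "q (Fn n \<omega>) * ?R \<omega> - q (F \<omega>) * ?S \<omega> = q (Fn n \<omega>) * (?R \<omega> - ?S \<omega>) + (q (Fn n \<omega>) - q (F \<omega>)) * ?S \<omega>"
      by (simp add: algebra_simps)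
    have "\<bar>q (Fn n \<omega>)\<bar> * \<bar>?R \<omega> - ?S \<omega>\<bar> \<le> 1 * \<bar>?R \<omega> - ?S \<omega>\<bar>" using q(2) by (intro mult_right_mono) auto
    then have x: "\<bar>q (Fn n \<omega>) * (?R \<omega> - ?S \<omega>)\<bar> \<le> \<bar>?R \<omega> - ?S \<omega>\<bar>" unfolding abs_mult[of "q _"] by simp
    have "\<bar>q (Fn n \<omega>) - q (F \<omega>)\<bar> * \<bar>?S \<omega>\<bar> \<le> \<bar>q (Fn n \<omega>) - q (F \<omega>)\<bar> * 1"
      using R(4) by (intro mult_left_mono) auto
    also have "\<dots> \<le> (L + 2 * 1) * min 1 (norm (Fn n \<omega> - F \<omega>))"
      unfolding mult_1_right by (rule lipschitz_bounded_le_min[where c=1, unfolded mult_1_right]) (use q in auto)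
    finally have y: "\<bar>(q (Fn n \<omega>) - q (F \<omega>)) * ?S \<omega>\<bar> \<le> (L + 2) * min 1 (norm (Fn n \<omega> - F \<omega>))"
      unfolding abs_mult[of "q _ - q _"] by simp
    show "\<bar>q (Fn n \<omega>) * ?R \<omega> - q (F \<omega>) * ?S \<omega>\<bar> \<le> \<bar>?R \<omega> - ?S \<omega>\<bar> + (L + 2) * min 1 (norm (Fn n \<omega> - F \<omega>))"
      unfolding eq by (rule order_trans[OF abs_triangle_ineq add_mono[OF x y]])
  qed
  also have "\<dots> = (\<integral>\<omega>. \<bar>?R \<omega> - ?S \<omega>\<bar> \<partial>M) + (L + 2) * (\<integral>\<omega>. min 1 (norm (Fn n \<omega> - F \<omega>)) \<partial>M)"
    using iR im by simp
  finally show ?thesis .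
qed

text \<open>The shift estimate makes the weighted laws of the \<open>Fn n\<close> uniformly close to their smoothings,
  and the smoothed test functions are Lipschitz with a constant that does not depend on the test
  function.\<close>

lemma weighted_convergence:
  assumes \<kappa>: "smooth_weight \<kappa> \<kappa>\<^sub>0" and s: "range s \<subseteq> H" and e: "e > 0"
  shows "\<forall>\<^sub>F n in sequentially. \<forall>(g :: real^'d \<Rightarrow> real) g'. C1_bounded g g' \<longrightarrow> (\<forall>x. \<bar>g x\<bar> \<le> 1) \<longrightarrow>
    \<bar>(\<integral>\<omega>. g (Fn n \<omega>) * weighted \<kappa> r s n \<omega> \<partial>M) - (\<integral>\<omega>. g (F \<omega>) * (\<kappa>\<^sub>0 \<omega> * det_cutoff r (jac s \<omega>)) \<partial>M)\<bar> \<le> e"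
proof -
  obtain C where C0: "C \<ge> 0" "\<forall>(g :: real^'d \<Rightarrow> real) g' n y. C1_bounded g g' \<longrightarrow> (\<forall>x. \<bar>g x\<bar> \<le> 1) \<longrightarrow>
      \<bar>\<integral>\<omega>. (g (Fn n \<omega>) - g (Fn n \<omega> - y)) * weighted \<kappa> r s n \<omega> \<partial>M\<bar> \<le> C * norm y"
    using weighted_shift_bound[OF \<kappa> s, where r=r] by blast
  note C = C0(1) C0(2)[rule_format]
  \<comment> \<open>The smoothing error \<open>C * \<delta>\<close> is spent twice, for
    \<open>Fn n\<close> and for F, at \<open>e / 4\<close> each; \<open>e / 2\<close> remains for
    the smoothed test functions.\<close>
  define \<delta> where "\<delta> = e / (4 * (C + 1))"
  have \<delta>: "\<delta> > 0" using e C by (simp add: \<delta>_def)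
  have C\<delta>: "C * \<delta> \<le> e / 4"
  proof -
    have "C * \<delta> \<le> (C + 1) * \<delta>" using \<delta> by simp
    also have "\<dots> = e / 4"
    proof -
      have "k * (e / (4 * k)) = e / 4" if "k \<noteq> 0" for k :: real using that by simp
      from this[of "C + 1"] show ?thesis using C(1) unfolding \<delta>_def by linarith
    qed
    finally show ?thesis .
  qed
  obtain L where L0: "L \<ge> 0"
    "\<forall>(g :: real^'d \<Rightarrow> real) x y. g \<in> borel_measurable borel \<longrightarrow> (\<forall>x. \<bar>g x\<bar> \<le> 1) \<longrightarrow>
      \<bar>smoothing \<delta> g x - smoothing \<delta> g y\<bar> \<le> L * norm (x - y)"
    using smoothing_lipschitz[OF \<delta>, where 'e="real^'d"] by blast
  note L = L0(1) L0(2)[rule_format]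
  note R = weighted_props[OF \<kappa> s, where r=r]
  let ?R = "weighted \<kappa> r s" and ?S = "\<lambda>\<omega>. \<kappa>\<^sub>0 \<omega> * det_cutoff r (jac s \<omega>)"
  \<comment> \<open>The parameter serves twice: with the Lipschitz constant L common to all
    smoothings, and below with the constant K of a single g.\<close>
  define \<eta> where "\<eta> L n = (\<integral>\<omega>. \<bar>?R n \<omega> - ?S \<omega>\<bar> \<partial>M) + (L + 2) * (\<integral>\<omega>. min 1 (norm (Fn n \<omega> - F \<omega>)) \<partial>M)" for L n
  have \<eta>: "\<eta> L \<longlonglongrightarrow> 0" for L
    unfolding \<eta>_def using R(5) conv by (intro tendsto_add_zero tendsto_mult_right_zero) (simp_all add: conv_in_prob_def)
  then have "\<forall>\<^sub>F n in sequentially. \<eta> L n < e / 2" using e by (intro order_tendstoD) auto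
  then show ?thesis
  proof eventually_elim
    case (elim n)
    show ?case
    proof (intro allI impI)
      fix g :: "real^'d \<Rightarrow> real" and g' assume g: "C1_bounded g g'" "\<forall>x. \<bar>g x\<bar> \<le> 1"
      have mg[measurable]: "g \<in> borel_measurable borel"
        using C1_continuous[OF C1_bounded_imp_C1[OF g(1)]] by (rule borel_measurable_continuous_onI)
      have g1: "\<bar>g x\<bar> \<le> 1" for x using g by blast
      note sl = L(2)[OF mg g1] and sb = abs_smoothing_le[OF mg g1 \<delta>]
      have ms[measurable]: "smoothing \<delta> g \<in> borel_measurable borel"
      proof (rule borel_measurable_continuous_onI)
        have "L-lipschitz_on UNIV (smoothing \<delta> g)"
          using sl L(1) by (intro lipschitz_onI) (auto simp: dist_norm)
        then show "continuous_on UNIV (smoothing \<delta> g)" by (rule lipschitz_on_continuous_on)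
      qed
      note [measurable] = R(1,2) Fn_measurable F_measurable
      have int: "integrable M (\<lambda>\<omega>. q (X \<omega>) * S \<omega>)"
        if "q \<in> borel_measurable borel" "X \<in> borel_measurable M" "S \<in> borel_measurable M" "\<And>x. \<bar>q x\<bar> \<le> 1" "\<And>\<omega>. \<bar>S \<omega>\<bar> \<le> 1"
        for q :: "real^'d \<Rightarrow> real" and X S
      proof (rule integrable_bounded_real[of _ 1])
        show "\<bar>q (X \<omega>) * S \<omega>\<bar> \<le> 1" for \<omega> unfolding abs_mult by (rule mult_le_one) (use that in auto)
        show "(\<lambda>\<omega>. q (X \<omega>) * S \<omega>) \<in> borel_measurable M"
          using that(1-3) by measurable
      qed
      have ig: "integrable M (\<lambda>\<omega>. g (Fn m \<omega>) * ?R m \<omega>)" "integrable M (\<lambda>\<omega>. smoothing \<delta> g (Fn m \<omega>) * ?R m \<omega>)" for m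
        by (rule int; use g1 sb R in auto)+
      have ig0: "integrable M (\<lambda>\<omega>. g (F \<omega>) * ?S \<omega>)" "integrable M (\<lambda>\<omega>. smoothing \<delta> g (F \<omega>) * ?S \<omega>)"
        by (rule int; use g1 sb R in auto)+
      have e1: "\<bar>(\<integral>\<omega>. g (Fn m \<omega>) * ?R m \<omega> \<partial>M) - (\<integral>\<omega>. smoothing \<delta> g (Fn m \<omega>) * ?R m \<omega> \<partial>M)\<bar> \<le> e / 4" for m
      proof -
        have "\<bar>\<integral>\<omega>. (g (Fn m \<omega>) - smoothing \<delta> g (Fn m \<omega>)) * ?R m \<omega> \<partial>M\<bar> \<le> C * \<delta>"
          by (rule smoothing_error[OF Fn_measurable R(1) mg g1 R(3) \<delta> C(2)[OF g(1) g1]])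
        then show ?thesis using ig[of m] C\<delta> by (simp add: left_diff_distrib)
      qed
      have lim: "(\<lambda>m. \<integral>\<omega>. q (Fn m \<omega>) * ?R m \<omega> \<partial>M) \<longlonglongrightarrow> (\<integral>\<omega>. q (F \<omega>) * ?S \<omega> \<partial>M)"
        if q: "q \<in> borel_measurable borel" "\<And>x. \<bar>q x\<bar> \<le> 1" "\<And>x y. \<bar>q x - q y\<bar> \<le> K * norm (x - y)" "0 \<le> K" for q K
        by (rule LIM_zero_cancel, rule Lim_null_comparison[OF _ \<eta>[of K]])
           (use lipschitz_weighted_diff[OF \<kappa> s q, where r=r] in \<open>auto simp: \<eta>_def\<close>)
      obtain K where K: "K > 0" "\<And>x y. norm (g x - g y) \<le> K * norm (x - y)" using C1_bounded_lipschitz[OF g(1)] by metis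
      \<comment> \<open>No shift estimate is available for F directly. For this one g, however large
        its Lipschitz constant, the estimate \<open>e1\<close> is carried over to F by letting m
        tend to infinity.\<close>
      have "(\<lambda>m. \<bar>(\<integral>\<omega>. g (Fn m \<omega>) * ?R m \<omega> \<partial>M) - (\<integral>\<omega>. smoothing \<delta> g (Fn m \<omega>) * ?R m \<omega> \<partial>M)\<bar>) \<longlonglongrightarrow>
          \<bar>(\<integral>\<omega>. g (F \<omega>) * ?S \<omega> \<partial>M) - (\<integral>\<omega>. smoothing \<delta> g (F \<omega>) * ?S \<omega> \<partial>M)\<bar>"
        using K by (intro tendsto_intros lim[OF mg g1, of K] lim[OF ms sb sl L(1)]) auto
      then have e2: "\<bar>(\<integral>\<omega>. g (F \<omega>) * ?S \<omega> \<partial>M) - (\<integral>\<omega>. smoothing \<delta> g (F \<omega>) * ?S \<omega> \<partial>M)\<bar> \<le> e / 4"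
        by (rule LIMSEQ_le_const2) (use e1 in auto)
      have e3: "\<bar>(\<integral>\<omega>. smoothing \<delta> g (Fn n \<omega>) * ?R n \<omega> \<partial>M) - (\<integral>\<omega>. smoothing \<delta> g (F \<omega>) * ?S \<omega> \<partial>M)\<bar> \<le> e / 2"
        using lipschitz_weighted_diff[OF \<kappa> s ms sb sl L(1), where r=r and n=n] elim by (simp add: \<eta>_def)
      show "\<bar>(\<integral>\<omega>. g (Fn n \<omega>) * ?R n \<omega> \<partial>M) - (\<integral>\<omega>. g (F \<omega>) * ?S \<omega> \<partial>M)\<bar> \<le> e"
        using e1[of n] e2 e3 by linarith
    qed
  qed
qed

text \<open>With the localising functions \<open>\<theta> p\<close> enumerated and
  \<open>\<kappa> p\<close> the product of the complements of the earlier ones, the products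
  \<open>\<kappa> p * \<theta> p\<close> for p below m and the remainder \<open>\<kappa> m\<close>
  add up to 1. \<open>weighted_convergence\<close> treats the former; the remainder is small in mean
  because almost every \<open>\<omega>\<close> is nondegenerate for some choice of
  directions.\<close>

lemma uniform_convergence:
  assumes nondeg: "AE \<omega> in M. \<exists>s. range s \<subseteq> H \<and> det (jac s \<omega>) \<noteq> 0" and e: "e > 0"
  shows "\<forall>\<^sub>F n in sequentially. \<forall>(g :: real^'d \<Rightarrow> real) g'. C1_bounded g g' \<longrightarrow> (\<forall>x. \<bar>g x\<bar> \<le> 1) \<longrightarrow>
    \<bar>(\<integral>\<omega>. g (Fn n \<omega>) \<partial>M) - (\<integral>\<omega>. g (F \<omega>) \<partial>M)\<bar> \<le> e"
proof -
  \<comment> \<open>A localising function is given by a choice of directions and a truncation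
    level.\<close>
  define S where "S = {s :: 'd \<Rightarrow> real \<times> 'n. range s \<subseteq> H} \<times> (UNIV :: nat set)"
  have "{s :: 'd \<Rightarrow> real \<times> 'n. range s \<subseteq> H} = PiE UNIV (\<lambda>_. H)" by (auto simp: PiE_def)
  then have "countable S" unfolding S_def using H_countable by (auto intro!: countable_PiE countable_SIGMA)
  have "S \<noteq> {}"
  proof
    assume "S = {}"
    then have "AE \<omega> in M. False" using nondeg by (auto simp: S_def)
    then show False using not_empty emeasure_space_1 by (simp add: AE_iff_null_sets null_sets_def)
  qed
  define t where "t p = from_nat_into S p" for p
  have range_t: "range t = S" unfolding t_def using range_from_nat_into[OF \<open>S \<noteq> {}\<close> \<open>countable S\<close>] by auto
  define \<theta> where "\<theta> p n \<omega> = det_cutoff (snd (t p)) (jacn (fst (t p)) n \<omega>)" for p n \<omega>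
  define \<theta>0 where "\<theta>0 p \<omega> = det_cutoff (snd (t p)) (jac (fst (t p)) \<omega>)" for p \<omega>
  define \<kappa> where "\<kappa> m n \<omega> = (\<Prod>p<m. 1 - \<theta> p n \<omega>)" for m n \<omega>
  define \<kappa>0 where "\<kappa>0 m \<omega> = (\<Prod>p<m. 1 - \<theta>0 p \<omega>)" for m \<omega>
  have sp: "range (fst (t p)) \<subseteq> H" for p
  proof -
    have "t p \<in> S" using range_t by auto
    then show ?thesis by (auto simp: S_def)
  qed
  have w: "smooth_weight (\<kappa> m) (\<kappa>0 m)" for m
  proof (induction m)
    case 0
    then show ?case using smooth_weight_1 by (simp add: \<kappa>_def[abs_def] \<kappa>0_def[abs_def])
  next
    case (Suc m)
    from smooth_weight_mult[OF this sp[of m], where r="snd (t m)"] show ?case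
      by (simp add: \<kappa>_def[abs_def] \<kappa>0_def[abs_def] \<theta>_def \<theta>0_def)
  qed
  have \<kappa>: "\<kappa> m n \<in> borel_measurable M" "0 \<le> \<kappa> m n \<omega>" "\<kappa> m n \<omega> \<le> 1" "\<kappa>0 m \<in> borel_measurable M" "0 \<le> \<kappa>0 m \<omega>" "\<kappa>0 m \<omega> \<le> 1"
    "(\<lambda>n. \<integral>\<omega>. \<bar>\<kappa> m n \<omega> - \<kappa>0 m \<omega>\<bar> \<partial>M) \<longlonglongrightarrow> 0" for m n \<omega>
    using w[of m] by (auto simp: smooth_weight_def)
  have i\<kappa>: "integrable M (\<kappa> m n)" "integrable M (\<kappa>0 m)" for m n
    by (rule integrable_bounded_real[of _ 1]; use \<kappa> in auto)+
  \<comment> \<open>The number m of weights is fixed with the remainder of F; the remainder of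
    \<open>Fn n\<close> is compared with it afterwards, for large n.\<close>
  have "(\<lambda>m. \<integral>\<omega>. \<kappa>0 m \<omega> \<partial>M) \<longlonglongrightarrow> (\<integral>\<omega>. 0 \<partial>M)"
  proof (rule integral_dominated_convergence[where w="\<lambda>_. 1"])
    show "AE \<omega> in M. (\<lambda>m. \<kappa>0 m \<omega>) \<longlonglongrightarrow> 0"
      using nondeg
    proof eventually_elim
      case (elim \<omega>)
      then obtain s where s: "range s \<subseteq> H" "det (jac s \<omega>) \<noteq> 0" by blast
      show ?case
      proof (rule LIMSEQ_I)
        fix d :: real assume d: "d > 0"
        have "\<forall>\<^sub>F r in sequentially. 1 - d < det_cutoff r (jac s \<omega>)"
          using det_cutoff_tendsto_1[OF s(2)] d by (intro order_tendstoD) auto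
        then obtain r where r: "1 - d < det_cutoff r (jac s \<omega>)" by (auto simp: eventually_sequentially)
        have "(s, r) \<in> range t" using s range_t by (auto simp: S_def)
        then obtain p where p: "t p = (s, r)" by auto
        show "\<exists>no. \<forall>n\<ge>no. norm (\<kappa>0 n \<omega> - 0) < d"
        proof (intro exI[of _ "Suc p"] allI impI)
          fix m assume m: "Suc p \<le> m"
          \<comment> \<open>One factor close to 0 is enough, since all the others lie in
            \<open>[0, 1]\<close>.\<close>
          have "\<kappa>0 m \<omega> = (1 - \<theta>0 p \<omega>) * (\<Prod>j\<in>{..<m} - {p}. 1 - \<theta>0 j \<omega>)"
            unfolding \<kappa>0_def using m by (subst prod.remove[of _ p]) auto
          also have "\<dots> \<le> (1 - \<theta>0 p \<omega>) * 1"
            using det_cutoff_range by (intro mult_left_mono prod_le_1) (auto simp: \<theta>0_def)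
          finally show "norm (\<kappa>0 m \<omega> - 0) < d" using \<kappa>(5)[of m \<omega>] r p by (simp add: \<theta>0_def)
        qed
      qed
    qed
  qed (use \<kappa> in auto)
  then have "\<forall>\<^sub>F m in sequentially. (\<integral>\<omega>. \<kappa>0 m \<omega> \<partial>M) < e / 8" using e by (intro order_tendstoD) auto
  then obtain m where m: "(\<integral>\<omega>. \<kappa>0 m \<omega> \<partial>M) < e / 8" by (auto simp: eventually_sequentially)
  \<comment> \<open>The m localised terms share \<open>e / 2\<close>; the remainders take
    \<open>e / 4\<close> for \<open>Fn n\<close> and \<open>e / 8\<close> for F.\<close>
  define d where "d = e / (2 * (real m + 1))"
  have d: "d > 0" using e by (simp add: d_def)
  have md: "real m * d \<le> e / 2"
  proof -
    have "real m * d \<le> (real m + 1) * d" using d by simp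
    also have "\<dots> = e / 2"
    proof -
      have "k * (e / (2 * k)) = e / 2" if "k \<noteq> 0" for k :: real using that by simp
      then show ?thesis unfolding d_def by (simp only: of_nat_Suc[symmetric] add.commute[of _ 1])
    qed
    finally show ?thesis .
  qed
  have "\<forall>\<^sub>F n in sequentially. \<forall>p\<in>{..<m}. \<forall>(g :: real^'d \<Rightarrow> real) g'. C1_bounded g g' \<longrightarrow> (\<forall>x. \<bar>g x\<bar> \<le> 1) \<longrightarrow>
    \<bar>(\<integral>\<omega>. g (Fn n \<omega>) * (\<kappa> p n \<omega> * \<theta> p n \<omega>) \<partial>M) - (\<integral>\<omega>. g (F \<omega>) * (\<kappa>0 p \<omega> * \<theta>0 p \<omega>) \<partial>M)\<bar> \<le> d"
    unfolding \<theta>_def \<theta>0_def using weighted_convergence[OF w sp d] by (intro eventually_ball_finite ballI) auto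
  moreover have "\<forall>\<^sub>F n in sequentially. (\<integral>\<omega>. \<bar>\<kappa> m n \<omega> - \<kappa>0 m \<omega>\<bar> \<partial>M) < e / 8"
    using \<kappa>(7) e by (intro order_tendstoD) auto
  ultimately show ?thesis
  proof eventually_elim
    case (elim n)
    show ?case
    proof (intro allI impI)
      fix g :: "real^'d \<Rightarrow> real" and g' assume g: "C1_bounded g g'" "\<forall>x. \<bar>g x\<bar> \<le> 1"
      have mg[measurable]: "g \<in> borel_measurable borel"
        using C1_continuous[OF C1_bounded_imp_C1[OF g(1)]] by (rule borel_measurable_continuous_onI)
      have split: "(\<integral>\<omega>. g (X \<omega>) \<partial>M) = (\<Sum>p<m. \<integral>\<omega>. g (X \<omega>) * ((\<Prod>j<p. 1 - u j \<omega>) * u p \<omega>) \<partial>M) + (\<integral>\<omega>. g (X \<omega>) * (\<Prod>j<m. 1 - u j \<omega>) \<partial>M)"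
        if [measurable]: "X \<in> borel_measurable M" "\<And>p. u p \<in> borel_measurable M" and u: "\<And>p \<omega>. 0 \<le> u p \<omega>" "\<And>p \<omega>. u p \<omega> \<le> 1"
        for X and u :: "nat \<Rightarrow> 'a \<Rightarrow> real"
      proof -
        \<comment> \<open>The telescoping identity behind this partition of unity.\<close>
        have one: "(\<Sum>p<k. (\<Prod>j<p. 1 - u j \<omega>) * u p \<omega>) + (\<Prod>j<k. 1 - u j \<omega>) = 1" for k \<omega>
          by (induction k) (auto simp: algebra_simps)
        have pr: "\<bar>\<Prod>j<p. 1 - u j \<omega>\<bar> \<le> 1" for p \<omega>
          using u by (auto simp: abs_prod intro!: prod_le_1)
        have i1: "integrable M (\<lambda>\<omega>. g (X \<omega>) * ((\<Prod>j<p. 1 - u j \<omega>) * u p \<omega>))" for p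
        proof (rule integrable_bounded_real[of _ 1])
          show "\<bar>g (X \<omega>) * ((\<Prod>j<p. 1 - u j \<omega>) * u p \<omega>)\<bar> \<le> 1" for \<omega>
            unfolding abs_mult using g(2) pr u by (intro mult_le_one mult_nonneg_nonneg) auto
        qed measurable
        have i2: "integrable M (\<lambda>\<omega>. g (X \<omega>) * (\<Prod>j<m. 1 - u j \<omega>))"
        proof (rule integrable_bounded_real[of _ 1])
          show "\<bar>g (X \<omega>) * (\<Prod>j<m. 1 - u j \<omega>)\<bar> \<le> 1" for \<omega>
            unfolding abs_mult[of "g _"] using g(2) pr by (intro mult_le_one) auto
        qed measurable
        have "(\<integral>\<omega>. g (X \<omega>) \<partial>M) = (\<integral>\<omega>. (\<Sum>p<m. g (X \<omega>) * ((\<Prod>j<p. 1 - u j \<omega>) * u p \<omega>)) + g (X \<omega>) * (\<Prod>j<m. 1 - u j \<omega>) \<partial>M)"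
          unfolding sum_distrib_left[symmetric] distrib_left[symmetric] one by simp
        also have "\<dots> = (\<Sum>p<m. \<integral>\<omega>. g (X \<omega>) * ((\<Prod>j<p. 1 - u j \<omega>) * u p \<omega>) \<partial>M) + (\<integral>\<omega>. g (X \<omega>) * (\<Prod>j<m. 1 - u j \<omega>) \<partial>M)"
          using i1 i2 by (simp add: Bochner_Integration.integral_sum)
        finally show ?thesis .
      qed
      have m\<theta>: "\<theta> p k \<in> borel_measurable M" "\<theta>0 p \<in> borel_measurable M" for p k
        using conv_det_cutoff(2,3)[OF sp] unfolding \<theta>_def[abs_def] \<theta>0_def[abs_def] by auto
      have r\<theta>: "0 \<le> \<theta> p k \<omega>" "\<theta> p k \<omega> \<le> 1" "0 \<le> \<theta>0 p \<omega>" "\<theta>0 p \<omega> \<le> 1" for p k \<omega>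
        by (auto simp: \<theta>_def \<theta>0_def det_cutoff_range)
      have A: "(\<integral>\<omega>. g (Fn n \<omega>) \<partial>M) = (\<Sum>p<m. \<integral>\<omega>. g (Fn n \<omega>) * (\<kappa> p n \<omega> * \<theta> p n \<omega>) \<partial>M) + (\<integral>\<omega>. g (Fn n \<omega>) * \<kappa> m n \<omega> \<partial>M)"
        using split[OF Fn_measurable[of n], of "\<lambda>p. \<theta> p n", OF m\<theta>(1) r\<theta>(1,2)] by (simp add: \<kappa>_def)
      have B: "(\<integral>\<omega>. g (F \<omega>) \<partial>M) = (\<Sum>p<m. \<integral>\<omega>. g (F \<omega>) * (\<kappa>0 p \<omega> * \<theta>0 p \<omega>) \<partial>M) + (\<integral>\<omega>. g (F \<omega>) * \<kappa>0 m \<omega> \<partial>M)"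
        using split[OF F_measurable, of \<theta>0, OF m\<theta>(2) r\<theta>(3,4)] by (simp add: \<kappa>0_def)
      have rest: "\<bar>\<integral>\<omega>. g (X \<omega>) * k \<omega> \<partial>M\<bar> \<le> (\<integral>\<omega>. k \<omega> \<partial>M)"
        if "integrable M k" "\<And>\<omega>. 0 \<le> k \<omega>" for X k
        by (rule order_trans[OF integral_abs_bound integral_mono'])
           (use that g(2) in \<open>auto simp: abs_mult intro!: mult_left_le_one_le\<close>)
      have "\<bar>\<integral>\<omega>. g (Fn n \<omega>) * \<kappa> m n \<omega> \<partial>M\<bar> \<le> (\<integral>\<omega>. \<kappa> m n \<omega> \<partial>M)" by (rule rest[OF i\<kappa>(1) \<kappa>(2)])
      also have "\<dots> \<le> (\<integral>\<omega>. \<kappa>0 m \<omega> + \<bar>\<kappa> m n \<omega> - \<kappa>0 m \<omega>\<bar> \<partial>M)"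
        using i\<kappa> by (intro integral_mono) auto
      also have "\<dots> = (\<integral>\<omega>. \<kappa>0 m \<omega> \<partial>M) + (\<integral>\<omega>. \<bar>\<kappa> m n \<omega> - \<kappa>0 m \<omega>\<bar> \<partial>M)" using i\<kappa> by simp
      finally have r1: "\<bar>\<integral>\<omega>. g (Fn n \<omega>) * \<kappa> m n \<omega> \<partial>M\<bar> \<le> e / 4" using m elim(2) by linarith
      have r2: "\<bar>\<integral>\<omega>. g (F \<omega>) * \<kappa>0 m \<omega> \<partial>M\<bar> \<le> e / 8" using rest[OF i\<kappa>(2) \<kappa>(5), of F m] m by linarith
      have "\<bar>(\<Sum>p<m. \<integral>\<omega>. g (Fn n \<omega>) * (\<kappa> p n \<omega> * \<theta> p n \<omega>) \<partial>M) - (\<Sum>p<m. \<integral>\<omega>. g (F \<omega>) * (\<kappa>0 p \<omega> * \<theta>0 p \<omega>) \<partial>M)\<bar> \<le> (\<Sum>p<m. d)"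
        unfolding sum_subtractf[symmetric] using elim(1) g by (intro order_trans[OF sum_abs] sum_mono) auto
      then have "\<bar>(\<Sum>p<m. \<integral>\<omega>. g (Fn n \<omega>) * (\<kappa> p n \<omega> * \<theta> p n \<omega>) \<partial>M) - (\<Sum>p<m. \<integral>\<omega>. g (F \<omega>) * (\<kappa>0 p \<omega> * \<theta>0 p \<omega>) \<partial>M)\<bar> \<le> e / 2"
        using md by simp
      then show "\<bar>(\<integral>\<omega>. g (Fn n \<omega>) \<partial>M) - (\<integral>\<omega>. g (F \<omega>) \<partial>M)\<bar> \<le> e"
        using r1 r2 e unfolding A B by linarith
    qed
  qed
qed

text \<open>Convergence uniform over C1 test functions yields an N before any measurable f is given.
  Such an f is then approximated in L^1 under the laws of \<open>Fn n\<close> and of F at once; the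
  approximation may depend on n and on f, because the estimate does not involve its
  derivative.\<close>

lemma tendsto_tv_dist:
  assumes nondeg: "AE \<omega> in M. \<exists>s. range s \<subseteq> H \<and> det (jac s \<omega>) \<noteq> 0"
  shows "(\<lambda>n. tv_dist M (Fn n) F) \<longlonglongrightarrow> 0"
proof (rule LIMSEQ_I)
  fix e :: real assume e: "e > 0"
  have "\<forall>\<^sub>F n in sequentially. \<forall>(g :: real^'d \<Rightarrow> real) g'. C1_bounded g g' \<longrightarrow> (\<forall>x. \<bar>g x\<bar> \<le> 1) \<longrightarrow>
    \<bar>(\<integral>\<omega>. g (Fn n \<omega>) \<partial>M) - (\<integral>\<omega>. g (F \<omega>) \<partial>M)\<bar> \<le> e / 4"
    using e by (intro uniform_convergence nondeg) auto
  then obtain N where N: "\<And>n (g :: real^'d \<Rightarrow> real) g'. n \<ge> N \<Longrightarrow> C1_bounded g g' \<Longrightarrow> (\<And>x. \<bar>g x\<bar> \<le> 1) \<Longrightarrow>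
    \<bar>(\<integral>\<omega>. g (Fn n \<omega>) \<partial>M) - (\<integral>\<omega>. g (F \<omega>) \<partial>M)\<bar> \<le> e / 4"
    unfolding eventually_sequentially by blast
  show "\<exists>no. \<forall>n\<ge>no. norm (tv_dist M (Fn n) F - 0) < e"
  proof (intro exI[of _ N] allI impI)
    fix n assume n: "N \<le> n"
    note [measurable] = Fn_measurable[of n] F_measurable
    let ?T = "{f :: real^'d \<Rightarrow> real. f \<in> borel_measurable borel \<and> (\<forall>x. \<bar>f x\<bar> \<le> 1)}"
    have le: "\<bar>(\<integral>\<omega>. f (Fn n \<omega>) \<partial>M) - (\<integral>\<omega>. f (F \<omega>) \<partial>M)\<bar> \<le> e / 2" if "f \<in> ?T" for f
    proof -
      have f[measurable]: "f \<in> borel_measurable borel" and f1: "\<And>x. \<bar>f x\<bar> \<le> 1" using that by auto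
      have fi: "integrable M (\<lambda>\<omega>. h (X \<omega>))"
        if [measurable]: "X \<in> borel_measurable M" "h \<in> borel_measurable borel" and "\<And>x. \<bar>h x\<bar> \<le> c" for X and h :: "real^'d \<Rightarrow> real" and c
        by (rule integrable_bounded_real[of _ c]) (use that in auto)
      \<comment> \<open>The average of both laws is realised with a fair coin, so that one
        approximation serves both. An error below \<open>e / 16\<close> for the average means one
        below \<open>e / 8\<close> for the sum.\<close>
      let ?U = "uniform_count_measure (UNIV :: bool set)"
      have [measurable_cong]: "sets ?U = sets (count_space UNIV)" by (simp add: sets_uniform_count_measure)
      interpret U: prob_space ?U by (rule prob_space_uniform_count_measure) auto
      interpret P: pair_prob_space M ?U ..
      define Z where "Z = (\<lambda>(\<omega>, b). if b then Fn n \<omega> else F \<omega>)"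
      have Z[measurable]: "Z \<in> borel_measurable (M \<Otimes>\<^sub>M ?U)" unfolding Z_def by measurable
      define \<mu> where "\<mu> = distr (M \<Otimes>\<^sub>M ?U) borel Z"
      have "finite_measure \<mu>" unfolding \<mu>_def
        by (intro prob_space.finite_measure P.prob_space_distr Z)
      moreover have "sets \<mu> = sets borel" by (simp add: \<mu>_def)
      moreover have "e / 16 > 0" using e by simp
      ultimately obtain g g' where g: "C1_bounded g g'" "\<And>x. \<bar>g x\<bar> \<le> 1" "(\<integral>x. \<bar>f x - g x\<bar> \<partial>\<mu>) < e / 16"
        using measurable_approx_C1_bounded[OF _ _ f f1, of \<mu> "e / 16"] by blast
      have mg[measurable]: "g \<in> borel_measurable borel"
        using C1_continuous[OF C1_bounded_imp_C1[OF g(1)]] by (rule borel_measurable_continuous_onI)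
      have d2: "\<bar>\<bar>f x - g x\<bar>\<bar> \<le> 2" for x using f1[of x] g(2)[of x] by simp
      have "(\<integral>x. \<bar>f x - g x\<bar> \<partial>\<mu>) = (\<integral>p. \<bar>f (Z p) - g (Z p)\<bar> \<partial>(M \<Otimes>\<^sub>M ?U))"
        unfolding \<mu>_def by (rule integral_distr) measurable
      also have "\<dots> = (\<integral>\<omega>. \<integral>b. \<bar>f (Z (\<omega>, b)) - g (Z (\<omega>, b))\<bar> \<partial>?U \<partial>M)"
      proof (rule P.integral_fst'[symmetric])
        show "integrable (M \<Otimes>\<^sub>M ?U) (\<lambda>p. \<bar>f (Z p) - g (Z p)\<bar>)"
          by (rule P.integrable_bounded_real[of _ 2]) (use d2 in \<open>auto\<close>)
      qed
      also have "\<dots> = (\<integral>\<omega>. (\<bar>f (Fn n \<omega>) - g (Fn n \<omega>)\<bar> + \<bar>f (F \<omega>) - g (F \<omega>)\<bar>) / 2 \<partial>M)"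
        by (simp add: integral_uniform_count_measure Z_def UNIV_bool add.commute)
      also have "\<dots> = ((\<integral>\<omega>. \<bar>f (Fn n \<omega>) - g (Fn n \<omega>)\<bar> \<partial>M) + (\<integral>\<omega>. \<bar>f (F \<omega>) - g (F \<omega>)\<bar> \<partial>M)) / 2"
        using fi[of "Fn n" "\<lambda>x. \<bar>f x - g x\<bar>" 2] fi[of F "\<lambda>x. \<bar>f x - g x\<bar>" 2] d2 by simp
      finally have sum: "(\<integral>\<omega>. \<bar>f (Fn n \<omega>) - g (Fn n \<omega>)\<bar> \<partial>M) + (\<integral>\<omega>. \<bar>f (F \<omega>) - g (F \<omega>)\<bar> \<partial>M) < e / 8"
        using g(3) by simp
      have diff: "\<bar>(\<integral>\<omega>. f (X \<omega>) \<partial>M) - (\<integral>\<omega>. g (X \<omega>) \<partial>M)\<bar> \<le> (\<integral>\<omega>. \<bar>f (X \<omega>) - g (X \<omega>)\<bar> \<partial>M)"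
        if "X \<in> borel_measurable M" for X
        using fi[OF that f f1] fi[OF that mg g(2)] integral_abs_bound[of M "\<lambda>\<omega>. f (X \<omega>) - g (X \<omega>)"] by simp
      show ?thesis
        using diff[OF Fn_measurable[of n]] diff[OF F_measurable] N[OF n g(1,2)] sum e by linarith
    qed
    have ne: "?T \<noteq> {}" by (auto intro!: exI[of _ "\<lambda>_. 0"])
    have "tv_dist M (Fn n) F \<le> e / 2"
      unfolding tv_dist_def by (rule cSUP_least[OF ne le])
    moreover have "0 \<le> tv_dist M (Fn n) F"
    proof -
      \<comment> \<open>A real supremum is meaningful for bounded sets; with that settled, the test
        function 0 shows nonnegativity.\<close>
      have "bdd_above ((\<lambda>f. \<bar>(\<integral>\<omega>. f (Fn n \<omega>) \<partial>M) - (\<integral>\<omega>. f (F \<omega>) \<partial>M)\<bar>) ` ?T)" using le by (rule bdd_aboveI2)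
      from cSUP_upper[OF _ this, of "\<lambda>_. 0"] show ?thesis unfolding tv_dist_def by simp
    qed
    ultimately show "norm (tv_dist M (Fn n) F - 0) < e" using e by simp
  qed
qed

end

section \<open>Simple functionals\<close>

text \<open>The growth bound is borrowed from \<open>\<Phi>\<close>, the finitely many times come
  from \<open>\<Psi>\<close>. This is how functions of polynomial growth enter the class.\<close>

lemma cylindrical_dominated:
  assumes \<Psi>: "\<Psi> \<in> borel_measurable path_space" and T: "finite T" "T \<subseteq> {0..1}"
    and dep: "\<And>w w'. (\<And>t. t \<in> T \<Longrightarrow> w t = w' t) \<Longrightarrow> \<Psi> w = \<Psi> w'"
    and \<Phi>: "cylindrical \<Phi>" "\<And>w. norm (\<Psi> w) \<le> norm (\<Phi> w)"
  shows "cylindrical \<Psi>"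
proof -
  obtain S c where S: "finite S" "S \<subseteq> {0..1}" "0 \<le> c" "cylindrical_on S c \<Phi>"
    using \<Phi>(1) by (auto simp: cylindrical_def)
  have "cylindrical_on (S \<union> T) c \<Phi>"
    using S T by (intro cylindrical_on_mono[OF S(4)]) auto
  then have "cylindrical_on (S \<union> T) c \<Psi>"
    using \<Psi> dep \<Phi>(2) unfolding cylindrical_on_def by (meson UnI2 order_trans)
  then show ?thesis using S T unfolding cylindrical_def by (intro exI[of _ "S \<union> T"] exI[of _ c]) auto
qed

lemma cylindrical_power: "cylindrical \<Psi> \<Longrightarrow> cylindrical (\<lambda>w. (\<Psi> w :: real) ^ q)"
  by (induction q) (auto intro: cylindrical_const cylindrical_mult)

lemma cylindrical_abs:
  assumes "cylindrical \<Psi>"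
  shows "cylindrical (\<lambda>w. \<bar>\<Psi> w :: real\<bar>)"
  by (rule cylindrical_compose[OF assms, where K=1]) auto

section \<open>Partial derivatives and the chain rule for smooth functions of polynomial
  growth\<close>

lemma partial_derivs_append: "partial_derivs (is @ js) f = partial_derivs is (partial_derivs js f)"
  by (induction "is") auto

lemma smooth_poly_growth_depends:
  assumes "smooth_poly_growth I f" "\<And>i. i \<in> I \<Longrightarrow> x i = y i"
  shows "f x = f y"
proof -
  have imp: "\<forall>x y. (\<forall>i\<in>I. x i = y i) \<longrightarrow> f x = f y"
    using assms(1) unfolding smooth_poly_growth_def by (rule conjunct1)
  have "\<forall>i\<in>I. x i = y i" using assms(2) by (rule ballI)
  with imp[THEN spec, of x, THEN spec, of y] show ?thesis by (rule mp)
qed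

lemma partial_derivs_depends:
  assumes f: "smooth_poly_growth I f" and "set is \<subseteq> I" "\<And>i. i \<in> I \<Longrightarrow> x i = y i"
  shows "partial_derivs is f x = partial_derivs is f y"
  using assms(2,3)
proof (induction "is" arbitrary: x y)
  case Nil
  show ?case unfolding partial_derivs.simps by (rule smooth_poly_growth_depends[OF f]) (rule Nil)
next
  case (Cons i js)
  have "partial_derivs js f (x(i := u)) = partial_derivs js f (y(i := u))" for u
    using Cons.prems by (intro Cons.IH) auto
  moreover have "x i = y i" using Cons.prems by simp
  ultimately show ?case by (simp add: partial_deriv_def)
qed

lemma smooth_poly_growth_partial_derivs:
  assumes "smooth_poly_growth I f" "set js \<subseteq> I"
  shows "smooth_poly_growth I (partial_derivs js f)"
  unfolding smooth_poly_growth_def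
proof (intro conjI allI impI)
  fix x y :: "'a \<Rightarrow> real" assume "\<forall>i\<in>I. x i = y i"
  then show "partial_derivs js f x = partial_derivs js f y"
    using partial_derivs_depends[OF assms, of x y] by simp
next
  fix "is" assume "set is \<subseteq> I"
  then have s: "set (is @ js) \<subseteq> I" using assms(2) by simp
  have "continuous_on UNIV (partial_derivs (is @ js) f) \<and>
        (\<forall>i\<in>I. \<forall>x. (\<lambda>y. partial_derivs (is @ js) f (x(i := y))) differentiable at (x i)) \<and>
        (\<exists>C (q::nat). \<forall>x. \<bar>partial_derivs (is @ js) f x\<bar> \<le> C * (1 + (\<Sum>i\<in>I. \<bar>x i\<bar>)) ^ q)"
    using assms(1) s unfolding smooth_poly_growth_def by blast
  then show "continuous_on UNIV (partial_derivs is (partial_derivs js f))"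
    "\<forall>i\<in>I. \<forall>x. (\<lambda>y. partial_derivs is (partial_derivs js f) (x(i := y))) differentiable at (x i)"
    "\<exists>C (q::nat). \<forall>x. \<bar>partial_derivs is (partial_derivs js f) x\<bar> \<le> C * (1 + (\<Sum>i\<in>I. \<bar>x i\<bar>)) ^ q"
    unfolding partial_derivs_append by blast+
qed

lemma smooth_partial_deriv:
  assumes f: "smooth_poly_growth I f" and i: "i \<in> I"
  shows "((\<lambda>y. f (x(i := y))) has_real_derivative partial_deriv i f (x(i := y))) (at y)"
proof -
  have "\<forall>i\<in>I. \<forall>x. (\<lambda>y. partial_derivs [] f (x(i := y))) differentiable (at (x i))"
    using f unfolding smooth_poly_growth_def by (metis empty_subsetI list.set(1))
  then have "(\<lambda>z. f ((x(i := y))(i := z))) differentiable (at ((x(i := y)) i))"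
    using i by (metis partial_derivs.simps(1))
  then have "(\<lambda>z. f (x(i := z))) differentiable (at y)" by simp
  then show ?thesis
    by (simp add: partial_deriv_def DERIV_deriv_iff_real_differentiable)
qed

lemma smooth_partial_continuous:
  assumes f: "smooth_poly_growth I f" and i: "i \<in> I"
  shows "continuous_on UNIV (partial_deriv i f)"
proof -
  have "set [i] \<subseteq> I" using i by simp
  then have "continuous_on UNIV (partial_derivs [i] f)"
    using f unfolding smooth_poly_growth_def by blast
  then show ?thesis by simp
qed

text \<open>The coordinates are indexed by an arbitrary type, so differentiability is known one
  coordinate at a time. The set of moving coordinates grows by one in each step of the induction:
  the old ones move with one parameter, the new one with another, and the derivative along the
  diagonal is wanted.\<close>

lemma smooth_chain_rule_on:
  assumes f: "smooth_poly_growth I f" and "finite J" "J \<subseteq> I"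
  shows "((\<lambda>\<epsilon>. f (\<lambda>i. if i \<in> J then x i + \<epsilon> * v i else x i)) has_real_derivative
    (\<Sum>i\<in>J. v i * partial_deriv i f (\<lambda>i. if i \<in> J then x i + \<epsilon> * v i else x i))) (at \<epsilon>)"
  using assms(2,3)
proof (induction J arbitrary: x \<epsilon> rule: finite_induct)
  case empty
  then show ?case by simp
next
  case (insert j J)
  define pt where "pt a b = (\<lambda>i. if i \<in> J then x i + a * v i else if i = j then x i + b * v i else x i)" for a b
  have pt_eq: "(\<lambda>i. if i \<in> insert j J then x i + \<epsilon> * v i else x i) = pt \<epsilon> \<epsilon>" for \<epsilon>
    by (auto simp: pt_def)
  have j: "j \<in> I" "j \<notin> J" using insert by auto
  have fx: "((\<lambda>a. f (pt a b)) has_derivative (\<lambda>t. t * (\<Sum>i\<in>J. v i * partial_deriv i f (pt a b)))) (at a)" for a b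
  proof -
    have e: "(\<lambda>i. if i \<in> J then (x(j := x j + b * v j)) i + a * v i else (x(j := x j + b * v j)) i) = pt a b" for a
      using j by (auto simp: pt_def fun_eq_iff)
    have "J \<subseteq> I" using insert by simp
    from insert.IH[OF this, of "x(j := x j + b * v j)" a] show ?thesis
      unfolding e has_field_derivative_def by (rule has_derivative_eq_rhs) (auto simp: mult.commute)
  qed
  have fy: "((\<lambda>b. f (pt a b)) has_derivative blinfun_apply (blinfun_scaleR_left (v j * partial_deriv j f (pt a b)))) (at b)" for a b
  proof -
    have e: "(pt a b)(j := x j + b' * v j) = pt a b'" for b b'
      using j by (auto simp: pt_def fun_eq_iff)
    have 1: "((\<lambda>y. f ((pt a b)(j := y))) has_real_derivative partial_deriv j f ((pt a b)(j := x j + b * v j))) (at (x j + b * v j))"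
      by (rule smooth_partial_deriv[OF f j(1)])
    have 2: "((\<lambda>b. x j + b * v j) has_real_derivative v j) (at b)" by (auto intro!: derivative_eq_intros)
    from DERIV_chain2[OF 1 2] have "((\<lambda>b'. f (pt a b')) has_real_derivative partial_deriv j f (pt a b) * v j) (at b)"
      unfolding e .
    then show ?thesis
      unfolding has_field_derivative_def by (rule has_derivative_eq_rhs) (auto simp: mult_ac)
  qed
  have cont: "continuous_on UNIV (\<lambda>(a, b). pt a b)"
    unfolding case_prod_unfold
  proof (rule continuous_on_coordinatewise_then_product)
    fix i
    show "continuous_on UNIV (\<lambda>p. pt (fst p) (snd p) i)"
      unfolding pt_def by (cases "i \<in> J"; cases "i = j") (auto intro!: continuous_intros)
  qed
  have "continuous_on UNIV (\<lambda>(a, b). blinfun_scaleR_left (v j * partial_deriv j f (pt a b)) :: real \<Rightarrow>\<^sub>L real)"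
    using continuous_on_compose2[OF smooth_partial_continuous[OF f j(1)] cont]
    unfolding case_prod_unfold by (intro continuous_intros bounded_linear.continuous_on[OF bounded_linear_blinfun_scaleR_left]) auto
  then have fyc: "continuous (at (\<epsilon>, \<epsilon>) within UNIV \<times> UNIV) (\<lambda>(a, b). blinfun_scaleR_left (v j * partial_deriv j f (pt a b)) :: real \<Rightarrow>\<^sub>L real)"
    by (auto simp: continuous_on_eq_continuous_within)
  \<comment> \<open>Two partial derivatives give a total one if that in the second parameter is
    continuous; the induction hypothesis for the first parameter is used without any
    continuity.\<close>
  from has_derivative_partialsI[OF fx[of \<epsilon> \<epsilon>] fy fyc]
  have D: "((\<lambda>(a, b). f (pt a b)) has_derivative (\<lambda>(tx, ty). tx * (\<Sum>i\<in>J. v i * partial_deriv i f (pt \<epsilon> \<epsilon>)) +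
      blinfun_apply (blinfun_scaleR_left (v j * partial_deriv j f (pt \<epsilon> \<epsilon>))) ty)) (at (\<epsilon>, \<epsilon>))"
    by simp
  have "((\<lambda>\<epsilon>. (\<epsilon>, \<epsilon>)) has_derivative (\<lambda>t. (t, t))) (at \<epsilon>)" by (auto intro!: derivative_intros)
  from has_derivative_compose[OF this D]
  have "((\<lambda>\<epsilon>. f (pt \<epsilon> \<epsilon>)) has_derivative (\<lambda>t. t * (\<Sum>i\<in>J. v i * partial_deriv i f (pt \<epsilon> \<epsilon>)) + t * (v j * partial_deriv j f (pt \<epsilon> \<epsilon>)))) (at \<epsilon>)"
    by simp
  then show ?case
    unfolding pt_eq has_field_derivative_def
    by (rule has_derivative_eq_rhs) (use insert in \<open>auto simp: algebra_simps\<close>)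
qed

lemma smooth_chain_rule:
  assumes f: "smooth_poly_growth I f" and I: "finite I"
  shows "((\<lambda>\<epsilon>. f (\<lambda>i. x i + \<epsilon> * v i)) has_real_derivative (\<Sum>i\<in>I. v i * partial_deriv i f x)) (at 0)"
proof -
  have e: "f (\<lambda>i. if i \<in> I then x i + \<epsilon> * v i else x i) = f (\<lambda>i. x i + \<epsilon> * v i)" for \<epsilon>
    by (rule smooth_poly_growth_depends[OF f]) simp
  have p: "(\<lambda>i. if i \<in> I then x i + 0 * v i else x i) = x" by auto
  show ?thesis
    using smooth_chain_rule_on[OF f I subset_refl, of x v 0] unfolding e p .
qed

text \<open>The deterministic counterpart of \<open>sample_path\<close>; unlike the latter it can be
  evaluated at a translated path.\<close>

definition sample :: "(nat \<Rightarrow> real) \<Rightarrow> (real \<Rightarrow> real^'n) \<Rightarrow> nat \<times> 'n \<Rightarrow> real" where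
  "sample t w = (\<lambda>(j, k). w (t j) $ k)"

lemma sample_measurable: "sample t \<in> borel_measurable (path_space :: (real \<Rightarrow> real^'n) measure)"
proof (rule measurable_coordinatewise_then_product)
  fix i :: "nat \<times> 'n"
  show "(\<lambda>w. sample t w i) \<in> borel_measurable path_space"
    unfolding sample_def case_prod_unfold
    by (intro measurable_compose[OF _ borel_measurable_nth] measurable_component_singleton) simp
qed

text \<open>The weight \<open>min (t j) (fst h)\<close> is the value of the shift at time
  \<open>t j\<close>, and at the same time the length of the overlap of \<open>[0, t j)\<close> with
  \<open>[0, b)\<close>. This coincidence matches directional derivatives with integrals of
  Malliavin derivatives.\<close>

definition grid_derivative ::
    "nat \<Rightarrow> (nat \<Rightarrow> real) \<Rightarrow> ((nat \<times> 'n \<Rightarrow> real) \<Rightarrow> real) \<Rightarrow> real \<times> 'n \<Rightarrow> (nat \<times> 'n \<Rightarrow> real) \<Rightarrow> real" where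
  "grid_derivative r t f h x = (\<Sum>j<r. min (t j) (fst h) * partial_deriv (j, snd h) f x)"

lemma cylindrical_smooth:
  assumes f: "smooth_poly_growth ({..<r} \<times> UNIV) f" and t: "\<And>j. j < r \<Longrightarrow> t j \<in> {0..1}"
  shows "cylindrical (\<lambda>w :: real \<Rightarrow> real^'n. f (sample t w))"
proof -
  let ?I = "{..<r} \<times> (UNIV :: 'n set)"
  have e: "set [] \<subseteq> ?I" by simp
  then have c: "continuous_on UNIV f" "\<exists>C (q::nat). \<forall>x. \<bar>f x\<bar> \<le> C * (1 + (\<Sum>i\<in>?I. \<bar>x i\<bar>)) ^ q"
    using f unfolding smooth_poly_growth_def by (metis partial_derivs.simps(1))+
  then obtain C and q :: nat where C: "\<And>x. \<bar>f x\<bar> \<le> C * (1 + (\<Sum>i\<in>?I. \<bar>x i\<bar>)) ^ q" by blast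
  show ?thesis
  proof (rule cylindrical_dominated[where T="t ` {..<r}"])
    show "(\<lambda>w. f (sample t w)) \<in> borel_measurable path_space"
      by (rule measurable_compose[OF sample_measurable borel_measurable_continuous_onI[OF c(1)]])
    show "f (sample t w) = f (sample t w')" if "\<And>s. s \<in> t ` {..<r} \<Longrightarrow> w s = w' s" for w w'
      using that by (intro smooth_poly_growth_depends[OF f]) (auto simp: sample_def)
    have "cylindrical (\<lambda>w :: real \<Rightarrow> real^'n. sample t w i)" if "i \<in> ?I" for i
      using that t by (cases i) (auto simp: sample_def intro!: cylindrical_linear[OF cylindrical_eval bounded_linear_vec_nth])
    then show "cylindrical (\<lambda>w :: real \<Rightarrow> real^'n. C * (1 + (\<Sum>i\<in>?I. \<bar>sample t w i\<bar>)) ^ q)"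
      by (intro cylindrical_mult cylindrical_const cylindrical_power cylindrical_add cylindrical_sum cylindrical_abs) auto
    show "norm (f (sample t w)) \<le> norm (C * (1 + (\<Sum>i\<in>?I. \<bar>sample t w i\<bar>)) ^ q)" for w
      using order_trans[OF C abs_ge_self] by simp
  qed (use t in auto)
qed

lemma directional_deriv_smooth:
  assumes f: "smooth_poly_growth ({..<r} \<times> UNIV) f"
  shows "directional_deriv h (\<lambda>w :: real \<Rightarrow> real^'n. f (sample t w)) (\<lambda>w. grid_derivative r t f h (sample t w))"
  unfolding directional_deriv_def
proof
  fix w :: "real \<Rightarrow> real^'n"
  let ?v = "\<lambda>i. if snd i = snd h then min (t (fst i)) (fst h) else 0"
  have e: "sample t (\<lambda>s. w s + \<epsilon> *\<^sub>R shift h s) = (\<lambda>i. sample t w i + \<epsilon> * ?v i)" for \<epsilon>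
    by (auto simp: sample_def shift_def axis_def fun_eq_iff)
  have "((\<lambda>\<epsilon>. f (\<lambda>i. sample t w i + \<epsilon> * ?v i)) has_real_derivative
      (\<Sum>i\<in>{..<r} \<times> UNIV. ?v i * partial_deriv i f (sample t w))) (at 0)"
    by (rule smooth_chain_rule[OF f]) simp
  also have "(\<Sum>i\<in>{..<r} \<times> UNIV. ?v i * partial_deriv i f (sample t w)) =
      (\<Sum>j<r. \<Sum>k\<in>UNIV. ?v (j, k) * partial_deriv (j, k) f (sample t w))"
    by (subst sum.cartesian_product) (rule sum.cong, auto)
  also have "\<dots> = grid_derivative r t f h (sample t w)"
    by (simp add: grid_derivative_def if_distrib[of "\<lambda>x. x * _"] cong: if_cong)
  finally show "((\<lambda>\<epsilon>. f (sample t (\<lambda>s. w s + \<epsilon> *\<^sub>R shift h s))) has_vector_derivative grid_derivative r t f h (sample t w)) (at 0)"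
    by (simp add: e has_real_derivative_iff_has_vector_derivative)
qed

text \<open>Partial derivatives of f are again smooth of polynomial growth, so the derivative along
  h is itself a cylindrical functional that can be differentiated along \<open>h'\<close>.\<close>

lemma smooth_grid_derivative:
  assumes "simple_data r t f"
  shows cylindrical_simple: "cylindrical (\<lambda>w :: real \<Rightarrow> real^'n. f (sample t w))"
    and cylindrical_grid: "cylindrical (\<lambda>w :: real \<Rightarrow> real^'n. grid_derivative r t f h (sample t w))"
    and cylindrical_grid2: "cylindrical (\<lambda>w :: real \<Rightarrow> real^'n. \<Sum>j<r. min (t j) (fst h) * grid_derivative r t (partial_deriv (j, snd h) f) h' (sample t w))"
    and deriv_simple: "directional_deriv h (\<lambda>w :: real \<Rightarrow> real^'n. f (sample t w)) (\<lambda>w. grid_derivative r t f h (sample t w))"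
    and deriv_grid: "directional_deriv h' (\<lambda>w :: real \<Rightarrow> real^'n. grid_derivative r t f h (sample t w))
      (\<lambda>w. \<Sum>j<r. min (t j) (fst h) * grid_derivative r t (partial_deriv (j, snd h) f) h' (sample t w))"
proof -
  have t: "\<And>j. j < r \<Longrightarrow> t j \<in> {0..1}" and f: "smooth_poly_growth ({..<r} \<times> UNIV) f"
    using assms by (auto simp: simple_data_def)
  have p: "smooth_poly_growth ({..<r} \<times> UNIV) (partial_deriv (j, k) f)" if "j < r" for j k
    using smooth_poly_growth_partial_derivs[OF f, of "[(j, k)]"] that by simp
  have pp: "smooth_poly_growth ({..<r} \<times> UNIV) (partial_deriv (i, l) (partial_deriv (j, k) f))" if "j < r" "i < r" for i j k l
    using smooth_poly_growth_partial_derivs[OF p, of j "[(i, l)]"] that by simp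
  show "cylindrical (\<lambda>w :: real \<Rightarrow> real^'n. f (sample t w))" by (rule cylindrical_smooth[OF f t])
  show "cylindrical (\<lambda>w :: real \<Rightarrow> real^'n. grid_derivative r t f h (sample t w))"
    unfolding grid_derivative_def
    by (intro cylindrical_sum cylindrical_mult cylindrical_const cylindrical_smooth[OF p t]) auto
  show "cylindrical (\<lambda>w :: real \<Rightarrow> real^'n. \<Sum>j<r. min (t j) (fst h) * grid_derivative r t (partial_deriv (j, snd h) f) h' (sample t w))"
    unfolding grid_derivative_def
    by (intro cylindrical_sum cylindrical_mult cylindrical_const cylindrical_smooth[OF pp t]) auto
  show "directional_deriv h (\<lambda>w :: real \<Rightarrow> real^'n. f (sample t w)) (\<lambda>w. grid_derivative r t f h (sample t w))"
    by (rule directional_deriv_smooth[OF f])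
  show "directional_deriv h' (\<lambda>w :: real \<Rightarrow> real^'n. grid_derivative r t f h (sample t w))
      (\<lambda>w. \<Sum>j<r. min (t j) (fst h) * grid_derivative r t (partial_deriv (j, snd h) f) h' (sample t w))"
    unfolding directional_deriv_def grid_derivative_def[of r t f h]
  proof (intro allI has_vector_derivative_sum)
    fix w :: "real \<Rightarrow> real^'n" and j assume "j \<in> {..<r}"
    then have "directional_deriv h' (\<lambda>w :: real \<Rightarrow> real^'n. partial_deriv (j, snd h) f (sample t w))
        (\<lambda>w. grid_derivative r t (partial_deriv (j, snd h) f) h' (sample t w))"
      by (intro directional_deriv_smooth p) simp
    then show "((\<lambda>\<epsilon>. min (t j) (fst h) * partial_deriv (j, snd h) f (sample t (\<lambda>s. w s + \<epsilon> *\<^sub>R shift h' s))) has_vector_derivative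
        min (t j) (fst h) * grid_derivative r t (partial_deriv (j, snd h) f) h' (sample t w)) (at 0)"
      unfolding directional_deriv_def by (intro has_vector_derivative_mult_right) simp
  qed
qed

section \<open>Fields integrated over boxes\<close>

lemma prob_space_unit_interval: "prob_space (restrict_space lborel {0..<1::real})"
  by (rule prob_spaceI) (simp add: emeasure_restrict_space space_restrict_space)

lemma prob_space_lebesgue_cube: "prob_space (lebesgue_cube m)"
  unfolding lebesgue_cube_def by (intro prob_space_PiM prob_space_unit_interval)

lemma product_sigma_finite_unit_interval: "product_sigma_finite (\<lambda>_. restrict_space lborel {0..<1::real})"
  unfolding product_sigma_finite_def
  by (intro allI prob_space_imp_sigma_finite prob_space_unit_interval)

lemma lebesgue_cube_component_measurable:
  assumes "l < m"
  shows "(\<lambda>s. s l) \<in> borel_measurable (lebesgue_cube m)"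
proof -
  have "(\<lambda>s. s l) \<in> lebesgue_cube m \<rightarrow>\<^sub>M restrict_space lborel {0..<1}"
    unfolding lebesgue_cube_def using assms by (intro measurable_component_singleton) auto
  then show ?thesis by (auto intro: measurable_compose[OF _ measurable_restrict_space1[of "\<lambda>x. x"]])
qed

definition slab :: "nat \<Rightarrow> (nat \<Rightarrow> real) \<Rightarrow> (nat \<Rightarrow> real) \<Rightarrow> real" where
  "slab m \<beta> s = (\<Prod>l<m. indicat_real {0..<\<beta> l} (s l))"

lemma slab_measurable: "slab m \<beta> \<in> borel_measurable (lebesgue_cube m)"
  unfolding slab_def[abs_def]
  by (intro borel_measurable_prod measurable_compose[OF lebesgue_cube_component_measurable]) auto

lemma slab_le_1: "\<bar>slab m \<beta> s\<bar> \<le> 1"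
  unfolding slab_def abs_prod by (intro prod_le_1) (auto simp: indicator_def)

text \<open>The integral factorises over the coordinates, and in each of them two initial intervals
  overlap in the shorter one. So the weights of \<open>grid_derivative\<close> arise from the
  indicators in \<open>simple_deriv\<close>.\<close>

lemma integral_slab_mult:
  assumes "\<And>l. l < m \<Longrightarrow> a l \<in> {0..1}" "\<And>l. l < m \<Longrightarrow> b l \<in> {0..1}"
  shows "(\<integral>s. slab m a s * slab m b s \<partial>lebesgue_cube m) = (\<Prod>l<m. min (a l) (b l))"
proof -
  interpret product_sigma_finite "\<lambda>_::nat. restrict_space lborel {0..<1::real}"
    by (rule product_sigma_finite_unit_interval)
  have one: "(\<integral>x. indicat_real {0..<c} x * indicat_real {0..<d} x \<partial>restrict_space lborel {0..<1}) = min c d"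
    if "c \<in> {0..1}" "d \<in> {0..1}" for c d :: real
  proof -
    have e: "indicat_real {0..<1} x *\<^sub>R (indicat_real {0..<c} x * indicat_real {0..<d} x) = indicat_real {0..<min c d} x" for x
      using that by (simp add: indicator_def)
    have "(\<integral>x. indicat_real {0..<c} x * indicat_real {0..<d} x \<partial>restrict_space lborel {0..<1}) =
        (\<integral>x. indicat_real {0..<min c d} x \<partial>lborel)"
      by (subst integral_restrict_space) (simp_all only: e, simp)
    also have "\<dots> = min c d" using that by simp
    finally show ?thesis .
  qed
  interpret U: prob_space "restrict_space lborel {0..<1::real}" by (rule prob_space_unit_interval)
  have i: "integrable (restrict_space lborel {0..<1}) (\<lambda>x. indicat_real {0..<c} x * indicat_real {0..<d} x)" for c d :: real
    by (rule U.integrable_const_bound[of _ 1]) (auto simp: indicator_def intro!: measurable_restrict_space1)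
  have "(\<integral>s. slab m a s * slab m b s \<partial>lebesgue_cube m) =
      (\<integral>s. (\<Prod>l<m. indicat_real {0..<a l} (s l) * indicat_real {0..<b l} (s l)) \<partial>lebesgue_cube m)"
    by (simp add: slab_def prod.distrib)
  also have "\<dots> = (\<Prod>l<m. \<integral>x. indicat_real {0..<a l} x * indicat_real {0..<b l} x \<partial>restrict_space lborel {0..<1})"
    unfolding lebesgue_cube_def by (rule product_integral_prod[OF _ i]) simp
  also have "\<dots> = (\<Prod>l<m. min (a l) (b l))"
    using assms by (intro prod.cong one) auto
  finally show ?thesis .
qed

text \<open>The pairing of a field of order m with the tensor product of the densities of m
  directions: for a Malliavin derivative this is the m-fold directional derivative.\<close>

definition field_integral ::
    "nat \<Rightarrow> ('a, 'n) field \<Rightarrow> (nat \<Rightarrow> 'n) \<Rightarrow> (nat \<Rightarrow> real) \<Rightarrow> 'a \<Rightarrow> real" where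
  "field_integral m D \<alpha> \<beta> \<omega> = (\<integral>s. D \<alpha> s \<omega> * slab m \<beta> s \<partial>lebesgue_cube m)"

lemma simple_deriv_alt:
  "simple_deriv W r t f m \<alpha> s \<omega> =
     (\<Sum>j\<in>{..<m} \<rightarrow>\<^sub>E {..<r}. partial_derivs (map (\<lambda>l. (j l, \<alpha> l)) [0..<m]) f (sample_path W t \<omega>) * slab m (\<lambda>l. t (j l)) s)"
  by (simp add: simple_deriv_def slab_def)

lemma simple_deriv_measurable_cube: "(\<lambda>s. simple_deriv W r t f m \<alpha> s \<omega>) \<in> borel_measurable (lebesgue_cube m)"
  unfolding simple_deriv_alt by (intro borel_measurable_sum borel_measurable_times slab_measurable) auto

lemma integrable_slab_mult: "integrable (lebesgue_cube m) (\<lambda>s. c * slab m \<beta> s)"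
proof -
  interpret prob_space "lebesgue_cube m" by (rule prob_space_lebesgue_cube)
  show ?thesis
    by (intro integrable_mult_right integrable_bounded_real[of _ 1] slab_measurable slab_le_1)
qed

lemma integrable_simple_deriv: "integrable (lebesgue_cube m) (\<lambda>s. simple_deriv W r t f m \<alpha> s \<omega>)"
  unfolding simple_deriv_alt by (intro Bochner_Integration.integrable_sum integrable_slab_mult)

lemma integrable_mult_slab:
  assumes "integrable (lebesgue_cube m) X"
  shows "integrable (lebesgue_cube m) (\<lambda>s. X s * slab m \<beta> s)"
proof (rule Bochner_Integration.integrable_bound[OF assms])
  show "AE s in lebesgue_cube m. norm (X s * slab m \<beta> s) \<le> norm (X s)"
    using slab_le_1[of m \<beta>] by (intro AE_I2) (simp add: abs_mult mult_right_le_one_le)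
qed (use assms slab_measurable in auto)

lemma field_integral_simple:
  assumes "simple_data r t f" "\<And>l. l < m \<Longrightarrow> \<beta> l \<in> {0..1}"
  shows "field_integral m (simple_deriv W r t f m) \<alpha> \<beta> \<omega> =
    (\<Sum>j\<in>{..<m} \<rightarrow>\<^sub>E {..<r}. partial_derivs (map (\<lambda>l. (j l, \<alpha> l)) [0..<m]) f (sample_path W t \<omega>) *
      (\<Prod>l<m. min (t (j l)) (\<beta> l)))"
proof -
  let ?c = "\<lambda>j. partial_derivs (map (\<lambda>l. (j l, \<alpha> l)) [0..<m]) f (sample_path W t \<omega>)"
  have i: "integrable (lebesgue_cube m) (\<lambda>s. ?c j * (slab m (\<lambda>l. t (j l)) s * slab m \<beta> s))" for j
  proof -
    have "integrable (lebesgue_cube m) (\<lambda>s. slab m (\<lambda>l. t (j l)) s)"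
      using integrable_slab_mult[of m 1] by simp
    from integrable_mult_slab[OF this] show ?thesis by (rule integrable_mult_right)
  qed
  have "field_integral m (simple_deriv W r t f m) \<alpha> \<beta> \<omega> =
      (\<integral>s. (\<Sum>j\<in>{..<m} \<rightarrow>\<^sub>E {..<r}. ?c j * (slab m (\<lambda>l. t (j l)) s * slab m \<beta> s)) \<partial>lebesgue_cube m)"
    by (simp add: field_integral_def simple_deriv_alt sum_distrib_right mult.assoc)
  also have "\<dots> = (\<Sum>j\<in>{..<m} \<rightarrow>\<^sub>E {..<r}. ?c j * (\<integral>s. slab m (\<lambda>l. t (j l)) s * slab m \<beta> s \<partial>lebesgue_cube m))"
    using i by (simp add: Bochner_Integration.integral_sum)
  also have "\<dots> = (\<Sum>j\<in>{..<m} \<rightarrow>\<^sub>E {..<r}. ?c j * (\<Prod>l<m. min (t (j l)) (\<beta> l)))"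
  proof (intro sum.cong refl arg_cong2[where f="(*)"] integral_slab_mult assms)
    fix j l assume "j \<in> {..<m} \<rightarrow>\<^sub>E {..<r}" "l < m"
    then have "j l < r" by auto
    then show "t (j l) \<in> {0..1}" using assms(1) by (auto simp: simple_data_def)
  qed
  finally show ?thesis .
qed

section \<open>Box integrals of the first and second derivatives of simple functionals\<close>

lemma sum_PiE_1: "(\<Sum>j\<in>{..<1::nat} \<rightarrow>\<^sub>E A. g j) = (\<Sum>a\<in>A. g (\<lambda>_\<in>{..<1}. a))"
proof (rule sum.reindex_bij_witness[of _ "\<lambda>a. \<lambda>_\<in>{..<1}. a" "\<lambda>j. j 0"])
  fix j assume j: "j \<in> {..<1::nat} \<rightarrow>\<^sub>E A"
  show e: "(\<lambda>_\<in>{..<1}. j 0) = j"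
  proof
    fix l show "(\<lambda>_\<in>{..<1}. j 0) l = j l" using PiE_arb[OF j, of l] by (cases l) auto
  qed
  show "j 0 \<in> A" using j by auto
  show "g (\<lambda>_\<in>{..<1}. j 0) = g j" by (simp only: e)
qed auto

lemma sum_PiE_2:
  "(\<Sum>j\<in>{..<2::nat} \<rightarrow>\<^sub>E A. g j) = (\<Sum>p\<in>A \<times> A. g (\<lambda>l\<in>{..<2}. if l = 0 then fst p else snd p))"
proof (rule sum.reindex_bij_witness[of _ "\<lambda>p. \<lambda>l\<in>{..<2}. if l = 0 then fst p else snd p" "\<lambda>j. (j 0, j 1)"])
  fix j assume j: "j \<in> {..<2::nat} \<rightarrow>\<^sub>E A"
  show e: "(\<lambda>l\<in>{..<2}. if l = 0 then fst (j 0, j 1) else snd (j 0, j 1)) = j"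
  proof
    fix l
    consider "l = 0" | "l = 1" | "\<not> l < (2::nat)" by linarith
    then show "(\<lambda>l\<in>{..<2}. if l = 0 then fst (j 0, j 1) else snd (j 0, j 1)) l = j l"
      using PiE_arb[OF j, of l] by cases simp_all
  qed
  have "j 0 \<in> A" "j 1 \<in> A" using PiE_mem[OF j, of 0] PiE_mem[OF j, of 1] by simp_all
  then show "(j 0, j 1) \<in> A \<times> A" by simp
  show "g (\<lambda>l\<in>{..<2}. if l = 0 then fst (j 0, j 1) else snd (j 0, j 1)) = g j" by (simp only: e)
next
  fix p assume p: "p \<in> A \<times> A"
  then show "(\<lambda>l\<in>{..<2::nat}. if l = 0 then fst p else snd p) \<in> {..<2} \<rightarrow>\<^sub>E A"
    by (intro restrict_PiE_iff[THEN iffD2] ballI) (simp add: mem_Times_iff)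
  show "((\<lambda>l\<in>{..<2::nat}. if l = 0 then fst p else snd p) 0, (\<lambda>l\<in>{..<2::nat}. if l = 0 then fst p else snd p) 1) = p"
    by simp
qed

lemma field_integral_simple_1:
  assumes "simple_data r t f" "\<beta> 0 \<in> {0..1}"
  shows "field_integral 1 (simple_deriv W r t f 1) \<alpha> \<beta> \<omega> = grid_derivative r t f (\<beta> 0, \<alpha> 0) (sample_path W t \<omega>)"
proof -
  have "field_integral 1 (simple_deriv W r t f 1) \<alpha> \<beta> \<omega> =
      (\<Sum>j\<in>{..<1::nat} \<rightarrow>\<^sub>E {..<r}. partial_deriv (j 0, \<alpha> 0) f (sample_path W t \<omega>) * min (t (j 0)) (\<beta> 0))"
  proof (subst field_integral_simple[OF assms(1)])
    have p: "(\<Prod>l<1. h l) = h 0" for h :: "nat \<Rightarrow> real" by (simp add: lessThan_Suc)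
    show "(\<Sum>j\<in>{..<1::nat} \<rightarrow>\<^sub>E {..<r}. partial_derivs (map (\<lambda>l. (j l, \<alpha> l)) [0..<1]) f (sample_path W t \<omega>) * (\<Prod>l<1. min (t (j l)) (\<beta> l))) =
      (\<Sum>j\<in>{..<1::nat} \<rightarrow>\<^sub>E {..<r}. partial_deriv (j 0, \<alpha> 0) f (sample_path W t \<omega>) * min (t (j 0)) (\<beta> 0))"
      unfolding p by (intro sum.cong refl) simp
  qed (use assms(2) in simp)
  also have "\<dots> = grid_derivative r t f (\<beta> 0, \<alpha> 0) (sample_path W t \<omega>)"
    by (subst sum_PiE_1) (simp add: grid_derivative_def mult.commute)
  finally show ?thesis .
qed

text \<open>\<open>partial_derivs\<close> applies the head of its list last: index 1 belongs to the
  inner derivative and index 0 to the outer one. The direction taken first therefore sits at index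
  1.\<close>

lemma field_integral_simple_2:
  assumes "simple_data r t f" "\<beta> 0 \<in> {0..1}" "\<beta> 1 \<in> {0..1}"
  shows "field_integral 2 (simple_deriv W r t f 2) \<alpha> \<beta> \<omega> =
    (\<Sum>j<r. min (t j) (\<beta> 1) * grid_derivative r t (partial_deriv (j, \<alpha> 1) f) (\<beta> 0, \<alpha> 0) (sample_path W t \<omega>))"
proof -
  have u: "[0..<2] = [0, 1::nat]" by (simp add: numeral_2_eq_2)
  have p: "(\<Prod>l<2. h l) = h 0 * h 1" for h :: "nat \<Rightarrow> real" by (simp add: numeral_2_eq_2)
  have "field_integral 2 (simple_deriv W r t f 2) \<alpha> \<beta> \<omega> =
      (\<Sum>j\<in>{..<2::nat} \<rightarrow>\<^sub>E {..<r}. partial_deriv (j 0, \<alpha> 0) (partial_deriv (j 1, \<alpha> 1) f) (sample_path W t \<omega>) *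
        (min (t (j 0)) (\<beta> 0) * min (t (j 1)) (\<beta> 1)))"
  proof (subst field_integral_simple[OF assms(1)])
    show "\<beta> l \<in> {0..1}" if "l < 2" for l using that assms(2,3) by (auto simp: less_2_cases_iff)
  qed (simp add: u p)
  also have "\<dots> = (\<Sum>a<r. \<Sum>b<r. partial_deriv (a, \<alpha> 0) (partial_deriv (b, \<alpha> 1) f) (sample_path W t \<omega>) *
        (min (t a) (\<beta> 0) * min (t b) (\<beta> 1)))"
    unfolding sum.cartesian_product by (subst sum_PiE_2) (simp add: case_prod_unfold)
  also have "\<dots> = (\<Sum>j<r. min (t j) (\<beta> 1) * grid_derivative r t (partial_deriv (j, \<alpha> 1) f) (\<beta> 0, \<alpha> 0) (sample_path W t \<omega>))"
    by (subst sum.swap) (simp add: grid_derivative_def sum_distrib_left mult_ac)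
  finally show ?thesis .
qed

section \<open>Powers of extended reals and bounds by Sobolev norms\<close>

lemma ennreal_powr_mono:
  assumes "x \<le> y" "0 \<le> p"
  shows "ennreal_powr x p \<le> ennreal_powr y p"
proof (cases "y = \<top>")
  case False
  then have y: "y < \<top>" by (simp add: less_top)
  with assms(1) have x: "x < \<top>" by (rule le_less_trans)
  have "enn2real x powr p \<le> enn2real y powr p"
    using assms y by (intro powr_mono2 enn2real_mono) auto
  moreover have "x \<noteq> \<top>" "y \<noteq> \<top>" using x y by (simp_all add: less_top)
  ultimately show ?thesis by (simp add: ennreal_powr_def ennreal_leI)
qed (simp add: ennreal_powr_def)

lemma ennreal_powr_top: "ennreal_powr x p < \<top> \<Longrightarrow> x < \<top>"
  by (auto simp: ennreal_powr_def less_top split: if_splits)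

lemma ennreal_powr_measurable [measurable]:
  assumes [measurable]: "f \<in> borel_measurable M"
  shows "(\<lambda>x. ennreal_powr (f x) p) \<in> borel_measurable M"
  unfolding ennreal_powr_def by measurable

text \<open>The cube is a probability space and the indicator of a box is at most 1, so the square
  of the box integral is at most the integral of the square, by the nonnegativity of a variance. The
  exponent 1/2 undoes the square in \<open>field_sq\<close>, and where that is infinite the bound is
  trivial.\<close>

lemma field_sq_bound:
  fixes X :: "('a, 'n::finite) field"
  assumes m: "(\<lambda>s. X \<alpha> s \<omega>) \<in> borel_measurable (lebesgue_cube m)" and \<alpha>: "\<alpha> \<in> multi_indices m"
  shows "ennreal \<bar>field_integral m X \<alpha> \<beta> \<omega>\<bar> \<le> ennreal_powr (field_sq m X \<omega>) (1 / 2)"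
    and "field_sq m X \<omega> < \<top> \<Longrightarrow> integrable (lebesgue_cube m) (\<lambda>s. X \<alpha> s \<omega>)"
proof -
  interpret prob_space "lebesgue_cube m" by (rule prob_space_lebesgue_cube)
  let ?A = "\<integral>\<^sup>+ s. ennreal ((X \<alpha> s \<omega>)\<^sup>2) \<partial>lebesgue_cube m"
  have A: "?A \<le> field_sq m X \<omega>"
    unfolding field_sq_def by (rule member_le_sum[OF \<alpha>]) (simp_all add: finite_PiE)
  have sq: "integrable (lebesgue_cube m) (\<lambda>s. (X \<alpha> s \<omega>)\<^sup>2)" if "field_sq m X \<omega> < \<top>"
    using that A m by (intro integrableI_nonneg) (auto intro: le_less_trans)
  show int: "integrable (lebesgue_cube m) (\<lambda>s. X \<alpha> s \<omega>)" if "field_sq m X \<omega> < \<top>"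
    by (rule square_integrable_imp_integrable[OF m sq[OF that]])
  show "ennreal \<bar>field_integral m X \<alpha> \<beta> \<omega>\<bar> \<le> ennreal_powr (field_sq m X \<omega>) (1 / 2)"
  proof (cases "field_sq m X \<omega> < \<top>")
    case True
    let ?Y = "\<lambda>s. X \<alpha> s \<omega> * slab m \<beta> s"
    have iY: "integrable (lebesgue_cube m) ?Y" by (rule integrable_mult_slab[OF int[OF True]])
    have le: "(?Y s)\<^sup>2 \<le> (X \<alpha> s \<omega>)\<^sup>2" for s
    proof -
      have "(slab m \<beta> s)\<^sup>2 \<le> 1" using slab_le_1[of m \<beta> s] by (simp add: abs_square_le_1)
      then show ?thesis by (simp add: power_mult_distrib mult_right_le_one_le)
    qed
    have iY2: "integrable (lebesgue_cube m) (\<lambda>s. (?Y s)\<^sup>2)"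
      by (rule Bochner_Integration.integrable_bound[OF sq[OF True]]) (use le m slab_measurable in auto)
    have "(field_integral m X \<alpha> \<beta> \<omega>)\<^sup>2 \<le> (\<integral>s. (?Y s)\<^sup>2 \<partial>lebesgue_cube m)"
      using variance_positive[of ?Y] variance_eq[OF iY iY2] by (simp add: field_integral_def)
    also have "\<dots> \<le> (\<integral>s. (X \<alpha> s \<omega>)\<^sup>2 \<partial>lebesgue_cube m)" by (intro integral_mono iY2 sq[OF True] le)
    also have "\<dots> = enn2real ?A" using m by (intro integral_eq_nn_integral) auto
    also have "\<dots> \<le> enn2real (field_sq m X \<omega>)" using A True by (intro enn2real_mono) auto
    finally have "\<bar>field_integral m X \<alpha> \<beta> \<omega>\<bar> \<le> sqrt (enn2real (field_sq m X \<omega>))"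
      by (intro real_le_rsqrt) simp
    then show ?thesis using True by (simp add: ennreal_powr_def powr_half_sqrt ennreal_leI)
  qed (simp add: ennreal_powr_def less_top)
qed

lemma sobolev_sq_ge:
  shows sobolev_sq_ge_field: "k \<in> {1..m} \<Longrightarrow> field_sq k (D k) \<omega> \<le> sobolev_sq m F D \<omega>"
    and sobolev_sq_ge_fun: "ennreal ((F \<omega>)\<^sup>2) \<le> sobolev_sq m F D \<omega>"
proof -
  show "field_sq k (D k) \<omega> \<le> sobolev_sq m F D \<omega>" if "k \<in> {1..m}"
  proof -
    have "field_sq k (D k) \<omega> \<le> (\<Sum>k=1..m. field_sq k (D k) \<omega>)"
      by (rule member_le_sum[OF that]) auto
    then show ?thesis by (simp add: sobolev_sq_def add_increasing)
  qed
qed (simp add: sobolev_sq_def)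

section \<open>Directional derivatives of Malliavin differentiable functionals\<close>

definition field_measurable :: "'a measure \<Rightarrow> nat \<Rightarrow> ('a, 'n) field \<Rightarrow> bool" where
  "field_measurable M m X \<longleftrightarrow>
     (\<forall>\<alpha>\<in>multi_indices m. (\<lambda>p. X \<alpha> (snd p) (fst p)) \<in> borel_measurable (M \<Otimes>\<^sub>M lebesgue_cube m))"

lemma field_measurableD:
  assumes X: "field_measurable M m (X :: ('a, 'n) field)" and \<alpha>: "\<alpha> \<in> multi_indices m"
  shows field_measurable_section: "\<omega> \<in> space M \<Longrightarrow> (\<lambda>s. X \<alpha> s \<omega>) \<in> borel_measurable (lebesgue_cube m)"
    and field_integral_measurable: "(\<lambda>\<omega>. field_integral m X \<alpha> \<beta> \<omega>) \<in> borel_measurable M"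
    and nn_integral_field_measurable: "(\<lambda>\<omega>. \<integral>\<^sup>+ s. ennreal ((X \<alpha> s \<omega>)\<^sup>2) \<partial>lebesgue_cube m) \<in> borel_measurable M"
proof -
  interpret C: prob_space "lebesgue_cube m" by (rule prob_space_lebesgue_cube)
  have J: "(\<lambda>p. X \<alpha> (snd p) (fst p)) \<in> borel_measurable (M \<Otimes>\<^sub>M lebesgue_cube m)"
    using X \<alpha> unfolding field_measurable_def by blast
  show "(\<lambda>s. X \<alpha> s \<omega>) \<in> borel_measurable (lebesgue_cube m)" if "\<omega> \<in> space M"
    using measurable_compose[OF measurable_Pair1'[OF that] J] by simp
  have "(\<lambda>p. slab m \<beta> (snd p)) \<in> borel_measurable (M \<Otimes>\<^sub>M lebesgue_cube m)"
    by (rule measurable_compose[OF measurable_snd slab_measurable])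
  then have "(\<lambda>p. X \<alpha> (snd p) (fst p) * slab m \<beta> (snd p)) \<in> borel_measurable (M \<Otimes>\<^sub>M lebesgue_cube m)"
    by (rule borel_measurable_times[OF J])
  then show "(\<lambda>\<omega>. field_integral m X \<alpha> \<beta> \<omega>) \<in> borel_measurable M"
    unfolding field_integral_def by (intro C.borel_measurable_lebesgue_integral) (simp add: case_prod_unfold)
  have "(\<lambda>p. ennreal ((X \<alpha> (snd p) (fst p))\<^sup>2)) \<in> borel_measurable (M \<Otimes>\<^sub>M lebesgue_cube m)"
    by (intro measurable_compose[OF _ measurable_ennreal] borel_measurable_power J)
  then show "(\<lambda>\<omega>. \<integral>\<^sup>+ s. ennreal ((X \<alpha> s \<omega>)\<^sup>2) \<partial>lebesgue_cube m) \<in> borel_measurable M"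
    by (intro C.borel_measurable_nn_integral) (simp add: case_prod_unfold)
qed

lemma field_sq_measurable:
  "field_measurable M m X \<Longrightarrow> field_sq m X \<in> borel_measurable M"
  unfolding field_sq_def[abs_def] by (intro borel_measurable_sum nn_integral_field_measurable)

lemma sobolev_sq_measurable:
  assumes "G \<in> borel_measurable M" "\<And>k. k \<in> {1..m} \<Longrightarrow> field_measurable M k (X k)"
  shows "sobolev_sq m G X \<in> borel_measurable M"
  unfolding sobolev_sq_def[abs_def]
  by (intro borel_measurable_add borel_measurable_sum field_sq_measurable measurable_compose[OF _ measurable_ennreal]
      borel_measurable_power assms)

lemma field_measurable_diff:
  "field_measurable M m X \<Longrightarrow> field_measurable M m Y \<Longrightarrow> field_measurable M m (\<lambda>\<alpha> s \<omega>. X \<alpha> s \<omega> - Y \<alpha> s \<omega>)"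
  unfolding field_measurable_def by (intro ballI borel_measurable_diff) blast+

lemma integrable_nn_bound:
  fixes Y :: "'a \<Rightarrow> real"
  assumes "Y \<in> borel_measurable M" "\<And>\<omega>. \<omega> \<in> space M \<Longrightarrow> ennreal \<bar>Y \<omega>\<bar> \<le> q \<omega>" "(\<integral>\<^sup>+ \<omega>. q \<omega> \<partial>M) \<le> ennreal a" "0 \<le> a"
  shows "integrable M Y \<and> (\<integral>\<omega>. \<bar>Y \<omega>\<bar> \<partial>M) \<le> a"
proof -
  have "(\<integral>\<^sup>+ \<omega>. ennreal (norm (Y \<omega>)) \<partial>M) \<le> ennreal a"
    using order_trans[OF nn_integral_mono assms(3), of "\<lambda>\<omega>. ennreal (norm (Y \<omega>))"] assms(2) by simp
  then have i: "integrable M Y" and n: "(\<integral>\<^sup>+ \<omega>. ennreal (norm (Y \<omega>)) \<partial>M) \<le> ennreal a"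
    using assms(1) by (simp_all add: integrable_iff_bounded le_less_trans[OF _ ennreal_less_top[of a]])
  have "(\<integral>\<^sup>+ \<omega>. ennreal (norm (Y \<omega>)) \<partial>M) = ennreal (\<integral>\<omega>. norm (Y \<omega>) \<partial>M)"
    using i by (intro nn_integral_eq_integral integrable_norm) auto
  with n assms(4) i show ?thesis by simp
qed

lemma abs_le_sobolev: "ennreal \<bar>G \<omega>\<bar> \<le> ennreal_powr (sobolev_sq m G X \<omega>) (1 / 2)"
proof -
  have "ennreal \<bar>G \<omega>\<bar> = ennreal_powr (ennreal ((G \<omega>)\<^sup>2)) (1 / 2)"
    by (simp add: ennreal_powr_def powr_half_sqrt)
  also have "\<dots> \<le> ennreal_powr (sobolev_sq m G X \<omega>) (1 / 2)"
    by (intro ennreal_powr_mono sobolev_sq_ge_fun) simp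
  finally show ?thesis .
qed

text \<open>The functional and the box integrals of its derivatives lie pointwise below the square
  root of \<open>sobolev_sq\<close>. Applied to differences, this turns convergence in the Sobolev
  norm of exponent 1 into L^1 convergence of all of them.\<close>

lemma L1_bound_sobolev:
  assumes G: "G \<in> borel_measurable M" and X: "\<And>k. k \<in> {1..m} \<Longrightarrow> field_measurable M k (X k)"
    and a: "(\<integral>\<^sup>+ \<omega>. ennreal_powr (sobolev_sq m G X \<omega>) (1 / 2) \<partial>M) \<le> ennreal a" "0 \<le> a"
  shows "integrable M G \<and> (\<integral>\<omega>. \<bar>G \<omega>\<bar> \<partial>M) \<le> a"
    and "k \<in> {1..m} \<Longrightarrow> \<alpha> \<in> multi_indices k \<Longrightarrow>
      integrable M (field_integral k (X k) \<alpha> \<beta>) \<and> (\<integral>\<omega>. \<bar>field_integral k (X k) \<alpha> \<beta> \<omega>\<bar> \<partial>M) \<le> a"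
    and "k \<in> {1..m} \<Longrightarrow> AE \<omega> in M. field_sq k (X k) \<omega> < \<top>"
proof -
  show "integrable M G \<and> (\<integral>\<omega>. \<bar>G \<omega>\<bar> \<partial>M) \<le> a"
    by (rule integrable_nn_bound[OF G abs_le_sobolev a])
  assume k: "k \<in> {1..m}"
  have mono: "ennreal_powr (field_sq k (X k) \<omega>) (1 / 2) \<le> ennreal_powr (sobolev_sq m G X \<omega>) (1 / 2)" for \<omega>
    by (intro ennreal_powr_mono sobolev_sq_ge_field k) simp
  show "integrable M (field_integral k (X k) \<alpha> \<beta>) \<and> (\<integral>\<omega>. \<bar>field_integral k (X k) \<alpha> \<beta> \<omega>\<bar> \<partial>M) \<le> a"
    if \<alpha>: "\<alpha> \<in> multi_indices k"
    by (rule integrable_nn_bound[OF field_integral_measurable[OF X[OF k] \<alpha>] order_trans[OF field_sq_bound(1) mono] a])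
       (rule field_measurable_section[OF X[OF k] \<alpha>] \<alpha>, assumption?)+
  have "(\<integral>\<^sup>+ \<omega>. ennreal_powr (field_sq k (X k) \<omega>) (1 / 2) \<partial>M) \<le> ennreal a"
    by (rule order_trans[OF nn_integral_mono[OF mono] a(1)])
  then have "(\<integral>\<^sup>+ \<omega>. ennreal_powr (field_sq k (X k) \<omega>) (1 / 2) \<partial>M) \<noteq> \<infinity>"
    by (auto simp: top_unique)
  then have "AE \<omega> in M. ennreal_powr (field_sq k (X k) \<omega>) (1 / 2) \<noteq> \<infinity>"
    by (intro nn_integral_PInf_AE ennreal_powr_measurable field_sq_measurable X k)
  then show "AE \<omega> in M. field_sq k (X k) \<omega> < \<top>"
    by eventually_elim (rule ennreal_powr_top, simp add: less_top)
qed

text \<open>With x the square root of S, either x is at most \<open>\<eta>\<close>, or x is at most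
  \<open>\<eta> powr (1 - p)\<close> times its p-th power. It plays the part of Hoelder's inequality
  when convergence in L^p is weakened to L^1.\<close>

lemma ennreal_powr_interpolate:
  assumes "0 < \<eta>" "1 \<le> p"
  shows "ennreal_powr S (1 / 2) \<le> ennreal \<eta> + ennreal (\<eta> powr (1 - p)) * ennreal_powr S (p / 2)"
proof (cases "S = \<top>")
  case True
  then show ?thesis using assms by (simp add: ennreal_powr_def ennreal_mult_top)
next
  case False
  let ?x = "enn2real S"
  have "?x powr (1 / 2) \<le> \<eta> + \<eta> powr (1 - p) * ?x powr (p / 2)"
  proof (cases "?x powr (1 / 2) \<le> \<eta>")
    case True
    then show ?thesis by (simp add: add_increasing2)
  next
    case False
    have "?x powr (1 / 2) = (?x powr (1 / 2)) powr (1 - p) * ?x powr (p / 2)"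
      by (simp add: powr_powr powr_add[symmetric] field_simps)
    also have "\<dots> \<le> \<eta> powr (1 - p) * ?x powr (p / 2)"
      using False assms by (intro mult_right_mono powr_mono2') auto
    finally show ?thesis using assms by simp
  qed
  then show ?thesis using False assms
    by (simp add: ennreal_powr_def ennreal_plus[symmetric] ennreal_mult[symmetric] ennreal_leI del: ennreal_plus)
qed

lemma ennreal_tendsto_0I:
  fixes f :: "nat \<Rightarrow> ennreal"
  assumes "\<And>\<eta>. 0 < \<eta> \<Longrightarrow> \<exists>g. g \<longlonglongrightarrow> 0 \<and> (\<forall>n. f n \<le> ennreal \<eta> + g n)"
  shows "f \<longlonglongrightarrow> 0"
proof (rule order_tendstoI)
  fix e :: ennreal assume e: "0 < e"
  obtain \<eta> where \<eta>: "0 < \<eta>" "ennreal (2 * \<eta>) < e"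
  proof (cases "e = \<top>")
    case True
    then show thesis using that[of 1] by simp
  next
    case False
    then obtain d where "e = ennreal d" "0 \<le> d" by (cases e) auto
    with e show thesis using that[of "d / 3"] by (simp add: ennreal_less_iff)
  qed
  then obtain g where g: "g \<longlonglongrightarrow> 0" "\<forall>n. f n \<le> ennreal \<eta> + g n" using assms by blast
  have "\<forall>\<^sub>F n in sequentially. g n < ennreal \<eta>" using g(1) \<eta>(1) by (intro order_tendstoD) auto
  then show "\<forall>\<^sub>F n in sequentially. f n < e"
  proof eventually_elim
    fix n assume "g n < ennreal \<eta>"
    have "f n \<le> ennreal \<eta> + ennreal \<eta>"
      using g(2) \<open>g n < ennreal \<eta>\<close> by (meson add_left_mono less_imp_le order_trans)
    also have "\<dots> = ennreal (2 * \<eta>)" using \<eta>(1) by (simp add: ennreal_plus[symmetric] del: ennreal_plus)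
    finally show "f n < e" using \<eta>(2) by simp
  qed
qed simp

lemma sobolev_sq_mono: "m' \<le> m \<Longrightarrow> sobolev_sq m' G X \<omega> \<le> sobolev_sq m G X \<omega>"
  unfolding sobolev_sq_def by (intro add_left_mono sum_mono2) auto

section \<open>From approximation in Sobolev norm to weak directional derivatives\<close>

context brownian
begin

text \<open>Both samples agree at the indices below r, whose times lie in \<open>[0, 1]\<close>, and
  g depends on no others.\<close>

lemma sample_path_eq_sample:
  assumes g: "smooth_poly_growth ({..<r} \<times> UNIV) g" and t: "\<And>j. j < r \<Longrightarrow> t j \<in> {0..1}"
  shows "g (sample_path W t \<omega>) = g (sample t (path \<omega>))"
  using t by (intro smooth_poly_growth_depends[OF g]) (auto simp: sample_path_def sample_def path_def)

lemma smooth_path_measurable: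
  assumes g: "smooth_poly_growth ({..<r} \<times> UNIV) g" and t: "\<And>j. j < r \<Longrightarrow> t j \<in> {0..1}"
  shows "(\<lambda>\<omega>. g (sample_path W t \<omega>)) \<in> borel_measurable M"
proof -
  have "(\<lambda>\<omega>. g (sample_path W t \<omega>)) = (\<lambda>\<omega>. g (sample t (path \<omega>)))"
    by (rule ext) (rule sample_path_eq_sample[OF g t])
  with measurable_compose[OF path_measurable cylindrical_measurable[OF cylindrical_smooth[OF g t]]] show ?thesis by simp
qed

lemma simple_deriv_field_measurable:
  assumes "simple_data r t (f :: (nat \<times> 'n \<Rightarrow> real) \<Rightarrow> real)"
  shows "field_measurable M m (simple_deriv W r t f m)"
proof -
  have t: "\<And>j. j < r \<Longrightarrow> t j \<in> {0..1}" and f: "smooth_poly_growth ({..<r} \<times> UNIV) f"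
    using assms by (auto simp: simple_data_def)
  have g: "smooth_poly_growth ({..<r} \<times> UNIV) (partial_derivs (map (\<lambda>l. (j l, \<alpha> l)) [0..<m]) f)"
    if "j \<in> {..<m} \<rightarrow>\<^sub>E {..<r}" for j \<alpha>
  proof (rule smooth_poly_growth_partial_derivs[OF f])
    show "set (map (\<lambda>l. (j l, \<alpha> l)) [0..<m]) \<subseteq> {..<r} \<times> UNIV"
      using PiE_mem[OF that] by fastforce
  qed
  show ?thesis
    unfolding field_measurable_def simple_deriv_alt
    by (intro ballI borel_measurable_sum borel_measurable_times measurable_compose[OF measurable_fst smooth_path_measurable[OF g t]]
        measurable_compose[OF measurable_snd slab_measurable])
qed

lemma simple_functional_measurable: "simple_data r t f \<Longrightarrow> simple_functional W t f \<in> borel_measurable M"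
  unfolding simple_functional_def[abs_def] by (intro smooth_path_measurable) (auto simp: simple_data_def)

lemma field_integral_simple_path:
  assumes "simple_data r t (f :: (nat \<times> 'n \<Rightarrow> real) \<Rightarrow> real)"
  shows "\<beta> 0 \<in> {0..1} \<Longrightarrow>
      field_integral 1 (simple_deriv W r t f 1) \<alpha> \<beta> \<omega> = grid_derivative r t f (\<beta> 0, \<alpha> 0) (sample t (path \<omega>))"
    and "\<beta> 0 \<in> {0..1} \<Longrightarrow> \<beta> 1 \<in> {0..1} \<Longrightarrow> field_integral 2 (simple_deriv W r t f 2) \<alpha> \<beta> \<omega> =
      (\<Sum>j<r. min (t j) (\<beta> 1) * grid_derivative r t (partial_deriv (j, \<alpha> 1) f) (\<beta> 0, \<alpha> 0) (sample t (path \<omega>)))"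
proof -
  have t: "\<And>j. j < r \<Longrightarrow> t j \<in> {0..1}" and f: "smooth_poly_growth ({..<r} \<times> UNIV) f"
    using assms by (auto simp: simple_data_def)
  have g: "grid_derivative r t g h (sample_path W t \<omega>) = grid_derivative r t g h (sample t (path \<omega>))"
    if "smooth_poly_growth ({..<r} \<times> UNIV) g" for g :: "(nat \<times> 'n \<Rightarrow> real) \<Rightarrow> real" and h
    unfolding grid_derivative_def
  proof (intro sum.cong refl arg_cong2[where f="(*)"] sample_path_eq_sample t)
    fix j assume "j \<in> {..<r}"
    then show "smooth_poly_growth ({..<r} \<times> UNIV) (partial_deriv (j, snd h) g)"
      using smooth_poly_growth_partial_derivs[OF that, of "[(j, snd h)]"] by simp
  qed
  have p: "smooth_poly_growth ({..<r} \<times> UNIV) (partial_deriv (j, k) f)" if "j < r" for j k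
    using smooth_poly_growth_partial_derivs[OF f, of "[(j, k)]"] that by simp
  show "field_integral 1 (simple_deriv W r t f 1) \<alpha> \<beta> \<omega> = grid_derivative r t f (\<beta> 0, \<alpha> 0) (sample t (path \<omega>))"
    if "\<beta> 0 \<in> {0..1}"
    unfolding field_integral_simple_1[where \<beta>=\<beta>, OF assms that] by (rule g[OF f])
  show "field_integral 2 (simple_deriv W r t f 2) \<alpha> \<beta> \<omega> =
      (\<Sum>j<r. min (t j) (\<beta> 1) * grid_derivative r t (partial_deriv (j, \<alpha> 1) f) (\<beta> 0, \<alpha> 0) (sample t (path \<omega>)))"
    if "\<beta> 0 \<in> {0..1}" "\<beta> 1 \<in> {0..1}"
    unfolding field_integral_simple_2[where \<beta>=\<beta>, OF assms that]
    by (intro sum.cong refl arg_cong2[where f="(*)"] g p) simp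
qed

lemma has_malliavin_derivs_measurable:
  assumes "has_malliavin_derivs M W m p F D"
  shows "F \<in> borel_measurable M" and "k \<in> {1..m} \<Longrightarrow> field_measurable M k (D k)"
  using assms unfolding has_malliavin_derivs_def field_measurable_def case_prod_unfold by blast+

text \<open>The same approximating sequence works: fewer derivatives make the Sobolev square
  smaller, and interpolation replaces the exponent p by 1, the one with which
  \<open>malliavin_deriv\<close> is defined.\<close>

lemma has_malliavin_derivs_mono:
  assumes D: "has_malliavin_derivs M W m p F D" and m: "m' \<le> m" and p: "1 \<le> p"
  shows "has_malliavin_derivs M W m' 1 F D"
proof -
  note meas = has_malliavin_derivs_measurable[OF D]
  obtain r t f where sd: "\<And>n. simple_data (r n) (t n) (f n)" and
    conv: "(\<lambda>n. \<integral>\<^sup>+ \<omega>. ennreal_powr (sobolev_sq m (\<lambda>\<omega>. simple_functional W (t n) (f n) \<omega> - F \<omega>)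
              (\<lambda>k \<alpha> s \<omega>. simple_deriv W (r n) (t n) (f n) k \<alpha> s \<omega> - D k \<alpha> s \<omega>) \<omega>) (p / 2) \<partial>M) \<longlonglongrightarrow> 0"
    using D unfolding has_malliavin_derivs_def by blast
  define S where "S k n \<omega> = sobolev_sq k (\<lambda>\<omega>. simple_functional W (t n) (f n) \<omega> - F \<omega>)
              (\<lambda>k \<alpha> s \<omega>. simple_deriv W (r n) (t n) (f n) k \<alpha> s \<omega> - D k \<alpha> s \<omega>) \<omega>" for k n \<omega>
  have S: "S m n \<in> borel_measurable M" for n
    unfolding S_def
    by (intro sobolev_sq_measurable borel_measurable_diff simple_functional_measurable[OF sd] meas
        field_measurable_diff simple_deriv_field_measurable[OF sd])
  have "(\<lambda>n. \<integral>\<^sup>+ \<omega>. ennreal_powr (S m' n \<omega>) (1 / 2) \<partial>M) \<longlonglongrightarrow> 0"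
  proof (rule ennreal_tendsto_0I, intro exI conjI allI)
    fix \<eta> :: real assume \<eta>: "0 < \<eta>"
    show "(\<lambda>n. ennreal (\<eta> powr (1 - p)) * (\<integral>\<^sup>+ \<omega>. ennreal_powr (S m n \<omega>) (p / 2) \<partial>M)) \<longlonglongrightarrow> 0"
      using ennreal_tendsto_cmult[OF _ conv, of "ennreal (\<eta> powr (1 - p))"] by (simp add: S_def)
    fix n
    have "(\<integral>\<^sup>+ \<omega>. ennreal_powr (S m' n \<omega>) (1 / 2) \<partial>M) \<le>
        (\<integral>\<^sup>+ \<omega>. ennreal \<eta> + ennreal (\<eta> powr (1 - p)) * ennreal_powr (S m n \<omega>) (p / 2) \<partial>M)"
    proof (rule nn_integral_mono)
      fix \<omega>
      have "ennreal_powr (S m' n \<omega>) (1 / 2) \<le> ennreal_powr (S m n \<omega>) (1 / 2)"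
        unfolding S_def by (intro ennreal_powr_mono sobolev_sq_mono m) simp
      also note ennreal_powr_interpolate[OF \<eta> p]
      finally show "ennreal_powr (S m' n \<omega>) (1 / 2) \<le> ennreal \<eta> + ennreal (\<eta> powr (1 - p)) * ennreal_powr (S m n \<omega>) (p / 2)" .
    qed
    also have "\<dots> = ennreal \<eta> + ennreal (\<eta> powr (1 - p)) * (\<integral>\<^sup>+ \<omega>. ennreal_powr (S m n \<omega>) (p / 2) \<partial>M)"
      using S[of n] by (simp add: nn_integral_add nn_integral_cmult emeasure_space_1)
    finally show "(\<integral>\<^sup>+ \<omega>. ennreal_powr (S m' n \<omega>) (1 / 2) \<partial>M) \<le>
      ennreal \<eta> + ennreal (\<eta> powr (1 - p)) * (\<integral>\<^sup>+ \<omega>. ennreal_powr (S m n \<omega>) (p / 2) \<partial>M)" .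
  qed
  then have lim: "\<exists>r t f. (\<forall>n. simple_data (r n) (t n) (f n)) \<and>
        (\<lambda>n. \<integral>\<^sup>+ \<omega>. ennreal_powr
           (sobolev_sq m' (\<lambda>\<omega>. simple_functional W (t n) (f n) \<omega> - F \<omega>)
              (\<lambda>k \<alpha> s \<omega>. simple_deriv W (r n) (t n) (f n) k \<alpha> s \<omega> - D k \<alpha> s \<omega>) \<omega>)
           (1 / 2) \<partial>M) \<longlonglongrightarrow> 0"
    unfolding S_def using sd by blast
  have "\<forall>k\<in>{1..m'}. \<forall>\<alpha>\<in>multi_indices k.
        (\<lambda>(\<omega>, s). D k \<alpha> s \<omega>) \<in> borel_measurable (M \<Otimes>\<^sub>M lebesgue_cube k)"
    using meas(2) m unfolding field_measurable_def case_prod_unfold by auto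
  with lim meas(1) show ?thesis unfolding has_malliavin_derivs_def by blast
qed

lemma malliavin_L1_approx:
  fixes F :: "'a \<Rightarrow> real"
  assumes D: "has_malliavin_derivs M W m 1 F D"
  obtains r t f a where "\<And>n. simple_data (r n) (t n) (f n)" "a \<longlonglongrightarrow> (0::real)" "integrable M F"
    "\<And>n. (\<integral>\<omega>. \<bar>f n (sample (t n) (path \<omega>)) - F \<omega>\<bar> \<partial>M) \<le> a n"
    "\<And>n k (\<alpha> :: nat \<Rightarrow> 'n) \<beta>. k \<in> {1..m} \<Longrightarrow> \<alpha> \<in> multi_indices k \<Longrightarrow>
      integrable M (\<lambda>\<omega>. field_integral k (simple_deriv W (r n) (t n) (f n) k) \<alpha> \<beta> \<omega> - field_integral k (D k) \<alpha> \<beta> \<omega>) \<and>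
      (\<integral>\<omega>. \<bar>field_integral k (simple_deriv W (r n) (t n) (f n) k) \<alpha> \<beta> \<omega> - field_integral k (D k) \<alpha> \<beta> \<omega>\<bar> \<partial>M) \<le> a n"
proof -
  note meas = has_malliavin_derivs_measurable[OF D]
  obtain r t f where sd: "\<And>n. simple_data (r n) (t n) (f n)" and
    conv: "(\<lambda>n. \<integral>\<^sup>+ \<omega>. ennreal_powr (sobolev_sq m (\<lambda>\<omega>. simple_functional W (t n) (f n) \<omega> - F \<omega>)
              (\<lambda>k \<alpha> s \<omega>. simple_deriv W (r n) (t n) (f n) k \<alpha> s \<omega> - D k \<alpha> s \<omega>) \<omega>) (1 / 2) \<partial>M) \<longlonglongrightarrow> 0"
    using D unfolding has_malliavin_derivs_def by blast
  define b where "b n = (\<integral>\<^sup>+ \<omega>. ennreal_powr (sobolev_sq m (\<lambda>\<omega>. simple_functional W (t n) (f n) \<omega> - F \<omega>)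
              (\<lambda>k \<alpha> s \<omega>. simple_deriv W (r n) (t n) (f n) k \<alpha> s \<omega> - D k \<alpha> s \<omega>) \<omega>) (1 / 2) \<partial>M)" for n
  have b0: "b \<longlonglongrightarrow> 0" using conv by (simp add: b_def[abs_def])
  then have "\<forall>\<^sub>F n in sequentially. b n < 1" by (intro order_tendstoD) auto
  \<comment> \<open>Finitely many of the distances may be infinite; dropping them allows the error
    bounds a to be real.\<close>
  then obtain N where N: "\<And>n. n \<ge> N \<Longrightarrow> b n < 1" by (auto simp: eventually_sequentially)
  define a where "a n = enn2real (b (n + N))" for n
  have "b (n + N) < \<top>" for n using N[of "n + N"] by (simp add: less_trans[OF _ ennreal_one_less_top])
  then have ba: "b (n + N) \<le> ennreal (a n)" for n by (simp add: a_def)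
  have a0: "a \<longlonglongrightarrow> 0"
    unfolding a_def using LIMSEQ_ignore_initial_segment[OF b0, of N] by (intro tendsto_enn2real) auto
  have a_nonneg: "0 \<le> a n" for n by (simp add: a_def)
  have G: "(\<lambda>\<omega>. simple_functional W (t n) (f n) \<omega> - F \<omega>) \<in> borel_measurable M" for n
    by (intro borel_measurable_diff simple_functional_measurable[OF sd] meas)
  have X: "field_measurable M k (\<lambda>\<alpha> s \<omega>. simple_deriv W (r n) (t n) (f n) k \<alpha> s \<omega> - D k \<alpha> s \<omega>)" if "k \<in> {1..m}" for n k
    by (intro field_measurable_diff simple_deriv_field_measurable[OF sd] meas that)
  note bound = L1_bound_sobolev[OF G _ ba[unfolded b_def] a_nonneg]
  have bound1: "integrable M (\<lambda>\<omega>. simple_functional W (t (n + N)) (f (n + N)) \<omega> - F \<omega>) \<and>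
      (\<integral>\<omega>. \<bar>simple_functional W (t (n + N)) (f (n + N)) \<omega> - F \<omega>\<bar> \<partial>M) \<le> a n" for n
    by (rule bound(1)) (rule X)
  have path: "simple_functional W (t n) (f n) \<omega> = f n (sample (t n) (path \<omega>))" for n \<omega>
    unfolding simple_functional_def using sd[of n]
    by (intro sample_path_eq_sample[of "r n"]) (auto simp: simple_data_def)
  show thesis
  proof (rule that[of "\<lambda>n. r (n + N)" "\<lambda>n. t (n + N)" "\<lambda>n. f (n + N)" a])
    show "simple_data (r (n + N)) (t (n + N)) (f (n + N))" for n by (rule sd)
    show "a \<longlonglongrightarrow> 0" by (rule a0)
    have "integrable M (\<lambda>\<omega>. f N (sample (t N) (path \<omega>)))"
      by (rule cylindrical_integrable[OF cylindrical_simple[OF sd]])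
    moreover have "integrable M (\<lambda>\<omega>. f N (sample (t N) (path \<omega>)) - F \<omega>)"
      using bound1[of 0] by (simp add: path)
    ultimately have "integrable M (\<lambda>\<omega>. f N (sample (t N) (path \<omega>)) - (f N (sample (t N) (path \<omega>)) - F \<omega>))"
      by (rule Bochner_Integration.integrable_diff)
    then show "integrable M F" by simp
    show "(\<integral>\<omega>. \<bar>f (n + N) (sample (t (n + N)) (path \<omega>)) - F \<omega>\<bar> \<partial>M) \<le> a n" for n
      using bound1[of n] by (simp add: path)
    fix n k and \<alpha> :: "nat \<Rightarrow> 'n" and \<beta> assume k: "k \<in> {1..m}" and \<alpha>: "\<alpha> \<in> multi_indices k"
    let ?S = "simple_deriv W (r (n + N)) (t (n + N)) (f (n + N)) k"
    let ?X = "\<lambda>\<alpha> s \<omega>. ?S \<alpha> s \<omega> - D k \<alpha> s \<omega>"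
    have fm: "field_measurable M k ?S" by (rule simple_deriv_field_measurable[OF sd])
    have bound2: "integrable M (field_integral k ?X \<alpha> \<beta>) \<and> (\<integral>\<omega>. \<bar>field_integral k ?X \<alpha> \<beta> \<omega>\<bar> \<partial>M) \<le> a n"
      by (rule bound(2)[OF X k \<alpha>]) assumption
    have bound3: "AE \<omega> in M. field_sq k ?X \<omega> < \<top>" by (rule bound(3)[OF X k]) assumption
    \<comment> \<open>The box integral is additive where the fields are integrable in s, which the
      finiteness of \<open>field_sq\<close> ensures almost everywhere.\<close>
    have ae: "AE \<omega> in M. field_integral k ?X \<alpha> \<beta> \<omega> = field_integral k ?S \<alpha> \<beta> \<omega> - field_integral k (D k) \<alpha> \<beta> \<omega>"
      using bound3 AE_space
    proof eventually_elim
      fix \<omega> assume \<omega>: "field_sq k ?X \<omega> < \<top>" "\<omega> \<in> space M"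
      have iX: "integrable (lebesgue_cube k) (\<lambda>s. ?X \<alpha> s \<omega>)"
        by (rule field_sq_bound(2)[OF field_measurable_section[OF X[OF k] \<alpha> \<omega>(2)] \<alpha> \<omega>(1)])
      have iS: "integrable (lebesgue_cube k) (\<lambda>s. ?S \<alpha> s \<omega>)" by (rule integrable_simple_deriv)
      have iD: "integrable (lebesgue_cube k) (\<lambda>s. D k \<alpha> s \<omega>)"
        using Bochner_Integration.integrable_diff[OF iS iX] by simp
      show "field_integral k ?X \<alpha> \<beta> \<omega> = field_integral k ?S \<alpha> \<beta> \<omega> - field_integral k (D k) \<alpha> \<beta> \<omega>"
        unfolding field_integral_def left_diff_distrib
        by (rule Bochner_Integration.integral_diff[OF integrable_mult_slab[OF iS] integrable_mult_slab[OF iD]])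
    qed
    have m1: "field_integral k ?X \<alpha> \<beta> \<in> borel_measurable M"
      using field_integral_measurable[OF X[OF k] \<alpha>] .
    have m2: "(\<lambda>\<omega>. field_integral k ?S \<alpha> \<beta> \<omega> - field_integral k (D k) \<alpha> \<beta> \<omega>) \<in> borel_measurable M"
      by (intro borel_measurable_diff field_integral_measurable[OF fm \<alpha>] field_integral_measurable[OF meas(2)[OF k] \<alpha>])
    have "integrable M (field_integral k ?X \<alpha> \<beta>) \<longleftrightarrow>
        integrable M (\<lambda>\<omega>. field_integral k ?S \<alpha> \<beta> \<omega> - field_integral k (D k) \<alpha> \<beta> \<omega>)"
      by (rule integrable_cong_AE[OF m1 m2 ae])
    moreover have "(\<integral>\<omega>. \<bar>field_integral k ?X \<alpha> \<beta> \<omega>\<bar> \<partial>M) =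
        (\<integral>\<omega>. \<bar>field_integral k ?S \<alpha> \<beta> \<omega> - field_integral k (D k) \<alpha> \<beta> \<omega>\<bar> \<partial>M)"
      using ae by (intro integral_cong_AE borel_measurable_abs m1 m2) auto
    ultimately show "integrable M (\<lambda>\<omega>. field_integral k ?S \<alpha> \<beta> \<omega> - field_integral k (D k) \<alpha> \<beta> \<omega>) \<and>
        (\<integral>\<omega>. \<bar>field_integral k ?S \<alpha> \<beta> \<omega> - field_integral k (D k) \<alpha> \<beta> \<omega>\<bar> \<partial>M) \<le> a n"
      using bound2 by simp
  qed
qed

text \<open>L^1 convergence of the functionals gives almost sure convergence along a subsequence,
  along which the derivatives still converge in L^1.\<close>

lemma weak_derivI_L1:
  fixes X X' :: "'a \<Rightarrow> real"
  assumes \<Psi>: "\<And>n. cylindrical (\<Psi> n)" "\<And>n. cylindrical (\<Psi>' n)" "\<And>n. directional_deriv h (\<Psi> n) (\<Psi>' n)"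
    and X: "integrable M X" "integrable M X'"
    and lim: "(\<lambda>n. \<integral>\<omega>. \<bar>\<Psi> n (path \<omega>) - X \<omega>\<bar> \<partial>M) \<longlonglongrightarrow> 0" "(\<lambda>n. \<integral>\<omega>. \<bar>\<Psi>' n (path \<omega>) - X' \<omega>\<bar> \<partial>M) \<longlonglongrightarrow> 0"
  shows "weak_deriv h X X'"
proof -
  have i: "integrable M (\<lambda>\<omega>. \<Psi> n (path \<omega>) - X \<omega>)" for n
    by (intro Bochner_Integration.integrable_diff cylindrical_integrable \<Psi> X)
  have "(\<lambda>n. \<integral>\<omega>. norm (\<Psi> n (path \<omega>) - X \<omega>) \<partial>M) \<longlonglongrightarrow> 0" using lim(1) by simp
  from tendsto_L1_AE_subseq[OF i this] obtain r :: "nat \<Rightarrow> nat" where r: "strict_mono r"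
    and ae: "AE \<omega> in M. (\<lambda>n. \<Psi> (r n) (path \<omega>) - X \<omega>) \<longlonglongrightarrow> 0" by blast
  have "weak_deriv_approx h (\<lambda>n. \<Psi> (r n)) (\<lambda>n. \<Psi>' (r n)) X X'"
  proof (rule weak_deriv_approxI)
    show "AE \<omega> in M. (\<lambda>n. \<Psi> (r n) (path \<omega>)) \<longlonglongrightarrow> X \<omega>"
      using ae by eventually_elim (rule LIM_zero_cancel)
    show "(\<lambda>n. \<integral>\<omega>. norm (\<Psi>' (r n) (path \<omega>) - X' \<omega>) \<partial>M) \<longlonglongrightarrow> 0"
      using LIMSEQ_subseq_LIMSEQ[OF lim(2) r] by (simp add: o_def)
  qed (use \<Psi> X in auto)
  then show ?thesis unfolding weak_deriv_def by blast
qed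

abbreviation malliavin_dir :: "('a, 'n) field \<Rightarrow> real \<times> 'n \<Rightarrow> 'a \<Rightarrow> real" where
  "malliavin_dir D h \<equiv> field_integral 1 D (\<lambda>_\<in>{..<1}. snd h) (\<lambda>_. fst h)"

text \<open>The head of the list in \<^const>\<open>partial_derivs\<close> is differentiated last, so the second direction
  \<open>h'\<close> has index 0.\<close>

abbreviation malliavin_dir2 :: "('a, 'n) field \<Rightarrow> real \<times> 'n \<Rightarrow> real \<times> 'n \<Rightarrow> 'a \<Rightarrow> real" where
  "malliavin_dir2 D h h' \<equiv> field_integral 2 D (\<lambda>l\<in>{..<2}. if l = 0 then snd h' else snd h) (\<lambda>l. if l = 0 then fst h' else fst h)"

text \<open>One sequence of simple functionals approximates F and all its derivatives at once, and
  the grid derivatives of its members are the box integrals of their Malliavin derivatives. The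
  second claim supplies the smooth approximation for the interpolation: the derivative of a member
  of the sequence is cylindrical and can be differentiated again, so the claim is available for
  \<open>m = 1\<close>.\<close>

lemma malliavin_weak_deriv:
  fixes F :: "'a \<Rightarrow> real"
  assumes D: "has_malliavin_derivs M W m 1 F D" and m: "1 \<le> m" and h: "fst h \<in> {0..1}"
  shows "weak_deriv h F (malliavin_dir (D 1) h)"
    and "\<epsilon> > 0 \<Longrightarrow> \<exists>Z Z'. weak_deriv h Z Z' \<and> integrable M Z \<and> (\<integral>\<omega>. \<bar>Z \<omega> - malliavin_dir (D 1) h \<omega>\<bar> \<partial>M) \<le> \<epsilon>"
    and "2 \<le> m \<Longrightarrow> fst h' \<in> {0..1} \<Longrightarrow> weak_deriv h' (malliavin_dir (D 1) h) (malliavin_dir2 (D 2) h h')"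
proof -
  from malliavin_L1_approx[OF D] obtain r t f a where sd: "\<And>n. simple_data (r n) (t n) (f n)"
    and a: "a \<longlonglongrightarrow> (0::real)" and iF: "integrable M F"
    and F: "\<And>n. (\<integral>\<omega>. \<bar>f n (sample (t n) (path \<omega>)) - F \<omega>\<bar> \<partial>M) \<le> a n"
    and field: "\<And>n k (\<alpha> :: nat \<Rightarrow> 'n) \<beta>. k \<in> {1..m} \<Longrightarrow> \<alpha> \<in> multi_indices k \<Longrightarrow>
      integrable M (\<lambda>\<omega>. field_integral k (simple_deriv W (r n) (t n) (f n) k) \<alpha> \<beta> \<omega> - field_integral k (D k) \<alpha> \<beta> \<omega>) \<and>
      (\<integral>\<omega>. \<bar>field_integral k (simple_deriv W (r n) (t n) (f n) k) \<alpha> \<beta> \<omega> - field_integral k (D k) \<alpha> \<beta> \<omega>\<bar> \<partial>M) \<le> a n"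
    by blast
  define g where "g n h w = grid_derivative (r n) (t n) (f n) h (sample (t n) w)" for n h w
  define gg where "gg n h h' w = (\<Sum>j<r n. min (t n j) (fst h) * grid_derivative (r n) (t n) (partial_deriv (j, snd h) (f n)) h' (sample (t n) w))" for n h h' w
  have cyl: "cylindrical (\<lambda>w. f n (sample (t n) w))" "cylindrical (g n h)" "cylindrical (gg n h h')" for n h h'
    unfolding g_def gg_def by (rule cylindrical_simple[OF sd] cylindrical_grid[OF sd] cylindrical_grid2[OF sd])+
  have dir: "directional_deriv h (\<lambda>w. f n (sample (t n) w)) (g n h)" "directional_deriv h' (g n h) (gg n h h')" for n h h'
    unfolding g_def gg_def by (rule deriv_simple[OF sd] deriv_grid[OF sd])+
  let ?\<alpha> = "\<lambda>_\<in>{..<1::nat}. snd h"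
  have s1: "field_integral 1 (simple_deriv W (r n) (t n) (f n) 1) ?\<alpha> (\<lambda>_. fst h) \<omega> = g n h (path \<omega>)" for n \<omega>
    unfolding g_def using field_integral_simple_path(1)[OF sd[of n], of "\<lambda>_. fst h" ?\<alpha> \<omega>] h by simp
  have d1: "integrable M (\<lambda>\<omega>. g n h (path \<omega>) - malliavin_dir (D 1) h \<omega>) \<and>
      (\<integral>\<omega>. \<bar>g n h (path \<omega>) - malliavin_dir (D 1) h \<omega>\<bar> \<partial>M) \<le> a n" for n
    using field[of 1 ?\<alpha> n "\<lambda>_. fst h"] m unfolding s1 by simp
  have int: "integrable M Y" if "cylindrical \<Psi>" "integrable M (\<lambda>\<omega>. \<Psi> (path \<omega>) - Y \<omega>)" for Y :: "'a \<Rightarrow> real" and \<Psi>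
    using Bochner_Integration.integrable_diff[OF cylindrical_integrable[OF that(1)] that(2)] by simp
  have lim: "(\<lambda>n. \<integral>\<omega>. \<bar>\<Psi> n (path \<omega>) - Y \<omega>\<bar> \<partial>M) \<longlonglongrightarrow> 0"
    if "\<And>n. (\<integral>\<omega>. \<bar>\<Psi> n (path \<omega>) - Y \<omega>\<bar> \<partial>M) \<le> a n" for \<Psi> :: "nat \<Rightarrow> _ \<Rightarrow> real" and Y
    by (rule tendsto_sandwich[OF _ _ tendsto_const a]) (use that in auto)
  have i1: "integrable M (malliavin_dir (D 1) h)" using int[OF cyl(2)] d1 by blast
  show "weak_deriv h F (malliavin_dir (D 1) h)"
    by (rule weak_derivI_L1[OF cyl(1) cyl(2) dir(1) iF i1 lim[OF F] lim]) (use d1 in blast)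
  show "\<exists>Z Z'. weak_deriv h Z Z' \<and> integrable M Z \<and> (\<integral>\<omega>. \<bar>Z \<omega> - malliavin_dir (D 1) h \<omega>\<bar> \<partial>M) \<le> \<epsilon>" if "\<epsilon> > 0"
  proof -
    from a that have "\<forall>\<^sub>F n in sequentially. a n < \<epsilon>" by (rule order_tendstoD)
    then obtain n where "a n < \<epsilon>" by (auto simp: eventually_sequentially)
    then show ?thesis
      using weak_deriv_cylindrical[OF cyl(2)[of n h] cyl(3)[of n h h] dir(2)] cylindrical_integrable[OF cyl(2)[of n h]] d1[of n]
      by (meson less_imp_le order_trans)
  qed
  assume m2: "2 \<le> m" and h': "fst h' \<in> {0..1}"
  let ?\<alpha>2 = "\<lambda>l\<in>{..<2::nat}. if l = 0 then snd h' else snd h" and ?\<beta> = "\<lambda>l::nat. if l = 0 then fst h' else fst h"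
  have s2: "field_integral 2 (simple_deriv W (r n) (t n) (f n) 2) ?\<alpha>2 ?\<beta> \<omega> = gg n h h' (path \<omega>)" for n \<omega>
    unfolding gg_def using field_integral_simple_path(2)[OF sd[of n], of ?\<beta> ?\<alpha>2 \<omega>] h h' by simp
  have d2: "integrable M (\<lambda>\<omega>. gg n h h' (path \<omega>) - malliavin_dir2 (D 2) h h' \<omega>) \<and>
      (\<integral>\<omega>. \<bar>gg n h h' (path \<omega>) - malliavin_dir2 (D 2) h h' \<omega>\<bar> \<partial>M) \<le> a n" for n
    using field[of 2 ?\<alpha>2 n ?\<beta>] m2 unfolding s2 by simp
  have i2: "integrable M (malliavin_dir2 (D 2) h h')" using int[OF cyl(3)] d2 by blast
  show "weak_deriv h' (malliavin_dir (D 1) h) (malliavin_dir2 (D 2) h h')"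
    by (rule weak_derivI_L1[OF cyl(2) cyl(3) dir(2) i1 i2 lim lim]) (use d1 d2 in blast)+
qed

end

section \<open>The Malliavin matrix\<close>

text \<open>Rational endpoints pass to all real ones by dominated convergence. The positive and the
  negative part of g are then densities of two finite measures that agree on half-lines, hence
  coincide.\<close>

lemma AE_zero_if_rational_integrals_zero:
  fixes g :: "real \<Rightarrow> real"
  assumes g: "integrable lborel g" and z: "\<And>q. q \<in> \<rat> \<Longrightarrow> (\<integral>x. indicat_real {..<q} x * g x \<partial>lborel) = 0"
  shows "AE x in lborel. g x = 0"
proof -
  have [measurable]: "g \<in> borel_measurable borel" using g by auto
  have lim: "(\<integral>x. c x * g x \<partial>lborel) = 0"
    if q: "\<And>n::nat. q n \<in> \<rat>" and c: "\<And>x. (\<lambda>n. indicat_real {..<q n} x) \<longlonglongrightarrow> c x"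
      and [measurable]: "c \<in> borel_measurable borel" for q c
  proof -
    have "(\<lambda>n. \<integral>x. indicat_real {..<q n} x * g x \<partial>lborel) \<longlonglongrightarrow> (\<integral>x. c x * g x \<partial>lborel)"
    proof (rule integral_dominated_convergence[where w="\<lambda>x. \<bar>g x\<bar>"])
      show "AE x in lborel. (\<lambda>n. indicat_real {..<q n} x * g x) \<longlonglongrightarrow> c x * g x"
        by (intro AE_I2 tendsto_mult_right c)
      show "AE x in lborel. norm (indicat_real {..<q n} x * g x) \<le> \<bar>g x\<bar>" for n
        by (intro AE_I2) (simp add: indicator_def)
    qed (use g in auto)
    with z[OF q] show ?thesis by (simp add: LIMSEQ_const_iff)
  qed
  have all: "(\<integral>x. 1 * g x \<partial>lborel) = 0"
  proof (rule lim[of "\<lambda>n. real n"])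
    fix x :: real
    obtain N :: nat where "x < real N" using reals_Archimedean2 by blast
    then have "\<forall>\<^sub>F n in sequentially. indicat_real {..<real n} x = 1"
      by (intro eventually_sequentiallyI[of N]) (simp add: indicator_def)
    then show "(\<lambda>n. indicat_real {..<real n} x) \<longlonglongrightarrow> 1" by (rule tendsto_eventually)
  qed auto
  have atMost: "(\<integral>x. indicat_real {..a} x * g x \<partial>lborel) = 0" for a
  proof -
    \<comment> \<open>Endpoints that approach a strictly from above make the open half-lines shrink
      to the closed one.\<close>
    have "\<exists>q\<in>\<rat>. a < q \<and> q < a + 1 / real (Suc n)" for n by (rule Rats_dense_in_real) simp
    then obtain q where q: "\<And>n. q n \<in> \<rat>" "\<And>n. a < q n" "\<And>n. q n < a + 1 / real (Suc n)" by metis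
    show ?thesis
    proof (rule lim[OF q(1)])
      fix x
      show "(\<lambda>n. indicat_real {..<q n} x) \<longlonglongrightarrow> indicat_real {..a} x"
      proof (cases "x \<le> a")
        case True
        then have "x < q n" for n using q(2)[of n] by simp
        with True show ?thesis by (simp add: indicator_def)
      next
        case False
        then obtain N where N: "1 / real (Suc N) < x - a" using reals_Archimedean[of "x - a"] by (auto simp: inverse_eq_divide)
        have "\<not> x < q n" if "N \<le> n" for n
        proof -
          have "1 / real (Suc n) \<le> 1 / real (Suc N)" using that by (intro divide_left_mono) auto
          with q(3)[of n] N show ?thesis by linarith
        qed
        then have "\<forall>\<^sub>F n in sequentially. indicat_real {..<q n} x = indicat_real {..a} x"
          using False by (intro eventually_sequentiallyI[of N]) (simp add: indicator_def)
        then show ?thesis by (rule tendsto_eventually)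
      qed
    qed auto
  qed
  have gm: "integrable lborel (\<lambda>x. indicat_real A x * g x)" if [measurable]: "A \<in> sets borel" for A
    by (rule Bochner_Integration.integrable_bound[OF g]) (auto simp: indicator_def)
  have greater: "(\<integral>x. indicat_real {a<..} x * g x \<partial>lborel) = 0" for a
  proof -
    have "(\<integral>x. indicat_real {a<..} x * g x \<partial>lborel) = (\<integral>x. 1 * g x - indicat_real {..a} x * g x \<partial>lborel)"
      by (rule Bochner_Integration.integral_cong) (auto simp: indicator_def)
    also have "\<dots> = (\<integral>x. 1 * g x \<partial>lborel) - (\<integral>x. indicat_real {..a} x * g x \<partial>lborel)"
      by (rule Bochner_Integration.integral_diff) (use g gm in auto)
    finally show ?thesis using all atMost by simp
  qed
  define p where "p x = max (g x) 0" for x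
  define m where "m x = max (- g x) 0" for x
  have [measurable]: "p \<in> borel_measurable borel" "m \<in> borel_measurable borel" unfolding p_def m_def by auto
  have pm: "g x = p x - m x" "0 \<le> p x" "0 \<le> m x" for x by (auto simp: p_def m_def max_def)
  have ip: "integrable lborel (\<lambda>x. p x * indicat_real A x)" "integrable lborel (\<lambda>x. m x * indicat_real A x)"
    if [measurable]: "A \<in> sets borel" for A
    by (rule Bochner_Integration.integrable_bound[OF g]; auto simp: indicator_def p_def m_def)+
  have dens: "emeasure (density lborel (\<lambda>x. ennreal (h x))) {a<..} = ennreal (\<integral>x. h x * indicat_real {a<..} x \<partial>lborel)"
    if [measurable]: "h \<in> borel_measurable borel" and "\<And>x. 0 \<le> h x" "integrable lborel (\<lambda>x. h x * indicat_real {a<..} x)" for h :: "real \<Rightarrow> real" and a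
  proof -
    have "emeasure (density lborel (\<lambda>x. ennreal (h x))) {a<..} = (\<integral>\<^sup>+ x. ennreal (h x * indicat_real {a<..} x) \<partial>lborel)"
    proof (subst emeasure_density)
      show "{a<..} \<in> sets lborel" by simp
    qed (auto intro!: nn_integral_cong simp: indicator_def)
    also have "\<dots> = ennreal (\<integral>x. h x * indicat_real {a<..} x \<partial>lborel)"
      using that by (intro nn_integral_eq_integral) auto
    finally show ?thesis .
  qed
  have "density lborel (\<lambda>x. ennreal (p x)) = density lborel (\<lambda>x. ennreal (m x))"
  proof (rule measure_eqI_lessThan)
    fix a :: real
    note [simp] = dens[OF _ pm(2) ip(1)] dens[OF _ pm(3) ip(2)]
    show "emeasure (density lborel (\<lambda>x. ennreal (p x))) {a<..} < \<infinity>" by simp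
    have "(\<integral>x. p x * indicat_real {a<..} x \<partial>lborel) - (\<integral>x. m x * indicat_real {a<..} x \<partial>lborel) =
        (\<integral>x. p x * indicat_real {a<..} x - m x * indicat_real {a<..} x \<partial>lborel)"
      by (rule Bochner_Integration.integral_diff[symmetric]) (intro ip; simp)+
    also have "\<dots> = 0"
      using greater[of a] by (simp add: pm(1) left_diff_distrib[symmetric] mult.commute)
    finally show "emeasure (density lborel (\<lambda>x. ennreal (p x))) {a<..} = emeasure (density lborel (\<lambda>x. ennreal (m x))) {a<..}"
      by simp
  qed auto
  then have "AE x in lborel. ennreal (p x) = ennreal (m x)"
    by (subst (asm) sigma_finite_measure.density_unique_iff[OF lborel.sigma_finite_measure_axioms]) auto
  then show ?thesis by eventually_elim (use pm in simp)
qed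

text \<open>A basis is extracted from the spanning family and traced back to indices; a square
  matrix whose rows span the space is invertible.\<close>

lemma det_of_spanning_family:
  fixes U :: "'h \<Rightarrow> real^'d"
  assumes "span (U ` H) = UNIV"
  obtains s where "range s \<subseteq> H" "det (\<chi> i l. U (s l) $ i) \<noteq> 0"
proof -
  obtain B where B: "B \<subseteq> U ` H" "independent B" "U ` H \<subseteq> span B"
    using maximal_independent_subset by blast
  have sB: "span B = UNIV" using B(3) assms span_mono span_span by (metis top.extremum_uniqueI)
  have "card B = CARD('d)" "finite B"
    using dim_eq_card_independent[OF B(2)] dim_span[of B] sB finiteI_independent[OF B(2)] by auto
  then obtain e :: "'d \<Rightarrow> real^'d" where e: "bij_betw e UNIV B"
    using finite_same_card_bij[of "UNIV :: 'd set" B] by auto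
  have "\<exists>h. h \<in> H \<and> U h = e l" for l
  proof -
    have "e l \<in> B" using bij_betwE[OF e] by simp
    then have "e l \<in> U ` H" using B(1) by (rule set_rev_mp)
    then show ?thesis by (elim imageE) auto
  qed
  then obtain s where s: "\<And>l. s l \<in> H" "\<And>l. U (s l) = e l" by metis
  let ?A = "(\<chi> l. e l) :: real^'d^'d"
  have "rows ?A = B" using e by (auto simp: rows_def row_def bij_betw_def)
  then have "\<exists>C. C ** ?A = mat 1" using sB by (simp add: matrix_left_invertible_span_rows)
  then have "det ?A \<noteq> 0" by (simp add: invertible_left_inverse invertible_det_nz[symmetric])
  moreover have "(\<chi> i l. U (s l) $ i) = transpose ?A" by (simp add: transpose_def s vec_eq_iff)
  ultimately show thesis using that[of s] s(1) by (auto simp: det_transpose)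
qed

text \<open>If the vectors of integrals over all rational initial intervals lay in a hyperplane with
  normal v, the combination of the functions \<open>u i\<close> with coefficients v would have all
  these integrals equal to zero, hence vanish almost everywhere, and the Gram matrix would
  annihilate v.\<close>

lemma gram_nondegenerate:
  fixes u :: "'d::finite \<Rightarrow> 'n \<Rightarrow> real \<Rightarrow> real"
  defines "R \<equiv> restrict_space lborel {0..<1::real}"
  assumes meas: "\<And>i k. u i k \<in> borel_measurable R" and sq: "\<And>i k. integrable R (\<lambda>x. (u i k x)\<^sup>2)"
    and det: "det ((\<chi> i j. \<Sum>k\<in>UNIV. \<integral>x. u i k x * u j k x \<partial>R) :: real^'d^'d) \<noteq> 0"
  obtains s :: "'d \<Rightarrow> real \<times> 'n" where "range s \<subseteq> ({0..1} \<inter> \<rat>) \<times> UNIV"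
    "det (\<chi> i l. \<integral>x. u i (snd (s l)) x * indicat_real {0..<fst (s l)} x \<partial>R) \<noteq> 0"
proof -
  interpret R: prob_space R unfolding R_def by (rule prob_space_unit_interval)
  let ?H = "({0..1::real} \<inter> \<rat>) \<times> (UNIV :: 'n set)"
  define U where "U h = ((\<chi> i. \<integral>x. u i (snd h) x * indicat_real {0..<fst h} x \<partial>R) :: real^'d)" for h
  have int: "integrable R (u i k)" for i k by (rule R.square_integrable_imp_integrable[OF meas sq])
  have ind: "indicat_real {0..<b} \<in> borel_measurable R" for b
    unfolding R_def by (intro measurable_restrict_space1) auto
  have int_ind: "integrable R (\<lambda>x. u i k x * indicat_real {0..<b} x)" for i k b
    by (rule Bochner_Integration.integrable_bound[OF int[of i k] borel_measurable_times[OF meas ind]]) (simp add: indicator_def)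
  have int_mult: "integrable R (\<lambda>x. u i k x * u j k x)" for i j k
  proof (rule Bochner_Integration.integrable_bound[OF Bochner_Integration.integrable_add[OF sq[of i k] sq[of j k]]])
    have "\<bar>a * b\<bar> \<le> a\<^sup>2 + b\<^sup>2" for a b :: real
    proof -
      have "0 \<le> (\<bar>a\<bar> - \<bar>b\<bar>)\<^sup>2" by simp
      then have "2 * (\<bar>a\<bar> * \<bar>b\<bar>) \<le> a\<^sup>2 + b\<^sup>2" by (simp add: power2_diff)
      moreover have "0 \<le> \<bar>a\<bar> * \<bar>b\<bar>" by simp
      ultimately show ?thesis unfolding abs_mult by linarith
    qed
    then show "AE x in R. norm (u i k x * u j k x) \<le> norm ((u i k x)\<^sup>2 + (u j k x)\<^sup>2)" by (intro AE_I2) simp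
  qed (intro borel_measurable_times meas)
  let ?C = "(\<chi> i j. \<Sum>k\<in>UNIV. \<integral>x. u i k x * u j k x \<partial>R) :: real^'d^'d"
  have "span (U ` ?H) = UNIV"
  proof (rule ccontr)
    assume "span (U ` ?H) \<noteq> UNIV"
    then obtain v where v: "v \<noteq> 0" "\<And>x. x \<in> span (U ` ?H) \<Longrightarrow> v \<bullet> x = 0"
      using span_not_UNIV_orthogonal by metis
    define w where "w k x = (\<Sum>i\<in>UNIV. v $ i * u i k x)" for k x
    have iw: "integrable R (w k)" for k
      unfolding w_def by (intro Bochner_Integration.integrable_sum integrable_mult_right int)
    have zero: "(\<integral>x. w k x * indicat_real {0..<b} x \<partial>R) = 0" if "b \<in> {0..1} \<inter> \<rat>" for b k
    proof -
      have "(\<integral>x. w k x * indicat_real {0..<b} x \<partial>R) = (\<integral>x. (\<Sum>i\<in>UNIV. v $ i * (u i k x * indicat_real {0..<b} x)) \<partial>R)"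
        by (simp add: w_def sum_distrib_right mult.assoc)
      also have "\<dots> = (\<Sum>i\<in>UNIV. v $ i * (\<integral>x. u i k x * indicat_real {0..<b} x \<partial>R))"
        using int_ind by (subst Bochner_Integration.integral_sum) auto
      also have "\<dots> = v \<bullet> U (b, k)" by (simp add: U_def inner_vec_def)
      also have "\<dots> = 0" using that by (intro v(2) span_base imageI) auto
      finally show ?thesis .
    qed
    have ae: "AE x in R. w k x = 0" for k
    proof -
      have "AE x in lborel. indicat_real {0..<1} x *\<^sub>R w k x = 0"
      proof (rule AE_zero_if_rational_integrals_zero)
        show "integrable lborel (\<lambda>x. indicat_real {0..<1} x *\<^sub>R w k x)"
          using iw[of k] unfolding R_def by (subst (asm) integrable_restrict_space) auto
        fix q :: real assume q: "q \<in> \<rat>"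
        \<comment> \<open>The half-line may end outside \<open>[0, 1]\<close>; clamping its endpoint
          keeps it rational and does not change the trace on \<open>[0, 1)\<close>.\<close>
        have b: "max 0 (min q 1) \<in> {0..1} \<inter> \<rat>" using q by (auto simp: max_def min_def)
        have e: "indicat_real {..<q} x * (indicat_real {0..<1} x *\<^sub>R w k x) =
            indicat_real {0..<1} x *\<^sub>R (w k x * indicat_real {0..<max 0 (min q 1)} x)" for x
          by (auto simp: indicator_def)
        show "(\<integral>x. indicat_real {..<q} x * (indicat_real {0..<1} x *\<^sub>R w k x) \<partial>lborel) = 0"
          using zero[OF b, of k] unfolding R_def e by (subst (asm) integral_restrict_space) auto
      qed
      then have "AE x in lborel. x \<in> {0..<1} \<longrightarrow> w k x = 0" by eventually_elim (auto simp: indicator_def)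
      then show ?thesis unfolding R_def by (subst AE_restrict_space_iff) auto
    qed
    have "(?C *v v) $ i = 0" for i
    proof -
      have "(?C *v v) $ i = (\<Sum>j\<in>UNIV. \<Sum>k\<in>UNIV. v $ j * (\<integral>x. u i k x * u j k x \<partial>R))"
        by (simp add: matrix_vector_mult_def sum_distrib_left mult.commute)
      also have "\<dots> = (\<Sum>k\<in>UNIV. \<Sum>j\<in>UNIV. v $ j * (\<integral>x. u i k x * u j k x \<partial>R))" by (rule sum.swap)
      also have "\<dots> = (\<Sum>k\<in>UNIV. \<integral>x. (\<Sum>j\<in>UNIV. v $ j * (u i k x * u j k x)) \<partial>R)"
        using int_mult by (subst Bochner_Integration.integral_sum) auto
      also have "\<dots> = (\<Sum>k\<in>UNIV. \<integral>x. u i k x * w k x \<partial>R)" by (simp add: w_def sum_distrib_left mult_ac)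
      also have "\<dots> = 0"
      proof (intro sum.neutral ballI integral_eq_zero_AE)
        fix k show "AE x in R. u i k x * w k x = 0" using ae[of k] by eventually_elim simp
      qed
      finally show ?thesis .
    qed
    then have "?C *v v = 0" by (simp add: vec_eq_iff)
    moreover have "\<exists>B. B ** ?C = mat 1" using det by (simp add: invertible_left_inverse[symmetric] invertible_det_nz)
    ultimately show False using v(1) by (simp add: matrix_left_invertible_ker)
  qed
  from det_of_spanning_family[OF this] obtain s where "range s \<subseteq> ?H" "det (\<chi> i l. U (s l) $ i) \<noteq> 0" by blast
  then show thesis using that[of s] by (simp add: U_def)
qed

text \<open>1-tuples are the extensional functions on \<open>{..<1}\<close>. This identifies the
  cube of order 1 with the unit interval, over which the entries of the Malliavin matrix are
  integrated.\<close>

lemma lebesgue_cube_1: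
  fixes X :: "(nat \<Rightarrow> real) \<Rightarrow> real"
  assumes X: "X \<in> borel_measurable (lebesgue_cube 1)"
  defines "u \<equiv> \<lambda>x. X (\<lambda>_\<in>{..<1}. x)" and "R \<equiv> restrict_space lborel {0..<1::real}"
  shows "u \<in> borel_measurable R"
    and "integrable (lebesgue_cube 1) (\<lambda>s. (X s)\<^sup>2) \<Longrightarrow> integrable R (\<lambda>x. (u x)\<^sup>2)"
    and "(\<integral>s. X s * slab 1 (\<lambda>_. b) s \<partial>lebesgue_cube 1) = (\<integral>x. u x * indicat_real {0..<b} x \<partial>R)"
proof -
  interpret product_sigma_finite "\<lambda>_::nat. R" unfolding R_def by (rule product_sigma_finite_unit_interval)
  have one: "{..<1::nat} = {0}" by auto
  have cube: "lebesgue_cube 1 = Pi\<^sub>M {0} (\<lambda>_. R)" by (simp only: lebesgue_cube_def R_def one)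
  have "(\<lambda>x. \<lambda>_\<in>{..<1::nat}. x) \<in> R \<rightarrow>\<^sub>M lebesgue_cube 1"
    unfolding cube one by (rule measurable_restrict) simp
  then show m: "u \<in> borel_measurable R" unfolding u_def by (rule measurable_compose[OF _ X])
  have ext: "X s = u (s 0)" if "s \<in> space (lebesgue_cube 1)" for s
  proof -
    have "s \<in> extensional {0}" using that unfolding cube by (auto simp: space_PiM PiE_def)
    then have "(\<lambda>_\<in>{..<1}. s 0) = s" unfolding one by (auto simp: extensional_def fun_eq_iff)
    then show ?thesis by (simp only: u_def)
  qed
  show "integrable R (\<lambda>x. (u x)\<^sup>2)" if i: "integrable (lebesgue_cube 1) (\<lambda>s. (X s)\<^sup>2)"
  proof -
    have "(\<integral>\<^sup>+ x. ennreal (norm ((u x)\<^sup>2)) \<partial>R) = (\<integral>\<^sup>+ s. ennreal (norm ((u (s 0))\<^sup>2)) \<partial>lebesgue_cube 1)"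
      unfolding cube using m by (intro product_nn_integral_singleton[symmetric]) auto
    also have "\<dots> = (\<integral>\<^sup>+ s. ennreal (norm ((X s)\<^sup>2)) \<partial>lebesgue_cube 1)" by (rule nn_integral_cong) (simp only: ext)
    also have "\<dots> < \<infinity>" using i by (simp only: integrable_iff_bounded)
    finally show ?thesis using m by (auto simp: integrable_iff_bounded)
  qed
  have "indicat_real {0..<b} \<in> borel_measurable R" unfolding R_def by (intro measurable_restrict_space1) auto
  then have m2: "(\<lambda>x. u x * indicat_real {0..<b} x) \<in> borel_measurable R" by (rule borel_measurable_times[OF m])
  have "(\<integral>s. X s * slab 1 (\<lambda>_. b) s \<partial>lebesgue_cube 1) = (\<integral>s. u (s 0) * indicat_real {0..<b} (s 0) \<partial>lebesgue_cube 1)"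
    by (rule Bochner_Integration.integral_cong) (simp_all only: ext slab_def one prod.insert prod.empty finite.emptyI empty_iff mult_1_right not_False_eq_True)
  also have "\<dots> = (\<integral>x. u x * indicat_real {0..<b} x \<partial>R)"
    unfolding cube by (rule product_integral_singleton[OF m2])
  finally show "(\<integral>s. X s * slab 1 (\<lambda>_. b) s \<partial>lebesgue_cube 1) = (\<integral>x. u x * indicat_real {0..<b} x \<partial>R)" .
qed

lemma slab_bound: "\<bar>\<Sum>j\<in>J. c j * slab m (\<beta> j) s\<bar> \<le> (\<Sum>j\<in>J. \<bar>c j\<bar>)"
proof -
  have "\<bar>\<Sum>j\<in>J. c j * slab m (\<beta> j) s\<bar> \<le> (\<Sum>j\<in>J. \<bar>c j * slab m (\<beta> j) s\<bar>)" by (rule sum_abs)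
  also have "\<dots> \<le> (\<Sum>j\<in>J. \<bar>c j\<bar>)"
    by (intro sum_mono) (simp add: abs_mult mult_right_le_one_le slab_le_1)
  finally show ?thesis .
qed

text \<open>The square of a mean is at most the mean of the square, by the nonnegativity of a
  variance; truncation makes this available before the second moment is known to be finite.\<close>

lemma (in prob_space) conv_in_prob_L2:
  fixes X :: "nat \<Rightarrow> 'a \<Rightarrow> 'e::euclidean_space"
  assumes [measurable]: "\<And>n. X n \<in> borel_measurable M" "Y \<in> borel_measurable M"
    and lim: "(\<lambda>n. \<integral>\<^sup>+ \<omega>. ennreal ((norm (X n \<omega> - Y \<omega>))\<^sup>2) \<partial>M) \<longlonglongrightarrow> 0"
  shows "conv_in_prob M X Y"
proof -
  define d where "d n = (\<integral>\<omega>. min 1 (norm (X n \<omega> - Y \<omega>)) \<partial>M)" for n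
  have le: "ennreal ((d n)\<^sup>2) \<le> (\<integral>\<^sup>+ \<omega>. ennreal ((norm (X n \<omega> - Y \<omega>))\<^sup>2) \<partial>M)" for n
  proof -
    let ?Z = "\<lambda>\<omega>. min 1 (norm (X n \<omega> - Y \<omega>))"
    have Z: "integrable M ?Z" by (intro integrable_min_norm assms)
    have Z2: "integrable M (\<lambda>\<omega>. (?Z \<omega>)\<^sup>2)" by (rule integrable_bounded_real[of _ 1]) (auto simp: power_le_one)
    have "(d n)\<^sup>2 \<le> (\<integral>\<omega>. (?Z \<omega>)\<^sup>2 \<partial>M)"
      using variance_positive[of ?Z] variance_eq[OF Z Z2] by (simp add: d_def)
    then have "ennreal ((d n)\<^sup>2) \<le> ennreal (\<integral>\<omega>. (?Z \<omega>)\<^sup>2 \<partial>M)" by (rule ennreal_leI)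
    also have "\<dots> = (\<integral>\<^sup>+ \<omega>. ennreal ((?Z \<omega>)\<^sup>2) \<partial>M)" by (intro nn_integral_eq_integral[symmetric] Z2) auto
    also have "\<dots> \<le> (\<integral>\<^sup>+ \<omega>. ennreal ((norm (X n \<omega> - Y \<omega>))\<^sup>2) \<partial>M)"
      by (intro nn_integral_mono ennreal_leI power_mono) auto
    finally show ?thesis .
  qed
  have "(\<lambda>n. ennreal ((d n)\<^sup>2)) \<longlonglongrightarrow> 0"
    by (rule tendsto_sandwich[OF _ _ tendsto_const lim]) (use le in auto)
  then have "(\<lambda>n. (d n)\<^sup>2) \<longlonglongrightarrow> 0" by (subst (asm) ennreal_tendsto_0_iff) auto
  then have "d \<longlonglongrightarrow> 0" by simp
  then show ?thesis by (simp add: conv_in_prob_def d_def[abs_def])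
qed

section \<open>The Malliavin matrix as a Gram matrix and the bound on second derivatives\<close>

context brownian
begin

text \<open>The exponent 1 concerns \<open>\<omega>\<close>; in s the norm is always quadratic. At a
  finite distance from a simple functional, whose derivative is bounded in s, the derivative of F is
  square integrable in s for almost every \<open>\<omega>\<close>. This is what makes the Malliavin
  matrix a Gram matrix.\<close>

lemma malliavin_square_integrable:
  assumes D: "has_malliavin_derivs M W m 1 F D" and k: "k \<in> {1..m}" and \<alpha>: "\<alpha> \<in> multi_indices k"
  shows "AE \<omega> in M. integrable (lebesgue_cube k) (\<lambda>s. (D k \<alpha> s \<omega>)\<^sup>2)"
proof -
  note meas = has_malliavin_derivs_measurable[OF D]
  obtain r t f where sd: "\<And>n. simple_data (r n) (t n) (f n)" and
    conv: "(\<lambda>n. \<integral>\<^sup>+ \<omega>. ennreal_powr (sobolev_sq m (\<lambda>\<omega>. simple_functional W (t n) (f n) \<omega> - F \<omega>)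
              (\<lambda>k \<alpha> s \<omega>. simple_deriv W (r n) (t n) (f n) k \<alpha> s \<omega> - D k \<alpha> s \<omega>) \<omega>) (1 / 2) \<partial>M) \<longlonglongrightarrow> 0"
    using D unfolding has_malliavin_derivs_def by blast
  from order_tendstoD(2)[OF conv, of 1] obtain n where
    n: "(\<integral>\<^sup>+ \<omega>. ennreal_powr (sobolev_sq m (\<lambda>\<omega>. simple_functional W (t n) (f n) \<omega> - F \<omega>)
              (\<lambda>k \<alpha> s \<omega>. simple_deriv W (r n) (t n) (f n) k \<alpha> s \<omega> - D k \<alpha> s \<omega>) \<omega>) (1 / 2) \<partial>M) \<le> ennreal 1"
    by (auto simp: eventually_sequentially intro: less_imp_le)
  let ?S = "simple_deriv W (r n) (t n) (f n) k"
  let ?X = "\<lambda>\<alpha> s \<omega>. ?S \<alpha> s \<omega> - D k \<alpha> s \<omega>"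
  have X: "field_measurable M j (\<lambda>\<alpha> s \<omega>. simple_deriv W (r n) (t n) (f n) j \<alpha> s \<omega> - D j \<alpha> s \<omega>)" if "j \<in> {1..m}" for j
    by (intro field_measurable_diff simple_deriv_field_measurable[OF sd] meas that)
  have "AE \<omega> in M. field_sq k ?X \<omega> < \<top>"
  proof (rule L1_bound_sobolev(3)[OF _ _ n _ k])
    show "(\<lambda>\<omega>. simple_functional W (t n) (f n) \<omega> - F \<omega>) \<in> borel_measurable M"
      by (intro borel_measurable_diff simple_functional_measurable[OF sd] meas)
  qed (rule X, simp_all)
  then show ?thesis using AE_space
  proof eventually_elim
    fix \<omega> assume \<omega>: "field_sq k ?X \<omega> < \<top>" "\<omega> \<in> space M"
    interpret C: prob_space "lebesgue_cube k" by (rule prob_space_lebesgue_cube)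
    have m1: "(\<lambda>s. ?X \<alpha> s \<omega>) \<in> borel_measurable (lebesgue_cube k)"
      by (rule field_measurable_section[OF X[OF k] \<alpha> \<omega>(2)])
    have m2: "(\<lambda>s. D k \<alpha> s \<omega>) \<in> borel_measurable (lebesgue_cube k)"
      by (rule field_measurable_section[OF meas(2)[OF k] \<alpha> \<omega>(2)])
    have "(\<integral>\<^sup>+ s. ennreal ((?X \<alpha> s \<omega>)\<^sup>2) \<partial>lebesgue_cube k) \<le> field_sq k ?X \<omega>"
      unfolding field_sq_def by (rule member_le_sum[OF \<alpha>]) (simp_all add: finite_PiE)
    then have i1: "integrable (lebesgue_cube k) (\<lambda>s. (?X \<alpha> s \<omega>)\<^sup>2)"
      using \<omega>(1) m1 by (intro integrableI_nonneg borel_measurable_power) (auto intro: le_less_trans)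
    have i2: "integrable (lebesgue_cube k) (\<lambda>s. (?S \<alpha> s \<omega>)\<^sup>2)"
    proof (rule C.integrable_bounded_real)
      show "(\<lambda>s. (?S \<alpha> s \<omega>)\<^sup>2) \<in> borel_measurable (lebesgue_cube k)"
        by (intro borel_measurable_power simple_deriv_measurable_cube)
      show "\<bar>(?S \<alpha> s \<omega>)\<^sup>2\<bar> \<le> (\<Sum>j\<in>{..<k} \<rightarrow>\<^sub>E {..<r n}. \<bar>partial_derivs (map (\<lambda>l. (j l, \<alpha> l)) [0..<k]) (f n) (sample_path W (t n) \<omega>)\<bar>)\<^sup>2" for s
        unfolding simple_deriv_alt abs_power2 by (subst power2_abs[symmetric]) (intro power_mono slab_bound abs_ge_zero)
    qed
    have "integrable (lebesgue_cube k) (\<lambda>s. 2 * (?S \<alpha> s \<omega>)\<^sup>2 + 2 * (?X \<alpha> s \<omega>)\<^sup>2)" using i1 i2 by auto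
    then show "integrable (lebesgue_cube k) (\<lambda>s. (D k \<alpha> s \<omega>)\<^sup>2)"
    proof (rule Bochner_Integration.integrable_bound)
      have "a\<^sup>2 \<le> 2 * b\<^sup>2 + 2 * (b - a)\<^sup>2" for a b :: real
      proof -
        have "0 \<le> (a - 2 * b)\<^sup>2" by simp
        then show ?thesis by (simp add: power2_eq_square algebra_simps)
      qed
      then show "AE s in lebesgue_cube k. norm ((D k \<alpha> s \<omega>)\<^sup>2) \<le> norm (2 * (?S \<alpha> s \<omega>)\<^sup>2 + 2 * (?X \<alpha> s \<omega>)\<^sup>2)"
        by (intro AE_I2) simp
    qed (intro borel_measurable_power m2)
  qed
qed

text \<open>\<open>malliavin_deriv\<close> retains the derivative of order k from a whole family of
  derivatives; here a family with this top member is recovered.\<close>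

lemma has_malliavin_derivs_malliavin_deriv:
  assumes "has_malliavin_derivs M W k 1 F D"
  obtains E where "has_malliavin_derivs M W k 1 F E" "E k = malliavin_deriv M W k F"
proof -
  have "\<exists>X E. has_malliavin_derivs M W k 1 F E \<and> X = E k" using assms by blast
  from someI_ex[OF this] show thesis using that unfolding malliavin_deriv_def by metis
qed

text \<open>The Gram matrix argument is applied to each \<open>\<omega>\<close> separately, with the
  sections of the derivatives as functions on the unit interval. The directions may depend on
  \<open>\<omega>\<close> but come from a countable set.\<close>

lemma malliavin_nondegenerate:
  fixes F :: "'a \<Rightarrow> real^'d"
  assumes E: "\<And>i. has_malliavin_derivs M W 1 1 (\<lambda>\<omega>. F \<omega> $ i) (E i)"
      "\<And>i. E i 1 = malliavin_deriv M W 1 (\<lambda>\<omega>. F \<omega> $ i)"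
    and det: "AE \<omega> in M. det (malliavin_cov M W F \<omega>) > 0"
  shows "AE \<omega> in M. \<exists>s. range s \<subseteq> ({0..1} \<inter> \<rat>) \<times> UNIV \<and> det (\<chi> i l. malliavin_dir (E i 1) (s l) \<omega>) \<noteq> 0"
proof -
  let ?\<alpha> = "\<lambda>k :: 'n. \<lambda>_\<in>{..<1::nat}. k"
  have \<alpha>: "?\<alpha> k \<in> multi_indices 1" for k by simp
  have "AE \<omega> in M. \<forall>p\<in>UNIV. integrable (lebesgue_cube 1) (\<lambda>s. (E (fst p) 1 (?\<alpha> (snd p)) s \<omega>)\<^sup>2)"
    by (rule AE_finite_allI) (use malliavin_square_integrable[OF E(1) _ \<alpha>] in auto)
  then show ?thesis using det AE_space
  proof eventually_elim
    fix \<omega>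
    assume sq: "\<forall>p\<in>UNIV. integrable (lebesgue_cube 1) (\<lambda>s. (E (fst p) 1 (?\<alpha> (snd p)) s \<omega>)\<^sup>2)"
      and det: "det (malliavin_cov M W F \<omega>) > 0" and \<omega>: "\<omega> \<in> space M"
    define u where "u i k x = E i 1 (?\<alpha> k) (\<lambda>_\<in>{..<1}. x) \<omega>" for i k and x :: real
    have m: "(\<lambda>s. E i 1 (?\<alpha> k) s \<omega>) \<in> borel_measurable (lebesgue_cube 1)" for i k
      by (rule field_measurable_section[OF has_malliavin_derivs_measurable(2)[OF E(1)] \<alpha> \<omega>]) simp
    note u = lebesgue_cube_1[OF m, folded u_def]
    have cov: "malliavin_cov M W F \<omega> = (\<chi> i j. \<Sum>k\<in>UNIV. \<integral>x. u i k x * u j k x \<partial>restrict_space lborel {0..<1})"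
      unfolding malliavin_cov_def malliavin_deriv1_def E(2)[symmetric] set_lebesgue_integral_def u_def
      by (subst integral_restrict_space) auto
    have dir: "malliavin_dir (E i 1) h \<omega> = (\<integral>x. u i (snd h) x * indicat_real {0..<fst h} x \<partial>restrict_space lborel {0..<1})" for i h
      unfolding field_integral_def by (rule u(3))
    have "integrable (restrict_space lborel {0..<1}) (\<lambda>x. (u i k x)\<^sup>2)" for i k
      using sq[rule_format, of "(i, k)"] by (intro u(2)) simp
    moreover have "det (\<chi> i j. \<Sum>k\<in>UNIV. \<integral>x. u i k x * u j k x \<partial>restrict_space lborel {0..<1}) \<noteq> 0"
      using det unfolding cov by simp
    ultimately obtain s where "range s \<subseteq> ({0..1} \<inter> \<rat>) \<times> UNIV"
      "det (\<chi> i l. \<integral>x. u i (snd (s l)) x * indicat_real {0..<fst (s l)} x \<partial>restrict_space lborel {0..<1}) \<noteq> 0"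
      by (rule gram_nondegenerate[OF u(1)])
    then show "\<exists>s. range s \<subseteq> ({0..1} \<inter> \<rat>) \<times> UNIV \<and> det (\<chi> i l. malliavin_dir (E i 1) (s l) \<omega>) \<noteq> 0"
      unfolding dir by (intro exI[of _ s] conjI)
  qed
qed

text \<open>For exponent 1 the norm is the mean of the square root of a Sobolev square in which the
  second derivative is one of the summands, and the box integral is at most the norm of that
  derivative.\<close>

lemma malliavin_second_deriv_bound:
  fixes G :: "'a \<Rightarrow> real^'d"
  assumes E: "has_malliavin_derivs M W 2 1 (\<lambda>\<omega>. G \<omega> $ i) E" "E 2 = malliavin_deriv M W 2 (\<lambda>\<omega>. G \<omega> $ i)"
    and C: "malliavin_norm M W 3 1 G \<le> ennreal C" "0 \<le> C"
  shows "(\<integral>\<omega>. \<bar>malliavin_dir2 (E 2) h h' \<omega>\<bar> \<partial>M) \<le> C"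
proof -
  let ?\<alpha> = "\<lambda>l\<in>{..<2::nat}. if l = 0 then snd h' else snd h"
  have \<alpha>: "?\<alpha> \<in> multi_indices 2" by simp
  have fm: "field_measurable M 2 (E 2)" by (rule has_malliavin_derivs_measurable(2)[OF E(1)]) simp
  let ?D = "\<lambda>i k. malliavin_deriv M W k (\<lambda>\<omega>. G \<omega> $ i)"
  let ?S = "\<lambda>\<omega>. \<Sum>i\<in>UNIV. sobolev_sq 3 (\<lambda>\<omega>. G \<omega> $ i) (?D i) \<omega>"
  have norm: "malliavin_norm M W 3 1 G = (\<integral>\<^sup>+ \<omega>. ennreal_powr (?S \<omega>) (1 / 2) \<partial>M)"
    by (simp add: malliavin_norm_def ennreal_powr_def[of _ 1] less_top)
  have le: "field_sq 2 (E 2) \<omega> \<le> ?S \<omega>" for \<omega>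
  proof -
    have "field_sq 2 (E 2) \<omega> \<le> sobolev_sq 3 (\<lambda>\<omega>. G \<omega> $ i) (?D i) \<omega>"
      unfolding E(2) by (rule sobolev_sq_ge_field) simp
    also have "\<dots> \<le> ?S \<omega>" by (rule member_le_sum) auto
    finally show ?thesis .
  qed
  have "ennreal \<bar>malliavin_dir2 (E 2) h h' \<omega>\<bar> \<le> ennreal_powr (?S \<omega>) (1 / 2)" if "\<omega> \<in> space M" for \<omega>
    by (rule order_trans[OF field_sq_bound(1)[where X="E 2", OF field_measurable_section[OF fm \<alpha> that] \<alpha>] ennreal_powr_mono[OF le]]) simp
  from integrable_nn_bound[OF field_integral_measurable[OF fm \<alpha>] this C(1)[unfolded norm] C(2)]
  show ?thesis by blast
qed

text \<open>Chooses versions of the derivatives and verifies the assumptions of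
  \<open>weak_convergence\<close> for all directions with rational b.\<close>

lemma tv_convergence:
  fixes Fn :: "nat \<Rightarrow> 'a \<Rightarrow> real^'d" and F :: "'a \<Rightarrow> real^'d"
  assumes Fn: "\<And>n i. (\<lambda>\<omega>. Fn n \<omega> $ i) \<in> malliavin_space M W 2 1"
    and bound: "(SUP n. malliavin_norm M W 3 1 (Fn n)) < \<top>"
    and F: "\<And>i. (\<lambda>\<omega>. F \<omega> $ i) \<in> malliavin_space M W 1 1"
    and det: "AE \<omega> in M. det (malliavin_cov M W F \<omega>) > 0"
    and lim: "(\<lambda>n. \<integral>\<^sup>+ \<omega>. ennreal ((norm (Fn n \<omega> - F \<omega>))\<^sup>2) \<partial>M) \<longlonglongrightarrow> 0"
  shows "(\<lambda>n. tv_dist M (Fn n) F) \<longlonglongrightarrow> 0"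
proof -
  have "\<exists>E. has_malliavin_derivs M W 1 1 (\<lambda>\<omega>. F \<omega> $ i) E \<and> E 1 = malliavin_deriv M W 1 (\<lambda>\<omega>. F \<omega> $ i)" for i
    using F[of i] has_malliavin_derivs_malliavin_deriv unfolding malliavin_space_def by blast
  then obtain E where E: "\<And>i. has_malliavin_derivs M W 1 1 (\<lambda>\<omega>. F \<omega> $ i) (E i)"
      "\<And>i. E i 1 = malliavin_deriv M W 1 (\<lambda>\<omega>. F \<omega> $ i)" by metis
  \<comment> \<open>Versions are pinned to \<open>malliavin_deriv\<close> where a hypothesis speaks
    of it: at order 1 for F, through \<open>malliavin_cov\<close>, and at order 2 for
    \<open>Fn n\<close>, through \<open>malliavin_norm\<close>. The first derivatives of
    \<open>Fn n\<close> are those that accompany the chosen second ones.\<close>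
  have "\<exists>E. has_malliavin_derivs M W 2 1 (\<lambda>\<omega>. Fn n \<omega> $ i) E \<and> E 2 = malliavin_deriv M W 2 (\<lambda>\<omega>. Fn n \<omega> $ i)" for n i
    using Fn[of n i] has_malliavin_derivs_malliavin_deriv unfolding malliavin_space_def by blast
  then obtain En where En: "\<And>n i. has_malliavin_derivs M W 2 1 (\<lambda>\<omega>. Fn n \<omega> $ i) (En n i)"
      "\<And>n i. En n i 2 = malliavin_deriv M W 2 (\<lambda>\<omega>. Fn n \<omega> $ i)" by metis
  define C where "C = enn2real (SUP n. malliavin_norm M W 3 1 (Fn n))"
  have C: "0 \<le> C" "malliavin_norm M W 3 1 (Fn n) \<le> ennreal C" for n
    using bound unfolding C_def by (auto intro: SUP_upper)
  have D2: "(\<integral>\<omega>. \<bar>malliavin_dir2 (En n i 2) h h' \<omega>\<bar> \<partial>M) \<le> C" for n i h h'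
    by (rule malliavin_second_deriv_bound[OF En C(2) C(1)])
  define DFn where "DFn n h \<omega> = ((\<chi> i. malliavin_dir (En n i 1) h \<omega>) :: real^'d)" for n h \<omega>
  define D2Fn where "D2Fn n h h' \<omega> = ((\<chi> i. malliavin_dir2 (En n i 2) h h' \<omega>) :: real^'d)" for n h h' \<omega>
  define DF where "DF h \<omega> = ((\<chi> i. malliavin_dir (E i 1) h \<omega>) :: real^'d)" for h \<omega>
  let ?H = "({0..1::real} \<inter> \<rat>) \<times> (UNIV :: 'n set)"
  have meas: "Fn n \<in> borel_measurable M" "F \<in> borel_measurable M" for n
    by (intro borel_measurable_vec has_malliavin_derivs_measurable(1)[OF En(1)] has_malliavin_derivs_measurable(1)[OF E(1)])+
  have conv: "conv_in_prob M Fn F" by (rule conv_in_prob_L2[OF meas lim])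
  have d1: "weak_deriv h (\<lambda>\<omega>. Fn n \<omega> $ i) (malliavin_dir (En n i 1) h)" if "h \<in> ?H" for n i h
    by (rule malliavin_weak_deriv(1)[OF En(1)]) (use that in auto)
  have d2: "weak_deriv h' (malliavin_dir (En n i 1) h) (malliavin_dir2 (En n i 2) h h')" if "h \<in> ?H" "h' \<in> ?H" for n i h h'
    by (rule malliavin_weak_deriv(3)[OF En(1)]) (use that in auto)
  interpret weak_convergence M W Fn F DFn DF D2Fn ?H
  proof unfold_locales
    fix h h' assume h: "h \<in> ?H" and h': "h' \<in> ?H"
    have "(\<integral>\<omega>. norm (D2Fn n h h' \<omega>) \<partial>M) \<le> (\<Sum>i\<in>(UNIV :: 'd set). C)" for n
    proof -
      have i: "integrable M (malliavin_dir2 (En n i 2) h h')" for i by (rule weak_deriv_integrable[OF d2[OF h h']])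
      have m: "D2Fn n h h' \<in> borel_measurable M" unfolding D2Fn_def using i by (intro borel_measurable_vec) simp
      have le: "norm (D2Fn n h h' \<omega>) \<le> (\<Sum>i\<in>UNIV. \<bar>malliavin_dir2 (En n i 2) h h' \<omega>\<bar>)" for \<omega>
        using norm_vec_le_sum[of "D2Fn n h h' \<omega>"] by (simp add: D2Fn_def)
      have int_sum: "integrable M (\<lambda>\<omega>. \<Sum>i\<in>UNIV. \<bar>malliavin_dir2 (En n i 2) h h' \<omega>\<bar>)"
        by (intro Bochner_Integration.integrable_sum integrable_abs i)
      have "(\<integral>\<omega>. norm (D2Fn n h h' \<omega>) \<partial>M) \<le> (\<integral>\<omega>. (\<Sum>i\<in>UNIV. \<bar>malliavin_dir2 (En n i 2) h h' \<omega>\<bar>) \<partial>M)"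
        by (rule integral_mono'[OF int_sum le]) (intro sum_nonneg, simp)
      also have "\<dots> = (\<Sum>i\<in>UNIV. \<integral>\<omega>. \<bar>malliavin_dir2 (En n i 2) h h' \<omega>\<bar> \<partial>M)"
        using i by (intro Bochner_Integration.integral_sum integrable_abs)
      also have "\<dots> \<le> (\<Sum>i\<in>(UNIV :: 'd set). C)" by (intro sum_mono D2)
      finally show ?thesis .
    qed
    then show "\<exists>C. \<forall>n. (\<integral>\<omega>. norm (D2Fn n h h' \<omega>) \<partial>M) \<le> C" by blast
    show "weak_deriv h' (DFn n h) (D2Fn n h h')" for n
      unfolding DFn_def D2Fn_def by (rule weak_deriv_vec) (simp only: vec_lambda_beta d2[OF h h'])
  next
    fix h assume h: "h \<in> ?H"
    then show h01: "fst h \<in> {0..1}" by auto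
    show "weak_deriv h (Fn n) (DFn n h)" for n
      unfolding DFn_def by (rule weak_deriv_vec) (simp only: vec_lambda_beta d1[OF h])
    show "conv_in_prob M (\<lambda>n. DFn n h) (DF h)"
    proof (rule conv_in_prob_vec)
      fix i
      \<comment> \<open>The interpolation in direction h uses the second derivative along h twice;
        mixed second derivatives enter through the weights.\<close>
      have "conv_in_prob M (\<lambda>n. malliavin_dir (En n i 1) h) (malliavin_dir (E i 1) h)"
      proof (rule conv_in_prob_weak_deriv[OF h01 d1[OF h] d2[OF h h] D2])
        show "weak_deriv h (\<lambda>\<omega>. F \<omega> $ i) (malliavin_dir (E i 1) h)"
          by (rule malliavin_weak_deriv(1)[OF E(1) _ h01]) simp
        show "\<exists>Z Z'. weak_deriv h Z Z' \<and> integrable M Z \<and> (\<integral>\<omega>. \<bar>Z \<omega> - malliavin_dir (E i 1) h \<omega>\<bar> \<partial>M) \<le> \<epsilon>" if "\<epsilon> > 0" for \<epsilon>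
          by (rule malliavin_weak_deriv(2)[OF E(1) _ h01 that]) simp
        show "conv_in_prob M (\<lambda>n \<omega>. Fn n \<omega> $ i) (\<lambda>\<omega>. F \<omega> $ i)" by (rule conv_in_prob_component[OF conv])
      qed
      then show "conv_in_prob M (\<lambda>n \<omega>. DFn n h \<omega> $ i) (\<lambda>\<omega>. DF h \<omega> $ i)" by (simp add: DFn_def DF_def)
    qed
  next
    show "countable ?H" by (intro countable_SIGMA countable_Int2 countable_rat) auto
    show "conv_in_prob M Fn F" by (rule conv)
  qed
  show ?thesis
  proof (rule tendsto_tv_dist)
    show "AE \<omega> in M. \<exists>s. range s \<subseteq> ?H \<and> det (jac s \<omega>) \<noteq> 0"
      using malliavin_nondegenerate[OF E det] by (simp add: jac_def DF_def)
  qed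
qed

end

theorem corollary2p16:
  fixes M :: "'a measure"
    and W :: "real \<Rightarrow> 'a \<Rightarrow> real ^ 'n"
    and Fn :: "nat \<Rightarrow> 'a \<Rightarrow> real ^ 'd"
    and F :: "'a \<Rightarrow> real ^ 'd"
  assumes "brownian_motion M W"
    and "\<And>n i. (\<lambda>\<omega>. Fn n \<omega> $ i) \<in> malliavin_space_inf M W 3"
    and "\<And>p::nat. p \<ge> 1 \<Longrightarrow> (SUP n. malliavin_norm M W 3 (real p) (Fn n)) < \<top>"
    and "\<And>i. (\<lambda>\<omega>. F \<omega> $ i) \<in> malliavin_space M W 2 2"
    and "AE \<omega> in M. det (malliavin_cov M W F \<omega>) > 0"
    and "(\<lambda>n. \<integral>\<^sup>+ \<omega>. ennreal ((norm (Fn n \<omega> - F \<omega>))\<^sup>2) \<partial>M) \<longlonglongrightarrow> 0"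
  shows "(\<lambda>n. tv_dist M (Fn n) F) \<longlonglongrightarrow> 0"
proof -
  interpret brownian M W by (rule brownian.intro) (rule assms(1))
  have Fn: "(\<lambda>\<omega>. Fn n \<omega> $ i) \<in> malliavin_space M W 2 1" for n i
  proof -
    have "(\<lambda>\<omega>. Fn n \<omega> $ i) \<in> malliavin_space M W 3 1"
      using assms(2)[of n i] unfolding malliavin_space_inf_def by (rule INT_D) simp
    then show ?thesis
      unfolding malliavin_space_def using has_malliavin_derivs_mono[of 3 1 _ _ 2] by auto
  qed
  have F: "(\<lambda>\<omega>. F \<omega> $ i) \<in> malliavin_space M W 1 1" for i
    using assms(4)[of i] unfolding malliavin_space_def using has_malliavin_derivs_mono[of 2 2 _ _ 1] by auto
  have "(SUP n. malliavin_norm M W 3 1 (Fn n)) < \<top>" using assms(3)[of 1] by simp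
  from tv_convergence[OF Fn this F assms(5,6)] show ?thesis .
qed

end
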